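(* Let $E$ be a Banach space, $H$ a separable Hilbert space, and $A:D(A)\subset E\to E$ the generator of a $C_0$-semigroup $S(t)$ on $E$ with $\|S(t)\|_{\mathcal L(E)}\le Me^{-\omega t}$ for all $t\ge 0$, for some $M\ge 1$, $\omega>0$. Let $Q$ be a linear operator with domain $H$ such that $S(t)Q\in\mathcal L(H,E)$ for every $t>0$ and such that for every $t>0$ the stochastic convolution $Z(t)=\int_0^t S(t-s)Q\,dw(s)$ is an $E$-valued Gaussian random variable. Let $F:E\to E$ be uniformly continuous on bounded subsets of $E$ with $F(0)=0$, and suppose there is $\lambda>0$ such that for all $x,y\in D(A)$ there is $x^\star\in\partial|x-y|_E$ with $\langle A(x-y)+F(x)-F(y),x^\star\rangle_{E,E^\star}\le-\lambda|x-y|_E$. Let $B:E\to\mathcal L(H)$ and suppose there is $\kappa>0$ such that for all $x,y\in E$, $h\in H$: $|(B(x)-B(y))h|_H\le\kappa|x-y|_E|h|_H$ and $|B(x)h|_H\le\kappa(1+|x|_E)|h|_H$. Assume moreover that there are $\kappa'>0$, $\lambda'>0$, $m\in\mathbb N$ such that $|F(x)|_E\le\kappa'(1+|x|_E^m)$ for all $x\in E$, and for all $x,h\in D(A)$ there is $h^\star\in\partial|h|_E$ with $\langle F(x+h)-F(x),h^\star\rangle_{E,E^\star}\le-\lambda'|h|_E^m+\kappa'(1+|x|_E^m)$. Then for every $r>0$ the set $$\mathcal K(r)=\left\{\varphi\in C((-\infty,0];E):\lim_{t\to-\infty}|\varphi(t)|_E=0,\ I_{-\infty,0}(\varphi)\le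 r\right\}$$ is compact in the topology of uniform convergence on bounded intervals.
   Context: $w(t)=\sum_{k\ge1}\beta_k(t)e_k$ (formal sum) is a cylindrical Wiener process on $H$: $\{e_k\}$ is a complete orthonormal system of $H$ and $\{\beta_k\}$ are independent one-dimensional Brownian motions. $Q$ need not be bounded into $E$; only the operators $S(t)Q\in\mathcal L(H,E)$, $t>0$, are used, with $S(s)(S(t)Q)=S(s+t)Q$. $Z(t)$ is characterized by $\langle Z(t),x^\star\rangle_{E,E^\star}=\sum_k\int_0^t\langle S(t-s)Qe_k,x^\star\rangle_{E,E^\star}d\beta_k(s)$ for $x^\star\in E^\star$. Subdifferential: $\partial|x|_E=\{x^\star\in E^\star:|x^\star|_{E^\star}=1,\ \langle x,x^\star\rangle_{E,E^\star}=|x|_E\}$. For $x\in E$, $\psi\in L^2([0,T];H)$, $X^\psi_x\in C([0,T];E)$ is the unique solution of $X^\psi_x(t)=S(t)x+\int_0^tS(t-s)F(X^\psi_x(s))ds+\int_0^tS(t-s)QB(X^\psi_x(s))\psi(s)ds$. For $\varphi\in C([0,T];E)$, $I_{0,T}(\varphi)=\inf\{\frac12|\psi|^2_{L^2([0,T];H)}:\varphi=X^\psi_{\varphi(0)}\}$ with $\inf\emptyset=+\infty$. For $t<T$ in $\mathbb R$, $I_{t,T}(\varphi)=I_{0,T-t}(\varphi(\cdot+t))$, and $I_{-\infty,0}(\varphi)=\sup_{t<0}I_{t,0}(\varphi)$. *)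

theory Defs
  imports "HOL-Probability.Probability"
begin

section \<open>Semigroups\<close>

text \<open>The dual of \<open>'e\<close> is \<^typ>\<open>'e \<Rightarrow>\<^sub>L real\<close>.  For a semigroup only the values \<open>S t\<close> with
  \<open>t \<ge> 0\<close> matter.\<close>

definition C0_semigroup :: "(real \<Rightarrow> 'e::real_normed_vector \<Rightarrow>\<^sub>L 'e) \<Rightarrow> bool" where
  "C0_semigroup S \<longleftrightarrow>
     S 0 = id_blinfun \<and>
     (\<forall>s\<ge>0. \<forall>t\<ge>0. S (s + t) = S s o\<^sub>L S t) \<and>
     (\<forall>x. ((\<lambda>t. S t x) \<longlongrightarrow> x) (at_right 0))"

definition is_generator ::
  "(real \<Rightarrow> 'e::real_normed_vector \<Rightarrow>\<^sub>L 'e) \<Rightarrow> 'e set \<Rightarrow> ('e \<Rightarrow> 'e) \<Rightarrow> bool" where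
  "is_generator S D A \<longleftrightarrow>
     D = {x. \<exists>y. ((\<lambda>t. (S t x - x) /\<^sub>R t) \<longlongrightarrow> y) (at_right 0)} \<and>
     (\<forall>x\<in>D. ((\<lambda>t. (S t x - x) /\<^sub>R t) \<longlongrightarrow> A x) (at_right 0))"

definition norm_subdiff :: "'e::real_normed_vector \<Rightarrow> ('e \<Rightarrow>\<^sub>L real) set" where
  "norm_subdiff x = {xs. norm xs = 1 \<and> blinfun_apply xs x = norm x}"

section \<open>Cylindrical Wiener processes and stochastic convolutions\<close>

text \<open>The index set \<open>K\<close> is infinite exactly when \<open>'h\<close> is infinite-dimensional.\<close>

definition complete_orthonormal_system :: "nat set \<Rightarrow> (nat \<Rightarrow> 'h::real_inner) \<Rightarrow> bool" where
  "complete_orthonormal_system K e \<longleftrightarrow>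
     (\<forall>i\<in>K. \<forall>j\<in>K. inner (e i) (e j) = (if i = j then 1 else 0)) \<and>
     closure (span (e ` K)) = UNIV"

definition brownian_motion :: "'w measure \<Rightarrow> (real \<Rightarrow> 'w \<Rightarrow> real) \<Rightarrow> bool" where
  "brownian_motion P b \<longleftrightarrow>
     (\<forall>t\<ge>0. b t \<in> borel_measurable P) \<and>
     (AE w in P. b 0 w = 0) \<and>
     (AE w in P. continuous_on {0..} (\<lambda>t. b t w)) \<and>
     (\<forall>s t. 0 \<le> s \<longrightarrow> s < t \<longrightarrow>
        distributed P lborel (\<lambda>w. b t w - b s w) (normal_density 0 (sqrt (t - s)))) \<and>
     (\<forall>n \<tau>. 0 \<le> \<tau> 0 \<longrightarrow> strict_mono_on {..n} \<tau> \<longrightarrow>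
        prob_space.indep_vars P (\<lambda>_. borel)
          (\<lambda>i w. b (\<tau> (Suc i)) w - b (\<tau> i) w) {..<n})"

definition cylindrical_wiener ::
  "'w measure \<Rightarrow> nat set \<Rightarrow> (nat \<Rightarrow> 'h::real_inner) \<Rightarrow> (nat \<Rightarrow> real \<Rightarrow> 'w \<Rightarrow> real) \<Rightarrow> bool" where
  "cylindrical_wiener P K e \<beta> \<longleftrightarrow>
     prob_space P \<and>
     complete_orthonormal_system K e \<and>
     (\<forall>k\<in>K. brownian_motion P (\<beta> k)) \<and>
     prob_space.indep_vars P (\<lambda>_. Pi\<^sub>M {0..} (\<lambda>_. borel)) (\<lambda>k w. \<lambda>t\<in>{0..}. \<beta> k t w) K"

text \<open>The Wiener integral of a deterministic \<open>f \<in> L\<^sup>2(0,t)\<close> is the mean-square limit of the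
  integrals of step functions.  A list of triples \<open>(a, b, c)\<close> represents the step function
  \<open>\<Sum> c 1\<^bsub>(a,b]\<^esub>\<close>.\<close>

definition step_fun :: "(real \<times> real \<times> real) list \<Rightarrow> real \<Rightarrow> real" where
  "step_fun p s = (\<Sum>(a, b, c)\<leftarrow>p. c * indicator {a<..b} s)"

definition step_integral ::
  "(real \<Rightarrow> 'w \<Rightarrow> real) \<Rightarrow> (real \<times> real \<times> real) list \<Rightarrow> 'w \<Rightarrow> real" where
  "step_integral \<beta> p w = (\<Sum>(a, b, c)\<leftarrow>p. c * (\<beta> b w - \<beta> a w))"

definition L2_tendsto :: "'a measure \<Rightarrow> (nat \<Rightarrow> 'a \<Rightarrow> real) \<Rightarrow> ('a \<Rightarrow> real) \<Rightarrow> bool" where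
  "L2_tendsto M f g \<longleftrightarrow>
     (\<forall>n. f n \<in> borel_measurable M) \<and> g \<in> borel_measurable M \<and>
     ((\<lambda>n. \<integral>\<^sup>+x. ennreal ((f n x - g x)\<^sup>2) \<partial>M) \<longlonglongrightarrow> 0)"

definition has_wiener_integral ::
  "'w measure \<Rightarrow> (real \<Rightarrow> 'w \<Rightarrow> real) \<Rightarrow> real \<Rightarrow> (real \<Rightarrow> real) \<Rightarrow> ('w \<Rightarrow> real) \<Rightarrow> bool" where
  "has_wiener_integral P \<beta> t f Y \<longleftrightarrow>
     (\<exists>p. (\<forall>n. \<forall>(a, b, c)\<in>set (p n). 0 \<le> a \<and> a \<le> b \<and> b \<le> t) \<and>
          L2_tendsto (lebesgue_on {0..t}) (\<lambda>n. step_fun (p n)) f \<and>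
          L2_tendsto P (\<lambda>n. step_integral \<beta> (p n)) Y)"

text \<open>\<open>Q\<close> may take values outside \<open>'e\<close>, so it enters only through the bounded operators
  \<open>SQ t = S t Q\<close> for \<open>t > 0\<close>.  The value \<open>SQ 0\<close> is meaningless; below it is
  used at most at the single time \<open>s = t\<close>, where it does not affect the integrals.\<close>

definition smoothed_noise_operator ::
  "(real \<Rightarrow> 'e::real_normed_vector \<Rightarrow>\<^sub>L 'e) \<Rightarrow> (real \<Rightarrow> 'h::real_normed_vector \<Rightarrow>\<^sub>L 'e) \<Rightarrow> bool" where
  "smoothed_noise_operator S SQ \<longleftrightarrow> (\<forall>s\<ge>0. \<forall>t>0. S s o\<^sub>L SQ t = SQ (s + t))"

text \<open>\<open>Z = \<integral>\<^sub>0\<^sup>t S(t - s) Q dw(s)\<close>, tested against the dual; the series over \<open>k\<close>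
  converges in mean square.\<close>

definition is_stochastic_convolution ::
  "'w measure \<Rightarrow> nat set \<Rightarrow> (nat \<Rightarrow> 'h::real_inner) \<Rightarrow> (nat \<Rightarrow> real \<Rightarrow> 'w \<Rightarrow> real) \<Rightarrow>
   (real \<Rightarrow> 'h \<Rightarrow>\<^sub>L 'e::real_normed_vector) \<Rightarrow> real \<Rightarrow> ('w \<Rightarrow> 'e) \<Rightarrow> bool" where
  "is_stochastic_convolution P K e \<beta> SQ t Z \<longleftrightarrow>
     (\<forall>xs :: 'e \<Rightarrow>\<^sub>L real. \<exists>Y.
        (\<forall>k\<in>K. has_wiener_integral P (\<beta> k) t (\<lambda>s. xs (SQ (t - s) (e k))) (Y k)) \<and>
        L2_tendsto P (\<lambda>n w. \<Sum>k\<in>K \<inter> {..<n}. Y k w) (\<lambda>w. xs (Z w)))"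

definition gaussian_real :: "'w measure \<Rightarrow> ('w \<Rightarrow> real) \<Rightarrow> bool" where
  "gaussian_real P Y \<longleftrightarrow>
     Y \<in> borel_measurable P \<and>
     ((\<exists>\<mu> \<sigma>. \<sigma> > 0 \<and> distributed P lborel Y (normal_density \<mu> \<sigma>)) \<or>
      (\<exists>\<mu>. AE w in P. Y w = \<mu>))"

text \<open>As \<open>'e\<close> need not be separable, a random variable in \<open>'e\<close> is required to be almost surely
  separably valued (strong measurability); this is automatic for separable \<open>'e\<close>.\<close>

definition gaussian_random_variable ::
  "'w measure \<Rightarrow> ('w \<Rightarrow> 'e::real_normed_vector) \<Rightarrow> bool" where
  "gaussian_random_variable P Z \<longleftrightarrow>
     Z \<in> borel_measurable P \<and>
     (\<exists>C. countable C \<and> (AE w in P. Z w \<in> closure C)) \<and>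
     (\<forall>xs :: 'e \<Rightarrow>\<^sub>L real. gaussian_real P (\<lambda>w. xs (Z w)))"

section \<open>Controlled equation and rate functionals\<close>

definition square_integrable_on :: "(real \<Rightarrow> 'h::real_normed_vector) \<Rightarrow> real set \<Rightarrow> bool" where
  "square_integrable_on \<psi> J \<longleftrightarrow>
     \<psi> \<in> borel_measurable (lebesgue_on J) \<and> integrable (lebesgue_on J) (\<lambda>s. (norm (\<psi> s))\<^sup>2)"

definition L2_norm_sq :: "(real \<Rightarrow> 'h::real_normed_vector) \<Rightarrow> real set \<Rightarrow> real" where
  "L2_norm_sq \<psi> J = (LINT s|lebesgue_on J. (norm (\<psi> s))\<^sup>2)"

text \<open>The weak (Pettis) integral.  The singularity of \<open>S (t - s) Q\<close> at \<open>s = t\<close> need not be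
  Bochner integrable, and \<open>'e\<close> need not be separable; where the Bochner integral
  exists, it is also the weak integral.\<close>

definition has_weak_integral ::
  "'a measure \<Rightarrow> ('a \<Rightarrow> 'e::real_normed_vector) \<Rightarrow> 'e \<Rightarrow> bool" where
  "has_weak_integral M f y \<longleftrightarrow>
     (\<forall>xs :: 'e \<Rightarrow>\<^sub>L real. integrable M (\<lambda>s. xs (f s)) \<and> (LINT s|M. xs (f s)) = xs y)"

text \<open>\<open>X\<close> is the mild solution on \<open>[0,T]\<close> with initial value \<open>x\<close> and control \<open>\<psi>\<close>.\<close>

definition controlled_solution ::
  "(real \<Rightarrow> 'e::banach \<Rightarrow>\<^sub>L 'e) \<Rightarrow> (real \<Rightarrow> 'h::real_normed_vector \<Rightarrow>\<^sub>L 'e) \<Rightarrow> ('e \<Rightarrow> 'e) \<Rightarrow>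
   ('e \<Rightarrow> 'h \<Rightarrow>\<^sub>L 'h) \<Rightarrow> real \<Rightarrow> 'e \<Rightarrow> (real \<Rightarrow> 'h) \<Rightarrow> (real \<Rightarrow> 'e) \<Rightarrow> bool" where
  "controlled_solution S SQ F B T x \<psi> X \<longleftrightarrow>
     continuous_on {0..T} X \<and>
     (\<forall>t\<in>{0..T}. \<exists>y.
        has_weak_integral (lebesgue_on {0..t}) (\<lambda>s. SQ (t - s) (B (X s) (\<psi> s))) y \<and>
        X t = S t x + integral {0..t} (\<lambda>s. S (t - s) (F (X s))) + y)"

text \<open>\<open>I\<^bsub>0,T\<^esub>\<close>; in \<^typ>\<open>ereal\<close> the infimum of the empty set is \<open>\<infinity>\<close>.\<close>

definition rate_0 ::
  "(real \<Rightarrow> 'e::banach \<Rightarrow>\<^sub>L 'e) \<Rightarrow> (real \<Rightarrow> 'h::real_normed_vector \<Rightarrow>\<^sub>L 'e) \<Rightarrow> ('e \<Rightarrow> 'e) \<Rightarrow>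
   ('e \<Rightarrow> 'h \<Rightarrow>\<^sub>L 'h) \<Rightarrow> real \<Rightarrow> (real \<Rightarrow> 'e) \<Rightarrow> ereal" where
  "rate_0 S SQ F B T \<phi> =
     (INF \<psi> \<in> {\<psi>. square_integrable_on \<psi> {0..T} \<and> controlled_solution S SQ F B T (\<phi> 0) \<psi> \<phi>}.
        ereal (1/2 * L2_norm_sq \<psi> {0..T}))"

definition rate ::
  "(real \<Rightarrow> 'e::banach \<Rightarrow>\<^sub>L 'e) \<Rightarrow> (real \<Rightarrow> 'h::real_normed_vector \<Rightarrow>\<^sub>L 'e) \<Rightarrow> ('e \<Rightarrow> 'e) \<Rightarrow>
   ('e \<Rightarrow> 'h \<Rightarrow>\<^sub>L 'h) \<Rightarrow> real \<Rightarrow> real \<Rightarrow> (real \<Rightarrow> 'e) \<Rightarrow> ereal" where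
  "rate S SQ F B t T \<phi> = rate_0 S SQ F B (T - t) (\<lambda>s. \<phi> (s + t))"

definition rate_past ::
  "(real \<Rightarrow> 'e::banach \<Rightarrow>\<^sub>L 'e) \<Rightarrow> (real \<Rightarrow> 'h::real_normed_vector \<Rightarrow>\<^sub>L 'e) \<Rightarrow> ('e \<Rightarrow> 'e) \<Rightarrow>
   ('e \<Rightarrow> 'h \<Rightarrow>\<^sub>L 'h) \<Rightarrow> (real \<Rightarrow> 'e) \<Rightarrow> ereal" where
  "rate_past S SQ F B \<phi> = (SUP t\<in>{..<0}. rate S SQ F B t 0 \<phi>)"

section \<open>Continuous paths on the negative half-line\<close>

text \<open>Paths on \<open>(-\<infinity>,0]\<close> are functions on \<^typ>\<open>real\<close> with the fixed value
  \<^term>\<open>undefined\<close> off \<open>{..0}\<close>, so that distinct functions are distinct paths.\<close>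

definition past_paths :: "(real \<Rightarrow> 'e::metric_space) set" where
  "past_paths = {\<phi> \<in> extensional {..0}. continuous_on {..0} \<phi>}"

definition past_nbhd :: "real \<Rightarrow> real \<Rightarrow> (real \<Rightarrow> 'e::metric_space) \<Rightarrow> (real \<Rightarrow> 'e) set" where
  "past_nbhd a \<epsilon> \<phi> = {\<xi> \<in> past_paths. \<forall>t\<in>{a..0}. dist (\<xi> t) (\<phi> t) < \<epsilon>}"

text \<open>Uniform convergence on bounded intervals.\<close>

definition past_topology :: "(real \<Rightarrow> 'e::metric_space) topology" where
  "past_topology = topology (\<lambda>U. U \<subseteq> past_paths \<and> (\<forall>\<phi>\<in>U. \<exists>a. \<exists>\<epsilon>>0. past_nbhd a \<epsilon> \<phi> \<subseteq> U))"

lemma past_nbhd_mono: "a \<le> a' \<Longrightarrow> \<epsilon> \<le> \<epsilon>' \<Longrightarrow> past_nbhd a \<epsilon> \<phi> \<subseteq> past_nbhd a' \<epsilon>' \<phi>"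
  unfolding past_nbhd_def by (smt (verit, best) Collect_mono atLeastAtMost_iff)

lemma openin_past_topology:
  "openin past_topology U \<longleftrightarrow> U \<subseteq> past_paths \<and> (\<forall>\<phi>\<in>U. \<exists>a. \<exists>\<epsilon>>0. past_nbhd a \<epsilon> \<phi> \<subseteq> U)"
proof -
  let ?P = "\<lambda>U :: (real \<Rightarrow> 'a) set.
    U \<subseteq> past_paths \<and> (\<forall>\<phi>\<in>U. \<exists>a. \<exists>\<epsilon>>0. past_nbhd a \<epsilon> \<phi> \<subseteq> U)"
  have "?P (U \<inter> V)" if U: "?P U" and V: "?P V" for U V
  proof (intro conjI ballI)
    fix \<phi> assume "\<phi> \<in> U \<inter> V"
    then obtain a1 e1 a2 e2 where *: "e1 > 0" "past_nbhd a1 e1 \<phi> \<subseteq> U"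
      "e2 > 0" "past_nbhd a2 e2 \<phi> \<subseteq> V"
      using U V by (metis IntE)
    have "past_nbhd (min a1 a2) (min e1 e2) \<phi> \<subseteq> past_nbhd a1 e1 \<phi> \<inter> past_nbhd a2 e2 \<phi>"
      by (simp add: past_nbhd_mono)
    then show "\<exists>a. \<exists>\<epsilon>>0. past_nbhd a \<epsilon> \<phi> \<subseteq> U \<inter> V"
      using * by (intro exI[of _ "min a1 a2"] exI[of _ "min e1 e2"]) auto
  qed (use U in auto)
  moreover have "?P (\<Union>\<U>)" if "\<forall>U\<in>\<U>. ?P U" for \<U>
    using that by (meson Sup_least UnionE Union_upper subset_trans)
  ultimately have "istopology ?P"
    unfolding istopology_def by blast
  then show ?thesis
    by (simp add: past_topology_def topology_inverse')
qed

lemma topspace_past_topology: "topspace past_topology = past_paths"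
proof -
  have "openin past_topology (past_paths :: (real \<Rightarrow> 'a) set)"
    unfolding openin_past_topology by (auto simp: past_nbhd_def intro: exI[of _ "1::real"])
  then show ?thesis
    by (metis openin_past_topology openin_subset openin_topspace subset_antisym)
qed

lemma past_topology_limitin:
  assumes "\<phi> \<in> past_paths" "\<And>n. f n \<in> past_paths"
  shows "limitin past_topology f \<phi> sequentially \<longleftrightarrow>
    (\<forall>a. uniform_limit {a..0} f \<phi> sequentially)"
proof
  assume L: "limitin past_topology f \<phi> sequentially"
  show "\<forall>a. uniform_limit {a..0} f \<phi> sequentially"
  proof (intro allI uniform_limitI)
    fix a \<epsilon> :: real assume e: "\<epsilon> > 0"
    define U where "U = {\<xi> \<in> past_paths. \<exists>\<delta><\<epsilon>. \<forall>t\<in>{a..0}. dist (\<xi> t) (\<phi> t) \<le> \<delta>}"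
    have "openin past_topology U"
      unfolding openin_past_topology
    proof (intro conjI ballI)
      fix \<xi> assume "\<xi> \<in> U"
      then obtain d where d: "d < \<epsilon>" "\<forall>t\<in>{a..0}. dist (\<xi> t) (\<phi> t) \<le> d"
        unfolding U_def by blast
      have "past_nbhd a ((\<epsilon> - d) / 2) \<xi> \<subseteq> U"
      proof
        fix \<eta> assume h: "\<eta> \<in> past_nbhd a ((\<epsilon> - d) / 2) \<xi>"
        have "dist (\<eta> t) (\<phi> t) \<le> (\<epsilon> + d) / 2" if "t \<in> {a..0}" for t
        proof -
          have "dist (\<eta> t) (\<xi> t) < (\<epsilon> - d) / 2" "dist (\<xi> t) (\<phi> t) \<le> d"
            using h d that by (auto simp: past_nbhd_def)
          then show ?thesis
            using dist_triangle[of "\<eta> t" "\<phi> t" "\<xi> t"] by (simp add: field_simps)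
        qed
        moreover have "(\<epsilon> + d) / 2 < \<epsilon>" using d by simp
        ultimately show "\<eta> \<in> U"
          using h unfolding U_def past_nbhd_def by blast
      qed
      then show "\<exists>a. \<exists>\<epsilon>>0. past_nbhd a \<epsilon> \<xi> \<subseteq> U"
        using d by (intro exI[of _ a] exI[of _ "(\<epsilon> - d) / 2"]) auto
    qed (auto simp: U_def)
    moreover have "\<phi> \<in> U"
      using assms e by (auto simp: U_def intro!: exI[of _ 0])
    ultimately have "\<forall>\<^sub>F n in sequentially. f n \<in> U"
      using L by (simp add: limitin_def)
    then show "\<forall>\<^sub>F n in sequentially. \<forall>t\<in>{a..0}. dist (f n t) (\<phi> t) < \<epsilon>"
      by eventually_elim (force simp: U_def)
  qed
next
  assume R: "\<forall>a. uniform_limit {a..0} f \<phi> sequentially"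
  show "limitin past_topology f \<phi> sequentially"
    unfolding limitin_def topspace_past_topology
  proof (intro conjI allI impI)
    fix U assume "openin past_topology U \<and> \<phi> \<in> U"
    then obtain a \<epsilon> where U: "\<epsilon> > 0" "past_nbhd a \<epsilon> \<phi> \<subseteq> U"
      unfolding openin_past_topology by blast
    have "\<forall>\<^sub>F n in sequentially. \<forall>t\<in>{a..0}. dist (f n t) (\<phi> t) < \<epsilon>"
      using R U(1) by (simp add: uniform_limit_iff)
    then show "\<forall>\<^sub>F n in sequentially. f n \<in> U"
      by eventually_elim (use U assms in \<open>auto simp: past_nbhd_def\<close>)
  qed (use assms in auto)
qed

end

theory Submission
  imports Defs
begin

text \<open>Write \<open>X = y + z\<close> with \<open>z\<close> the noise part of a controlled path.  By the Cauchy--Schwarz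
  inequality \<open>z(t)\<close> lies in the set of \<open>v\<close> with \<open>\<langle>v, x\<^sup>\<star>\<rangle>\<^sup>2 \<le> C\<^sup>2 \<integral>\<^sub>0\<^sup>t |Q\<^sup>\<star> S(s)\<^sup>\<star> x\<^sup>\<star>|\<^sup>2 ds\<close>, and the integral
  is the variance of \<open>\<langle>Z(t), x\<^sup>\<star>\<rangle>\<close>.  As \<open>Z(t)\<close> is Gaussian and almost surely separably valued, the unit
  ball of the dual is totally bounded for this variance, so the noise parts of bounded cost are
  equicontinuous and determined up to \<open>\<epsilon>\<close> by finitely many functionals at finitely many times.
  Dissipativity makes \<open>y\<close> depend on \<open>z\<close> with exponential forgetting of the initial value, which gives
  total boundedness of \<open>\<K>(r)\<close> on every bounded interval once \<open>\<K>(r)\<close> is known to be uniformly bounded;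
  that bound comes from the coercivity of \<open>F\<close>, which keeps \<open>|y|\<close> linear in \<open>sup |z|\<close>, and a Gronwall
  argument whose number of steps is controlled by the energy alone.  The rate functional is lower
  semicontinuous by the parallelogram law, and a limit path decays at \<open>-\<infinity>\<close> because
  near-optimal controls spend little energy in the remote past.\<close>

text \<open>Three obstacles shape the argument. The window \<open>[s, 0]\<close> on which a path is
  controlled has no bound on its length, and the value at \<open>s\<close> ranges over a ball, which
  need not be compact; so constants have to be uniform in the length, and initial values have to be
  forgotten rather than compactified. The noise is multiplicative and \<open>B\<close> grows
  linearly, so the size of the noise part depends on the size of the path: dissipativity alone
  bounds \<open>y\<close> in terms of \<open>F (z)\<close>, of order \<open>|z|^m\<close>, and for
  \<open>m \<ge> 2\<close> the Gronwall argument would not close. Finally \<open>S (t - s) Q\<close>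
  may fail to be integrable at \<open>s = t\<close>; estimates of the noise therefore go through the
  dual, where the squared norms of the functionals \<open>h \<mapsto> xs (SQ s h)\<close> are
  integrable in \<open>s\<close>. Moreover dissipativity concerns \<open>A + F\<close> only, so a
  one-sided bound for \<open>A\<close> itself is first extracted from the behaviour of
  \<open>F\<close> on the unit sphere; only then can coercivity of \<open>F\<close> be used.\<close>

text \<open>Pigeonhole on a grid of mesh \<open>\<epsilon>\<close>: boundedness leaves finitely many
  tuples of rounded values, and one representative is kept per tuple. Representatives come from
  \<open>X\<close> itself, because later the members of a net of paths must again be controlled
  paths.\<close>

lemma finite_family_net:
  fixes f :: "'i \<Rightarrow> 'a \<Rightarrow> real"
  assumes I: "finite I" and bd: "\<And>i. i \<in> I \<Longrightarrow> \<exists>b. \<forall>x\<in>X. \<bar>f i x\<bar> \<le> b" and \<epsilon>: "\<epsilon> > 0"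
  obtains N where "finite N" "N \<subseteq> X"
    "\<And>x. x \<in> X \<Longrightarrow> \<exists>x'\<in>N. \<forall>i\<in>I. \<bar>f i x - f i x'\<bar> < \<epsilon>"
proof -
  obtain b where b: "\<And>i x. i \<in> I \<Longrightarrow> x \<in> X \<Longrightarrow> \<bar>f i x\<bar> \<le> b i"
    using bd by metis
  define g where "g x = (\<lambda>i\<in>I. \<lfloor>f i x / \<epsilon>\<rfloor>)" for x
  have "g ` X \<subseteq> (\<Pi>\<^sub>E i\<in>I. {\<lfloor>- b i / \<epsilon>\<rfloor>..\<lfloor>b i / \<epsilon>\<rfloor>})"
  proof (rule image_subsetI)
    fix x assume "x \<in> X"
    then have "- b i / \<epsilon> \<le> f i x / \<epsilon>" "f i x / \<epsilon> \<le> b i / \<epsilon>" if "i \<in> I" for i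
      using b[OF that \<open>x \<in> X\<close>] \<epsilon> by (auto simp: field_simps abs_le_iff)
    then show "g x \<in> (\<Pi>\<^sub>E i\<in>I. {\<lfloor>- b i / \<epsilon>\<rfloor>..\<lfloor>b i / \<epsilon>\<rfloor>})"
      unfolding g_def by (auto intro!: floor_mono)
  qed
  then have fin: "finite (g ` X)"
    by (rule finite_subset) (auto intro!: finite_PiE I)
  show ?thesis
  proof
    show "finite (inv_into X g ` g ` X)" using fin by simp
    show "inv_into X g ` g ` X \<subseteq> X" by (auto intro: inv_into_into)
    fix x assume x: "x \<in> X"
    define x' where "x' = inv_into X g (g x)"
    have eq: "g x' = g x" using x unfolding x'_def by (simp add: f_inv_into_f)
    have "\<bar>f i x - f i x'\<bar> < \<epsilon>" if "i \<in> I" for i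
    proof -
      have "\<lfloor>f i x' / \<epsilon>\<rfloor> = \<lfloor>f i x / \<epsilon>\<rfloor>"
        using fun_cong[OF eq, of i] that by (simp add: g_def)
      then have "\<bar>f i x / \<epsilon> - f i x' / \<epsilon>\<bar> < 1" by linarith
      then show ?thesis using \<epsilon> by (simp add: diff_divide_distrib[symmetric])
    qed
    then show "\<exists>x'\<in>inv_into X g ` g ` X. \<forall>i\<in>I. \<bar>f i x - f i x'\<bar> < \<epsilon>"
      using x unfolding x'_def by blast
  qed
qed

section \<open>Differential and Gronwall inequalities\<close>

text \<open>Left difference quotients are the natural ones here: a functional that norms
  \<open>w t\<close> bounds \<open>norm (w t) - norm (w (t - h))\<close> from above for
  \<open>h > 0\<close>, while for forward increments it gives a lower bound only.\<close>

lemma left_Dini_nonpos_imp_le: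
  fixes u :: "real \<Rightarrow> real"
  assumes cont: "continuous_on {0..T} u" and T: "0 \<le> T"
    and dini: "\<And>t \<eta>. 0 < t \<Longrightarrow> t \<le> T \<Longrightarrow> \<eta> > 0 \<Longrightarrow> \<forall>\<^sub>F h in at_right 0. u t - u (t - h) \<le> \<eta> * h"
  shows "u T \<le> u 0"
proof -
  have "u T \<le> u 0 + \<eta> * (1 + T)" if \<eta>: "\<eta> > 0" for \<eta>
  proof (rule ccontr)
    \<comment> \<open>The tilt absorbs the error \<open>\<eta> * h\<close>: at the least time
      \<open>t\<close> where \<open>g\<close> is at least its terminal value, looking back gives
      \<open>g (t - h) \<ge> g t\<close>, so there would be an earlier such time.\<close>
    define g where "g t = u t - \<eta> * t" for t
    assume "\<not> u T \<le> u 0 + \<eta> * (1 + T)"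
    then have gT: "g T > g 0" using \<eta> by (simp add: g_def algebra_simps)
    have contg: "continuous_on {0..T} g"
      unfolding g_def by (intro continuous_intros cont)
    define A where "A = {0..T} \<inter> g -` {g T..}"
    have "compact A"
      unfolding A_def
      using continuous_on_closed_vimage[of "{0..T}" g] contg
      by (metis Int_commute bounded_Int bounded_closed_interval closed_atLeast closed_atLeastAtMost compact_eq_bounded_closed)
    moreover have "A \<noteq> {}" using T by (auto simp: A_def)
    ultimately obtain t where t: "t \<in> A" "\<And>s. s \<in> A \<Longrightarrow> t \<le> s"
      using compact_attains_inf by meson
    have t0: "0 < t" "t \<le> T"
      using t(1) gT by (auto simp: A_def) (metis less_eq_real_def not_le)
    have "\<forall>\<^sub>F h in at_right 0. u t - u (t - h) \<le> \<eta> * h" "\<forall>\<^sub>F h in at_right 0. h < t" "\<forall>\<^sub>F h in at_right 0. (0::real) < h"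
      using dini[OF t0 \<eta>] t0 by (auto simp: eventually_at_right_less intro: eventually_at_right_field[THEN iffD2])
    then have "\<forall>\<^sub>F h in at_right 0. u t - u (t - h) \<le> \<eta> * h \<and> h < t \<and> 0 < h"
      by eventually_elim simp
    then obtain h where h: "u t - u (t - h) \<le> \<eta> * h" "h < t" "0 < h"
      using eventually_happens'[OF trivial_limit_at_right_real] by blast
    have "g t \<le> g (t - h)" using h by (simp add: g_def algebra_simps)
    moreover have "g T \<le> g t" using t(1) by (simp add: A_def)
    ultimately have "t - h \<in> A" using h t0 by (auto simp: A_def)
    then show False using t(2) h by force
  qed
  then have "u T \<le> u 0 + e" if "e > 0" for e
    using that[THEN divide_pos_pos, of "1 + T"] T by (metis add_pos_nonneg zero_less_one nonzero_eq_divide_eq less_irrefl)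
  then show ?thesis by (rule field_le_epsilon)
qed

text \<open>The integrating factor \<open>exp (\<Lambda> * t)\<close> reduces the claim to the
  previous lemma. The sign of \<open>\<Lambda>\<close> is left free, since the growth bound of the
  semigroup comes from a negative one.\<close>

lemma left_Dini_exp_bound:
  fixes f :: "real \<Rightarrow> real"
  assumes cont: "continuous_on {0..T} f" and T: "0 \<le> T"
    and dini: "\<And>t. 0 < t \<Longrightarrow> t \<le> T \<Longrightarrow> \<exists>L l. (\<forall>\<^sub>F h in at_right 0. f t - f (t - h) \<le> h * L h) \<and>
      (L \<longlongrightarrow> l) (at_right 0) \<and> l \<le> - \<Lambda> * (f t - b)"
  shows "f T - b \<le> exp (- \<Lambda> * T) * (f 0 - b)"
proof -
  define u where "u t = exp (\<Lambda> * t) * (f t - b)" for t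
  have "u T \<le> u 0"
  proof (rule left_Dini_nonpos_imp_le)
    show "continuous_on {0..T} u" unfolding u_def by (intro continuous_intros cont)
    fix t \<eta> :: real assume t: "0 < t" "t \<le> T" and \<eta>: "\<eta> > 0"
    obtain L l where L: "\<forall>\<^sub>F h in at_right 0. f t - f (t - h) \<le> h * L h"
      "(L \<longlongrightarrow> l) (at_right 0)" "l \<le> - \<Lambda> * (f t - b)" using dini[OF t] by blast
    have lim1: "((\<lambda>h. t - h) \<longlongrightarrow> t) (at_right 0)"
      by (auto intro!: tendsto_eq_intros)
    have "\<forall>\<^sub>F h in at_right 0. t - h \<in> {0..T}"
      unfolding eventually_at_right_field using t by (intro exI[of _ t]) auto
    from continuous_on_tendsto_compose[OF cont lim1 _ this] t
    have limf: "((\<lambda>h. f (t - h)) \<longlongrightarrow> f t) (at_right 0)" by simp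
    have "((\<lambda>h. (exp (\<Lambda> * t) - exp (\<Lambda> * (t - h))) / h) \<longlongrightarrow> \<Lambda> * exp (\<Lambda> * t)) (at_right 0)"
    proof -
      have "((\<lambda>h. exp (\<Lambda> * (t - h))) has_field_derivative - \<Lambda> * exp (\<Lambda> * t)) (at 0)"
        by (auto intro!: derivative_eq_intros)
      then have "((\<lambda>h. (exp (\<Lambda> * (t - h)) - exp (\<Lambda> * t)) / h) \<longlongrightarrow> - \<Lambda> * exp (\<Lambda> * t)) (at 0)"
        by (simp add: DERIV_def)
      from tendsto_minus[OF this] have "((\<lambda>h. (exp (\<Lambda> * t) - exp (\<Lambda> * (t - h))) / h) \<longlongrightarrow> \<Lambda> * exp (\<Lambda> * t)) (at 0)"
        by (simp add: minus_divide_left)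
      then show ?thesis by (rule filterlim_mono) (auto simp: at_le)
    qed
    then have "((\<lambda>h. exp (\<Lambda> * t) * L h + (exp (\<Lambda> * t) - exp (\<Lambda> * (t - h))) / h * (f (t - h) - b))
      \<longlongrightarrow> exp (\<Lambda> * t) * l + \<Lambda> * exp (\<Lambda> * t) * (f t - b)) (at_right 0)"
      by (intro tendsto_intros L limf)
    moreover have "exp (\<Lambda> * t) * l + \<Lambda> * exp (\<Lambda> * t) * (f t - b) < \<eta>"
      using mult_left_mono[OF L(3), of "exp (\<Lambda> * t)"] \<eta> by (simp add: algebra_simps)
    ultimately have "\<forall>\<^sub>F h in at_right 0. exp (\<Lambda> * t) * L h + (exp (\<Lambda> * t) - exp (\<Lambda> * (t - h))) / h * (f (t - h) - b) < \<eta>"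
      by (rule order_tendstoD)
    moreover have "\<forall>\<^sub>F h in at_right 0. (0::real) < h" by (simp add: eventually_at_right_less)
    ultimately show "\<forall>\<^sub>F h in at_right 0. u t - u (t - h) \<le> \<eta> * h"
      using L(1)
    proof eventually_elim
      case (elim h)
      have "u t - u (t - h) = exp (\<Lambda> * t) * (f t - f (t - h)) + (exp (\<Lambda> * t) - exp (\<Lambda> * (t - h))) * (f (t - h) - b)"
        by (simp add: u_def algebra_simps)
      also have "\<dots> \<le> exp (\<Lambda> * t) * (h * L h) + (exp (\<Lambda> * t) - exp (\<Lambda> * (t - h))) * (f (t - h) - b)"
        using elim by (intro add_right_mono mult_left_mono) auto
      also have "\<dots> = (exp (\<Lambda> * t) * L h + (exp (\<Lambda> * t) - exp (\<Lambda> * (t - h))) / h * (f (t - h) - b)) * h"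
        using elim by (simp add: field_simps)
      also have "\<dots> \<le> \<eta> * h" using elim by (intro mult_right_mono) auto
      finally show ?case .
    qed
  qed (rule T)
  then have "exp (- \<Lambda> * T) * u T \<le> exp (- \<Lambda> * T) * u 0" by simp
  then show ?thesis by (simp add: u_def mult.assoc[symmetric] exp_add[symmetric])
qed

text \<open>The unknown \<open>V t\<close> at the right endpoint sits on both sides and is absorbed
  as long as \<open>a\<close> increases by at most \<open>1 / (2 * C)\<close>; over such a stretch
  \<open>V\<close> at most doubles. The number of doublings is read off from \<open>a\<close>,
  whatever the length of the time interval.\<close>

lemma Gronwall_dyadic:
  fixes V a :: "real \<Rightarrow> real"
  assumes cont: "continuous_on {0..T} a" and a0: "a 0 = 0" and V0: "V 0 = 1" and C: "C > 0"
    and V: "\<And>t. 0 \<le> t \<Longrightarrow> t \<le> T \<Longrightarrow> 0 \<le> V t"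
    and step: "\<And>s t. 0 \<le> s \<Longrightarrow> s \<le> t \<Longrightarrow> t \<le> T \<Longrightarrow> V t - V s \<le> C * V t * (a t - a s)"
  shows "0 \<le> t \<Longrightarrow> t \<le> T \<Longrightarrow> a t \<le> real n / (2 * C) \<Longrightarrow> V t \<le> 2 ^ n"
proof (induction n arbitrary: t)
  case 0
  have "V t - V 0 \<le> C * V t * (a t - a 0)" using 0 by (intro step) auto
  also have "\<dots> \<le> 0" using 0 a0 C V[of t] by (simp add: mult_nonneg_nonpos)
  finally show ?case using V0 by simp
next
  case (Suc n)
  have *: "V t \<le> 2 * V s" if "0 \<le> s" "s \<le> t" "a t - a s \<le> 1 / (2 * C)" for s
  proof -
    have "V t - V s \<le> C * V t * (a t - a s)" using Suc that by (intro step) auto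
    also have "\<dots> \<le> C * V t * (1 / (2 * C))" using that C V[of t] Suc by (intro mult_left_mono) auto
    also have "\<dots> = V t / 2" using C by simp
    finally show ?thesis by simp
  qed
  show ?case
  proof (cases "a t \<le> 1 / (2 * C)")
    case True
    then have "V t \<le> 2 * V 0" using Suc a0 by (intro *) auto
    also have "\<dots> \<le> 2 ^ Suc n" using V0 by simp
    finally show ?thesis .
  next
    case False
    then obtain s where s: "0 \<le> s" "s \<le> t" "a s = a t - 1 / (2 * C)"
      using IVT'[of a 0 "a t - 1 / (2 * C)" t] a0 Suc.prems C continuous_on_subset[OF cont, of "{0..t}"]
      by auto
    have "a s \<le> real n / (2 * C)" using s(3) Suc.prems by (simp add: add_divide_distrib)
    then have "V s \<le> 2 ^ n" using s Suc.prems by (intro Suc.IH) auto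
    moreover have "V t \<le> 2 * V s" using s by (intro *) auto
    ultimately show ?thesis by simp
  qed
qed

section \<open>Mild solutions for a decaying semigroup\<close>

locale decaying_semigroup =
  fixes S :: "real \<Rightarrow> 'e::banach \<Rightarrow>\<^sub>L 'e" and M \<omega> :: real
  assumes C0: "C0_semigroup S" and M: "M \<ge> 1" and \<omega>: "\<omega> > 0"
    and decay: "\<And>t. t \<ge> 0 \<Longrightarrow> norm (S t) \<le> M * exp (- \<omega> * t)"
begin

lemma S_0 [simp]: "S 0 x = x"
  using C0 by (simp add: C0_semigroup_def)

lemma S_add: "s \<ge> 0 \<Longrightarrow> t \<ge> 0 \<Longrightarrow> S (s + t) x = S s (S t x)"
  using C0 by (simp add: C0_semigroup_def)

lemma S_commute: "s \<ge> 0 \<Longrightarrow> t \<ge> 0 \<Longrightarrow> S s (S t x) = S t (S s x)"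
  by (metis S_add add.commute)

lemma S_right_cont: "((\<lambda>t. S t x) \<longlongrightarrow> x) (at_right 0)"
  using C0 by (simp add: C0_semigroup_def)

lemma norm_S_le: "t \<ge> 0 \<Longrightarrow> norm (S t) \<le> M"
proof -
  assume t: "t \<ge> 0"
  have "norm (S t) \<le> M * exp (- \<omega> * t)" by (rule decay[OF t])
  also have "\<dots> \<le> M * 1" using M \<omega> t by (intro mult_left_mono) auto
  finally show ?thesis by simp
qed

lemma S_bound: "t \<ge> 0 \<Longrightarrow> norm (S t x) \<le> M * norm x"
  using norm_blinfun[of "S t" x] mult_right_mono[OF norm_S_le[of t] norm_ge_zero[of x]] by linarith

lemma S_diff_bound:
  assumes "s \<ge> 0" "t \<ge> 0"
  shows "norm (S t x - S s x) \<le> M * norm (S \<bar>t - s\<bar> x - x)"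
proof -
  have *: "norm (S t x - S s x) \<le> M * norm (S (t - s) x - x)" if "0 \<le> s" "s \<le> t" for s t
  proof -
    have "S t x - S s x = S s (S (t - s) x - x)"
      using S_add[of s "t - s" x] that by (simp add: blinfun.diff_right)
    then show ?thesis using S_bound[OF \<open>0 \<le> s\<close>, of "S (t - s) x - x"] by simp
  qed
  show ?thesis
  proof (cases "s \<le> t")
    case False
    then show ?thesis using *[of t s] assms by (simp add: norm_minus_commute)
  qed (use * assms in auto)
qed

lemma S_cont: "continuous_on {0..} (\<lambda>t. S t x)"
  unfolding continuous_on_iff
proof (intro ballI allI impI)
  fix t \<epsilon> :: real assume t: "t \<in> {0..}" and \<epsilon>: "\<epsilon> > 0"
  have "\<epsilon> / M > 0" using \<epsilon> M by simp
  then have "\<forall>\<^sub>F h in at_right 0. dist (S h x) x < \<epsilon> / M"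
    using S_right_cont tendstoD by blast
  then obtain d where d: "d > 0" "\<And>h. 0 < h \<Longrightarrow> h < d \<Longrightarrow> dist (S h x) x < \<epsilon> / M"
    unfolding eventually_at_right_field by auto
  have "dist (S s x) (S t x) < \<epsilon>" if s: "s \<in> {0..}" "dist s t < d" for s
  proof -
    have "dist (S \<bar>s - t\<bar> x) x < \<epsilon> / M"
      using d(2)[of "\<bar>s - t\<bar>"] s(2) \<open>\<epsilon> / M > 0\<close> by (cases "s = t") (auto simp: dist_real_def)
    moreover have "dist (S s x) (S t x) \<le> M * dist (S \<bar>s - t\<bar> x) x"
      using S_diff_bound[of t s x] s t by (simp add: dist_norm)
    ultimately show ?thesis using M by (smt (verit) mult.commute pos_less_divide_eq)
  qed
  then show "\<exists>d>0. \<forall>x'\<in>{0..}. dist x' t < d \<longrightarrow> dist (S x' x) (S t x) < \<epsilon>"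
    using d(1) by blast
qed

text \<open>\<open>S\<close> is only strongly continuous, so the argument is frozen at
  \<open>g a\<close>; the bound \<open>M\<close>, uniform in time, takes care of the
  difference.\<close>

lemma S_jointly_cont:
  assumes f: "continuous_on X f" and g: "continuous_on X g" and nn: "\<And>x. x \<in> X \<Longrightarrow> 0 \<le> f x"
  shows "continuous_on X (\<lambda>x. S (f x) (g x))"
  unfolding continuous_on_def
proof
  fix a assume a: "a \<in> X"
  let ?F = "at a within X"
  have ev: "\<forall>\<^sub>F x in ?F. x \<in> X" by (simp add: eventually_at_filter)
  have g': "(g \<longlongrightarrow> g a) ?F" and f': "(f \<longlongrightarrow> f a) ?F"
    using f g a by (auto simp: continuous_on_def)
  have "((\<lambda>x. S (f x) (g a)) \<longlongrightarrow> S (f a) (g a)) ?F"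
    by (rule continuous_on_tendsto_compose[OF S_cont f']) (use ev nn a in \<open>auto elim: eventually_mono\<close>)
  moreover have "((\<lambda>x. S (f x) (g x - g a)) \<longlongrightarrow> 0) ?F"
  proof (rule Lim_null_comparison)
    show "\<forall>\<^sub>F x in ?F. norm (S (f x) (g x - g a)) \<le> M * norm (g x - g a)"
      using ev by eventually_elim (auto intro!: S_bound nn)
    show "((\<lambda>x. M * norm (g x - g a)) \<longlongrightarrow> 0) ?F"
      using g' by (auto intro!: tendsto_eq_intros)
  qed
  ultimately have "((\<lambda>x. S (f x) (g a) + S (f x) (g x - g a)) \<longlongrightarrow> S (f a) (g a) + 0) ?F"
    by (rule tendsto_add)
  then show "((\<lambda>x. S (f x) (g x)) \<longlongrightarrow> S (f a) (g a)) ?F"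
    by (simp add: blinfun.diff_right)
qed

text \<open>The averages \<open>J \<delta>\<close> map into the domain of the generator and tend to the identity, so they take
  over the usual role of the Yosida approximation without requiring resolvents.\<close>

definition J :: "real \<Rightarrow> 'e \<Rightarrow> 'e" where
  "J \<delta> x = integral {0..\<delta>} (\<lambda>s. S s x) /\<^sub>R \<delta>"

lemma S_integrable: "0 \<le> a \<Longrightarrow> (\<lambda>s. S s x) integrable_on {a..b}"
  by (intro integrable_continuous_real continuous_on_subset[OF S_cont]) auto

lemma J_bound:
  assumes "\<delta> > 0"
  shows "norm (J \<delta> x) \<le> M * norm x"
proof -
  have "norm (integral {0..\<delta>} (\<lambda>s. S s x)) \<le> M * norm x * (\<delta> - 0)"
    using assms by (intro integral_bound continuous_on_subset[OF S_cont]) (auto intro: S_bound)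
  then show ?thesis using assms by (simp add: J_def field_simps)
qed

lemma J_linear: "linear (J \<delta>)"
  unfolding J_def
  by (rule linearI) (simp_all add: blinfun.add_right blinfun.scaleR_right integral_add S_integrable scaleR_add_right)

lemma J_bounded_linear: "\<delta> > 0 \<Longrightarrow> bounded_linear (J \<delta>)"
  using J_linear J_bound by (auto intro!: bounded_linear_intro[of _ M] simp: linear_add linear_scale mult.commute)

lemma J_S_commute:
  assumes "\<delta> > 0" "t \<ge> 0"
  shows "J \<delta> (S t x) = S t (J \<delta> x)"
proof -
  have "integral {0..\<delta>} (\<lambda>s. S s (S t x)) = integral {0..\<delta>} (S t \<circ> (\<lambda>s. S s x))"
    using assms by (intro integral_cong) (auto simp: S_commute)
  also have "\<dots> = S t (integral {0..\<delta>} (\<lambda>s. S s x))"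
    by (intro integral_linear S_integrable blinfun.bounded_linear_right) simp
  finally show ?thesis by (simp add: J_def blinfun.scaleR_right)
qed

lemma J_tendsto: "((\<lambda>\<delta>. J \<delta> x) \<longlongrightarrow> x) (at_right 0)"
proof -
  have "\<forall>\<^sub>F \<delta> in at_right 0. dist (J \<delta> x) x < \<epsilon>" if \<epsilon>: "\<epsilon> > 0" for \<epsilon>
  proof -
    have "\<forall>\<^sub>F h in at_right 0. dist (S h x) x < \<epsilon> / 2"
      using S_right_cont tendstoD \<epsilon> half_gt_zero by blast
    then obtain d where d: "d > 0" "\<And>h. 0 < h \<Longrightarrow> h < d \<Longrightarrow> dist (S h x) x < \<epsilon> / 2"
      unfolding eventually_at_right_field by auto
    have "dist (J \<delta> x) x < \<epsilon>" if \<delta>: "0 < \<delta>" "\<delta> < d" for \<delta>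
    proof -
      have "norm (integral {0..\<delta>} (\<lambda>s. S s x - x)) \<le> \<epsilon> / 2 * (\<delta> - 0)"
      proof (rule integral_bound)
        fix s assume "s \<in> {0..\<delta>}"
        then show "norm (S s x - x) \<le> \<epsilon> / 2"
          using d(2)[of s] \<delta> \<epsilon> by (cases "s = 0") (auto simp: dist_norm)
      qed (use \<delta> in \<open>auto intro!: continuous_intros continuous_on_subset[OF S_cont]\<close>)
      moreover have "integral {0..\<delta>} (\<lambda>s. S s x - x) = \<delta> *\<^sub>R (J \<delta> x - x)"
        using \<delta> by (subst integral_diff) (auto simp: S_integrable J_def scaleR_diff_right)
      ultimately have "\<delta> * norm (J \<delta> x - x) \<le> \<epsilon> / 2 * \<delta>" using \<delta> by simp
      then have "norm (J \<delta> x - x) \<le> \<epsilon> / 2" using \<delta> by (simp add: mult.commute)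
      then show ?thesis using \<epsilon> by (simp add: dist_norm)
    qed
    then show ?thesis using d(1) by (auto simp: eventually_at_right_field)
  qed
  then show ?thesis by (rule tendstoI)
qed

text \<open>Up to the factor \<open>1 / (\<delta> * h)\<close> both sides are the integral of the
  orbit over \<open>{h..\<delta> + h}\<close> minus that over \<open>{0..\<delta>}\<close>, which is
  symmetric in \<open>\<delta>\<close> and \<open>h\<close>. Exchanging the two turns the difference
  quotient in \<open>h\<close> into an average over \<open>{0..h}\<close> of a fixed vector, and
  such averages converge for every vector.\<close>

lemma J_generator_identity:
  assumes "\<delta> > 0" "h > 0"
  shows "(S h (J \<delta> x) - J \<delta> x) /\<^sub>R h = J h ((S \<delta> x - x) /\<^sub>R \<delta>)"
proof -
  let ?I = "\<lambda>a b. integral {a..b} (\<lambda>s. S s x)"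
  have shift: "integral {0..a} (\<lambda>s. S s (S b x)) = ?I b (a + b)" if "a > 0" "b > 0" for a b
  proof -
    have "?I b (a + b) = integral {0..a} (\<lambda>s. S (s + b) x)"
      using integral_shift_real_ivl[of b b "a + b" "\<lambda>s. S s x"] by simp
    also have "\<dots> = integral {0..a} (\<lambda>s. S s (S b x))"
      using that by (intro integral_cong) (auto simp: S_add)
    finally show ?thesis by simp
  qed
  have comb: "?I 0 a + ?I a (a + b) = ?I 0 (a + b)" if "a > 0" "b > 0" for a b
    using that by (intro Henstock_Kurzweil_Integration.integral_combine S_integrable) auto
  have "S h (J \<delta> x) = J \<delta> (S h x)" using assms by (simp add: J_S_commute)
  then have "S h (J \<delta> x) - J \<delta> x = (?I h (\<delta> + h) - ?I 0 \<delta>) /\<^sub>R \<delta>"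
    using assms shift by (simp add: J_def scaleR_diff_right)
  also have "?I h (\<delta> + h) - ?I 0 \<delta> = ?I \<delta> (h + \<delta>) - ?I 0 h"
    using comb[of h \<delta>] comb[of \<delta> h] assms by (simp add: algebra_simps)
  also have "\<dots> = integral {0..h} (\<lambda>s. S s (S \<delta> x)) - ?I 0 h" using shift assms by simp
  also have "\<dots> = h *\<^sub>R (J h (S \<delta> x) - J h x)" using assms by (simp add: J_def scaleR_diff_right)
  finally have "S h (J \<delta> x) - J \<delta> x = (h / \<delta>) *\<^sub>R (J h (S \<delta> x - x))"
    by (simp add: linear_diff[OF J_linear] divide_inverse mult.commute)
  then show ?thesis using assms by (simp add: linear_scale[OF J_linear] divide_inverse)
qed

lemma J_in_domain:
  assumes "is_generator S D A" "\<delta> > 0"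
  shows "J \<delta> x \<in> D" "A (J \<delta> x) = (S \<delta> x - x) /\<^sub>R \<delta>"
proof -
  have "((\<lambda>h. J h ((S \<delta> x - x) /\<^sub>R \<delta>)) \<longlongrightarrow> (S \<delta> x - x) /\<^sub>R \<delta>) (at_right 0)"
    by (rule J_tendsto)
  moreover have "\<forall>\<^sub>F h in at_right 0. J h ((S \<delta> x - x) /\<^sub>R \<delta>) = (S h (J \<delta> x) - J \<delta> x) /\<^sub>R h"
    using assms J_generator_identity by (auto simp: eventually_at_right_field intro!: exI[of _ 1])
  ultimately have lim: "((\<lambda>h. (S h (J \<delta> x) - J \<delta> x) /\<^sub>R h) \<longlongrightarrow> (S \<delta> x - x) /\<^sub>R \<delta>) (at_right 0)"
    by (simp add: tendsto_cong)
  then show D: "J \<delta> x \<in> D"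
    using assms by (auto simp: is_generator_def)
  then have "((\<lambda>h. (S h (J \<delta> x) - J \<delta> x) /\<^sub>R h) \<longlongrightarrow> A (J \<delta> x)) (at_right 0)"
    using assms by (auto simp: is_generator_def)
  with lim show "A (J \<delta> x) = (S \<delta> x - x) /\<^sub>R \<delta>"
    using tendsto_unique trivial_limit_at_right_real by blast
qed

text \<open>Homogeneity of \<open>A\<close> is read off from its difference quotients; it permits
  normalising elements of \<open>D\<close> to the unit sphere.\<close>

lemma generator_scale:
  assumes "is_generator S D A" "x \<in> D"
  shows "c *\<^sub>R x \<in> D" "A (c *\<^sub>R x) = c *\<^sub>R A x"
proof -
  have "((\<lambda>t. c *\<^sub>R ((S t x - x) /\<^sub>R t)) \<longlongrightarrow> c *\<^sub>R A x) (at_right 0)"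
    using assms by (intro tendsto_intros) (auto simp: is_generator_def)
  then have lim: "((\<lambda>t. (S t (c *\<^sub>R x) - c *\<^sub>R x) /\<^sub>R t) \<longlongrightarrow> c *\<^sub>R A x) (at_right 0)"
    by (simp add: blinfun.scaleR_right scaleR_diff_right mult.commute)
  then show D: "c *\<^sub>R x \<in> D" using assms by (auto simp: is_generator_def)
  then have "((\<lambda>t. (S t (c *\<^sub>R x) - c *\<^sub>R x) /\<^sub>R t) \<longlongrightarrow> A (c *\<^sub>R x)) (at_right 0)"
    using assms by (auto simp: is_generator_def)
  with lim show "A (c *\<^sub>R x) = c *\<^sub>R A x"
    using tendsto_unique trivial_limit_at_right_real by blast
qed

lemma zero_in_domain: "is_generator S D A \<Longrightarrow> 0 \<in> D"
  by (auto simp: is_generator_def)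

text \<open>The convergence is checked on a finite net and carried to \<open>X\<close> by the common
  bound \<open>C\<close>. Finite nets are assumed rather than compactness because the lemma is also
  applied to \<open>reach\<close> sets, for which nets are what is constructed.\<close>

lemma equibounded_tendsto_uniform:
  fixes L :: "real \<Rightarrow> 'e \<Rightarrow> 'e"
  assumes lin: "\<And>h. h > 0 \<Longrightarrow> linear (L h)" and bd: "\<And>h x. h > 0 \<Longrightarrow> norm (L h x) \<le> C * norm x"
    and lim: "\<And>x. ((\<lambda>h. L h x) \<longlongrightarrow> x) (at_right 0)"
    and net: "\<And>\<epsilon>. \<epsilon> > 0 \<Longrightarrow> \<exists>N. finite N \<and> (\<forall>x\<in>X. \<exists>y\<in>N. norm (x - y) < \<epsilon>)" and \<epsilon>: "\<epsilon> > 0"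
  shows "\<forall>\<^sub>F h in at_right 0. \<forall>x\<in>X. norm (L h x - x) < \<epsilon>"
proof -
  define K where "K = max 0 C + 1"
  have K: "K > 0" "C \<le> K" by (auto simp: K_def)
  define \<eta> where "\<eta> = \<epsilon> / (2 * (K + 1))"
  have \<eta>: "\<eta> > 0" "(K + 1) * \<eta> = \<epsilon> / 2" using \<epsilon> K by (auto simp: \<eta>_def field_simps)
  obtain N where N: "finite N" "\<And>x. x \<in> X \<Longrightarrow> \<exists>y\<in>N. norm (x - y) < \<eta>" using net[OF \<eta>(1)] by blast
  have "\<forall>\<^sub>F h in at_right 0. \<forall>y\<in>N. norm (L h y - y) < \<epsilon> / 2"
    using N(1) \<epsilon> tendstoD[OF lim, of "\<epsilon> / 2"] by (intro eventually_ball_finite) (auto simp: dist_norm)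
  moreover have "\<forall>\<^sub>F h in at_right 0. (0::real) < h" by (simp add: eventually_at_right_less)
  ultimately show ?thesis
  proof eventually_elim
    case (elim h)
    show ?case
    proof
      fix x assume "x \<in> X"
      then obtain y where y: "y \<in> N" "norm (x - y) < \<eta>" using N by blast
      have eq: "L h x - x = L h (x - y) + (L h y - y) - (x - y)"
        using lin[OF elim(2)] by (simp add: linear_diff)
      have "norm (L h x - x) \<le> norm (L h (x - y)) + norm (L h y - y) + norm (x - y)"
        unfolding eq using norm_triangle_ineq4[of "L h (x - y) + (L h y - y)" "x - y"]
          norm_triangle_ineq[of "L h (x - y)" "L h y - y"] by linarith
      also have "norm (L h (x - y)) \<le> K * norm (x - y)"
        using bd[OF elim(2), of "x - y"] mult_right_mono[OF K(2) norm_ge_zero[of "x - y"]] by linarith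
      also have "K * norm (x - y) + norm (L h y - y) + norm (x - y) = (K + 1) * norm (x - y) + norm (L h y - y)"
        by (simp add: algebra_simps)
      also have "\<dots> < (K + 1) * \<eta> + \<epsilon> / 2"
        using y elim K by (intro add_le_less_mono mult_left_mono) auto
      finally show "norm (L h x - x) < \<epsilon>" using \<eta>(2) by simp
    qed
  qed
qed

lemma compact_finite_net:
  fixes X :: "'e set"
  assumes "compact X" "\<epsilon> > 0"
  shows "\<exists>N. finite N \<and> (\<forall>x\<in>X. \<exists>y\<in>N. norm (x - y) < \<epsilon>)"
proof -
  obtain N where "finite N" "X \<subseteq> (\<Union>y\<in>N. ball y \<epsilon>)"
    using assms unfolding compact_eq_totally_bounded by blast
  then show ?thesis by (intro exI[of _ N]) (auto simp: dist_norm norm_minus_commute subset_eq)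
qed

lemma J_uniform:
  assumes "compact X" "\<epsilon> > 0"
  shows "\<forall>\<^sub>F \<delta> in at_right 0. \<forall>x\<in>X. norm (J \<delta> x - x) < \<epsilon>"
  by (rule equibounded_tendsto_uniform[where C = M])
     (use J_linear J_bound J_tendsto compact_finite_net assms in auto)

lemma conv_cont:
  assumes "continuous_on {a..b} g" "b \<le> t"
  shows "continuous_on {a..b} (\<lambda>s. S (t - s) (g s))"
  by (rule S_jointly_cont) (use assms in \<open>auto intro!: continuous_intros\<close>)

lemma conv_integrable:
  assumes "continuous_on {a..b} g" "b \<le> t"
  shows "(\<lambda>s. S (t - s) (g s)) integrable_on {a..b}"
  by (intro integrable_continuous_real conv_cont assms)

definition mild :: "real \<Rightarrow> (real \<Rightarrow> 'e) \<Rightarrow> (real \<Rightarrow> 'e) \<Rightarrow> bool" where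
  "mild T g w \<longleftrightarrow> continuous_on {0..T} w \<and> continuous_on {0..T} g \<and>
     (\<forall>t\<in>{0..T}. w t = S t (w 0) + integral {0..t} (\<lambda>s. S (t - s) (g s)))"

lemma mild_eq:
  "mild T g w \<Longrightarrow> t \<in> {0..T} \<Longrightarrow> w t = S t (w 0) + integral {0..t} (\<lambda>s. S (t - s) (g s))"
  unfolding mild_def by blast

lemma mild_cont: "mild T g w \<Longrightarrow> continuous_on {0..T} w" "mild T g w \<Longrightarrow> continuous_on {0..T} g"
  by (simp_all only: mild_def)

lemma conv_step:
  assumes g: "continuous_on {0..t} g" and st: "0 \<le> s" "s \<le> t"
  shows "integral {0..t} (\<lambda>\<sigma>. S (t - \<sigma>) (g \<sigma>)) =
    S (t - s) (integral {0..s} (\<lambda>\<sigma>. S (s - \<sigma>) (g \<sigma>))) + integral {s..t} (\<lambda>\<sigma>. S (t - \<sigma>) (g \<sigma>))"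
proof -
  have gs: "continuous_on {0..s} g" using continuous_on_subset[OF g] st by auto
  have "S (t - s) (integral {0..s} (\<lambda>\<sigma>. S (s - \<sigma>) (g \<sigma>))) =
      integral {0..s} (S (t - s) \<circ> (\<lambda>\<sigma>. S (s - \<sigma>) (g \<sigma>)))"
    by (intro integral_linear[symmetric] conv_integrable gs blinfun.bounded_linear_right) simp
  also have "\<dots> = integral {0..s} (\<lambda>\<sigma>. S (t - \<sigma>) (g \<sigma>))"
  proof (intro integral_cong)
    fix \<sigma> assume "\<sigma> \<in> {0..s}"
    then show "(S (t - s) \<circ> (\<lambda>\<sigma>. S (s - \<sigma>) (g \<sigma>))) \<sigma> = S (t - \<sigma>) (g \<sigma>)"
      using S_add[of "t - s" "s - \<sigma>" "g \<sigma>"] st by simp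
  qed
  finally show ?thesis
    using Henstock_Kurzweil_Integration.integral_combine[OF st conv_integrable[OF g order_refl]] by simp
qed

lemma mild_step:
  assumes w: "mild T g w" and st: "0 \<le> s" "s \<le> t" "t \<le> T"
  shows "w t = S (t - s) (w s) + integral {s..t} (\<lambda>\<sigma>. S (t - \<sigma>) (g \<sigma>))"
proof -
  have g: "continuous_on {0..t} g"
    using mild_cont(2)[OF w] continuous_on_subset[of "{0..T}" g "{0..t}"] st by auto
  have eq: "w r = S r (w 0) + integral {0..r} (\<lambda>\<sigma>. S (r - \<sigma>) (g \<sigma>))" if "0 \<le> r" "r \<le> T" for r
    using that by (intro mild_eq[OF w]) auto
  have "S (t - s) (S s (w 0)) = S t (w 0)" using S_add[of "t - s" s "w 0"] st by simp
  moreover have "S (t - s) (w s) = S (t - s) (S s (w 0)) + S (t - s) (integral {0..s} (\<lambda>\<sigma>. S (s - \<sigma>) (g \<sigma>)))"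
    using arg_cong[OF eq[of s], of "S (t - s)"] st by (simp only: blinfun.add_right)
  moreover have "w t = S t (w 0) + integral {0..t} (\<lambda>s. S (t - s) (g s))"
    by (rule eq) (use st in auto)
  ultimately show ?thesis
    using conv_step[OF g st(1,2)] by (simp only: add.assoc)
qed

lemma mild_diff:
  assumes "mild T g w" "mild T g' w'"
  shows "mild T (\<lambda>t. g t - g' t) (\<lambda>t. w t - w' t)"
proof -
  have g: "continuous_on {0..T} g" "continuous_on {0..T} g'" using assms mild_cont by auto
  have "w t - w' t = S t (w 0 - w' 0) + integral {0..t} (\<lambda>s. S (t - s) (g s - g' s))"
    if t: "t \<in> {0..T}" for t
  proof -
    let ?I = "\<lambda>g. integral {0..t} (\<lambda>s. S (t - s) (g s))"
    have int: "?I (\<lambda>s. g s - g' s) = ?I g - ?I g'"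
      using g t unfolding blinfun.diff_right
      by (intro integral_diff conv_integrable) (auto intro: continuous_on_subset)
    have "w t - w' t = (S t (w 0) + ?I g) - (S t (w' 0) + ?I g')"
      using mild_eq[OF assms(1) t] mild_eq[OF assms(2) t] by (rule arg_cong2)
    also have "\<dots> = S t (w 0 - w' 0) + (?I g - ?I g')"
      by (simp add: blinfun.diff_right)
    finally show ?thesis unfolding int .
  qed
  then show ?thesis
    unfolding mild_def using assms[THEN mild_cont(1)] g continuous_on_diff by blast
qed

lemma mild_semigroup: "mild T (\<lambda>t. 0) (\<lambda>t. S t x)"
  by (auto simp: mild_def intro!: continuous_on_subset[OF S_cont])

lemma mild_zero: "mild T (\<lambda>t. 0) (\<lambda>t. 0)"
  by (auto simp: mild_def)

lemma mild_restrict: "mild T g w \<Longrightarrow> T' \<le> T \<Longrightarrow> mild T' g w"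
  unfolding mild_def by (meson atLeastatMost_subset_iff continuous_on_subset order_refl subsetD)

text \<open>A mild solution need not be differentiable, but its averages are. Stepping from
  \<open>t - h\<close> to \<open>t\<close> splits the quotient into the semigroup quotient of
  \<open>J \<delta> (w (t - h))\<close>, which \<open>J_generator_identity\<close> rewrites as
  \<open>J h\<close> of the bounded operator \<open>G\<close> below, and an average of the
  continuous function \<open>k\<close>.\<close>

lemma mild_J_left_derivative:
  assumes w: "mild T g w" and \<delta>: "\<delta> > 0" and t: "0 < t" "t \<le> T"
  shows "((\<lambda>h. (J \<delta> (w t) - J \<delta> (w (t - h))) /\<^sub>R h) \<longlongrightarrow> (S \<delta> (w t) - w t) /\<^sub>R \<delta> + J \<delta> (g t)) (at_right 0)"
proof -
  interpret Jl: bounded_linear "J \<delta>" by (rule J_bounded_linear[OF \<delta>])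
  have wc: "continuous_on {0..T} w" and gc: "continuous_on {0..T} g" using mild_cont[OF w] by auto
  have gct: "continuous_on {0..t} g" using gc t by (auto intro: continuous_on_subset)
  define G where "G x = (S \<delta> x - x) /\<^sub>R \<delta>" for x
  define k where "k \<sigma> = S (t - \<sigma>) (J \<delta> (g \<sigma>))" for \<sigma>
  have kc: "continuous_on {0..t} k"
    unfolding k_def by (intro conv_cont Jl.continuous_on gct) auto
  have inI: "\<forall>\<^sub>F h in at_right 0. t - h \<in> {0..T}" "\<forall>\<^sub>F h in at_right 0. 0 < h \<and> h < t"
    using t by (auto simp: eventually_at_right_field intro!: exI[of _ t])
  have "((\<lambda>h. t - h) \<longlongrightarrow> t) (at_right 0)" by (auto intro!: tendsto_eq_intros)
  from continuous_on_tendsto_compose[OF wc this _ inI(1)] t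
  have wlim: "((\<lambda>h. w (t - h)) \<longlongrightarrow> w t) (at_right 0)" by simp
  \<comment> \<open>\<open>J h\<close> converges at a fixed vector, while the argument
    \<open>w (t - h)\<close> moves; so the vector is frozen at \<open>w t\<close> and the remainder
    is estimated by the uniform bound for \<open>J h\<close>.\<close>
  have "((\<lambda>h. J h (G (w t)) + J h (G (w (t - h) - w t))) \<longlongrightarrow> G (w t) + 0) (at_right 0)"
  proof (intro tendsto_add J_tendsto)
    show "((\<lambda>h. J h (G (w (t - h) - w t))) \<longlongrightarrow> 0) (at_right 0)"
    proof (rule Lim_null_comparison)
      show "\<forall>\<^sub>F h in at_right 0. norm (J h (G (w (t - h) - w t))) \<le> M * norm (G (w (t - h) - w t))"
        using inI(2) by eventually_elim (auto intro: J_bound)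
      have "((\<lambda>h. S \<delta> (w (t - h) - w t)) \<longlongrightarrow> S \<delta> (w t - w t)) (at_right 0)"
        by (intro tendsto_intros wlim)
      then show "((\<lambda>h. M * norm (G (w (t - h) - w t))) \<longlongrightarrow> 0) (at_right 0)"
        unfolding G_def using wlim by (auto intro!: tendsto_eq_intros)
    qed
  qed
  moreover have "((\<lambda>h. integral {t - h..t} k /\<^sub>R h) \<longlongrightarrow> k t) (at_right 0)"
  proof (rule tendstoI)
    fix \<epsilon> :: real assume \<epsilon>: "\<epsilon> > 0"
    obtain d where d: "d > 0" "\<And>s. s \<in> {0..t} \<Longrightarrow> dist s t < d \<Longrightarrow> dist (k s) (k t) < \<epsilon> / 2"
      using kc t half_gt_zero[OF \<epsilon>] unfolding continuous_on_iff
      by (metis atLeastAtMost_iff less_eq_real_def order_refl)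
    have "dist (integral {t - h..t} k /\<^sub>R h) (k t) < \<epsilon>" if h: "0 < h" "h < min d t" for h
    proof -
      have kh: "continuous_on {t - h..t} k" using kc h by (auto intro: continuous_on_subset)
      have "norm (integral {t - h..t} (\<lambda>s. k s - k t)) \<le> \<epsilon> / 2 * (t - (t - h))"
      proof (rule integral_bound)
        fix s assume "s \<in> {t - h..t}"
        then have "dist (k s) (k t) < \<epsilon> / 2" using h by (intro d(2)) (auto simp: dist_real_def)
        then show "norm (k s - k t) \<le> \<epsilon> / 2" by (simp add: dist_norm)
      qed (use h kh in \<open>auto intro!: continuous_intros\<close>)
      moreover have "integral {t - h..t} (\<lambda>s. k s - k t) = h *\<^sub>R (integral {t - h..t} k /\<^sub>R h - k t)"
        using h integrable_continuous_real[OF kh]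
        by (subst integral_diff) (auto simp: scaleR_diff_right)
      ultimately have "h * norm (integral {t - h..t} k /\<^sub>R h - k t) \<le> \<epsilon> / 2 * h" using h by simp
      then have "norm (integral {t - h..t} k /\<^sub>R h - k t) \<le> \<epsilon> / 2" using h by (simp add: mult.commute)
      then show ?thesis using \<epsilon> by (simp add: dist_norm)
    qed
    then show "\<forall>\<^sub>F h in at_right 0. dist (integral {t - h..t} k /\<^sub>R h) (k t) < \<epsilon>"
      using d(1) t by (auto simp: eventually_at_right_field intro!: exI[of _ "min d t"])
  qed
  ultimately have lim: "((\<lambda>h. (J h (G (w t)) + J h (G (w (t - h) - w t))) + integral {t - h..t} k /\<^sub>R h) \<longlongrightarrow>
      G (w t) + 0 + k t) (at_right 0)"
    by (rule tendsto_add)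
  have "\<forall>\<^sub>F h in at_right 0. (J h (G (w t)) + J h (G (w (t - h) - w t))) + integral {t - h..t} k /\<^sub>R h =
      (J \<delta> (w t) - J \<delta> (w (t - h))) /\<^sub>R h"
    using inI(2)
  proof eventually_elim
    case (elim h)
    have gh: "continuous_on {t - h..t} g" using gct elim by (auto intro: continuous_on_subset)
    have "J h (G (w t)) + J h (G (w (t - h) - w t)) = J h (G (w (t - h)))"
      by (simp add: linear_add[OF J_linear, symmetric] G_def blinfun.diff_right algebra_simps scaleR_add_right scaleR_diff_right)
    also have "\<dots> = (S h (J \<delta> (w (t - h))) - J \<delta> (w (t - h))) /\<^sub>R h"
      unfolding G_def using J_generator_identity[of \<delta> h] elim \<delta> by simp
    finally have 1: "J h (G (w t)) + J h (G (w (t - h) - w t)) = (S h (J \<delta> (w (t - h))) - J \<delta> (w (t - h))) /\<^sub>R h" .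
    have "J \<delta> (w t) = J \<delta> (S h (w (t - h))) + J \<delta> (integral {t - h..t} (\<lambda>\<sigma>. S (t - \<sigma>) (g \<sigma>)))"
      using mild_step[OF w, of "t - h" t] elim t by (simp add: Jl.add)
    also have "J \<delta> (integral {t - h..t} (\<lambda>\<sigma>. S (t - \<sigma>) (g \<sigma>))) =
        integral {t - h..t} (J \<delta> \<circ> (\<lambda>\<sigma>. S (t - \<sigma>) (g \<sigma>)))"
      by (intro integral_linear[symmetric] conv_integrable gh Jl.bounded_linear_axioms) simp
    also have "\<dots> = integral {t - h..t} k"
      by (intro integral_cong) (auto simp: k_def J_S_commute \<delta>)
    also have "J \<delta> (S h (w (t - h))) = S h (J \<delta> (w (t - h)))"
      using elim \<delta> by (simp add: J_S_commute)
    finally show ?case unfolding 1 by (simp add: scaleR_diff_right scaleR_add_right)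
  qed
  from Lim_transform_eventually[OF lim this] show ?thesis
    by (simp add: G_def k_def)
qed

text \<open>For fixed \<open>\<delta>\<close>, a norming functional at
  \<open>J \<delta> (w t)\<close> turns the left derivative into a Dini inequality with equilibrium
  level \<open>(c + \<eta>) / \<Lambda>\<close>; then \<open>\<delta>\<close> and afterwards
  \<open>\<eta>\<close> tend to 0. The error \<open>\<eta>\<close> is allowed because averaging does
  not commute with a nonlinear \<open>F\<close>. Subtracting \<open>c / \<Lambda>\<close> on both
  sides keeps the estimate meaningful for negative \<open>\<Lambda>\<close>.\<close>

lemma mild_norm_bound:
  assumes gen: "is_generator S D A" and w: "mild T g w" and T: "0 \<le> T" and \<Lambda>: "\<Lambda> \<noteq> 0"
    and diss: "\<And>\<eta>. \<eta> > 0 \<Longrightarrow> \<forall>\<^sub>F \<delta> in at_right 0. \<forall>t\<in>{0<..T}. \<exists>xs\<in>norm_subdiff (J \<delta> (w t)).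
      blinfun_apply xs (A (J \<delta> (w t)) + J \<delta> (g t)) \<le> - \<Lambda> * norm (J \<delta> (w t)) + c + \<eta>"
  shows "norm (w T) - c / \<Lambda> \<le> exp (- \<Lambda> * T) * (norm (w 0) - c / \<Lambda>)"
proof -
  have wc: "continuous_on {0..T} w" by (rule mild_cont(1)[OF w])
  have *: "norm (w T) - (c + \<eta>) / \<Lambda> \<le> exp (- \<Lambda> * T) * (norm (w 0) - (c + \<eta>) / \<Lambda>)" if \<eta>: "\<eta> > 0" for \<eta>
  proof (rule tendsto_le)
    show "((\<lambda>\<delta>. exp (- \<Lambda> * T) * (norm (J \<delta> (w 0)) - (c + \<eta>) / \<Lambda>)) \<longlongrightarrow> exp (- \<Lambda> * T) * (norm (w 0) - (c + \<eta>) / \<Lambda>)) (at_right 0)"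
      by (intro tendsto_diff tendsto_mult tendsto_const tendsto_norm J_tendsto)
    show "((\<lambda>\<delta>. norm (J \<delta> (w T)) - (c + \<eta>) / \<Lambda>) \<longlongrightarrow> norm (w T) - (c + \<eta>) / \<Lambda>) (at_right 0)"
      by (intro tendsto_diff tendsto_mult tendsto_const tendsto_norm J_tendsto)
    have "norm (J \<delta> (w T)) - (c + \<eta>) / \<Lambda> \<le> exp (- \<Lambda> * T) * (norm (J \<delta> (w 0)) - (c + \<eta>) / \<Lambda>)"
      if elim: "\<forall>t\<in>{0<..T}. \<exists>xs\<in>norm_subdiff (J \<delta> (w t)).
      blinfun_apply xs (A (J \<delta> (w t)) + J \<delta> (g t)) \<le> - \<Lambda> * norm (J \<delta> (w t)) + c + \<eta>" "0 < \<delta>" for \<delta>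
    proof -
      interpret Jl: bounded_linear "J \<delta>" by (rule J_bounded_linear[OF elim(2)])
      show ?thesis
      proof (rule left_Dini_exp_bound[OF _ T, where f = "\<lambda>t. norm (J \<delta> (w t))"])
        show "continuous_on {0..T} (\<lambda>t. norm (J \<delta> (w t)))"
          by (intro continuous_intros Jl.continuous_on wc)
        fix t assume t: "0 < t" "t \<le> T"
        have "\<exists>xs\<in>norm_subdiff (J \<delta> (w t)). blinfun_apply xs (A (J \<delta> (w t)) + J \<delta> (g t)) \<le> - \<Lambda> * norm (J \<delta> (w t)) + c + \<eta>"
          by (rule bspec[OF elim(1)]) (use t in simp)
        then obtain xs where sub: "xs \<in> norm_subdiff (J \<delta> (w t))" and
          le: "blinfun_apply xs (A (J \<delta> (w t)) + J \<delta> (g t)) \<le> - \<Lambda> * norm (J \<delta> (w t)) + c + \<eta>"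
          by (rule bexE)
        have xs: "norm xs = 1" "xs (J \<delta> (w t)) = norm (J \<delta> (w t))"
          using sub by (simp_all add: norm_subdiff_def)
        let ?L = "\<lambda>h. xs ((J \<delta> (w t) - J \<delta> (w (t - h))) /\<^sub>R h)"
        have "norm (J \<delta> (w t)) - norm (J \<delta> (w (t - h))) \<le> h * ?L h" if "h > 0" for h
        proof -
          have "xs (J \<delta> (w (t - h))) \<le> norm (J \<delta> (w (t - h)))"
            using norm_blinfun[of xs "J \<delta> (w (t - h))"] xs(1) by simp
          then show ?thesis using that xs(2) by (simp add: blinfun.scaleR_right blinfun.diff_right mult.assoc[symmetric])
        qed
        then have ev: "\<forall>\<^sub>F h in at_right 0. norm (J \<delta> (w t)) - norm (J \<delta> (w (t - h))) \<le> h * ?L h"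
          unfolding eventually_at_right_field by (intro exI[of _ 1]) simp
        have lim: "(?L \<longlongrightarrow> xs (A (J \<delta> (w t)) + J \<delta> (g t))) (at_right 0)"
          using blinfun.tendsto[OF tendsto_const mild_J_left_derivative[OF w elim(2) t], of xs]
          by (simp only: J_in_domain(2)[OF gen elim(2)])
        have eq: "- \<Lambda> * norm (J \<delta> (w t)) + c + \<eta> = - \<Lambda> * (norm (J \<delta> (w t)) - (c + \<eta>) / \<Lambda>)"
          using \<Lambda> by (simp add: right_diff_distrib)
        show "\<exists>L l. (\<forall>\<^sub>F h in at_right 0. norm (J \<delta> (w t)) - norm (J \<delta> (w (t - h))) \<le> h * L h) \<and>
            (L \<longlongrightarrow> l) (at_right 0) \<and> l \<le> - \<Lambda> * (norm (J \<delta> (w t)) - (c + \<eta>) / \<Lambda>)"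
          by (rule exI[of _ ?L], rule exI, intro conjI, rule ev, rule lim, rule le[unfolded eq])
      qed
    qed
    then show "\<forall>\<^sub>F \<delta> in at_right 0. norm (J \<delta> (w T)) - (c + \<eta>) / \<Lambda> \<le> exp (- \<Lambda> * T) * (norm (J \<delta> (w 0)) - (c + \<eta>) / \<Lambda>)"
      using eventually_conj[OF diss[OF \<eta>] eventually_at_right_less[of 0]]
      by (elim eventually_mono) blast
  qed (rule trivial_limit_at_right_real)
  have lim: "((\<lambda>\<eta>. (c + \<eta>) / \<Lambda>) \<longlongrightarrow> c / \<Lambda>) (at_right 0)"
  proof -
    have "((\<lambda>\<eta>. (c + \<eta>) / \<Lambda>) \<longlongrightarrow> (c + 0) / \<Lambda>) (at_right 0)"
      by (intro tendsto_divide tendsto_add tendsto_const tendsto_ident_at \<Lambda>)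
    then show ?thesis by simp
  qed
  show ?thesis
  proof (rule tendsto_le)
    show "((\<lambda>\<eta>. exp (- \<Lambda> * T) * (norm (w 0) - (c + \<eta>) / \<Lambda>)) \<longlongrightarrow> exp (- \<Lambda> * T) * (norm (w 0) - c / \<Lambda>)) (at_right 0)"
      by (intro tendsto_diff tendsto_mult tendsto_const lim)
    show "((\<lambda>\<eta>. norm (w T) - (c + \<eta>) / \<Lambda>) \<longlongrightarrow> norm (w T) - c / \<Lambda>) (at_right 0)"
      by (intro tendsto_diff tendsto_mult tendsto_const lim)
    show "\<forall>\<^sub>F \<eta> in at_right 0. norm (w T) - (c + \<eta>) / \<Lambda> \<le> exp (- \<Lambda> * T) * (norm (w 0) - (c + \<eta>) / \<Lambda>)"
      unfolding eventually_at_right_field using * by (intro exI[of _ 1]) simp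
  qed simp
qed

end

section \<open>Dissipative nonlinearities\<close>

locale dissipative_system = decaying_semigroup S M \<omega>
  for S :: "real \<Rightarrow> 'e::banach \<Rightarrow>\<^sub>L 'e" and M \<omega> :: real +
  fixes D :: "'e set" and A F :: "'e \<Rightarrow> 'e" and lam \<kappa>' lam' :: real and m :: nat
  assumes generator: "is_generator S D A"
    and F_cont: "\<And>G. bounded G \<Longrightarrow> uniformly_continuous_on G F" and F_0: "F 0 = 0"
    and lam: "lam > 0"
    and dissipative: "\<And>x y. x \<in> D \<Longrightarrow> y \<in> D \<Longrightarrow>
      \<exists>xs \<in> norm_subdiff (x - y). blinfun_apply xs (A (x - y) + F x - F y) \<le> - lam * norm (x - y)"
    and \<kappa>': "\<kappa>' > 0" and lam': "lam' > 0"
    and F_growth: "\<And>x. norm (F x) \<le> \<kappa>' * (1 + norm x ^ m)"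
    and F_coercive: "\<And>x h. x \<in> D \<Longrightarrow> h \<in> D \<Longrightarrow>
      \<exists>hs \<in> norm_subdiff h. blinfun_apply hs (F (x + h) - F x) \<le> - lam' * norm h ^ m + \<kappa>' * (1 + norm x ^ m)"
begin

lemmas J_D = J_in_domain(1)[OF generator] and A_J = J_in_domain(2)[OF generator]

lemma blinfun_le_norm: "norm xs \<le> 1 \<Longrightarrow> blinfun_apply (xs :: 'e \<Rightarrow>\<^sub>L real) x \<le> norm x"
  using norm_blinfun[of xs x] mult_right_mono[of "norm xs" 1 "norm x"] by simp

text \<open>Dissipativity with \<open>y = 0\<close> supplies norming functionals on the dense set \<open>D\<close>, which replaces
  the Hahn--Banach theorem.\<close>

lemma norm_le_dualI:
  assumes "\<And>xs :: 'e \<Rightarrow>\<^sub>L real. norm xs \<le> 1 \<Longrightarrow> blinfun_apply xs x \<le> c"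
  shows "norm x \<le> c"
proof (rule tendsto_upperbound)
  have "((\<lambda>\<delta>. norm (J \<delta> x) - norm (J \<delta> x - x)) \<longlongrightarrow> norm x - norm (x - x)) (at_right 0)"
    by (intro tendsto_diff tendsto_norm J_tendsto tendsto_const)
  then show "((\<lambda>\<delta>. norm (J \<delta> x) - norm (J \<delta> x - x)) \<longlongrightarrow> norm x) (at_right 0)" by simp
  have "norm (J \<delta> x) - norm (J \<delta> x - x) \<le> c" if \<delta>: "\<delta> > 0" for \<delta>
  proof -
    obtain xs where "xs \<in> norm_subdiff (J \<delta> x)"
      using dissipative[OF J_D[OF \<delta>] zero_in_domain[OF generator]] by auto
    then have xs: "norm xs = 1" "blinfun_apply xs (J \<delta> x) = norm (J \<delta> x)"
      by (auto simp: norm_subdiff_def)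
    have "blinfun_apply xs x = blinfun_apply xs (J \<delta> x) - blinfun_apply xs (J \<delta> x - x)"
      by (simp add: blinfun.diff_right)
    then show ?thesis
      using assms[of xs] xs blinfun_le_norm[of xs "J \<delta> x - x"] by simp
  qed
  then show "\<forall>\<^sub>F \<delta> in at_right 0. norm (J \<delta> x) - norm (J \<delta> x - x) \<le> c"
    unfolding eventually_at_right_field by (intro exI[of _ 1]) simp
qed simp

lemma F_continuous: "continuous_on X F"
proof (rule continuous_on_subset)
  show "continuous_on UNIV F"
  proof (rule continuous_at_imp_continuous_on, rule ballI)
    fix x :: 'e
    have "continuous_on (ball x 1) F"
      by (rule uniformly_continuous_imp_continuous[OF F_cont]) simp
    then show "isCont F x" by (simp add: continuous_on_eq_continuous_at)
  qed
qed simp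

text \<open>Both terms are compared with \<open>F x\<close>: the first because \<open>F\<close> maps
  \<open>X\<close> to a compact set, the second by uniform continuity of \<open>F\<close> on a ball
  of radius \<open>R + 1\<close>, which also contains the points \<open>J \<delta> x\<close> that
  leave \<open>X\<close>.\<close>

lemma J_F_commutator:
  assumes "compact X" "\<eta> > 0"
  shows "\<forall>\<^sub>F \<delta> in at_right 0. \<forall>x\<in>X. norm (J \<delta> (F x) - F (J \<delta> x)) < \<eta>"
proof -
  obtain R where R: "\<And>x. x \<in> X \<Longrightarrow> norm x \<le> R"
    using compact_imp_bounded[OF assms(1)] by (auto simp: bounded_iff)
  obtain d where d: "d > 0" "\<And>x y. norm x \<le> R + 1 \<Longrightarrow> norm y \<le> R + 1 \<Longrightarrow> norm (y - x) < d \<Longrightarrow> norm (F y - F x) < \<eta> / 2"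
    using F_cont[OF bounded_cball[of 0 "R + 1"]] half_gt_zero[OF assms(2)]
    unfolding uniformly_continuous_on_def dist_norm by (metis diff_zero mem_cball_0)
  have "\<forall>\<^sub>F \<delta> in at_right 0. \<forall>x\<in>F ` X. norm (J \<delta> x - x) < \<eta> / 2"
    by (rule J_uniform) (use assms in \<open>auto intro: compact_continuous_image F_continuous\<close>)
  moreover have "\<forall>\<^sub>F \<delta> in at_right 0. \<forall>x\<in>X. norm (J \<delta> x - x) < min d 1"
    by (rule J_uniform) (use assms d in auto)
  ultimately show ?thesis
  proof eventually_elim
    case (elim \<delta>)
    show ?case
    proof
      fix x assume x: "x \<in> X"
      have J: "norm (J \<delta> x - x) < d" "norm (J \<delta> x - x) < 1" using elim(2) x by auto
      have "norm (J \<delta> x) \<le> R + 1"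
        using J(2) R[OF x] norm_triangle_ineq2[of "J \<delta> x" x] by linarith
      then have "norm (F (J \<delta> x) - F x) < \<eta> / 2" using J(1) R[OF x] by (intro d(2)) auto
      moreover have "norm (J \<delta> (F x) - F x) < \<eta> / 2" using elim(1) x by auto
      ultimately show "norm (J \<delta> (F x) - F (J \<delta> x)) < \<eta>"
        by (smt (verit, ccfv_threshold) norm_triangle_half_l norm_minus_commute)
    qed
  qed
qed

text \<open>Dissipativity compares \<open>F\<close> at two points whose difference is the vector
  being normed. Hence both \<open>y1\<close> and \<open>y2\<close> are shifted by the same
  \<open>z1\<close>; replacing \<open>z1\<close> by \<open>z2\<close> in the second equation is
  treated as a forcing error, which averaging enlarges by at most \<open>M\<close>.\<close>

lemma mild_comparison:
  assumes 1: "mild T (\<lambda>t. F (y1 t + z1 t)) y1" and 2: "mild T (\<lambda>t. F (y2 t + z2 t)) y2"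
    and z1: "continuous_on {0..T} z1" and T: "0 \<le> T"
    and \<rho>: "\<And>t. t \<in> {0..T} \<Longrightarrow> norm (F (y2 t + z1 t) - F (y2 t + z2 t)) \<le> \<rho>"
  shows "norm (y1 T - y2 T) \<le> exp (- lam * T) * norm (y1 0 - y2 0) + M * \<rho> / lam"
proof -
  let ?w = "\<lambda>t. y1 t - y2 t" and ?g = "\<lambda>t. F (y1 t + z1 t) - F (y2 t + z2 t)"
  have y: "continuous_on {0..T} y1" "continuous_on {0..T} y2" using 1 2 mild_cont by auto
  have "norm (?w T) - (M * \<rho>) / lam \<le> exp (- lam * T) * (norm (?w 0) - (M * \<rho>) / lam)"
  proof (rule mild_norm_bound[OF generator mild_diff[OF 1 2] T])
    fix \<eta> :: real assume \<eta>: "\<eta> > 0"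
    have "\<forall>\<^sub>F \<delta> in at_right 0. \<forall>x\<in>(\<lambda>t. y1 t + z1 t) ` {0..T}. norm (J \<delta> (F x) - F (J \<delta> x)) < \<eta> / 2"
      using \<eta> y z1 by (intro J_F_commutator compact_continuous_image) (auto intro!: continuous_intros)
    moreover have "\<forall>\<^sub>F \<delta> in at_right 0. \<forall>x\<in>(\<lambda>t. y2 t + z1 t) ` {0..T}. norm (J \<delta> (F x) - F (J \<delta> x)) < \<eta> / 2"
      using \<eta> y z1 by (intro J_F_commutator compact_continuous_image) (auto intro!: continuous_intros)
    ultimately show "\<forall>\<^sub>F \<delta> in at_right 0. \<forall>t\<in>{0<..T}. \<exists>xs\<in>norm_subdiff (J \<delta> (?w t)).
        blinfun_apply xs (A (J \<delta> (?w t)) + J \<delta> (?g t)) \<le> - lam * norm (J \<delta> (?w t)) + M * \<rho> + \<eta>"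
      using eventually_at_right_less[of 0]
    proof eventually_elim
      case (elim \<delta>)
      interpret Jl: bounded_linear "J \<delta>" by (rule J_bounded_linear[OF elim(3)])
      show ?case
      proof
        fix t assume t: "t \<in> {0<..T}"
        define u v where "u = y1 t + z1 t" and "v = y2 t + z1 t"
        have uv: "J \<delta> u - J \<delta> v = J \<delta> (?w t)"
          by (simp add: u_def v_def Jl.diff[symmetric])
        obtain xs where xs: "xs \<in> norm_subdiff (J \<delta> (?w t))"
          and le: "blinfun_apply xs (A (J \<delta> (?w t)) + F (J \<delta> u) - F (J \<delta> v)) \<le> - lam * norm (J \<delta> (?w t))"
          using dissipative[OF J_D[OF elim(3)] J_D[OF elim(3)], of u v] unfolding uv by blast
        have xs1: "norm xs \<le> 1" using xs by (simp add: norm_subdiff_def)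
        let ?v' = "F v - F (y2 t + z2 t)"
        have eq: "A (J \<delta> (?w t)) + J \<delta> (?g t) = (A (J \<delta> (?w t)) + F (J \<delta> u) - F (J \<delta> v)) +
            (J \<delta> (F u) - F (J \<delta> u)) + - (J \<delta> (F v) - F (J \<delta> v)) + J \<delta> ?v'"
          by (simp add: u_def Jl.diff)
        have "blinfun_apply xs (J \<delta> (F u) - F (J \<delta> u)) \<le> \<eta> / 2"
          using elim(1) t blinfun_le_norm[OF xs1] unfolding u_def by (smt (verit, best) atLeastAtMost_iff greaterThanAtMost_iff image_eqI)
        moreover have "blinfun_apply xs (- (J \<delta> (F v) - F (J \<delta> v))) \<le> \<eta> / 2"
          using elim(2) t blinfun_le_norm[OF xs1, of "- (J \<delta> (F v) - F (J \<delta> v))"] unfolding v_def norm_minus_cancel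
          by (smt (verit, best) atLeastAtMost_iff greaterThanAtMost_iff image_eqI)
        moreover have "blinfun_apply xs (J \<delta> ?v') \<le> M * \<rho>"
        proof -
          have "blinfun_apply xs (J \<delta> ?v') \<le> norm (J \<delta> ?v')" by (rule blinfun_le_norm[OF xs1])
          also have "\<dots> \<le> M * norm ?v'" by (rule J_bound[OF elim(3)])
          also have "\<dots> \<le> M * \<rho>" using M \<rho>[of t] t by (intro mult_left_mono) (auto simp: v_def)
          finally show ?thesis .
        qed
        ultimately have "blinfun_apply xs (A (J \<delta> (?w t)) + J \<delta> (?g t)) \<le> - lam * norm (J \<delta> (?w t)) + M * \<rho> + \<eta>"
          using le unfolding eq blinfun.add_right[of xs "_ + _ + _"] blinfun.add_right[of xs "_ + _" "- _"]
            blinfun.add_right[of xs "_ + _ - _"] by linarith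
        then show "\<exists>xs\<in>norm_subdiff (J \<delta> (?w t)).
            blinfun_apply xs (A (J \<delta> (?w t)) + J \<delta> (?g t)) \<le> - lam * norm (J \<delta> (?w t)) + M * \<rho> + \<eta>"
          using xs by blast
      qed
    qed
  qed (use lam in simp)
  moreover have "0 \<le> M * \<rho> / lam"
    using M lam \<rho>[of 0] T norm_ge_zero order_trans by (metis atLeastAtMost_iff divide_nonneg_pos mult_nonneg_nonneg order_refl zero_le_one)
  ultimately show ?thesis
    using mult_nonneg_nonneg[of "exp (- lam * T)" "M * \<rho> / lam"] by (simp add: right_diff_distrib)
qed

lemma norm_subdiff_scale: "c > 0 \<Longrightarrow> norm_subdiff (c *\<^sub>R x) = norm_subdiff (x :: 'e)"
  by (auto simp: norm_subdiff_def blinfun.scaleR_right)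

text \<open>\<open>F h\<close> has only polynomial growth, so the dissipativity inequality at
  \<open>h\<close> itself gives no linear bound. On the unit sphere \<open>F\<close> is at most
  \<open>2 * \<kappa>'\<close>, and homogeneity of \<open>A\<close> extends the estimate to all of
  \<open>D\<close>.\<close>

lemma A_quasi_dissipative:
  assumes "h \<in> D"
  shows "\<exists>hs\<in>norm_subdiff h. blinfun_apply hs (A h) \<le> 2 * \<kappa>' * norm h"
proof (cases "h = 0")
  case True
  have "A 0 = 0" using generator_scale(2)[OF generator assms, of 0] by simp
  then show ?thesis
    using dissipative[OF assms assms] True by (auto simp: blinfun.zero_right)
next
  case False
  define u where "u = (1 / norm h) *\<^sub>R h"
  have u: "u \<in> D" "norm u = 1" "h = norm h *\<^sub>R u"
    using generator_scale(1)[OF generator assms] False by (auto simp: u_def)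
  obtain xs where xs: "xs \<in> norm_subdiff u" "blinfun_apply xs (A u + F u) \<le> - lam"
    using dissipative[OF u(1) zero_in_domain[OF generator]] u(2) F_0 by auto
  have "blinfun_apply xs (- F u) \<le> norm (- F u)"
    using xs(1) by (intro blinfun_le_norm) (auto simp: norm_subdiff_def)
  also have "\<dots> \<le> \<kappa>' * 2" using F_growth[of u] u(2) by simp
  finally have "blinfun_apply xs (A u) \<le> 2 * \<kappa>'"
    using xs(2) lam by (simp add: blinfun.add_right blinfun.minus_right)
  then have "norm h * blinfun_apply xs (A u) \<le> norm h * (2 * \<kappa>')" by (intro mult_left_mono) auto
  moreover have "A h = norm h *\<^sub>R A u"
    using generator_scale(2)[OF generator u(1)] u(3) by metis
  moreover have "xs \<in> norm_subdiff h"
    using xs(1) norm_subdiff_scale[of "norm h" u] u(3) False by simp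
  ultimately show ?thesis by (intro bexI[of _ xs]) (auto simp: blinfun.scaleR_right mult.commute)
qed

text \<open>In contrast to the decay bound with \<open>M\<close>, the right-hand side equals
  \<open>norm x\<close> at time 0; only so can the estimate be differentiated there in the next
  lemma.\<close>

lemma S_quasi_contraction:
  assumes t: "t \<ge> 0"
  shows "norm (S t x) \<le> exp (2 * \<kappa>' * t) * norm x"
proof -
  have "norm (S t x) - 0 / (- (2 * \<kappa>')) \<le> exp (- (- (2 * \<kappa>')) * t) * (norm (S 0 x) - 0 / (- (2 * \<kappa>')))"
  proof (rule mild_norm_bound[OF generator mild_semigroup t])
    fix \<eta> :: real assume "\<eta> > 0"
    have "\<exists>xs\<in>norm_subdiff (J \<delta> u). blinfun_apply xs (A (J \<delta> u) + J \<delta> 0) \<le> - (- (2 * \<kappa>')) * norm (J \<delta> u) + 0 + \<eta>"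
      if \<delta>: "\<delta> > 0" for \<delta> u
    proof -
      obtain xs where "xs \<in> norm_subdiff (J \<delta> u)" "blinfun_apply xs (A (J \<delta> u)) \<le> 2 * \<kappa>' * norm (J \<delta> u)"
        using A_quasi_dissipative[OF J_D[OF \<delta>]] by blast
      then show ?thesis using \<open>\<eta> > 0\<close> by (intro bexI[of _ xs]) (simp_all add: linear_0[OF J_linear])
    qed
    then show "\<forall>\<^sub>F \<delta> in at_right 0. \<forall>s\<in>{0<..t}. \<exists>xs\<in>norm_subdiff (J \<delta> (S s x)).
      blinfun_apply xs (A (J \<delta> (S s x)) + J \<delta> 0) \<le> - (- (2 * \<kappa>')) * norm (J \<delta> (S s x)) + 0 + \<eta>"
      unfolding eventually_at_right_field by (intro exI[of _ 1]) simp
  qed (use \<kappa>' in simp)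
  then show ?thesis by simp
qed

text \<open>Coercivity and dissipativity may provide different norming functionals at
  \<open>h\<close>. To add the two estimates, the one for \<open>A\<close> is needed for every
  norming functional, and it follows by differentiating
  \<open>hs (S t h) \<le> exp (2 * \<kappa>' * t) * norm h\<close> at 0, where equality
  holds.\<close>

lemma A_quasi_dissipative_all:
  assumes h: "h \<in> D" and hs: "hs \<in> norm_subdiff h"
  shows "blinfun_apply hs (A h) \<le> 2 * \<kappa>' * norm h"
proof (rule tendsto_le)
  have "((\<lambda>t. (S t h - h) /\<^sub>R t) \<longlongrightarrow> A h) (at_right 0)"
    using generator h by (auto simp: is_generator_def)
  then show "((\<lambda>t. blinfun_apply hs ((S t h - h) /\<^sub>R t)) \<longlongrightarrow> blinfun_apply hs (A h)) (at_right 0)"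
    by (intro blinfun.tendsto tendsto_const)
  have "((\<lambda>t. exp (2 * \<kappa>' * t)) has_field_derivative 2 * \<kappa>') (at 0)"
    by (auto intro!: derivative_eq_intros)
  then have "((\<lambda>t. (exp (2 * \<kappa>' * t) - 1) / t) \<longlongrightarrow> 2 * \<kappa>') (at_right 0)"
    by (auto simp: DERIV_def intro: filterlim_mono at_le)
  then show "((\<lambda>t. (exp (2 * \<kappa>' * t) - 1) / t * norm h) \<longlongrightarrow> 2 * \<kappa>' * norm h) (at_right 0)"
    by (intro tendsto_mult tendsto_const)
  have "blinfun_apply hs ((S t h - h) /\<^sub>R t) \<le> (exp (2 * \<kappa>' * t) - 1) / t * norm h" if t: "t > 0" for t
  proof -
    have "blinfun_apply hs (S t h) \<le> norm (S t h)"
      using hs by (intro blinfun_le_norm) (auto simp: norm_subdiff_def)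
    also have "\<dots> \<le> exp (2 * \<kappa>' * t) * norm h" using t by (intro S_quasi_contraction) simp
    finally have "blinfun_apply hs (S t h - h) \<le> (exp (2 * \<kappa>' * t) - 1) * norm h"
      using hs by (simp add: norm_subdiff_def blinfun.diff_right algebra_simps)
    from divide_right_mono[OF this, of t] show ?thesis
      using t by (simp add: blinfun.scaleR_right divide_inverse_commute mult.assoc)
  qed
  then show "\<forall>\<^sub>F t in at_right 0. blinfun_apply hs ((S t h - h) /\<^sub>R t) \<le> (exp (2 * \<kappa>' * t) - 1) / t * norm h"
    unfolding eventually_at_right_field by (intro exI[of _ 1]) simp
qed simp

text \<open>For \<open>m \<le> 1\<close> the growth of \<open>F\<close> is linear, so comparison
  with the zero solution suffices: the noise enters through \<open>F (z t)\<close>, which is at most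
  a multiple of \<open>1 + Z\<close>.\<close>

lemma mild_linear_bound_small_exponent:
  assumes m: "m \<le> 1"
    and y: "mild T (\<lambda>t. F (y t + z t)) y" and z: "continuous_on {0..T} z" and T: "0 \<le> T"
    and Z: "\<And>t. t \<in> {0..T} \<Longrightarrow> norm (z t) \<le> Z"
  shows "norm (y T) \<le> norm (y 0) + M * (\<kappa>' * 2) / lam * (1 + Z)"
proof -
  have Z0: "Z \<ge> 0" using Z[of 0] T norm_ge_zero[of "z 0"] by (simp del: norm_ge_zero)
  have "mild T (\<lambda>t. F (0 + 0)) (\<lambda>t. 0)" using mild_zero F_0 by simp
  from mild_comparison[OF y this z T, of "\<kappa>' * (2 * (1 + Z))"]
  have "norm (y T) \<le> exp (- lam * T) * norm (y 0) + M * (\<kappa>' * (2 * (1 + Z))) / lam"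
  proof -
    have "norm (F (z t)) \<le> \<kappa>' * (2 * (1 + Z))" if "t \<in> {0..T}" for t
    proof -
      have "norm (z t) ^ m \<le> 1 + Z"
        using m Z[OF that] Z0 by (cases m) auto
      then have "\<kappa>' * (1 + norm (z t) ^ m) \<le> \<kappa>' * (2 * (1 + Z))"
        using \<kappa>' Z0 by (intro mult_left_mono) auto
      then show ?thesis using F_growth[of "z t"] by linarith
    qed
    then show ?thesis using mild_comparison[OF y \<open>mild T (\<lambda>t. F (0 + 0)) (\<lambda>t. 0)\<close> z T, of "\<kappa>' * (2 * (1 + Z))"] F_0 by simp
  qed
  also have "exp (- lam * T) * norm (y 0) \<le> norm (y 0)"
    using lam T by (intro mult_left_le_one_le) auto
  finally show ?thesis by (simp add: mult.assoc)
qed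

text \<open>With \<open>b = a * Y\<close> this is the line \<open>b ^ (n - 1) * (h - b)\<close>
  below \<open>h ^ n\<close>. Its slope can be made as large as needed, at the price of the constant
  term.\<close>

lemma power_ge_linear:
  fixes a Y h :: real
  assumes "a \<ge> 0" "Y \<ge> 0" "h \<ge> 0" "n \<ge> 1"
  shows "h ^ n \<ge> a ^ (n - 1) * Y ^ (n - 1) * h - a ^ n * Y ^ n"
proof -
  have n: "x ^ n = x ^ (n - 1) * x" for x :: real
    using assms(4) by (cases n) (auto simp: mult.commute)
  have e: "a ^ n * Y ^ n = a ^ (n - 1) * Y ^ (n - 1) * (a * Y)" using n[of a] n[of Y] by simp
  show ?thesis
  proof (cases "h \<ge> a * Y")
    case True
    then have "(a * Y) ^ (n - 1) * h \<le> h ^ (n - 1) * h"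
      using assms by (intro mult_right_mono power_mono) auto
    moreover have "0 \<le> a ^ n * Y ^ n" using assms by simp
    ultimately show ?thesis using n[of h] by (simp add: power_mult_distrib)
  next
    case False
    then have "a ^ (n - 1) * Y ^ (n - 1) * h \<le> a ^ n * Y ^ n"
      unfolding e using assms by (intro mult_left_mono) auto
    moreover have "0 \<le> h ^ n" using assms by simp
    ultimately show ?thesis by linarith
  qed
qed

text \<open>A superlinear \<open>F\<close> absorbs the growth of the semigroup: the norm decays at rate
  \<open>Y ^ (m - 1)\<close> above a level proportional to \<open>Y = 1 + M Z\<close>.\<close>

lemma mild_linear_bound_large_exponent:
  defines "a \<equiv> max 1 ((2 * \<kappa>' + 1) / lam')"
  assumes m: "m \<ge> 2"
    and y: "mild T (\<lambda>t. F (y t + z t)) y" and z: "continuous_on {0..T} z" and T: "0 \<le> T"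
    and Z: "\<And>t. t \<in> {0..T} \<Longrightarrow> norm (z t) \<le> Z"
  shows "norm (y T) \<le> norm (y 0) + (lam' * a ^ m + 4 * \<kappa>') * M * (1 + Z)"
proof -
  have Z0: "Z \<ge> 0" using Z[of 0] T norm_ge_zero[of "z 0"] by (simp del: norm_ge_zero)
  define Y where "Y = 1 + M * Z"
  have Y: "Y \<ge> 1" using Z0 M by (simp add: Y_def)
  \<comment> \<open>The summand \<open>lam' * a ^ m\<close> is the price of replacing the power by a
    line in \<open>power_ge_linear\<close>; \<open>4 * \<kappa>'\<close> is the sum of
    \<open>2 * \<kappa>'\<close> from coercivity and \<open>2 * \<kappa>'\<close> from the growth of
    \<open>F x\<close>.\<close>
  define K where "K = lam' * a ^ m + 4 * \<kappa>'"
  \<comment> \<open>Of the slope \<open>lam' * a\<close>, the part \<open>2 * \<kappa>'\<close>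
    offsets the growth of the semigroup, and the remaining 1 is the decay rate in units of
    \<open>Y ^ (m - 1)\<close>.\<close>
  have a: "a \<ge> 1" "2 * \<kappa>' + 1 \<le> lam' * a"
    using lam' by (auto simp: a_def field_simps max_def)
  have K: "K \<ge> 0" using lam' \<kappa>' a by (auto simp: K_def)
  have Ym: "Y ^ m = Y ^ (m - 1) * Y" using m by (cases m) (auto simp: mult.commute)
  have \<Lambda>: "Y ^ (m - 1) \<ge> 1" using Y by simp
  have key: "2 * \<kappa>' * h - lam' * h ^ m + 4 * \<kappa>' * Y ^ m \<le> - (Y ^ (m - 1)) * h + K * Y ^ m" if h: "h \<ge> 0" for h
  proof -
    have "lam' * h ^ m \<ge> lam' * (a ^ (m - 1) * Y ^ (m - 1) * h - a ^ m * Y ^ m)"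
      using power_ge_linear[of a Y h m] a Y h m lam' by (intro mult_left_mono) auto
    moreover have "a ^ 1 \<le> a ^ (m - 1)" using a m by (intro power_increasing) auto
    then have "lam' * a \<le> lam' * a ^ (m - 1)" using lam' by simp
    then have "(2 * \<kappa>' + 1) * (Y ^ (m - 1) * h) \<le> lam' * a ^ (m - 1) * (Y ^ (m - 1) * h)"
      using a h \<Lambda> by (intro mult_right_mono) auto
    moreover have "2 * \<kappa>' * (1 * h) \<le> 2 * \<kappa>' * (Y ^ (m - 1) * h)"
      using \<kappa>' h \<Lambda> by (intro mult_left_mono mult_right_mono) auto
    ultimately show ?thesis by (simp add: K_def algebra_simps)
  qed
  have yc: "continuous_on {0..T} y" using y mild_cont by auto
  have "norm (y T) - (K * Y ^ m) / Y ^ (m - 1) \<le> exp (- (Y ^ (m - 1)) * T) * (norm (y 0) - (K * Y ^ m) / Y ^ (m - 1))"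
  proof (rule mild_norm_bound[OF generator y T])
    fix \<eta> :: real assume \<eta>: "\<eta> > 0"
    have "\<forall>\<^sub>F \<delta> in at_right 0. \<forall>x\<in>(\<lambda>t. y t + z t) ` {0..T}. norm (J \<delta> (F x) - F (J \<delta> x)) < \<eta>"
      using \<eta> yc z by (intro J_F_commutator compact_continuous_image) (auto intro!: continuous_intros)
    then show "\<forall>\<^sub>F \<delta> in at_right 0. \<forall>t\<in>{0<..T}. \<exists>xs\<in>norm_subdiff (J \<delta> (y t)).
        blinfun_apply xs (A (J \<delta> (y t)) + J \<delta> (F (y t + z t))) \<le> - (Y ^ (m - 1)) * norm (J \<delta> (y t)) + K * Y ^ m + \<eta>"
      using eventually_at_right_less[of 0]
    proof eventually_elim
      case (elim \<delta>)
      interpret Jl: bounded_linear "J \<delta>" by (rule J_bounded_linear[OF elim(2)])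
      show ?case
      proof
        fix t assume t: "t \<in> {0<..T}"
        define h x where "h = J \<delta> (y t)" and "x = J \<delta> (z t)"
        have D: "h \<in> D" "x \<in> D" by (auto simp: h_def x_def J_D elim(2))
        obtain hs where hs: "hs \<in> norm_subdiff h"
          and le: "blinfun_apply hs (F (x + h) - F x) \<le> - lam' * norm h ^ m + \<kappa>' * (1 + norm x ^ m)"
          using F_coercive[OF D(2,1)] by blast
        have hs1: "norm hs \<le> 1" using hs by (simp add: norm_subdiff_def)
        let ?err = "J \<delta> (F (y t + z t)) - F (J \<delta> (y t + z t))"
        have eq: "A h + J \<delta> (F (y t + z t)) = A h + (F (x + h) - F x) + F x + ?err"
          by (simp add: h_def x_def Jl.add add.commute)
        have "norm x \<le> Y"
        proof -
          have "norm x \<le> M * norm (z t)" unfolding x_def by (rule J_bound[OF elim(2)])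
          also have "\<dots> \<le> M * Z" using Z[of t] t M by (intro mult_left_mono) auto
          finally show ?thesis by (simp add: Y_def)
        qed
        then have "1 + norm x ^ m \<le> 2 * Y ^ m"
          using power_mono[of "norm x" Y m] one_le_power[OF Y, of m] by simp
        then have x: "\<kappa>' * (1 + norm x ^ m) \<le> \<kappa>' * (2 * Y ^ m)" using \<kappa>' by simp
        have "blinfun_apply hs (F x) \<le> \<kappa>' * (1 + norm x ^ m)"
          using blinfun_le_norm[OF hs1, of "F x"] F_growth[of x] by linarith
        moreover have "blinfun_apply hs ?err \<le> \<eta>"
        proof -
          have "norm ?err < \<eta>" using elim(1) t by auto
          then show ?thesis using blinfun_le_norm[OF hs1, of ?err] by linarith
        qed
        moreover have "blinfun_apply hs (A h) \<le> 2 * \<kappa>' * norm h"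
          by (rule A_quasi_dissipative_all[OF D(1) hs])
        ultimately have "blinfun_apply hs (A h + J \<delta> (F (y t + z t))) \<le> - (Y ^ (m - 1)) * norm h + K * Y ^ m + \<eta>"
          using le x key[of "norm h"] norm_ge_zero[of h] unfolding eq blinfun.add_right[of hs "_ + _ + _"]
            blinfun.add_right[of hs "_ + _" "F x"] blinfun.add_right[of hs "A h"]
          by linarith
        then show "\<exists>xs\<in>norm_subdiff (J \<delta> (y t)).
            blinfun_apply xs (A (J \<delta> (y t)) + J \<delta> (F (y t + z t))) \<le> - (Y ^ (m - 1)) * norm (J \<delta> (y t)) + K * Y ^ m + \<eta>"
          using hs unfolding h_def by blast
      qed
    qed
  qed (use Y in simp)
  \<comment> \<open>A forcing \<open>K * Y ^ m\<close> against decay at rate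
    \<open>Y ^ (m - 1)\<close> has an equilibrium level that is linear in \<open>Y\<close>; this is
    why the large rate was kept.\<close>
  moreover have "(K * Y ^ m) / Y ^ (m - 1) = K * Y" using Ym \<Lambda> by simp
  ultimately have *: "norm (y T) - K * Y \<le> exp (- (Y ^ (m - 1)) * T) * (norm (y 0) - K * Y)" by simp
  have "exp (- (Y ^ (m - 1)) * T) * (norm (y 0) - K * Y) \<le> exp (- (Y ^ (m - 1)) * T) * norm (y 0)"
    using K Y by (intro mult_left_mono) auto
  also have "\<dots> \<le> norm (y 0)"
    using T \<Lambda> by (intro mult_left_le_one_le) auto
  finally have "norm (y T) \<le> norm (y 0) + K * Y" using * by linarith
  also have "K * Y \<le> K * (M * (1 + Z))" using K M by (intro mult_left_mono) (auto simp: Y_def algebra_simps)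
  finally show ?thesis by (simp add: K_def mult.assoc)
qed

text \<open>Three features are used later: linearity in the size of the noise, coefficient 1 at the
  initial value, and a constant that does not depend on \<open>T\<close>.\<close>

corollary mild_linear_bound:
  obtains C where "C \<ge> 0" "\<And>T y z Z. mild T (\<lambda>t. F (y t + z t)) y \<Longrightarrow> continuous_on {0..T} z \<Longrightarrow> 0 \<le> T \<Longrightarrow>
    (\<And>t. t \<in> {0..T} \<Longrightarrow> norm (z t) \<le> Z) \<Longrightarrow> norm (y T) \<le> norm (y 0) + C * (1 + Z)"
proof (cases "m \<le> 1")
  case True
  show ?thesis
    by (rule that[of "M * (\<kappa>' * 2) / lam"])
       (use mild_linear_bound_small_exponent[OF True] M \<kappa>' lam in auto)
next
  case False
  then have m: "m \<ge> 2" by simp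
  show ?thesis
    by (rule that[of "(lam' * max 1 ((2 * \<kappa>' + 1) / lam') ^ m + 4 * \<kappa>') * M"])
       (use mild_linear_bound_large_exponent[OF m] M \<kappa>' lam' in auto)
qed

end

section \<open>Gaussian variables and the stochastic convolution\<close>

context prob_space begin

lemma normal_second_moment:
  assumes \<sigma>: "\<sigma> > 0" and D: "distributed M lborel Y (normal_density \<mu> \<sigma>)"
  shows "integrable M (\<lambda>w. (Y w - \<mu>)\<^sup>2)" "expectation (\<lambda>w. (Y w - \<mu>)\<^sup>2) = \<sigma>\<^sup>2"
    "integrable M Y" "expectation Y = \<mu>"
proof -
  show "integrable M (\<lambda>w. (Y w - \<mu>)\<^sup>2)"
    using integrable_normal_moment[OF \<sigma>, of \<mu> 2]
      distributed_integrable[OF D, of "\<lambda>x. (x - \<mu>)\<^sup>2"] by simp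
  show E: "expectation Y = \<mu>" by (rule normal_distributed_expectation[OF \<sigma> D])
  show "expectation (\<lambda>w. (Y w - \<mu>)\<^sup>2) = \<sigma>\<^sup>2"
    using normal_distributed_variance[OF \<sigma> D] E by simp
  show "integrable M Y"
    using integrable_normal_moment_nz_1[OF \<sigma>, of \<mu>] distributed_integrable_var[OF D] by simp
qed

lemma normal_density_le:
  assumes "\<sigma> > 0"
  shows "normal_density \<mu> \<sigma> x \<le> 1 / (2 * \<sigma>)"
proof -
  have "2 * \<sigma> \<le> sqrt (2 * pi * \<sigma>\<^sup>2)"
  proof (rule real_le_rsqrt)
    show "(2 * \<sigma>)\<^sup>2 \<le> 2 * pi * \<sigma>\<^sup>2"
      using pi_gt3 assms by (simp add: power_mult_distrib)
  qed
  then have "1 / sqrt (2 * pi * \<sigma>\<^sup>2) \<le> 1 / (2 * \<sigma>)" using assms by (intro divide_left_mono) auto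
  moreover have "exp (- (x - \<mu>)\<^sup>2 / (2 * \<sigma>\<^sup>2)) \<le> 1" by simp
  ultimately show ?thesis
    unfolding normal_density_def by (smt (verit, ccfv_SIG) divide_nonneg_nonneg mult_left_le real_sqrt_ge_zero assms pi_ge_zero zero_le_mult_iff zero_le_power2)
qed

text \<open>A Gaussian variable that is small with probability \<open>3/4\<close> is small in mean square: the bound on
  the density controls the standard deviation, and Chebyshev's inequality then controls the mean.\<close>

lemma gaussian_small_second_moment:
  assumes Y: "gaussian_real M Y" and \<epsilon>: "\<epsilon> > 0" and p: "prob {w \<in> space M. \<bar>Y w\<bar> \<le> \<epsilon>} \<ge> 3 / 4"
  shows "(\<integral>\<^sup>+w. ennreal ((Y w)\<^sup>2) \<partial>M) \<le> ennreal (58 * \<epsilon>\<^sup>2)"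
proof -
  have [measurable]: "Y \<in> borel_measurable M" using Y by (simp add: gaussian_real_def)
  let ?E = "{w \<in> space M. \<bar>Y w\<bar> \<le> \<epsilon>}"
  consider \<mu> \<sigma> where "\<sigma> > 0" "distributed M lborel Y (normal_density \<mu> \<sigma>)" | \<mu> where "AE w in M. Y w = \<mu>"
    using Y unfolding gaussian_real_def by blast
  then show ?thesis
  proof cases
    case (1 \<mu> \<sigma>)
    have "ennreal (prob ?E) = emeasure M (Y -` {-\<epsilon>..\<epsilon>} \<inter> space M)"
      unfolding emeasure_eq_measure by (intro arg_cong[of _ _ "\<lambda>A. ennreal (prob A)"]) auto
    also have "\<dots> = (\<integral>\<^sup>+x. ennreal (normal_density \<mu> \<sigma> x) * indicator {-\<epsilon>..\<epsilon>} x \<partial>lborel)"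
      by (rule distributed_emeasure[OF 1(2)]) simp
    also have "\<dots> \<le> (\<integral>\<^sup>+x. ennreal (1 / (2 * \<sigma>)) * indicator {-\<epsilon>..\<epsilon>} x \<partial>lborel)"
      by (intro nn_integral_mono mult_right_mono ennreal_leI normal_density_le 1) auto
    also have "\<dots> = ennreal (1 / (2 * \<sigma>)) * ennreal (2 * \<epsilon>)"
      using \<epsilon> by (simp add: nn_integral_cmult_indicator)
    also have "\<dots> = ennreal (\<epsilon> / \<sigma>)" using \<epsilon> 1 by (simp add: ennreal_mult[symmetric])
    finally have "prob ?E \<le> \<epsilon> / \<sigma>" using \<epsilon> 1 by (simp add: ennreal_le_iff)
    then have "3 / 4 \<le> \<epsilon> / \<sigma>" using p by linarith
    then have \<sigma>: "\<sigma> \<le> 2 * \<epsilon>" using 1(1) \<epsilon> by (simp add: field_simps)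
    have sq: "(\<lambda>w. (Y w)\<^sup>2) = (\<lambda>w. (Y w - \<mu>)\<^sup>2 + 2 * \<mu> * Y w - \<mu>\<^sup>2)"
      by (auto simp: power2_eq_square algebra_simps)
    have int: "integrable M (\<lambda>w. (Y w)\<^sup>2)" unfolding sq using normal_second_moment[OF 1] by simp
    \<comment> \<open>The probability is at least \<open>3 / 4 - 1 / 9\<close>, so some outcome
      satisfies both inequalities, and it ties the mean to \<open>\<epsilon>\<close> and
      \<open>\<sigma>\<close>.\<close>
    have "prob {w \<in> space M. \<bar>Y w\<bar> \<le> \<epsilon> \<and> \<bar>Y w - \<mu>\<bar> < 3 * \<sigma>} > 0"
    proof -
      have "prob {w \<in> space M. 3 * \<sigma> \<le> \<bar>Y w - \<mu>\<bar>} \<le> \<sigma>\<^sup>2 / (3 * \<sigma>)\<^sup>2"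
        using Chebyshev_inequality[OF _ int, of "3 * \<sigma>"] 1(1) normal_second_moment[OF 1] by simp
      also have "\<dots> = 1 / 9" using 1(1) by (simp add: power_mult_distrib)
      finally have *: "prob {w \<in> space M. 3 * \<sigma> \<le> \<bar>Y w - \<mu>\<bar>} \<le> 1 / 9" .
      have "prob ?E \<le> prob ({w \<in> space M. \<bar>Y w\<bar> \<le> \<epsilon> \<and> \<bar>Y w - \<mu>\<bar> < 3 * \<sigma>} \<union> {w \<in> space M. 3 * \<sigma> \<le> \<bar>Y w - \<mu>\<bar>})"
        by (intro finite_measure_mono) auto
      also have "\<dots> \<le> prob {w \<in> space M. \<bar>Y w\<bar> \<le> \<epsilon> \<and> \<bar>Y w - \<mu>\<bar> < 3 * \<sigma>} + prob {w \<in> space M. 3 * \<sigma> \<le> \<bar>Y w - \<mu>\<bar>}"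
        by (intro measure_Un_le) auto
      finally show ?thesis using * p by linarith
    qed
    then have "{w \<in> space M. \<bar>Y w\<bar> \<le> \<epsilon> \<and> \<bar>Y w - \<mu>\<bar> < 3 * \<sigma>} \<noteq> {}" by (metis less_irrefl measure_empty)
    then have "\<bar>\<mu>\<bar> \<le> \<epsilon> + 3 * \<sigma>" by auto
    \<comment> \<open>With \<open>\<sigma> \<le> 2 * \<epsilon>\<close> the mean is at most
      \<open>7 * \<epsilon>\<close> in modulus; \<open>4 + 49 = 53\<close> then stays below the
      constant 58.\<close>
    then have \<mu>: "\<mu>\<^sup>2 \<le> (7 * \<epsilon>)\<^sup>2" using \<sigma> by (intro power2_le_iff_abs_le[THEN iffD2]) (use \<epsilon> in auto)
    have "(\<integral>\<^sup>+w. ennreal ((Y w)\<^sup>2) \<partial>M) = ennreal (expectation (\<lambda>w. (Y w)\<^sup>2))"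
      using int by (intro nn_integral_eq_integral) auto
    also have "expectation (\<lambda>w. (Y w)\<^sup>2) = \<sigma>\<^sup>2 + \<mu>\<^sup>2"
      unfolding sq using normal_second_moment[OF 1] by (simp add: prob_space power2_eq_square[of \<mu>])
    also have "\<sigma>\<^sup>2 + \<mu>\<^sup>2 \<le> (2 * \<epsilon>)\<^sup>2 + (7 * \<epsilon>)\<^sup>2"
      using \<sigma> 1(1) \<mu> power_mono[of \<sigma> "2 * \<epsilon>" 2] by (intro add_mono) auto
    also have "\<dots> \<le> 58 * \<epsilon>\<^sup>2" by (simp add: power2_eq_square)
    finally show ?thesis using ennreal_leI by blast
  next
    case (2 \<mu>)
    have "\<bar>\<mu>\<bar> \<le> \<epsilon>"
    proof (rule ccontr)
      assume "\<not> \<bar>\<mu>\<bar> \<le> \<epsilon>"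
      then have "AE w in M. \<not> \<bar>Y w\<bar> \<le> \<epsilon>" using 2 by auto
      then have "prob ?E = 0" by (subst prob_eq_0) auto
      then show False using p by simp
    qed
    then have "\<mu>\<^sup>2 \<le> \<epsilon>\<^sup>2" by (intro power2_le_iff_abs_le[THEN iffD2]) (use \<epsilon> in auto)
    then have "\<mu>\<^sup>2 \<le> 58 * \<epsilon>\<^sup>2" by (smt (verit) zero_le_power2)
    moreover have "(\<integral>\<^sup>+w. ennreal ((Y w)\<^sup>2) \<partial>M) = (\<integral>\<^sup>+w. ennreal (\<mu>\<^sup>2) \<partial>M)"
      using 2 by (intro nn_integral_cong_AE) auto
    ultimately show ?thesis using ennreal_leI by (simp add: emeasure_space_1)
  qed
qed

section \<open>Isometry for integrals of step functions against one Brownian motion\<close>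

context
  fixes b :: "real \<Rightarrow> 'a \<Rightarrow> real"
  assumes b: "brownian_motion M b"
begin

lemma brownian_measurable [measurable]: "t \<ge> 0 \<Longrightarrow> b t \<in> borel_measurable M"
  using b by (simp add: brownian_motion_def)

lemma brownian_increment:
  assumes "s \<ge> 0" "t \<ge> 0"
  shows "integrable M (\<lambda>w. (b t w - b s w)\<^sup>2)" "expectation (\<lambda>w. (b t w - b s w)\<^sup>2) = \<bar>t - s\<bar>"
    "integrable M (\<lambda>w. b t w - b s w)" "expectation (\<lambda>w. b t w - b s w) = 0"
proof -
  have D: "integrable M (\<lambda>w. (b t w - b s w)\<^sup>2) \<and> expectation (\<lambda>w. (b t w - b s w)\<^sup>2) = t - s \<and>
     integrable M (\<lambda>w. b t w - b s w) \<and> expectation (\<lambda>w. b t w - b s w) = 0" if "0 \<le> s" "s < t" for s t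
  proof -
    have "distributed M lborel (\<lambda>w. b t w - b s w) (normal_density 0 (sqrt (t - s)))"
      using b that by (simp add: brownian_motion_def)
    from normal_second_moment[OF _ this] that show ?thesis by simp
  qed
  have sw: "(b t w - b s w)\<^sup>2 = (b s w - b t w)\<^sup>2" for w by (simp add: power2_commute)
  consider "s < t" | "s = t" | "t < s" by linarith
  then have "integrable M (\<lambda>w. (b t w - b s w)\<^sup>2) \<and> expectation (\<lambda>w. (b t w - b s w)\<^sup>2) = \<bar>t - s\<bar> \<and>
     integrable M (\<lambda>w. b t w - b s w) \<and> expectation (\<lambda>w. b t w - b s w) = 0"
  proof cases
    case 1 then show ?thesis using D[of s t] assms by simp
  next
    case 2 then show ?thesis by simp
  next
    case 3
    note D' = D[OF assms(2) 3]
    have "integrable M (\<lambda>w. - (b s w - b t w))" "expectation (\<lambda>w. - (b s w - b t w)) = 0"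
      using D' integrable_minus[of M "\<lambda>w. b s w - b t w"] Bochner_Integration.integral_minus[of M "\<lambda>w. b s w - b t w"]
      by simp_all
    then show ?thesis using D' 3 sw by simp
  qed
  then show "integrable M (\<lambda>w. (b t w - b s w)\<^sup>2)" "expectation (\<lambda>w. (b t w - b s w)\<^sup>2) = \<bar>t - s\<bar>"
    "integrable M (\<lambda>w. b t w - b s w)" "expectation (\<lambda>w. b t w - b s w) = 0" by auto
qed

text \<open>Polarisation: the product is a combination of four squared differences, so the variances
  of single increments determine the covariance, and for two arbitrary intervals it comes out as the
  length of their overlap.\<close>

lemma brownian_increment_product:
  assumes "0 \<le> a" "a \<le> c" "0 \<le> a'" "a' \<le> c'"
  shows "integrable M (\<lambda>w. (b c w - b a w) * (b c' w - b a' w))"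
    "expectation (\<lambda>w. (b c w - b a w) * (b c' w - b a' w)) = (\<integral>s. indicator {a<..c} s * indicator {a'<..c'} s \<partial>lborel)"
proof -
  have nn: "0 \<le> c" "0 \<le> c'" using assms by auto
  have eq: "(\<lambda>w. (b c w - b a w) * (b c' w - b a' w)) =
     (\<lambda>w. 1/2 * ((b c w - b a' w)\<^sup>2 + (b a w - b c' w)\<^sup>2 - (b c w - b c' w)\<^sup>2 - (b a w - b a' w)\<^sup>2))"
    by (auto simp: power2_eq_square algebra_simps)
  note B = brownian_increment[of _ _]
  show "integrable M (\<lambda>w. (b c w - b a w) * (b c' w - b a' w))"
    unfolding eq using assms nn by (intro integrable_mult_right Bochner_Integration.integrable_diff Bochner_Integration.integrable_add B) auto
  have "expectation (\<lambda>w. (b c w - b a w) * (b c' w - b a' w)) =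
     1/2 * (\<bar>c - a'\<bar> + \<bar>a - c'\<bar> - \<bar>c - c'\<bar> - \<bar>a - a'\<bar>)"
    unfolding eq using assms nn brownian_increment(1,2)[of a' c] brownian_increment(1,2)[of c' a]
      brownian_increment(1,2)[of c' c] brownian_increment(1,2)[of a' a] by simp
  also have "\<dots> = max 0 (min c c' - max a a')"
    using assms by (auto simp: max_def min_def abs_if)
  also have "\<dots> = measure lborel {max a a'<..min c c'}" by (auto simp: max_def)
  also have "\<dots> = (\<integral>s. indicator {max a a'<..min c c'} s \<partial>lborel)" by simp
  also have "\<dots> = (\<integral>s. indicator {a<..c} s * indicator {a'<..c'} s \<partial>lborel)"
    by (intro Bochner_Integration.integral_cong) (auto simp: indicator_def)
  finally show "expectation (\<lambda>w. (b c w - b a w) * (b c' w - b a' w)) = (\<integral>s. indicator {a<..c} s * indicator {a'<..c'} s \<partial>lborel)" .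
qed

abbreviation (input) adm :: "(real \<times> real \<times> real) list \<Rightarrow> bool" where
  "adm p \<equiv> \<forall>(a, c, k)\<in>set p. 0 \<le> a \<and> a \<le> c"

lemma step_integral_integrable:
  "adm p \<Longrightarrow> integrable M (step_integral b p) \<and> expectation (step_integral b p) = 0"
proof (induction p)
  case Nil
  then show ?case by (simp add: step_integral_def[abs_def])
next
  case (Cons x p)
  obtain a c k where x: "x = (a, c, k)" by (cases x)
  have eq: "step_integral b (x # p) = (\<lambda>w. k * (b c w - b a w) + step_integral b p w)"
    by (auto simp: step_integral_def x)
  have "0 \<le> a" "0 \<le> c" using Cons.prems x by auto
  then show ?case unfolding eq using Cons brownian_increment[of a c] by simp
qed

text \<open>Bilinear induction, here one interval against a list and then list against list. The
  intervals of a list may overlap, and the product formula for two arbitrary intervals covers all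
  pairs.\<close>

lemma step_isometry1:
  assumes "0 \<le> a" "a \<le> c"
  shows "adm q \<Longrightarrow> integrable M (\<lambda>w. (b c w - b a w) * step_integral b q w) \<and>
    integrable lborel (\<lambda>s. indicator {a<..c} s * step_fun q s) \<and>
    expectation (\<lambda>w. (b c w - b a w) * step_integral b q w) = (\<integral>s. indicator {a<..c} s * step_fun q s \<partial>lborel)"
proof (induction q)
  case Nil
  then show ?case by (simp add: step_integral_def step_fun_def)
next
  case (Cons x q)
  obtain a' c' k where x: "x = (a', c', k)" by (cases x)
  have eq1: "(\<lambda>w. (b c w - b a w) * step_integral b (x # q) w) =
      (\<lambda>w. k * ((b c w - b a w) * (b c' w - b a' w)) + (b c w - b a w) * step_integral b q w)"
    by (auto simp: step_integral_def x algebra_simps)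
  have eq2: "(\<lambda>s. indicator {a<..c} s * step_fun (x # q) s) =
      (\<lambda>s. k * (indicator {a<..c} s * indicator {a'<..c'} s) + indicator {a<..c} s * step_fun q s)"
    by (auto simp: step_fun_def x algebra_simps)
  have int: "integrable lborel (\<lambda>s. indicator {a<..c} s * indicator {a'<..c'} s :: real)"
  proof -
    have "(\<lambda>s. indicator {a<..c} s * indicator {a'<..c'} s :: real) = indicator ({a<..c} \<inter> {a'<..c'})"
      by (auto simp: indicator_def)
    moreover have "emeasure lborel ({a<..c} \<inter> {a'<..c'}) \<le> emeasure lborel {a<..c}" by (intro emeasure_mono) auto
    then have "emeasure lborel ({a<..c} \<inter> {a'<..c'}) < \<infinity>" using assms by (auto simp: less_top[symmetric] top_unique)
    ultimately show ?thesis by (simp add: integrable_indicator_iff)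
  qed
  have adm: "0 \<le> a'" "a' \<le> c'" "adm q" using Cons.prems x by auto
  show ?case
    unfolding eq1 eq2 using Cons.IH[OF adm(3)] int brownian_increment_product[OF assms adm(1,2)] by simp
qed

lemma step_isometry:
  assumes q: "adm q"
  shows "adm p \<Longrightarrow> integrable M (\<lambda>w. step_integral b p w * step_integral b q w) \<and>
    integrable lborel (\<lambda>s. step_fun p s * step_fun q s) \<and>
    expectation (\<lambda>w. step_integral b p w * step_integral b q w) = (\<integral>s. step_fun p s * step_fun q s \<partial>lborel)"
proof (induction p)
  case Nil
  then show ?case by (simp add: step_integral_def step_fun_def)
next
  case (Cons x p)
  obtain a c k where x: "x = (a, c, k)" by (cases x)
  have eq1: "(\<lambda>w. step_integral b (x # p) w * step_integral b q w) =
      (\<lambda>w. k * ((b c w - b a w) * step_integral b q w) + step_integral b p w * step_integral b q w)"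
    by (auto simp: step_integral_def x algebra_simps)
  have eq2: "(\<lambda>s. step_fun (x # p) s * step_fun q s) =
      (\<lambda>s. k * (indicator {a<..c} s * step_fun q s) + step_fun p s * step_fun q s)"
    by (auto simp: step_fun_def x algebra_simps)
  have adm: "0 \<le> a" "a \<le> c" "adm p" using Cons.prems x by auto
  show ?case
    unfolding eq1 eq2 using Cons.IH[OF adm(3)] step_isometry1[OF adm(1,2) q] by simp
qed

end

end

section \<open>Mean-square limits and orthonormal expansions\<close>

text \<open>The weighted inequality \<open>sq\<close>, applied with the roles of \<open>f n\<close>
  and \<open>g\<close> exchanged as well, replaces the triangle inequality of the mean-square norm
  and squeezes the second moments.\<close>

lemma L2_norm_tendsto:
  assumes L: "L2_tendsto M f g" and int: "\<And>n. integrable M (\<lambda>x. (f n x)\<^sup>2)"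
  shows "integrable M (\<lambda>x. (g x)\<^sup>2)" "(\<lambda>n. \<integral>x. (f n x)\<^sup>2 \<partial>M) \<longlonglongrightarrow> (\<integral>x. (g x)\<^sup>2 \<partial>M)"
proof -
  have [measurable]: "f n \<in> borel_measurable M" "g \<in> borel_measurable M" for n
    using L by (auto simp: L2_tendsto_def)
  have lim: "(\<lambda>n. \<integral>\<^sup>+x. ennreal ((f n x - g x)\<^sup>2) \<partial>M) \<longlonglongrightarrow> 0" using L by (simp add: L2_tendsto_def)
  have sq: "(u::real)\<^sup>2 \<le> (1 + \<theta>) * v\<^sup>2 + (1 + 1 / \<theta>) * (u - v)\<^sup>2" if "\<theta> > 0" for u v \<theta>
  proof -
    have "0 \<le> (\<theta> * v - (u - v))\<^sup>2 / \<theta>" using that by simp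
    also have "\<dots> = (1 + \<theta>) * v\<^sup>2 + (1 + 1 / \<theta>) * (u - v)\<^sup>2 - u\<^sup>2"
      using that by (simp add: power2_eq_square field_simps)
    finally show ?thesis by simp
  qed
  have ev: "\<forall>\<^sub>F n in sequentially. (\<integral>\<^sup>+x. ennreal ((f n x - g x)\<^sup>2) \<partial>M) < 1"
    using lim by (rule order_tendstoD) simp
  have intd: "\<forall>\<^sub>F n in sequentially. integrable M (\<lambda>x. (f n x - g x)\<^sup>2)"
    using ev by eventually_elim (auto intro!: integrableI_bounded simp: less_top intro: less_le_trans order.strict_trans)
  then obtain n0 where n0: "integrable M (\<lambda>x. (f n0 x - g x)\<^sup>2)"
    by (meson eventually_happens' sequentially_bot)
  show g: "integrable M (\<lambda>x. (g x)\<^sup>2)"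
  proof (rule Bochner_Integration.integrable_bound)
    show "integrable M (\<lambda>x. 2 * (f n0 x)\<^sup>2 + 2 * (f n0 x - g x)\<^sup>2)" using int n0 by simp
    show "AE x in M. norm ((g x)\<^sup>2) \<le> norm (2 * (f n0 x)\<^sup>2 + 2 * (f n0 x - g x)\<^sup>2)"
    proof (rule AE_I2)
      fix x show "norm ((g x)\<^sup>2) \<le> norm (2 * (f n0 x)\<^sup>2 + 2 * (f n0 x - g x)\<^sup>2)"
        using sq[of 1 "g x" "f n0 x"] by (simp add: power2_commute)
    qed
  qed simp
  define d where "d n = (\<integral>x. (f n x - g x)\<^sup>2 \<partial>M)" for n
  define F where "F n = (\<integral>x. (f n x)\<^sup>2 \<partial>M)" for n
  define G where "G = (\<integral>x. (g x)\<^sup>2 \<partial>M)"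
  have d0: "d n \<ge> 0" for n unfolding d_def by simp
  \<comment> \<open>The identity holds for every \<open>n\<close>: if the square is not integrable,
    the Bochner integral and \<open>enn2real\<close> of the infinite integral are both 0.\<close>
  have "d = (\<lambda>n. enn2real (\<integral>\<^sup>+x. ennreal ((f n x - g x)\<^sup>2) \<partial>M))"
    unfolding d_def by (subst integral_eq_nn_integral) auto
  then have dlim: "d \<longlonglongrightarrow> 0"
    using tendsto_enn2real[of _ 0, unfolded ennreal_0, OF lim] by simp
  \<comment> \<open>The weight must tend to 0 while \<open>d n / \<theta> n\<close> tends to 0 too;
    \<open>sqrt (d n)\<close> balances the two, and the second summand keeps the weight positive
    when \<open>d n = 0\<close>.\<close>
  define \<theta> where "\<theta> n = sqrt (d n) + 1 / real (Suc n)" for n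
  have \<theta>: "\<theta> n > 0" for n using d0[of n] by (simp add: \<theta>_def add_nonneg_pos)
  have "\<theta> \<longlonglongrightarrow> sqrt 0 + 0"
    unfolding \<theta>_def by (intro tendsto_add tendsto_real_sqrt dlim LIMSEQ_Suc lim_1_over_n) 
  then have \<theta>lim: "\<theta> \<longlonglongrightarrow> 0" by simp
  have dth: "d n / \<theta> n \<le> sqrt (d n)" for n
  proof -
    have "sqrt (d n) * sqrt (d n) \<le> sqrt (d n) * \<theta> n"
      using d0[of n] by (intro mult_left_mono) (auto simp: \<theta>_def)
    then show ?thesis using d0[of n] \<theta>[of n] by (simp add: pos_divide_le_eq)
  qed
  have up: "\<forall>\<^sub>F n in sequentially. F n \<le> (1 + \<theta> n) * G + (d n + sqrt (d n))"
    using intd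
  proof eventually_elim
    case (elim n)
    have "F n \<le> (\<integral>x. (1 + \<theta> n) * (g x)\<^sup>2 + (1 + 1 / \<theta> n) * (f n x - g x)\<^sup>2 \<partial>M)"
      unfolding F_def using int g elim by (intro integral_mono sq \<theta>) auto
    also have "\<dots> = (1 + \<theta> n) * G + (d n + d n / \<theta> n)"
      using g elim by (simp add: G_def d_def algebra_simps)
    finally show ?case using dth[of n] by linarith
  qed
  have lo: "\<forall>\<^sub>F n in sequentially. (G - (d n + sqrt (d n))) / (1 + \<theta> n) \<le> F n"
    using intd
  proof eventually_elim
    case (elim n)
    have "G \<le> (\<integral>x. (1 + \<theta> n) * (f n x)\<^sup>2 + (1 + 1 / \<theta> n) * (f n x - g x)\<^sup>2 \<partial>M)"
      unfolding G_def
    proof (intro integral_mono g)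
      fix x show "(g x)\<^sup>2 \<le> (1 + \<theta> n) * (f n x)\<^sup>2 + (1 + 1 / \<theta> n) * (f n x - g x)\<^sup>2"
        using sq[OF \<theta>[of n], of "g x" "f n x"] by (simp add: power2_commute)
    qed (use int elim in auto)
    also have "\<dots> = (1 + \<theta> n) * F n + (d n + d n / \<theta> n)"
      using int elim by (simp add: F_def d_def algebra_simps)
    finally have "G - (d n + sqrt (d n)) \<le> F n * (1 + \<theta> n)" using dth[of n] by (simp add: mult.commute)
    then show ?case using \<theta>[of n] by (simp add: pos_divide_le_eq)
  qed
  have "F \<longlonglongrightarrow> G"
  proof (rule tendsto_sandwich[OF lo up])
    have "(\<lambda>n. (G - (d n + sqrt (d n))) / (1 + \<theta> n)) \<longlonglongrightarrow> (G - (0 + sqrt 0)) / (1 + 0)"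
      by (intro tendsto_divide tendsto_diff tendsto_add tendsto_real_sqrt tendsto_const dlim \<theta>lim) simp
    then show "(\<lambda>n. (G - (d n + sqrt (d n))) / (1 + \<theta> n)) \<longlonglongrightarrow> G" by simp
    have "(\<lambda>n. (1 + \<theta> n) * G + (d n + sqrt (d n))) \<longlonglongrightarrow> (1 + 0) * G + (0 + sqrt 0)"
      by (intro tendsto_mult tendsto_add tendsto_real_sqrt tendsto_const dlim \<theta>lim)
    then show "(\<lambda>n. (1 + \<theta> n) * G + (d n + sqrt (d n))) \<longlonglongrightarrow> G" by simp
  qed
  then show "(\<lambda>n. \<integral>x. (f n x)\<^sup>2 \<partial>M) \<longlonglongrightarrow> (\<integral>x. (g x)\<^sup>2 \<partial>M)" by (simp add: F_def[abs_def] G_def)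
qed

lemma L2_tendsto_sum:
  assumes "finite I" "\<And>i. i \<in> I \<Longrightarrow> L2_tendsto M (f i) (g i)"
  shows "L2_tendsto M (\<lambda>n x. \<Sum>i\<in>I. f i n x) (\<lambda>x. \<Sum>i\<in>I. g i x)"
  using assms
proof (induction I rule: finite_induct)
  case empty
  then show ?case by (simp add: L2_tendsto_def)
next
  case (insert i I)
  let ?f = "\<lambda>n x. \<Sum>i\<in>I. f i n x" and ?g = "\<lambda>x. \<Sum>i\<in>I. g i x"
  have A: "L2_tendsto M (f i) (g i)" and B: "L2_tendsto M ?f ?g" using insert by auto
  have [measurable]: "f i n \<in> borel_measurable M" "g i \<in> borel_measurable M"
     "?f n \<in> borel_measurable M" "?g \<in> borel_measurable M" for n
    using A B by (auto simp: L2_tendsto_def)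
  have "(\<lambda>n. \<integral>\<^sup>+x. ennreal (((f i n x + ?f n x) - (g i x + ?g x))\<^sup>2) \<partial>M) \<longlonglongrightarrow> 0"
  proof (rule tendsto_sandwich[OF always_eventually always_eventually tendsto_const])
    have "(\<lambda>n. 2 * (\<integral>\<^sup>+x. ennreal ((f i n x - g i x)\<^sup>2) \<partial>M) + 2 * (\<integral>\<^sup>+x. ennreal ((?f n x - ?g x)\<^sup>2) \<partial>M)) \<longlonglongrightarrow> 2 * 0 + 2 * 0"
      using A B by (intro tendsto_add ennreal_tendsto_cmult) (auto simp: L2_tendsto_def)
    then show "(\<lambda>n. 2 * (\<integral>\<^sup>+x. ennreal ((f i n x - g i x)\<^sup>2) \<partial>M) + 2 * (\<integral>\<^sup>+x. ennreal ((?f n x - ?g x)\<^sup>2) \<partial>M)) \<longlonglongrightarrow> 0" by simp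
    show "\<forall>n. (\<integral>\<^sup>+x. ennreal (((f i n x + ?f n x) - (g i x + ?g x))\<^sup>2) \<partial>M) \<le>
        2 * (\<integral>\<^sup>+x. ennreal ((f i n x - g i x)\<^sup>2) \<partial>M) + 2 * (\<integral>\<^sup>+x. ennreal ((?f n x - ?g x)\<^sup>2) \<partial>M)"
    proof
      fix n
      have "(\<integral>\<^sup>+x. ennreal (((f i n x + ?f n x) - (g i x + ?g x))\<^sup>2) \<partial>M) \<le>
          (\<integral>\<^sup>+x. 2 * ennreal ((f i n x - g i x)\<^sup>2) + 2 * ennreal ((?f n x - ?g x)\<^sup>2) \<partial>M)"
      proof (rule nn_integral_mono)
        fix x
        have "((f i n x + ?f n x) - (g i x + ?g x))\<^sup>2 \<le> 2 * (f i n x - g i x)\<^sup>2 + 2 * (?f n x - ?g x)\<^sup>2"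
          using zero_le_power2[of "(f i n x - g i x) - (?f n x - ?g x)"] by (simp add: power2_eq_square algebra_simps)
        then have "ennreal (((f i n x + ?f n x) - (g i x + ?g x))\<^sup>2) \<le> ennreal (2 * (f i n x - g i x)\<^sup>2 + 2 * (?f n x - ?g x)\<^sup>2)"
          by (rule ennreal_leI)
        also have "\<dots> = 2 * ennreal ((f i n x - g i x)\<^sup>2) + 2 * ennreal ((?f n x - ?g x)\<^sup>2)"
          by (simp add: ennreal_plus ennreal_mult)
        finally show "ennreal (((f i n x + ?f n x) - (g i x + ?g x))\<^sup>2) \<le> 2 * ennreal ((f i n x - g i x)\<^sup>2) + 2 * ennreal ((?f n x - ?g x)\<^sup>2)" .
      qed
      also have "\<dots> = 2 * (\<integral>\<^sup>+x. ennreal ((f i n x - g i x)\<^sup>2) \<partial>M) + 2 * (\<integral>\<^sup>+x. ennreal ((?f n x - ?g x)\<^sup>2) \<partial>M)"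
        by (simp add: nn_integral_add nn_integral_cmult)
      finally show "(\<integral>\<^sup>+x. ennreal (((f i n x + ?f n x) - (g i x + ?g x))\<^sup>2) \<partial>M) \<le>
        2 * (\<integral>\<^sup>+x. ennreal ((f i n x - g i x)\<^sup>2) \<partial>M) + 2 * (\<integral>\<^sup>+x. ennreal ((?f n x - ?g x)\<^sup>2) \<partial>M)" .
    qed
  qed simp
  then show ?case using insert(1,2) by (simp add: L2_tendsto_def)
qed

lemma step_fun_borel [measurable]: "step_fun p \<in> borel_measurable borel"
proof (induction p)
  case Nil
  then show ?case by (simp add: step_fun_def[abs_def])
next
  case (Cons x p)
  obtain a c k where x: "x = (a, c, k)" by (cases x)
  have "step_fun (x # p) = (\<lambda>s. k * indicator {a<..c} s + step_fun p s)"
    by (auto simp: step_fun_def x)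
  with Cons show ?case by simp
qed

lemma step_fun_outside:
  "\<forall>(a, b, c)\<in>set p. 0 \<le> a \<and> a \<le> b \<and> b \<le> t \<Longrightarrow> s \<notin> {0..t} \<Longrightarrow> step_fun p s = 0"
  by (induction p) (auto simp: step_fun_def indicator_def)

text \<open>Cauchy-Schwarz for the coefficients bounds the functional on finite combinations of the
  system, and completeness makes these dense.\<close>

lemma complete_orthonormal_norm_le:
  fixes \<phi> :: "'h::real_inner \<Rightarrow>\<^sub>L real"
  assumes e: "complete_orthonormal_system K e" and c: "\<And>N. (\<Sum>k\<in>K \<inter> {..<N}. (\<phi> (e k))\<^sup>2) \<le> c"
  shows "(norm \<phi>)\<^sup>2 \<le> c"
proof -
  have on: "inner (e i) (e j) = (if i = j then 1 else 0)" if "i \<in> K" "j \<in> K" for i j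
    using e that by (auto simp: complete_orthonormal_system_def)
  have c0: "c \<ge> 0" using c[of 0] by simp
  have span: "\<exists>N a. h = (\<Sum>k\<in>K \<inter> {..<N}. a k *\<^sub>R e k)" if "h \<in> span (e ` K)" for h
    using that
  proof (induction rule: span_induct_alt)
    case base
    show ?case by (intro exI[of _ 0]) simp
  next
    case (step r x y)
    obtain k where k: "k \<in> K" "x = e k" using step by auto
    obtain N a where y: "y = (\<Sum>k\<in>K \<inter> {..<N}. a k *\<^sub>R e k)" using step by blast
    define N' where "N' = max N (Suc k)"
    define a' where "a' i = (if i < N then a i else 0) + (if i = k then r else 0)" for i
    have "(\<Sum>i\<in>K \<inter> {..<N'}. a' i *\<^sub>R e i) =
        (\<Sum>i\<in>K \<inter> {..<N'}. if i < N then a i *\<^sub>R e i else 0) + (\<Sum>i\<in>K \<inter> {..<N'}. if i = k then r *\<^sub>R e i else 0)"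
      unfolding a'_def sum.distrib[symmetric] by (intro sum.cong) (auto simp: scaleR_add_left)
    also have "(\<Sum>i\<in>K \<inter> {..<N'}. if i < N then a i *\<^sub>R e i else 0) = y"
      unfolding y by (rule sum.mono_neutral_cong_right) (auto simp: N'_def)
    also have "(\<Sum>i\<in>K \<inter> {..<N'}. if i = k then r *\<^sub>R e i else 0) = r *\<^sub>R x"
      using k by (subst sum.delta) (auto simp: N'_def)
    finally show ?case by (metis add.commute)
  qed
  have le: "\<bar>\<phi> h\<bar> \<le> sqrt c * norm h" if hs: "h \<in> span (e ` K)" for h
  proof -
    obtain N a where h: "h = (\<Sum>k\<in>K \<inter> {..<N}. a k *\<^sub>R e k)" using span[OF hs] by blast
    have "inner h h = (\<Sum>i\<in>K \<inter> {..<N}. \<Sum>j\<in>K \<inter> {..<N}. a i * (a j * inner (e j) (e i)))"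
      unfolding h by (simp add: inner_sum_left inner_sum_right sum_distrib_left)
    also have "\<dots> = (\<Sum>i\<in>K \<inter> {..<N}. \<Sum>j\<in>K \<inter> {..<N}. if i = j then a i * a i else 0)"
      by (intro sum.cong refl) (auto simp: on)
    also have "\<dots> = (\<Sum>i\<in>K \<inter> {..<N}. (a i)\<^sup>2)"
      by (intro sum.cong refl) (subst sum.delta', auto simp: power2_eq_square)
    finally have n: "(norm h)\<^sup>2 = (\<Sum>i\<in>K \<inter> {..<N}. (a i)\<^sup>2)" by (simp add: power2_norm_eq_inner)
    have "\<phi> h = (\<Sum>i\<in>K \<inter> {..<N}. a i * \<phi> (e i))"
      unfolding h by (simp add: blinfun.sum_right blinfun.scaleR_right)
    then have "(\<phi> h)\<^sup>2 \<le> (\<Sum>i\<in>K \<inter> {..<N}. (a i)\<^sup>2) * (\<Sum>i\<in>K \<inter> {..<N}. (\<phi> (e i))\<^sup>2)"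
      using Cauchy_Schwarz_ineq_sum by metis
    also have "\<dots> \<le> (norm h)\<^sup>2 * c" unfolding n by (intro mult_left_mono c sum_nonneg) auto
    finally have "sqrt ((\<phi> h)\<^sup>2) \<le> sqrt ((norm h)\<^sup>2 * c)" by (rule real_sqrt_le_mono)
    then show ?thesis by (simp add: real_sqrt_mult mult.commute)
  qed
  have "closed {h. \<bar>\<phi> h\<bar> \<le> sqrt c * norm h}"
    by (intro closed_Collect_le continuous_intros)
  then have "closure (span (e ` K)) \<subseteq> {h. \<bar>\<phi> h\<bar> \<le> sqrt c * norm h}"
    using le by (intro closure_minimal) auto
  then have "\<bar>\<phi> h\<bar> \<le> sqrt c * norm h" for h
    using e by (auto simp: complete_orthonormal_system_def)
  then have "norm \<phi> \<le> sqrt c" using c0 by (intro norm_blinfun_bound) auto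
  then have "(norm \<phi>)\<^sup>2 \<le> (sqrt c)\<^sup>2" by (intro power_mono) auto
  then show ?thesis using c0 by simp
qed

text \<open>In \<open>ennreal\<close> the supremum makes sense before its finiteness is known, and
  it has the form that monotone convergence expects.\<close>

lemma complete_orthonormal_norm_le_SUP:
  fixes \<phi> :: "'h::real_inner \<Rightarrow>\<^sub>L real"
  assumes e: "complete_orthonormal_system K e"
  shows "ennreal ((norm \<phi>)\<^sup>2) \<le> (SUP N. ennreal (\<Sum>k\<in>K \<inter> {..<N}. (\<phi> (e k))\<^sup>2))" (is "_ \<le> ?S")
proof (cases "?S = \<top>")
  case False
  then obtain c where c: "?S = ennreal c" "c \<ge> 0" by (cases ?S) auto
  have "ennreal (\<Sum>k\<in>K \<inter> {..<N}. (\<phi> (e k))\<^sup>2) \<le> ennreal c" for N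
    unfolding c(1)[symmetric] by (rule SUP_upper) simp
  then have "(\<Sum>k\<in>K \<inter> {..<N}. (\<phi> (e k))\<^sup>2) \<le> c" for N using c(2) by (simp add: ennreal_le_iff)
  from complete_orthonormal_norm_le[OF e this] show ?thesis unfolding c(1) by (rule ennreal_leI)
next
  case True
  show ?thesis unfolding True by (rule top_greatest)
qed

section \<open>Wiener integrals against independent Brownian motions\<close>

context prob_space begin

text \<open>Independence is given for whole paths as elements of a product space. A step integral is
  a measurable functional of the path, so it inherits independence, and its mean is zero.\<close>

lemma cylindrical_orthogonal:
  assumes W: "cylindrical_wiener M K e \<beta>" and jk: "j \<in> K" "k \<in> K" "j \<noteq> k"
    and p: "\<forall>(a, c, r)\<in>set p. 0 \<le> a \<and> a \<le> c" and q: "\<forall>(a, c, r)\<in>set q. 0 \<le> a \<and> a \<le> c"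
  shows "integrable M (\<lambda>w. step_integral (\<beta> j) p w * step_integral (\<beta> k) q w) \<and>
    expectation (\<lambda>w. step_integral (\<beta> j) p w * step_integral (\<beta> k) q w) = 0"
proof -
  have b: "brownian_motion M (\<beta> j)" "brownian_motion M (\<beta> k)"
    using W jk by (auto simp: cylindrical_wiener_def)
  \<comment> \<open>\<open>ev\<close> is the coordinate process on path space;
    \<open>step_integral ev p\<close> is the step integral read as a functional of the path.\<close>
  define ev :: "real \<Rightarrow> (real \<Rightarrow> real) \<Rightarrow> real" where "ev t x = x t" for t x
  define Y where "Y i = step_integral ev (if i = j then p else q)" for i
  have meas: "step_integral ev p \<in> borel_measurable (Pi\<^sub>M {0..} (\<lambda>_. borel))"
    if "\<forall>(a, c, r)\<in>set p. 0 \<le> a \<and> a \<le> c" for p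
    using that
  proof (induction p)
    case Nil
    then show ?case by (simp add: step_integral_def[abs_def])
  next
    case (Cons x p)
    obtain a c r where x: "x = (a, c, r)" by (cases x)
    have ac: "a \<in> {0..}" "c \<in> {0..}" using Cons.prems x by auto
    have [measurable]: "ev t \<in> borel_measurable (Pi\<^sub>M {0..} (\<lambda>_. borel))" if "t \<in> {0..}" for t
      unfolding ev_def[abs_def] by (rule measurable_component_singleton[OF that])
    have [measurable]: "step_integral ev p \<in> borel_measurable (Pi\<^sub>M {0..} (\<lambda>_. borel))"
      using Cons by simp
    have "step_integral ev (x # p) = (\<lambda>w. r * (ev c w - ev a w) + step_integral ev p w)"
      by (auto simp: step_integral_def x)
    then show ?case using ac by simp
  qed
  have ev: "step_integral ev p (\<lambda>t\<in>{0..}. \<beta> i t w) = step_integral (\<beta> i) p w"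
    if "\<forall>(a, c, r)\<in>set p. 0 \<le> a \<and> a \<le> c" for p i w
    using that by (induction p) (auto simp: step_integral_def ev_def restrict_def)
  have "indep_vars (\<lambda>_. Pi\<^sub>M {0..} (\<lambda>_. borel)) (\<lambda>k w. \<lambda>t\<in>{0..}. \<beta> k t w) K"
    using W unfolding cylindrical_wiener_def by blast
  from indep_vars_subset[OF this, of "{j, k}"]
  have "indep_vars (\<lambda>_. Pi\<^sub>M {0..} (\<lambda>_. borel)) (\<lambda>k w. \<lambda>t\<in>{0..}. \<beta> k t w) {j, k}"
    using jk by simp
  then have ind: "indep_vars (\<lambda>_. borel) (\<lambda>i w. Y i (\<lambda>t\<in>{0..}. \<beta> i t w)) {j, k}"
    by (rule indep_vars_compose2) (auto simp: Y_def meas[OF p] meas[OF q])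
  have Yj: "Y j (\<lambda>t\<in>{0..}. \<beta> j t w) = step_integral (\<beta> j) p w" for w using ev[OF p, of j w] by (simp add: Y_def)
  have Yk: "Y k (\<lambda>t\<in>{0..}. \<beta> k t w) = step_integral (\<beta> k) q w" for w using ev[OF q, of k w] jk by (simp add: Y_def)
  have int: "integrable M (\<lambda>w. Y i (\<lambda>t\<in>{0..}. \<beta> i t w))" if "i \<in> {j, k}" for i
    using that step_integral_integrable[OF b(1) p] step_integral_integrable[OF b(2) q] by (auto simp: Yj Yk)
  show ?thesis
    using indep_vars_lebesgue_integral[OF _ ind int] indep_vars_integrable[OF _ ind int] jk
      step_integral_integrable[OF b(1) p] by (simp add: Yj Yk)
qed

lemma step_sum_isometry:
  assumes W: "cylindrical_wiener M K e \<beta>" and I: "finite I" "I \<subseteq> K"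
    and p: "\<And>k. k \<in> I \<Longrightarrow> \<forall>(a, c, r)\<in>set (p k). 0 \<le> a \<and> a \<le> c"
  shows "integrable M (\<lambda>w. (\<Sum>k\<in>I. step_integral (\<beta> k) (p k) w)\<^sup>2)"
    "expectation (\<lambda>w. (\<Sum>k\<in>I. step_integral (\<beta> k) (p k) w)\<^sup>2) = (\<Sum>k\<in>I. \<integral>s. (step_fun (p k) s)\<^sup>2 \<partial>lborel)"
proof -
  have eq: "(\<lambda>w. (\<Sum>k\<in>I. step_integral (\<beta> k) (p k) w)\<^sup>2) =
     (\<lambda>w. \<Sum>j\<in>I. \<Sum>k\<in>I. step_integral (\<beta> j) (p j) w * step_integral (\<beta> k) (p k) w)"
    by (simp add: power2_eq_square sum_product)
  have b: "brownian_motion M (\<beta> k)" if "k \<in> I" for k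
    using W I that by (auto simp: cylindrical_wiener_def)
  have tm: "integrable M (\<lambda>w. step_integral (\<beta> j) (p j) w * step_integral (\<beta> k) (p k) w) \<and>
     expectation (\<lambda>w. step_integral (\<beta> j) (p j) w * step_integral (\<beta> k) (p k) w) =
       (if j = k then \<integral>s. (step_fun (p k) s)\<^sup>2 \<partial>lborel else 0)" if "j \<in> I" "k \<in> I" for j k
  proof (cases "j = k")
    case True
    then show ?thesis
      using step_isometry[OF b[OF that(1)] p[OF that(1)] p[OF that(1)]] by (simp add: power2_eq_square)
  next
    case False
    then show ?thesis using cylindrical_orthogonal[OF W _ _ False p[OF that(1)] p[OF that(2)]] that I by auto
  qed
  show "integrable M (\<lambda>w. (\<Sum>k\<in>I. step_integral (\<beta> k) (p k) w)\<^sup>2)"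
    unfolding eq using tm by (intro Bochner_Integration.integrable_sum) auto
  have "expectation (\<lambda>w. (\<Sum>k\<in>I. step_integral (\<beta> k) (p k) w)\<^sup>2) =
     (\<Sum>j\<in>I. \<Sum>k\<in>I. if j = k then \<integral>s. (step_fun (p k) s)\<^sup>2 \<partial>lborel else 0)"
    unfolding eq using tm by (subst Bochner_Integration.integral_sum, intro Bochner_Integration.integrable_sum, simp)
      (intro sum.cong refl, subst Bochner_Integration.integral_sum, auto)
  also have "\<dots> = (\<Sum>k\<in>I. \<integral>s. (step_fun (p k) s)\<^sup>2 \<partial>lborel)"
    using I by (intro sum.cong refl) (subst sum.delta', auto)
  finally show "expectation (\<lambda>w. (\<Sum>k\<in>I. step_integral (\<beta> k) (p k) w)\<^sup>2) = (\<Sum>k\<in>I. \<integral>s. (step_fun (p k) s)\<^sup>2 \<partial>lborel)" .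
qed

text \<open>Both sides of the isometry for step functions pass to the limit, since second moments
  are continuous under mean-square convergence.\<close>

lemma wiener_sum_isometry:
  assumes W: "cylindrical_wiener M K e \<beta>" and I: "finite I" "I \<subseteq> K"
    and Y: "\<And>k. k \<in> I \<Longrightarrow> has_wiener_integral M (\<beta> k) t (f k) (Y k)"
  shows "\<And>k. k \<in> I \<Longrightarrow> integrable (lebesgue_on {0..t}) (\<lambda>s. (f k s)\<^sup>2)"
    "integrable M (\<lambda>w. (\<Sum>k\<in>I. Y k w)\<^sup>2)"
    "expectation (\<lambda>w. (\<Sum>k\<in>I. Y k w)\<^sup>2) = (\<Sum>k\<in>I. \<integral>s. (f k s)\<^sup>2 \<partial>lebesgue_on {0..t})"
proof -
  have "\<forall>k\<in>I. \<exists>p. (\<forall>n. \<forall>(a, b, c)\<in>set (p n). 0 \<le> a \<and> a \<le> b \<and> b \<le> t) \<and>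
      L2_tendsto (lebesgue_on {0..t}) (\<lambda>n. step_fun (p n)) (f k) \<and> L2_tendsto M (\<lambda>n. step_integral (\<beta> k) (p n)) (Y k)"
    using Y unfolding has_wiener_integral_def by (rule ballI)
  from bchoice[OF this] obtain p where
    "\<forall>k\<in>I. (\<forall>n. \<forall>(a, b, c)\<in>set (p k n). 0 \<le> a \<and> a \<le> b \<and> b \<le> t) \<and>
      L2_tendsto (lebesgue_on {0..t}) (\<lambda>n. step_fun (p k n)) (f k) \<and> L2_tendsto M (\<lambda>n. step_integral (\<beta> k) (p k n)) (Y k)"
    by (rule exE)
  then have p: "\<And>k n. k \<in> I \<Longrightarrow> \<forall>(a, b, c)\<in>set (p k n). 0 \<le> a \<and> a \<le> b \<and> b \<le> t"
    and f: "\<And>k. k \<in> I \<Longrightarrow> L2_tendsto (lebesgue_on {0..t}) (\<lambda>n. step_fun (p k n)) (f k)"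
    and L: "\<And>k. k \<in> I \<Longrightarrow> L2_tendsto M (\<lambda>n. step_integral (\<beta> k) (p k n)) (Y k)"
    by simp_all
  have adm: "\<forall>(a, b, c)\<in>set (p k n). 0 \<le> a \<and> a \<le> b" if "k \<in> I" for k n
    using p[OF that, of n] by auto
  have b: "brownian_motion M (\<beta> k)" if "k \<in> I" for k
    using W I that by (auto simp: cylindrical_wiener_def)
  \<comment> \<open>Step functions with endpoints in \<open>{0..t}\<close> vanish outside, so
    restricting the measure changes neither integrability nor the integral.\<close>
  have on: "integrable (lebesgue_on {0..t}) (\<lambda>s. (step_fun (p k n) s)\<^sup>2) \<and>
     (\<integral>s. (step_fun (p k n) s)\<^sup>2 \<partial>lebesgue_on {0..t}) = (\<integral>s. (step_fun (p k n) s)\<^sup>2 \<partial>lborel)" if k: "k \<in> I" for k n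
  proof -
    have "integrable lborel (\<lambda>s. (step_fun (p k n) s)\<^sup>2)"
      using step_isometry[OF b[OF k] adm[OF k] adm[OF k]] by (simp add: power2_eq_square)
    then have int: "integrable lebesgue (\<lambda>s. (step_fun (p k n) s)\<^sup>2)" by (simp add: integrable_completion)
    have eq: "(\<lambda>s. indicator {0..t} s * (step_fun (p k n) s)\<^sup>2) = (\<lambda>s. (step_fun (p k n) s)\<^sup>2)"
      using step_fun_outside[OF p[OF k, of n]] by (auto simp: indicator_def fun_eq_iff)
    show ?thesis
      using int by (simp add: integrable_restrict_space integral_restrict_space eq integral_completion)
  qed
  show fi: "integrable (lebesgue_on {0..t}) (\<lambda>s. (f k s)\<^sup>2)" if "k \<in> I" for k
    using L2_norm_tendsto(1)[OF f[OF that]] on[OF that] by simp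
  have S: "L2_tendsto M (\<lambda>n w. \<Sum>k\<in>I. step_integral (\<beta> k) (p k n) w) (\<lambda>w. \<Sum>k\<in>I. Y k w)"
    by (rule L2_tendsto_sum[OF I(1) L])
  note iso = step_sum_isometry[OF W I adm]
  show "integrable M (\<lambda>w. (\<Sum>k\<in>I. Y k w)\<^sup>2)"
    by (rule L2_norm_tendsto(1)[OF S iso(1)]) 
  have eq: "(\<lambda>n. expectation (\<lambda>w. (\<Sum>k\<in>I. step_integral (\<beta> k) (p k n) w)\<^sup>2)) =
      (\<lambda>n. \<Sum>k\<in>I. \<integral>s. (step_fun (p k n) s)\<^sup>2 \<partial>lebesgue_on {0..t})"
    by (subst iso(2)) (auto simp: on intro!: sum.cong)
  have lim1: "(\<lambda>n. \<Sum>k\<in>I. \<integral>s. (step_fun (p k n) s)\<^sup>2 \<partial>lebesgue_on {0..t}) \<longlonglongrightarrow> expectation (\<lambda>w. (\<Sum>k\<in>I. Y k w)\<^sup>2)"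
    unfolding eq[symmetric] by (rule L2_norm_tendsto(2)[OF S iso(1)])
  have lim2: "(\<lambda>n. \<Sum>k\<in>I. \<integral>s. (step_fun (p k n) s)\<^sup>2 \<partial>lebesgue_on {0..t}) \<longlonglongrightarrow>
      (\<Sum>k\<in>I. \<integral>s. (f k s)\<^sup>2 \<partial>lebesgue_on {0..t})"
    using on by (intro tendsto_sum L2_norm_tendsto(2) f) auto
  show "expectation (\<lambda>w. (\<Sum>k\<in>I. Y k w)\<^sup>2) = (\<Sum>k\<in>I. \<integral>s. (f k s)\<^sup>2 \<partial>lebesgue_on {0..t})"
    by (rule LIMSEQ_unique[OF lim1 lim2])
qed

text \<open>The truncated series has second moment equal to a partial sum of squared norms, and
  these partial sums increase to the second moment of the limit.\<close>

lemma stochastic_convolution_variance: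
  assumes W: "cylindrical_wiener M K e \<beta>" and Z: "is_stochastic_convolution M K e \<beta> SQ t Z"
  shows "integrable M (\<lambda>w. (blinfun_apply xs (Z w))\<^sup>2)"
    "(\<Sum>k\<in>K \<inter> {..<N}. \<integral>\<^sup>+s. ennreal ((blinfun_apply xs (SQ (t - s) (e k)))\<^sup>2) \<partial>lebesgue_on {0..t}) \<le>
      (\<integral>\<^sup>+w. ennreal ((blinfun_apply xs (Z w))\<^sup>2) \<partial>M)"
proof -
  obtain Y where Y: "\<And>k. k \<in> K \<Longrightarrow> has_wiener_integral M (\<beta> k) t (\<lambda>s. xs (SQ (t - s) (e k))) (Y k)"
    and L: "L2_tendsto M (\<lambda>n w. \<Sum>k\<in>K \<inter> {..<n}. Y k w) (\<lambda>w. xs (Z w))"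
    using Z unfolding is_stochastic_convolution_def by meson
  let ?f = "\<lambda>k s. (blinfun_apply xs (SQ (t - s) (e k)))\<^sup>2"
  have iso: "k \<in> K \<inter> {..<n} \<Longrightarrow> integrable (lebesgue_on {0..t}) (?f k)"
    "integrable M (\<lambda>w. (\<Sum>k\<in>K \<inter> {..<n}. Y k w)\<^sup>2)"
    "expectation (\<lambda>w. (\<Sum>k\<in>K \<inter> {..<n}. Y k w)\<^sup>2) = (\<Sum>k\<in>K \<inter> {..<n}. \<integral>s. ?f k s \<partial>lebesgue_on {0..t})" for n k
    using wiener_sum_isometry[OF W, of "K \<inter> {..<n}" t "\<lambda>k s. xs (SQ (t - s) (e k))" Y] Y by auto
  show int: "integrable M (\<lambda>w. (blinfun_apply xs (Z w))\<^sup>2)"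
    by (rule L2_norm_tendsto(1)[OF L iso(2)])
  have lim: "(\<lambda>n. \<Sum>k\<in>K \<inter> {..<n}. \<integral>s. ?f k s \<partial>lebesgue_on {0..t}) \<longlonglongrightarrow> expectation (\<lambda>w. (blinfun_apply xs (Z w))\<^sup>2)"
    using L2_norm_tendsto(2)[OF L iso(2)] unfolding iso(3) .
  have "(\<Sum>k\<in>K \<inter> {..<N}. \<integral>s. ?f k s \<partial>lebesgue_on {0..t}) \<le> expectation (\<lambda>w. (blinfun_apply xs (Z w))\<^sup>2)"
  proof (rule incseq_le[OF _ lim])
    show "incseq (\<lambda>n. \<Sum>k\<in>K \<inter> {..<n}. \<integral>s. ?f k s \<partial>lebesgue_on {0..t})"
      by (intro monoI sum_mono2) (auto intro!: integral_nonneg_AE)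
  qed
  moreover have "(\<Sum>k\<in>K \<inter> {..<N}. \<integral>\<^sup>+s. ennreal (?f k s) \<partial>lebesgue_on {0..t}) =
      ennreal (\<Sum>k\<in>K \<inter> {..<N}. \<integral>s. ?f k s \<partial>lebesgue_on {0..t})"
  proof -
    have "(\<Sum>k\<in>K \<inter> {..<N}. \<integral>\<^sup>+s. ennreal (?f k s) \<partial>lebesgue_on {0..t}) =
        (\<Sum>k\<in>K \<inter> {..<N}. ennreal (\<integral>s. ?f k s \<partial>lebesgue_on {0..t}))"
      using iso(1) by (intro sum.cong refl nn_integral_eq_integral) auto
    also have "\<dots> = ennreal (\<Sum>k\<in>K \<inter> {..<N}. \<integral>s. ?f k s \<partial>lebesgue_on {0..t})"
      by (intro sum_ennreal) auto
    finally show ?thesis .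
  qed
  moreover have "(\<integral>\<^sup>+w. ennreal ((blinfun_apply xs (Z w))\<^sup>2) \<partial>M) = ennreal (expectation (\<lambda>w. (blinfun_apply xs (Z w))\<^sup>2))"
    using int by (intro nn_integral_eq_integral) auto
  ultimately show "(\<Sum>k\<in>K \<inter> {..<N}. \<integral>\<^sup>+s. ennreal (?f k s) \<partial>lebesgue_on {0..t}) \<le>
      (\<integral>\<^sup>+w. ennreal ((blinfun_apply xs (Z w))\<^sup>2) \<partial>M)"
    by (simp add: ennreal_leI)
qed

end

section \<open>Energy of the noise kernel\<close>

locale noise_semigroup = decaying_semigroup S M \<omega>
  for S :: "real \<Rightarrow> 'e::banach \<Rightarrow>\<^sub>L 'e" and M \<omega> :: real +
  fixes SQ :: "real \<Rightarrow> 'h::{real_inner, banach, second_countable_topology} \<Rightarrow>\<^sub>L 'e"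
  assumes noise: "smoothed_noise_operator S SQ"
begin

lemma SQ_add: "s \<ge> 0 \<Longrightarrow> t > 0 \<Longrightarrow> SQ (s + t) h = S s (SQ t h)"
  using noise by (metis smoothed_noise_operator_def blinfun_apply_blinfun_compose)

text \<open>Away from 0 the operator factors as \<open>S (s - d)\<close> after the fixed operator
  \<open>SQ d\<close>, so strong continuity is inherited from the semigroup.\<close>

lemma SQ_cont: "continuous_on {0<..} (\<lambda>s. SQ s h)"
proof (rule continuous_at_imp_continuous_on, rule ballI)
  fix s :: real assume s: "s \<in> {0<..}"
  define d where "d = s / 2"
  have d: "d > 0" "d < s" using s by (auto simp: d_def)
  have "continuous_on {d<..} (\<lambda>s. S (s - d) (SQ d h))"
    by (intro continuous_on_compose2[OF S_cont]) (auto intro!: continuous_intros)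
  moreover have "S (r - d) (SQ d h) = SQ r h" if "r \<in> {d<..}" for r
    using SQ_add[of "r - d" d h] that d by simp
  ultimately have "continuous_on {d<..} (\<lambda>s. SQ s h)"
    by (rule continuous_on_eq)
  then show "isCont (\<lambda>s. SQ s h) s" using d by (simp add: continuous_on_eq_continuous_at)
qed

text \<open>This is the norm of the adjoint of \<open>S(s) Q\<close> applied to \<open>xs\<close>, a
  functional on \<open>'h\<close>.\<close>

definition kernel_norm :: "('e \<Rightarrow>\<^sub>L real) \<Rightarrow> real \<Rightarrow> real" where
  "kernel_norm xs s = norm (xs o\<^sub>L SQ s)"

text \<open>\<open>energy t xs\<close> is the variance of \<open>xs (Z t)\<close>; \<open>SQ 0\<close> is kept out by the half-open interval.\<close>

definition energy :: "real \<Rightarrow> ('e \<Rightarrow>\<^sub>L real) \<Rightarrow> ennreal" where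
  "energy t xs = (\<integral>\<^sup>+s. ennreal ((kernel_norm xs s)\<^sup>2) * indicator {0<..t} s \<partial>lborel)"

lemma kernel_norm_nonneg [simp]: "0 \<le> kernel_norm xs s"
  by (simp add: kernel_norm_def)

lemma kernel_norm_bound: "\<bar>blinfun_apply xs (SQ s h)\<bar> \<le> kernel_norm xs s * norm h"
  unfolding kernel_norm_def using norm_blinfun[of "xs o\<^sub>L SQ s" h] by simp

text \<open>As a supremum over \<open>h\<close> of functions continuous for \<open>s > 0\<close>,
  the norm is lower semicontinuous there: superlevel sets are unions of open sets, hence open,
  however many vectors \<open>h\<close> are involved.\<close>

lemma kernel_norm_borel: "(\<lambda>s. kernel_norm xs s * indicator {0<..} s) \<in> borel_measurable borel"
proof (rule borel_measurableI_greater)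
  fix a :: real
  show "{s \<in> space borel. a < kernel_norm xs s * indicator {0<..} s} \<in> sets borel"
  proof (cases "a < 0")
    case True
    then have "{s \<in> space borel. a < kernel_norm xs s * indicator {0<..} s} = UNIV"
      by (auto simp: indicator_def intro: less_le_trans)
    then show ?thesis by simp
  next
    case False
    have "a < kernel_norm xs s \<longleftrightarrow> (\<exists>h. a * norm h < \<bar>blinfun_apply xs (SQ s h)\<bar>)" for s
    proof
      assume "a < kernel_norm xs s"
      show "\<exists>h. a * norm h < \<bar>blinfun_apply xs (SQ s h)\<bar>"
      proof (rule ccontr)
        assume "\<not> ?thesis"
        then have "norm (blinfun_apply (xs o\<^sub>L SQ s) h) \<le> a * norm h" for h by (auto simp: not_less)
        then have "kernel_norm xs s \<le> a"
          unfolding kernel_norm_def using False by (intro norm_blinfun_bound) auto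
        then show False using \<open>a < kernel_norm xs s\<close> by simp
      qed
    next
      assume "\<exists>h. a * norm h < \<bar>blinfun_apply xs (SQ s h)\<bar>"
      then obtain h where "a * norm h < \<bar>blinfun_apply xs (SQ s h)\<bar>" by blast
      then have "a * norm h < kernel_norm xs s * norm h"
        using kernel_norm_bound[of xs s h] by linarith
      then show "a < kernel_norm xs s" by (simp add: mult_less_cancel_right)
    qed
    then have "{s \<in> space borel. a < kernel_norm xs s * indicator {0<..} s} =
        (\<Union>h. {s \<in> {0<..}. a * norm h < \<bar>blinfun_apply xs (SQ s h)\<bar>})"
      using False by (auto simp: indicator_def split: if_splits)
    moreover have "open {s \<in> {0<..}. a * norm h < \<bar>blinfun_apply xs (SQ s h)\<bar>}" for h
    proof -
      have "continuous_on {0<..} (\<lambda>s. \<bar>blinfun_apply xs (SQ s h)\<bar>)" by (intro continuous_intros SQ_cont)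
      then have "open ({0<..} \<inter> (\<lambda>s. \<bar>blinfun_apply xs (SQ s h)\<bar>) -` {a * norm h<..})"
        by (rule continuous_open_preimage) auto
      moreover have "{0<..} \<inter> (\<lambda>s. \<bar>blinfun_apply xs (SQ s h)\<bar>) -` {a * norm h<..} = {s \<in> {0<..}. a * norm h < \<bar>blinfun_apply xs (SQ s h)\<bar>}"
        by auto
      ultimately show ?thesis by simp
    qed
    then have "open (\<Union>h. {s \<in> {0<..}. a * norm h < \<bar>blinfun_apply xs (SQ s h)\<bar>})" by (intro open_UN) simp
    ultimately show ?thesis by (simp only: borel_open)
  qed
qed

lemma kernel_norm_restrict_borel:
  assumes "a \<ge> 0"
  shows "(\<lambda>s. ennreal ((kernel_norm xs s)\<^sup>2) * indicator {a<..b} s) \<in> borel_measurable borel"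
proof -
  have "(\<lambda>s. ennreal ((kernel_norm xs s)\<^sup>2) * indicator {a<..b} s) =
      (\<lambda>s. ennreal ((kernel_norm xs s * indicator {0<..} s)\<^sup>2) * indicator {a<..b} s)"
    using assms by (auto simp: fun_eq_iff indicator_def)
  then show ?thesis using kernel_norm_borel[of xs] by simp
qed

lemma energy_mono: "s \<le> t \<Longrightarrow> energy s xs \<le> energy t xs"
  unfolding energy_def by (intro nn_integral_mono mult_left_mono) (auto simp: indicator_def)

lemma kernel_norm_add: "kernel_norm (xs + ys) s \<le> kernel_norm xs s + kernel_norm ys s"
  unfolding kernel_norm_def
  using norm_triangle_ineq[of "xs o\<^sub>L SQ s" "ys o\<^sub>L SQ s"]
  by (simp add: bounded_bilinear.add_left[OF bounded_bilinear_blinfun_compose])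

lemma energy_add: "energy t (xs + ys) \<le> 2 * energy t xs + 2 * energy t ys"
proof -
  have "energy t (xs + ys) \<le> (\<integral>\<^sup>+s. 2 * (ennreal ((kernel_norm xs s)\<^sup>2) * indicator {0<..t} s) +
      2 * (ennreal ((kernel_norm ys s)\<^sup>2) * indicator {0<..t} s) \<partial>lborel)"
    unfolding energy_def
  proof (rule nn_integral_mono)
    fix s
    have "(kernel_norm (xs + ys) s)\<^sup>2 \<le> (kernel_norm xs s + kernel_norm ys s)\<^sup>2"
      by (intro power_mono kernel_norm_add) simp
    also have "\<dots> \<le> 2 * (kernel_norm xs s)\<^sup>2 + 2 * (kernel_norm ys s)\<^sup>2"
      using zero_le_power2[of "kernel_norm xs s - kernel_norm ys s"] by (simp add: power2_eq_square algebra_simps)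
    finally have "ennreal ((kernel_norm (xs + ys) s)\<^sup>2) \<le> ennreal (2 * (kernel_norm xs s)\<^sup>2 + 2 * (kernel_norm ys s)\<^sup>2)"
      by (rule ennreal_leI)
    also have "\<dots> = 2 * ennreal ((kernel_norm xs s)\<^sup>2) + 2 * ennreal ((kernel_norm ys s)\<^sup>2)"
      by (simp add: ennreal_plus ennreal_mult)
    finally show "ennreal ((kernel_norm (xs + ys) s)\<^sup>2) * indicator {0<..t} s \<le>
      2 * (ennreal ((kernel_norm xs s)\<^sup>2) * indicator {0<..t} s) + 2 * (ennreal ((kernel_norm ys s)\<^sup>2) * indicator {0<..t} s)"
      by (auto simp: indicator_def)
  qed
  also have "\<dots> = 2 * energy t xs + 2 * energy t ys"
  proof -
    have m: "(\<lambda>s. ennreal ((kernel_norm xs s)\<^sup>2) * indicator {0<..t} s) \<in> borel_measurable lborel" for xs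
      using kernel_norm_restrict_borel[of 0] by simp
    then have m2: "(\<lambda>s. 2 * (ennreal ((kernel_norm xs s)\<^sup>2) * indicator {0<..t} s)) \<in> borel_measurable lborel" for xs
      by (rule borel_measurable_times_ennreal[OF borel_measurable_const])
    show ?thesis unfolding energy_def by (simp only: nn_integral_add[OF m2 m2] nn_integral_cmult[OF m])
  qed
  finally show ?thesis .
qed

lemma energy_scale: "energy t (c *\<^sub>R xs) = ennreal (c\<^sup>2) * energy t xs"
proof -
  have "kernel_norm (c *\<^sub>R xs) s = \<bar>c\<bar> * kernel_norm xs s" for s
    by (simp add: kernel_norm_def bounded_bilinear.scaleR_left[OF bounded_bilinear_blinfun_compose])
  then show ?thesis
    unfolding energy_def
    by (simp add: power_mult_distrib ennreal_mult mult.assoc nn_integral_cmult kernel_norm_restrict_borel)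
qed

text \<open>The later part of the energy is seen through \<open>xs o\<^sub>L S a\<close>, on which
  the decay of the semigroup acts.\<close>

lemma energy_split:
  assumes "0 \<le> a" "0 \<le> b"
  shows "energy (a + b) xs = energy a xs + energy b (xs o\<^sub>L S a)"
proof -
  have "energy (a + b) xs = (\<integral>\<^sup>+s. ennreal ((kernel_norm xs s)\<^sup>2) * indicator {0<..a} s +
      ennreal ((kernel_norm xs s)\<^sup>2) * indicator {a<..a + b} s \<partial>lborel)"
    unfolding energy_def using assms by (intro nn_integral_cong) (auto simp: indicator_def)
  also have "\<dots> = energy a xs + (\<integral>\<^sup>+s. ennreal ((kernel_norm xs s)\<^sup>2) * indicator {a<..a + b} s \<partial>lborel)"
    unfolding energy_def using assms by (intro nn_integral_add) (auto simp: kernel_norm_restrict_borel)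
  also have "(\<integral>\<^sup>+s. ennreal ((kernel_norm xs s)\<^sup>2) * indicator {a<..a + b} s \<partial>lborel) =
      (\<integral>\<^sup>+s. ennreal ((kernel_norm xs (a + 1 * s))\<^sup>2) * indicator {a<..a + b} (a + 1 * s) \<partial>lborel)"
    using assms by (subst nn_integral_real_affine[of _ 1 a]) (auto simp: kernel_norm_restrict_borel)
  also have "\<dots> = energy b (xs o\<^sub>L S a)"
    unfolding energy_def
  proof (rule nn_integral_cong)
    fix s :: real
    have "kernel_norm xs (a + s) = kernel_norm (xs o\<^sub>L S a) s" if "s > 0"
    proof -
      have "SQ (a + s) = S a o\<^sub>L SQ s"
        using noise that assms by (simp add: smoothed_noise_operator_def)
      then have "xs o\<^sub>L SQ (a + s) = (xs o\<^sub>L S a) o\<^sub>L SQ s" by (intro blinfun_eqI) simp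
      then show ?thesis by (simp add: kernel_norm_def)
    qed
    then show "ennreal ((kernel_norm xs (a + 1 * s))\<^sup>2) * indicator {a<..a + b} (a + 1 * s) =
      ennreal ((kernel_norm (xs o\<^sub>L S a) s)\<^sup>2) * indicator {0<..b} s"
      by (auto simp: indicator_def)
  qed
  finally show ?thesis .
qed

text \<open>Parseval bounds the integrand by a supremum of partial sums, monotone convergence moves
  the supremum outside the integral, and each partial sum is part of the second moment of
  \<open>xs (Z w)\<close>.\<close>

lemma energy_le_variance:
  assumes P: "prob_space P" and W: "cylindrical_wiener P K e \<beta>"
    and Z: "is_stochastic_convolution P K e \<beta> SQ t Z"
  shows "energy t xs \<le> (\<integral>\<^sup>+w. ennreal ((blinfun_apply xs (Z w))\<^sup>2) \<partial>P)"
proof -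
  interpret prob_space P by (rule P)
  have ons: "complete_orthonormal_system K e" using W by (simp add: cylindrical_wiener_def)
  let ?g = "\<lambda>k s. ennreal ((blinfun_apply xs (SQ s (e k)))\<^sup>2) * indicator {0<..t} s"
  let ?V = "\<integral>\<^sup>+w. ennreal ((blinfun_apply xs (Z w))\<^sup>2) \<partial>P"
  have meas: "?g k \<in> borel_measurable borel" for k
  proof -
    have "(\<lambda>s. indicator {0<..} s *\<^sub>R blinfun_apply xs (SQ s (e k))) \<in> borel_measurable borel"
      by (intro borel_measurable_continuous_on_indicator) (auto intro!: continuous_intros SQ_cont)
    moreover have "?g k = (\<lambda>s. ennreal ((indicator {0<..} s *\<^sub>R blinfun_apply xs (SQ s (e k)))\<^sup>2) * indicator {0<..t} s)"
      by (auto simp: indicator_def)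
    ultimately show ?thesis by simp
  qed
  \<comment> \<open>After reflection the left integrand vanishes at \<open>s = t\<close>, where
    \<open>SQ 0\<close> would enter, while the right one is taken over the closed interval; an
    inequality avoids comparing them at that point.\<close>
  have refl: "(\<integral>\<^sup>+s. ?g k s \<partial>lborel) \<le> (\<integral>\<^sup>+s. ennreal ((blinfun_apply xs (SQ (t - s) (e k)))\<^sup>2) \<partial>lebesgue_on {0..t})" for k
  proof -
    have "(\<integral>\<^sup>+s. ?g k s \<partial>lborel) = (\<integral>\<^sup>+s. ?g k (t + (-1) * s) \<partial>lborel)"
      using meas by (subst nn_integral_real_affine[of _ "-1" t]) auto
    also have "\<dots> = (\<integral>\<^sup>+s. ?g k (t + (-1) * s) \<partial>lebesgue)"
      by (simp add: nn_integral_completion)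
    also have "\<dots> \<le> (\<integral>\<^sup>+s. ennreal ((blinfun_apply xs (SQ (t - s) (e k)))\<^sup>2) * indicator {0..t} s \<partial>lebesgue)"
      by (intro nn_integral_mono) (auto simp: indicator_def)
    also have "\<dots> = (\<integral>\<^sup>+s. ennreal ((blinfun_apply xs (SQ (t - s) (e k)))\<^sup>2) \<partial>lebesgue_on {0..t})"
      by (simp add: nn_integral_restrict_space)
    finally show ?thesis .
  qed
  have "energy t xs \<le> (\<integral>\<^sup>+s. (SUP N. \<Sum>k\<in>K \<inter> {..<N}. ?g k s) \<partial>lborel)"
    unfolding energy_def
  proof (rule nn_integral_mono)
    fix s :: real
    show "ennreal ((kernel_norm xs s)\<^sup>2) * indicator {0<..t} s \<le> (SUP N. \<Sum>k\<in>K \<inter> {..<N}. ?g k s)"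
    proof (cases "s \<in> {0<..t}")
      case True
      have "ennreal ((kernel_norm xs s)\<^sup>2) \<le> (SUP N. ennreal (\<Sum>k\<in>K \<inter> {..<N}. (blinfun_apply xs (SQ s (e k)))\<^sup>2))"
        using complete_orthonormal_norm_le_SUP[OF ons, of "xs o\<^sub>L SQ s"] by (simp add: kernel_norm_def)
      also have "(\<lambda>N. ennreal (\<Sum>k\<in>K \<inter> {..<N}. (blinfun_apply xs (SQ s (e k)))\<^sup>2)) = (\<lambda>N. \<Sum>k\<in>K \<inter> {..<N}. ?g k s)"
        using True by (simp add: sum_ennreal)
      finally show ?thesis using True by (simp only: indicator_simps mult_1_right)
    qed simp
  qed
  also have "\<dots> = (SUP N. \<integral>\<^sup>+s. (\<Sum>k\<in>K \<inter> {..<N}. ?g k s) \<partial>lborel)"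
  proof (rule nn_integral_monotone_convergence_SUP)
    show "incseq (\<lambda>N s. \<Sum>k\<in>K \<inter> {..<N}. ?g k s)"
      by (intro monoI le_funI sum_mono2) auto
    show "(\<lambda>s. \<Sum>k\<in>K \<inter> {..<N}. ?g k s) \<in> borel_measurable lborel" for N
      using meas by (intro borel_measurable_sum) simp
  qed
  also have "\<dots> \<le> ?V"
  proof (rule SUP_least)
    fix N
    have "(\<integral>\<^sup>+s. (\<Sum>k\<in>K \<inter> {..<N}. ?g k s) \<partial>lborel) = (\<Sum>k\<in>K \<inter> {..<N}. \<integral>\<^sup>+s. ?g k s \<partial>lborel)"
      using meas by (intro nn_integral_sum) simp
    also have "\<dots> \<le> (\<Sum>k\<in>K \<inter> {..<N}. \<integral>\<^sup>+s. ennreal ((blinfun_apply xs (SQ (t - s) (e k)))\<^sup>2) \<partial>lebesgue_on {0..t})"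
      by (intro sum_mono refl)
    also have "\<dots> \<le> ?V" by (rule stochastic_convolution_variance(2)[OF W Z])
    finally show "(\<integral>\<^sup>+s. (\<Sum>k\<in>K \<inter> {..<N}. ?g k s) \<partial>lborel) \<le> ?V" .
  qed
  finally show ?thesis .
qed

lemma energy_finite:
  assumes P: "prob_space P" and W: "cylindrical_wiener P K e \<beta>"
    and Z: "is_stochastic_convolution P K e \<beta> SQ t Z"
  shows "energy t xs < \<infinity>"
proof -
  interpret prob_space P by (rule P)
  have "(\<integral>\<^sup>+w. ennreal ((blinfun_apply xs (Z w))\<^sup>2) \<partial>P) < \<infinity>"
    using stochastic_convolution_variance(1)[OF W Z, of xs] by (simp add: integrable_iff_bounded)
  then show ?thesis using energy_le_variance[OF P W Z, of xs] by (rule le_less_trans[rotated])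
qed

text \<open>An almost surely separably valued variable lies with probability above 3/4 in finitely
  many small balls. Functionals that nearly agree at the centres nearly agree on \<open>Z\<close> on
  this event, and for Gaussian variables smallness with probability 3/4 is already smallness in mean
  square, hence in energy.\<close>

lemma energy_totally_bounded:
  assumes P: "prob_space P" and W: "cylindrical_wiener P K e \<beta>"
    and Z: "is_stochastic_convolution P K e \<beta> SQ t Z" and G: "gaussian_random_variable P Z" and \<epsilon>: "\<epsilon> > 0"
  obtains X where "finite X" "X \<subseteq> cball 0 1" "\<And>xs. norm xs \<le> 1 \<Longrightarrow> \<exists>ys\<in>X. energy t (xs - ys) \<le> ennreal \<epsilon>"
proof -
  interpret prob_space P by (rule P)
  have [measurable]: "Z \<in> borel_measurable P" using G by (simp add: gaussian_random_variable_def)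
  obtain C where C: "countable C" "AE w in P. Z w \<in> closure C"
    using G unfolding gaussian_random_variable_def by blast
  \<comment> \<open>On the event the difference is at most \<open>3 * \<eta>\<close>: radius
    \<open>\<eta>\<close> times \<open>norm (xs - ys) \<le> 2\<close>, plus \<open>\<eta>\<close> at
    the centre. The constant 58 is that of \<open>gaussian_small_second_moment\<close>.\<close>
  define \<eta> where "\<eta> = sqrt (\<epsilon> / 58) / 3"
  have \<eta>: "\<eta> > 0" "58 * (3 * \<eta>)\<^sup>2 = \<epsilon>" using \<epsilon> by (auto simp: \<eta>_def)
  have "C \<noteq> {}"
  proof
    assume "C = {}"
    then have "AE w in P. False" using C(2) by simp
    then show False by (simp add: AE_False emeasure_space_1)
  qed
  define c where "c = from_nat_into C"
  have c: "range c = C" using C \<open>C \<noteq> {}\<close> by (simp add: c_def range_from_nat_into)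
  define A where "A n = {w \<in> space P. \<exists>i<n. dist (Z w) (c i) < \<eta>}" for n
  have A [measurable]: "A n \<in> sets P" for n
  proof -
    have "A n = Z -` (\<Union>i\<in>{..<n}. ball (c i) \<eta>) \<inter> space P"
      by (auto simp: A_def dist_commute)
    moreover have "(\<Union>i\<in>{..<n}. ball (c i) \<eta>) \<in> sets borel" by (intro borel_open open_UN) auto
    ultimately show ?thesis using measurable_sets[OF \<open>Z \<in> borel_measurable P\<close>] by metis
  qed
  have inc: "incseq A" by (auto simp: A_def incseq_def) (meson less_le_trans)
  have "AE w in P. w \<in> (\<Union>n. A n)"
    using C(2) AE_space
  proof eventually_elim
    case (elim w)
    then obtain y where "y \<in> C" "dist y (Z w) < \<eta>" using \<eta>(1) by (auto simp: closure_approachable)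
    then obtain i where "dist (Z w) (c i) < \<eta>" using c by (auto simp: dist_commute)
    then show ?case using elim by (auto simp: A_def)
  qed
  then have "prob (\<Union>n. A n) = 1" by (subst prob_eq_1) auto
  moreover have "(\<lambda>n. prob (A n)) \<longlonglongrightarrow> prob (\<Union>n. A n)"
    using inc by (intro finite_Lim_measure_incseq) auto
  ultimately have "\<forall>\<^sub>F n in sequentially. prob (A n) > 3 / 4"
    by (intro order_tendstoD(1)[of _ 1]) auto
  then obtain n where n: "prob (A n) > 3 / 4" by (meson eventually_happens' sequentially_bot)
  have bd: "\<exists>b. \<forall>xs\<in>cball 0 1. \<bar>blinfun_apply (xs :: 'e \<Rightarrow>\<^sub>L real) (c i)\<bar> \<le> b" if "i \<in> {..<n}" for i
  proof (intro exI ballI)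
    fix xs :: "'e \<Rightarrow>\<^sub>L real" assume "xs \<in> cball 0 1"
    then have "norm xs * norm (c i) \<le> 1 * norm (c i)" by (intro mult_right_mono) auto
    then show "\<bar>blinfun_apply xs (c i)\<bar> \<le> norm (c i)" using norm_blinfun[of xs "c i"] by simp
  qed
  obtain X :: "('e \<Rightarrow>\<^sub>L real) set" where X: "finite X" "X \<subseteq> cball 0 1"
    "\<And>xs. xs \<in> cball 0 1 \<Longrightarrow> \<exists>ys\<in>X. \<forall>i\<in>{..<n}. \<bar>blinfun_apply xs (c i) - blinfun_apply ys (c i)\<bar> < \<eta>"
    by (rule finite_family_net[of "{..<n}" "cball 0 1" "\<lambda>i xs. blinfun_apply xs (c i)" \<eta>, OF finite_lessThan bd \<eta>(1)])
       (assumption, rule that)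
  show ?thesis
  proof (rule that[OF X(1,2)])
    fix xs :: "'e \<Rightarrow>\<^sub>L real" assume xs: "norm xs \<le> 1"
    then obtain ys where ys: "ys \<in> X" "\<And>i. i < n \<Longrightarrow> \<bar>blinfun_apply xs (c i) - blinfun_apply ys (c i)\<bar> < \<eta>"
      using X(3)[of xs] by auto
    have ys1: "norm ys \<le> 1" using X(2) ys(1) by auto
    let ?D = "\<lambda>w. blinfun_apply (xs - ys) (Z w)"
    have gD: "gaussian_real P ?D" using G by (simp add: gaussian_random_variable_def)
    then have [measurable]: "?D \<in> borel_measurable P" by (simp add: gaussian_real_def)
    have "A n \<subseteq> {w \<in> space P. \<bar>?D w\<bar> \<le> 3 * \<eta>}"
    proof
      fix w assume "w \<in> A n"
      then obtain i where i: "i < n" "dist (Z w) (c i) < \<eta>" and w: "w \<in> space P" by (auto simp: A_def)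
      have "norm (xs - ys) \<le> 2" using norm_triangle_ineq4[of xs ys] xs ys1 by linarith
      then have "norm (xs - ys) * norm (Z w - c i) \<le> 2 * \<eta>"
        using i(2) by (intro mult_mono) (auto simp: dist_norm)
      then have "\<bar>blinfun_apply (xs - ys) (Z w - c i)\<bar> \<le> 2 * \<eta>"
        using norm_blinfun[of "xs - ys" "Z w - c i"] by simp
      moreover have "?D w = blinfun_apply (xs - ys) (Z w - c i) + (blinfun_apply xs (c i) - blinfun_apply ys (c i))"
        by (simp add: blinfun.diff_right blinfun.diff_left)
      ultimately have "\<bar>?D w\<bar> \<le> 3 * \<eta>" using ys(2)[OF i(1)] by linarith
      then show "w \<in> {w \<in> space P. \<bar>?D w\<bar> \<le> 3 * \<eta>}" using w by simp
    qed
    then have "prob (A n) \<le> prob {w \<in> space P. \<bar>?D w\<bar> \<le> 3 * \<eta>}"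
      by (intro finite_measure_mono) auto
    then have "(\<integral>\<^sup>+w. ennreal ((?D w)\<^sup>2) \<partial>P) \<le> ennreal (58 * (3 * \<eta>)\<^sup>2)"
      using n \<eta>(1) by (intro gaussian_small_second_moment[OF gD]) auto
    then have "energy t (xs - ys) \<le> ennreal \<epsilon>"
      using energy_le_variance[OF P W Z, of "xs - ys"] unfolding \<eta>(2) by (rule order_trans[rotated])
    then show "\<exists>ys\<in>X. energy t (xs - ys) \<le> ennreal \<epsilon>" using ys(1) by blast
  qed
qed

end

section \<open>Lebesgue integrals over subintervals\<close>

lemma integrable_lebesgue_on_subinterval:
  fixes f :: "real \<Rightarrow> 'b::{banach, second_countable_topology}"
  assumes "integrable (lebesgue_on {a..b}) f" "a \<le> c" "d \<le> b"
  shows "integrable (lebesgue_on {c..d}) f"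
proof -
  have "set_integrable lebesgue {a..b} f"
    using assms(1) by (simp add: integrable_restrict_space set_integrable_def)
  then have "set_integrable lebesgue {c..d} f"
    by (rule set_integrable_subset) (use assms in auto)
  then show ?thesis by (simp add: integrable_restrict_space set_integrable_def)
qed

lemma integral_lebesgue_on_combine:
  fixes f :: "real \<Rightarrow> real"
  assumes f: "integrable (lebesgue_on {a..b}) f" and c: "a \<le> c" "c \<le> b"
  shows "(LINT s|lebesgue_on {a..b}. f s) = (LINT s|lebesgue_on {a..c}. f s) + (LINT s|lebesgue_on {c..b}. f s)"
proof -
  have i: "integrable (lebesgue_on {a..c}) f" "integrable (lebesgue_on {c..b}) f"
    using c by (auto intro: integrable_lebesgue_on_subinterval[OF f])
  have "f integrable_on {a..b}" using f by (intro integrable_on_lebesgue_on) auto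
  then show ?thesis
    using f i c by (simp add: lebesgue_integral_eq_integral Henstock_Kurzweil_Integration.integral_combine)
qed

lemma continuous_on_integral_lebesgue_on:
  fixes f :: "real \<Rightarrow> real"
  assumes f: "integrable (lebesgue_on {a..b}) f"
  shows "continuous_on {a..b} (\<lambda>t. LINT s|lebesgue_on {a..t}. f s)"
proof -
  have "continuous_on {a..b} (\<lambda>t. integral {a..t} f)"
    using f by (intro indefinite_integral_continuous_1 integrable_on_lebesgue_on) auto
  moreover have "integral {a..t} f = (LINT s|lebesgue_on {a..t}. f s)" if "t \<in> {a..b}" for t
    using that integrable_lebesgue_on_subinterval[OF f, of a t] by (simp add: lebesgue_integral_eq_integral)
  ultimately show ?thesis by (rule continuous_on_eq)
qed

section \<open>Duality bounds for weak integrals\<close>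

context noise_semigroup begin

text \<open>By duality \<open>reach T C\<close> contains every weak integral \<open>\<integral>\<^sub>0\<^sup>T S(T - s) Q u(s) ds\<close> with
  \<open>u\<close> of \<open>L\<^sup>2\<close>-norm at most \<open>C\<close>.\<close>

definition reach :: "real \<Rightarrow> real \<Rightarrow> 'e set" where
  "reach T C = {y. \<forall>xs. ennreal ((blinfun_apply xs y)\<^sup>2) \<le> ennreal (C\<^sup>2) * energy T xs}"

lemma reach_mono:
  assumes "y \<in> reach s C" "s \<le> t" "0 \<le> C" "C \<le> C'"
  shows "y \<in> reach t C'"
  unfolding reach_def
proof (intro CollectI allI)
  fix xs
  have "ennreal ((blinfun_apply xs y)\<^sup>2) \<le> ennreal (C\<^sup>2) * energy s xs" using assms(1) by (simp add: reach_def)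
  also have "\<dots> \<le> ennreal (C'\<^sup>2) * energy t xs"
    using assms by (intro mult_mono ennreal_leI power_mono energy_mono) auto
  finally show "ennreal ((blinfun_apply xs y)\<^sup>2) \<le> ennreal (C'\<^sup>2) * energy t xs" .
qed

text \<open>The cut-off \<open>{..<t}\<close> removes the time \<open>s = t\<close>, where
  \<open>SQ 0\<close> would enter; the value of the integral is not affected.\<close>

lemma kernel_reflect:
  assumes "a \<le> t"
  defines "k \<equiv> \<lambda>xs s. ennreal (kernel_norm xs (t - s) * indicator {..<t} s)"
  shows "k xs \<in> borel_measurable (lebesgue_on {a..t})"
    "(\<integral>\<^sup>+s. (k xs s)\<^sup>2 \<partial>lebesgue_on {a..t}) = energy (t - a) xs"
proof -
  have "(\<lambda>s. kernel_norm xs (t - s) * indicator {0<..} (t - s)) \<in> borel_measurable borel"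
    using measurable_compose[OF _ kernel_norm_borel[of xs], of "\<lambda>s. t - s" borel] by simp
  moreover have "(\<lambda>s. kernel_norm xs (t - s) * indicator {0<..} (t - s)) = (\<lambda>s. kernel_norm xs (t - s) * indicator {..<t} s)"
    by (auto simp: indicator_def)
  ultimately have m: "(\<lambda>s. kernel_norm xs (t - s) * indicator {..<t} s) \<in> borel_measurable borel" by simp
  then have kb: "k xs \<in> borel_measurable borel" unfolding k_def by simp
  then have "k xs \<in> borel_measurable lebesgue" by (simp add: measurable_completion)
  then show "k xs \<in> borel_measurable (lebesgue_on {a..t})" by (rule measurable_restrict_space1)
  let ?g = "\<lambda>s. ennreal ((kernel_norm xs s)\<^sup>2) * indicator {0<..t - a} s"
  have "energy (t - a) xs = (\<integral>\<^sup>+s. ?g (t + (-1) * s) \<partial>lborel)"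
    unfolding energy_def using kernel_norm_restrict_borel[of 0]
    by (subst nn_integral_real_affine[of _ "-1" t]) auto
  also have "\<dots> = (\<integral>\<^sup>+s. (k xs s)\<^sup>2 * indicator {a..t} s \<partial>lborel)"
    by (intro nn_integral_cong) (auto simp: k_def indicator_def power2_eq_square ennreal_mult)
  also have "\<dots> = (\<integral>\<^sup>+s. (k xs s)\<^sup>2 * indicator {a..t} s \<partial>lebesgue)"
    by (simp add: nn_integral_completion)
  also have "\<dots> = (\<integral>\<^sup>+s. (k xs s)\<^sup>2 \<partial>lebesgue_on {a..t})"
    by (simp add: nn_integral_restrict_space)
  finally show "(\<integral>\<^sup>+s. (k xs s)\<^sup>2 \<partial>lebesgue_on {a..t}) = energy (t - a) xs" by simp
qed

lemma AE_lebesgue_on_neq: "AE s in lebesgue_on {a..t}. s \<noteq> (c::real)"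
proof -
  have "AE s in lebesgue. s \<notin> {c}" by (rule AE_not_in) simp
  then show ?thesis by (auto simp: AE_restrict_space_iff elim: eventually_mono)
qed

text \<open>The bound is expressed through a measurable majorant \<open>v\<close> of
  \<open>norm (u s)\<close>, because in the application \<open>u\<close> involves \<open>B\<close>
  along the path, while \<open>v\<close> is an explicit product.\<close>

lemma kernel_Cauchy_Schwarz:
  fixes u :: "real \<Rightarrow> 'h"
  assumes at: "a \<le> t" and v: "v \<in> borel_measurable (lebesgue_on {a..t})"
    and uv: "\<And>s. s \<in> {a..t} \<Longrightarrow> norm (u s) \<le> v s"
  shows "(\<integral>\<^sup>+s. ennreal \<bar>blinfun_apply xs (SQ (t - s) (u s))\<bar> \<partial>lebesgue_on {a..t})\<^sup>2 \<le>
    energy (t - a) xs * (\<integral>\<^sup>+s. ennreal ((v s)\<^sup>2) \<partial>lebesgue_on {a..t})"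
proof -
  let ?k = "\<lambda>s. ennreal (kernel_norm xs (t - s) * indicator {..<t} s)"
  have v0: "v s \<ge> 0" if "s \<in> {a..t}" for s using uv[OF that] norm_ge_zero[of "u s"] by linarith
  have "(\<integral>\<^sup>+s. ennreal \<bar>blinfun_apply xs (SQ (t - s) (u s))\<bar> \<partial>lebesgue_on {a..t}) \<le>
      (\<integral>\<^sup>+s. ?k s * ennreal (v s) \<partial>lebesgue_on {a..t})"
  proof (rule nn_integral_mono_AE)
    show "AE s in lebesgue_on {a..t}. ennreal \<bar>blinfun_apply xs (SQ (t - s) (u s))\<bar> \<le> ?k s * ennreal (v s)"
      using AE_lebesgue_on_neq[where a = a and t = t and c = t] AE_space
    proof eventually_elim
      case (elim s)
      have s: "s < t" "s \<in> {a..t}" using elim by auto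
      have "\<bar>blinfun_apply xs (SQ (t - s) (u s))\<bar> \<le> kernel_norm xs (t - s) * norm (u s)" by (rule kernel_norm_bound)
      also have "\<dots> \<le> kernel_norm xs (t - s) * v s" using uv[OF s(2)] by (intro mult_left_mono) auto
      finally have "ennreal \<bar>blinfun_apply xs (SQ (t - s) (u s))\<bar> \<le> ennreal (kernel_norm xs (t - s) * v s)"
        by (rule ennreal_leI)
      then show ?case using s v0[OF s(2)] by (simp add: ennreal_mult)
    qed
  qed
  then have "(\<integral>\<^sup>+s. ennreal \<bar>blinfun_apply xs (SQ (t - s) (u s))\<bar> \<partial>lebesgue_on {a..t})\<^sup>2 \<le>
      (\<integral>\<^sup>+s. ?k s * ennreal (v s) \<partial>lebesgue_on {a..t})\<^sup>2" by (rule power_mono) simp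
  also have "\<dots> \<le> (\<integral>\<^sup>+s. (?k s)\<^sup>2 \<partial>lebesgue_on {a..t}) * (\<integral>\<^sup>+s. (ennreal (v s))\<^sup>2 \<partial>lebesgue_on {a..t})"
    using kernel_reflect(1)[OF at] v by (intro Cauchy_Schwarz_nn_integral) auto
  also have "(\<integral>\<^sup>+s. (ennreal (v s))\<^sup>2 \<partial>lebesgue_on {a..t}) = (\<integral>\<^sup>+s. ennreal ((v s)\<^sup>2) \<partial>lebesgue_on {a..t})"
    using v0 by (intro nn_integral_cong) (auto simp: ennreal_power)
  finally show ?thesis unfolding kernel_reflect(2)[OF at] .
qed

lemma weak_integral_reach:
  fixes u :: "real \<Rightarrow> 'h"
  assumes at: "a \<le> t" and w: "has_weak_integral (lebesgue_on {a..t}) (\<lambda>s. SQ (t - s) (u s)) y"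
    and v: "v \<in> borel_measurable (lebesgue_on {a..t})" and uv: "\<And>s. s \<in> {a..t} \<Longrightarrow> norm (u s) \<le> v s"
    and C: "(\<integral>\<^sup>+s. ennreal ((v s)\<^sup>2) \<partial>lebesgue_on {a..t}) \<le> ennreal (C\<^sup>2)"
  shows "y \<in> reach (t - a) C"
  unfolding reach_def
proof (intro CollectI allI)
  fix xs :: "'e \<Rightarrow>\<^sub>L real"
  let ?f = "\<lambda>s. blinfun_apply xs (SQ (t - s) (u s))"
  have f: "integrable (lebesgue_on {a..t}) ?f" "(LINT s|lebesgue_on {a..t}. ?f s) = blinfun_apply xs y"
    using w by (auto simp: has_weak_integral_def)
  have "ennreal \<bar>blinfun_apply xs y\<bar> \<le> (\<integral>\<^sup>+s. ennreal \<bar>?f s\<bar> \<partial>lebesgue_on {a..t})"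
    using integral_norm_bound_ennreal[OF f(1)] f(2) by simp
  then have "(ennreal \<bar>blinfun_apply xs y\<bar>)\<^sup>2 \<le> (\<integral>\<^sup>+s. ennreal \<bar>?f s\<bar> \<partial>lebesgue_on {a..t})\<^sup>2"
    by (rule power_mono) simp
  also have "\<dots> \<le> energy (t - a) xs * (\<integral>\<^sup>+s. ennreal ((v s)\<^sup>2) \<partial>lebesgue_on {a..t})"
    by (rule kernel_Cauchy_Schwarz[OF at v uv])
  also have "\<dots> \<le> energy (t - a) xs * ennreal (C\<^sup>2)" by (rule mult_left_mono[OF C]) simp
  finally show "ennreal ((blinfun_apply xs y)\<^sup>2) \<le> ennreal (C\<^sup>2) * energy (t - a) xs"
    by (simp add: ennreal_power mult.commute)
qed

text \<open>Testing the integral up to \<open>a\<close> with \<open>xs o\<^sub>L S (t - a)\<close>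
  gives the integrand of the integral up to \<open>t\<close>, since \<open>S (t - a)\<close> carries
  \<open>SQ (a - s)\<close> to \<open>SQ (t - s)\<close> for \<open>s < a\<close>; the time
  \<open>s = a\<close> is a null set.\<close>

lemma weak_integral_flow:
  fixes u :: "real \<Rightarrow> 'h"
  assumes a: "0 \<le> a" "a \<le> t"
    and wt: "has_weak_integral (lebesgue_on {0..t}) (\<lambda>s. SQ (t - s) (u s)) yt"
    and wa: "has_weak_integral (lebesgue_on {0..a}) (\<lambda>s. SQ (a - s) (u s)) ya"
  shows "has_weak_integral (lebesgue_on {a..t}) (\<lambda>s. SQ (t - s) (u s)) (yt - S (t - a) ya)"
  unfolding has_weak_integral_def
proof
  fix xs :: "'e \<Rightarrow>\<^sub>L real"
  let ?f = "\<lambda>s. blinfun_apply xs (SQ (t - s) (u s))"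
  have f: "integrable (lebesgue_on {0..t}) ?f" "(LINT s|lebesgue_on {0..t}. ?f s) = blinfun_apply xs yt"
    using wt by (auto simp: has_weak_integral_def)
  have "(LINT s|lebesgue_on {0..a}. ?f s) = (LINT s|lebesgue_on {0..a}. blinfun_apply (xs o\<^sub>L S (t - a)) (SQ (a - s) (u s)))"
  proof (rule integral_cong_AE)
    have fa: "integrable (lebesgue_on {0..a}) ?f" using a by (intro integrable_lebesgue_on_subinterval[OF f(1)]) auto
    then show "?f \<in> borel_measurable (lebesgue_on {0..a})" by simp
    have "integrable (lebesgue_on {0..a}) (\<lambda>s. blinfun_apply (xs o\<^sub>L S (t - a)) (SQ (a - s) (u s)))"
      using wa unfolding has_weak_integral_def by blast
    then show "(\<lambda>s. blinfun_apply (xs o\<^sub>L S (t - a)) (SQ (a - s) (u s))) \<in> borel_measurable (lebesgue_on {0..a})" by simp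
    show "AE s in lebesgue_on {0..a}. ?f s = blinfun_apply (xs o\<^sub>L S (t - a)) (SQ (a - s) (u s))"
      using AE_lebesgue_on_neq[where a = 0 and t = a and c = a] AE_space
    proof eventually_elim
      case (elim s)
      then show ?case using SQ_add[of "t - a" "a - s" "u s"] a by simp
    qed
  qed
  also have "\<dots> = blinfun_apply xs (S (t - a) ya)"
    using wa[unfolded has_weak_integral_def, rule_format, of "xs o\<^sub>L S (t - a)"] by simp
  finally show "integrable (lebesgue_on {a..t}) ?f \<and> (LINT s|lebesgue_on {a..t}. ?f s) = blinfun_apply xs (yt - S (t - a) ya)"
    using integral_lebesgue_on_combine[OF f(1) a] f a integrable_lebesgue_on_subinterval[OF f(1), of a t]
    by (simp add: blinfun.diff_right)
qed

end

section \<open>Controlled paths and their noise parts\<close>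

text \<open>The conditions \<open>energy_fin\<close> and \<open>energy_net\<close> carry all that
  the probabilistic hypotheses contribute; from here on the argument is deterministic.\<close>

locale controlled_system = dissipative_system S M \<omega> D A F lam \<kappa>' lam' m + noise_semigroup S M \<omega> SQ
  for S :: "real \<Rightarrow> 'e::banach \<Rightarrow>\<^sub>L 'e" and M \<omega> :: real and D :: "'e set" and A F :: "'e \<Rightarrow> 'e"
    and lam \<kappa>' lam' :: real and m :: nat
    and SQ :: "real \<Rightarrow> 'h::{real_inner, banach, second_countable_topology} \<Rightarrow>\<^sub>L 'e" +
  fixes B :: "'e \<Rightarrow> 'h \<Rightarrow>\<^sub>L 'h" and \<kappa> :: real
  assumes \<kappa>: "\<kappa> > 0"
    and B_lipschitz: "\<And>x y h. norm ((B x - B y) h) \<le> \<kappa> * norm (x - y) * norm h"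
    and B_growth: "\<And>x h. norm (B x h) \<le> \<kappa> * (1 + norm x) * norm h"
    and energy_fin: "\<And>t xs. t > 0 \<Longrightarrow> energy t xs < \<infinity>"
    and energy_net: "\<And>t \<epsilon>. t > 0 \<Longrightarrow> \<epsilon> > 0 \<Longrightarrow> \<exists>X. finite X \<and> X \<subseteq> cball 0 1 \<and>
      (\<forall>xs. norm xs \<le> 1 \<longrightarrow> (\<exists>ys\<in>X. energy t (xs - ys) \<le> ennreal \<epsilon>))"
begin

section \<open>Uniform bounds for the energy and compactness of reachable sets\<close>

lemma energy_le_net:
  assumes "energy t (xs - ys) \<le> ennreal \<epsilon>"
  shows "energy t xs \<le> 2 * ennreal \<epsilon> + 2 * energy t ys"
proof -
  have "energy t xs \<le> 2 * energy t (xs - ys) + 2 * energy t ys"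
    using energy_add[of t "xs - ys" ys] by simp
  also have "\<dots> \<le> 2 * ennreal \<epsilon> + 2 * energy t ys" using assms by (intro add_mono mult_left_mono) auto
  finally show ?thesis .
qed

lemma energy_homogeneous:
  assumes "\<And>xs. norm xs \<le> 1 \<Longrightarrow> energy t xs \<le> ennreal c" and "c \<ge> 0"
  shows "energy t xs \<le> ennreal (c * (norm xs)\<^sup>2)"
proof (cases "xs = 0")
  case True
  then show ?thesis using energy_scale[of t 0 0] by simp
next
  case False
  have "energy t xs = energy t (norm xs *\<^sub>R ((1 / norm xs) *\<^sub>R xs))" using False by simp
  also have "\<dots> = ennreal ((norm xs)\<^sup>2) * energy t ((1 / norm xs) *\<^sub>R xs)" by (rule energy_scale)
  also have "\<dots> \<le> ennreal ((norm xs)\<^sup>2) * ennreal c" using False by (intro mult_left_mono assms) auto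
  finally show ?thesis using assms(2) by (simp add: ennreal_mult[symmetric] mult.commute)
qed

text \<open>The energy is finite at each of the finitely many points of a net, and the other
  functionals of the unit ball differ from these by a bounded energy.\<close>

lemma energy_bound_one:
  obtains c where "c \<ge> 0" "\<And>xs. energy 1 xs \<le> ennreal (c * (norm xs)\<^sup>2)"
proof -
  obtain X where X: "finite X" "\<And>xs. norm xs \<le> 1 \<Longrightarrow> \<exists>ys\<in>X. energy 1 (xs - ys) \<le> ennreal 1"
    using energy_net[of 1 1] by auto
  define c where "c = 2 + 2 * (\<Sum>ys\<in>X. enn2real (energy 1 ys))"
  have "energy 1 xs \<le> ennreal c" if "norm xs \<le> 1" for xs
  proof -
    obtain ys where ys: "ys \<in> X" "energy 1 (xs - ys) \<le> ennreal 1" using X(2)[OF \<open>norm xs \<le> 1\<close>] by blast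
    have "energy 1 xs \<le> 2 * ennreal 1 + 2 * energy 1 ys" by (rule energy_le_net[OF ys(2)])
    also have "energy 1 ys = ennreal (enn2real (energy 1 ys))" using energy_fin[of 1 ys] by (simp add: less_top)
    also have "2 * ennreal 1 + 2 * ennreal (enn2real (energy 1 ys)) = ennreal (2 + 2 * enn2real (energy 1 ys))"
      by (simp add: ennreal_plus ennreal_mult)
    also have "\<dots> \<le> ennreal c"
      unfolding c_def using X(1) ys(1)
      by (intro ennreal_leI add_mono mult_left_mono member_le_sum) auto
    finally show ?thesis .
  qed
  moreover have "c \<ge> 0" unfolding c_def by (intro add_nonneg_nonneg mult_nonneg_nonneg sum_nonneg) auto
  ultimately show ?thesis using that[of c] energy_homogeneous[of 1 c] by blast
qed

text \<open>The decay of the semigroup makes the total energy finite, as it is dominated by a geometric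
  series over unit intervals.\<close>

lemma energy_bound:
  obtains C where "C \<ge> 0" "\<And>T xs. energy T xs \<le> ennreal (C\<^sup>2 * (norm xs)\<^sup>2)"
proof -
  obtain c where c: "c \<ge> 0" "\<And>xs. energy 1 xs \<le> ennreal (c * (norm xs)\<^sup>2)" using energy_bound_one by blast
  define q where "q = exp (- \<omega> * 1) ^ 2"
  have q: "0 \<le> q" "q < 1" using \<omega> by (auto simp: q_def power_less_one_iff)
  have n: "energy (real n) xs \<le> ennreal (c * M\<^sup>2 * (norm xs)\<^sup>2 * (\<Sum>i<n. q ^ i))" for n xs
  proof (induction n)
    case 0
    have "energy 0 xs = 0" by (simp add: energy_def)
    then show ?case by simp
  next
    case (Suc n)
    have "energy (real (Suc n)) xs = energy (real n) xs + energy 1 (xs o\<^sub>L S (real n))"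
      using energy_split[of "real n" 1 xs] by (simp add: add.commute)
    also have "energy 1 (xs o\<^sub>L S (real n)) \<le> ennreal (c * M\<^sup>2 * (norm xs)\<^sup>2 * q ^ n)"
    proof -
      have "norm (xs o\<^sub>L S (real n)) \<le> norm xs * (M * exp (- \<omega> * real n))"
        using norm_blinfun_compose[of xs "S (real n)"] mult_left_mono[OF decay[of "real n"], of "norm xs"] by simp
      then have "(norm (xs o\<^sub>L S (real n)))\<^sup>2 \<le> (norm xs * (M * exp (- \<omega> * real n)))\<^sup>2" by (intro power_mono) auto
      also have "\<dots> = M\<^sup>2 * (norm xs)\<^sup>2 * q ^ n"
        by (simp add: q_def power_mult_distrib exp_of_nat_mult[symmetric] power_mult[symmetric] mult.commute) 
      finally have "c * (norm (xs o\<^sub>L S (real n)))\<^sup>2 \<le> c * (M\<^sup>2 * (norm xs)\<^sup>2 * q ^ n)" using c(1) by (rule mult_left_mono)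
      then have "ennreal (c * (norm (xs o\<^sub>L S (real n)))\<^sup>2) \<le> ennreal (c * M\<^sup>2 * (norm xs)\<^sup>2 * q ^ n)"
        by (intro ennreal_leI) (simp add: mult.assoc)
      then show ?thesis using c(2)[of "xs o\<^sub>L S (real n)"] by (rule order_trans[rotated])
    qed
    also have "energy (real n) xs + ennreal (c * M\<^sup>2 * (norm xs)\<^sup>2 * q ^ n) \<le>
        ennreal (c * M\<^sup>2 * (norm xs)\<^sup>2 * (\<Sum>i<n. q ^ i)) + ennreal (c * M\<^sup>2 * (norm xs)\<^sup>2 * q ^ n)"
      by (rule add_right_mono[OF Suc.IH])
    also have "\<dots> = ennreal (c * M\<^sup>2 * (norm xs)\<^sup>2 * (\<Sum>i<Suc n. q ^ i))"
      using c(1) q by (simp add: ennreal_plus[symmetric] sum_nonneg distrib_left del: ennreal_plus)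
    finally show ?case by (meson add_left_mono order_trans)
  qed
  define C where "C = sqrt (c * M\<^sup>2 / (1 - q))"
  have C: "C\<^sup>2 = c * M\<^sup>2 / (1 - q)" "C \<ge> 0" using c(1) q by (auto simp: C_def)
  show ?thesis
  proof (rule that[OF C(2)])
    fix T :: real and xs :: "'e \<Rightarrow>\<^sub>L real"
    obtain n where "T \<le> real n" using real_arch_simple by blast
    then have "energy T xs \<le> energy (real n) xs" by (rule energy_mono)
    also note n
    also have "c * M\<^sup>2 * (norm xs)\<^sup>2 * (\<Sum>i<n. q ^ i) \<le> c * M\<^sup>2 * (norm xs)\<^sup>2 * (1 / (1 - q))"
    proof (intro mult_left_mono)
      have "(\<Sum>i<n. q ^ i) = (1 - q ^ n) / (1 - q)" using q by (subst sum_gp_strict) auto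
      also have "\<dots> \<le> 1 / (1 - q)" using q by (intro divide_right_mono) auto
      finally show "(\<Sum>i<n. q ^ i) \<le> 1 / (1 - q)" .
    qed (use c in auto)
    then have "ennreal (c * M\<^sup>2 * (norm xs)\<^sup>2 * (\<Sum>i<n. q ^ i)) \<le> ennreal (C\<^sup>2 * (norm xs)\<^sup>2)"
      unfolding C(1) by (intro ennreal_leI) (simp add: mult_ac)
    finally show "energy T xs \<le> ennreal (C\<^sup>2 * (norm xs)\<^sup>2)" .
  qed
qed

text \<open>For a single functional the energy over a short time tends to 0 by dominated
  convergence. The net for time 1 makes this uniform over the unit ball, since shortening the time
  only lowers the energy of the differences.\<close>

lemma energy_small:
  assumes "\<epsilon> > 0"
  obtains h where "h > 0" "\<And>xs. norm xs \<le> 1 \<Longrightarrow> energy h xs \<le> ennreal \<epsilon>"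
proof -
  define \<eta> where "\<eta> = \<epsilon> / 4"
  have \<eta>: "\<eta> > 0" using assms by (simp add: \<eta>_def)
  have lim: "(\<lambda>n. energy (1 / real (Suc n)) ys) \<longlonglongrightarrow> 0" for ys
  proof -
    have "(\<lambda>n. energy (1 / real (Suc n)) ys) \<longlonglongrightarrow> (\<integral>\<^sup>+(s::real). 0 \<partial>lborel)"
      unfolding energy_def
    proof (rule nn_integral_dominated_convergence[where w = "\<lambda>s. ennreal ((kernel_norm ys s)\<^sup>2) * indicator {0<..1} s"
          and u' = "\<lambda>s. 0" and u = "\<lambda>n s. ennreal ((kernel_norm ys s)\<^sup>2) * indicator {0<..1 / real (Suc n)} s"])
      let ?w = "\<lambda>s. ennreal ((kernel_norm ys s)\<^sup>2) * indicator {0<..1} s"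
      show "?w \<in> borel_measurable lborel" using kernel_norm_restrict_borel[of 0] by simp
      show "(\<integral>\<^sup>+s. ?w s \<partial>lborel) < \<infinity>" using energy_fin[of 1 ys] by (simp add: energy_def)
      show "(\<lambda>s. ennreal ((kernel_norm ys s)\<^sup>2) * indicator {0<..1 / real (Suc n)} s) \<in> borel_measurable lborel" for n
        using kernel_norm_restrict_borel[of 0] by simp
      show "AE s in lborel. ennreal ((kernel_norm ys s)\<^sup>2) * indicator {0<..1 / real (Suc n)} s \<le> ?w s" for n
      proof (rule AE_I2, rule mult_left_mono)
        fix s :: real
        have "s \<le> 1" if "s \<le> 1 / real (Suc n)"
          using that order_trans[of s "1 / real (Suc n)" 1] by simp
        then show "indicator {0<..1 / real (Suc n)} s \<le> (indicator {0<..1} s :: ennreal)"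
          by (auto simp: indicator_def simp del: of_nat_Suc)
      qed simp
      show "AE s in lborel. (\<lambda>n. ennreal ((kernel_norm ys s)\<^sup>2) * indicator {0<..1 / real (Suc n)} s) \<longlonglongrightarrow> 0"
      proof (rule AE_I2)
        fix s :: real
        show "(\<lambda>n. ennreal ((kernel_norm ys s)\<^sup>2) * indicator {0<..1 / real (Suc n)} s) \<longlonglongrightarrow> 0"
        proof (cases "s > 0")
          case True
          have "\<forall>\<^sub>F n in sequentially. 1 / real (Suc n) < s"
            using True by (intro order_tendstoD(2)[OF LIMSEQ_Suc[OF lim_1_over_n]])
          then have "\<forall>\<^sub>F n in sequentially. ennreal ((kernel_norm ys s)\<^sup>2) * indicator {0<..1 / real (Suc n)} s = 0"
            by eventually_elim (auto simp: indicator_def)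
          then show ?thesis by (rule tendsto_eventually)
        qed simp
      qed
    qed simp
    then show ?thesis by simp
  qed
  obtain X where X: "finite X" "\<And>xs. norm xs \<le> 1 \<Longrightarrow> \<exists>ys\<in>X. energy 1 (xs - ys) \<le> ennreal \<eta>"
    using energy_net[OF zero_less_one \<eta>] by auto
  have "\<forall>\<^sub>F n in sequentially. \<forall>ys\<in>X. energy (1 / real (Suc n)) ys < ennreal \<eta>"
    using X(1) lim \<eta> by (intro eventually_ball_finite ballI order_tendstoD(2)) auto
  then obtain n where "\<forall>ys\<in>X. energy (1 / real (Suc n)) ys < ennreal \<eta>"
    using eventually_happens'[OF sequentially_bot] by blast
  then have n: "\<And>ys. ys \<in> X \<Longrightarrow> energy (1 / real (Suc n)) ys < ennreal \<eta>" by blast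
  show ?thesis
  proof (rule that[of "1 / real (Suc n)"])
    fix xs :: "'e \<Rightarrow>\<^sub>L real" assume "norm xs \<le> 1"
    then obtain ys where ys: "ys \<in> X" "energy 1 (xs - ys) \<le> ennreal \<eta>" using X(2) by blast
    have "energy (1 / real (Suc n)) (xs - ys) \<le> energy 1 (xs - ys)" by (rule energy_mono) simp
    then have "energy (1 / real (Suc n)) xs \<le> 2 * ennreal \<eta> + 2 * energy (1 / real (Suc n)) ys"
      using ys(2) by (intro energy_le_net) auto
    also have "\<dots> \<le> 2 * ennreal \<eta> + 2 * ennreal \<eta>"
      using n[OF ys(1)] by (intro add_mono mult_left_mono) auto
    also have "\<dots> = ennreal (2 * \<eta>) + ennreal (2 * \<eta>)" using \<eta> ennreal_mult[of 2 \<eta>] by simp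
    also have "\<dots> = ennreal (2 * \<eta> + 2 * \<eta>)" using \<eta> by (intro ennreal_plus[symmetric]) auto
    also have "2 * \<eta> + 2 * \<eta> = \<epsilon>" by (simp add: \<eta>_def)
    finally show "energy (1 / real (Suc n)) xs \<le> ennreal \<epsilon>" .
  qed simp
qed

lemma reach_apply_le:
  assumes y: "y \<in> reach T C" and e: "energy T xs \<le> ennreal (b\<^sup>2)" and nn: "b \<ge> 0" "C \<ge> 0"
  shows "\<bar>blinfun_apply xs y\<bar> \<le> C * b"
proof -
  have "ennreal ((blinfun_apply xs y)\<^sup>2) \<le> ennreal (C\<^sup>2) * energy T xs" using y by (simp add: reach_def)
  also have "\<dots> \<le> ennreal (C\<^sup>2) * ennreal (b\<^sup>2)" by (rule mult_left_mono[OF e]) simp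
  also have "\<dots> = ennreal ((C * b)\<^sup>2)" by (simp add: ennreal_mult[symmetric] power_mult_distrib)
  finally have "(blinfun_apply xs y)\<^sup>2 \<le> (C * b)\<^sup>2" by (simp add: ennreal_le_iff)
  then show ?thesis using nn by (simp add: abs_le_square_iff[symmetric])
qed

text \<open>The constant does not depend on \<open>T\<close>, because the energy is bounded over all
  times; this is what makes estimates on windows of arbitrary length possible.\<close>

lemma reach_norm_le:
  obtains K where "K \<ge> 0" "\<And>T C y. y \<in> reach T C \<Longrightarrow> C \<ge> 0 \<Longrightarrow> norm y \<le> K * C"
proof -
  obtain K where K: "K \<ge> 0" "\<And>T xs. energy T xs \<le> ennreal (K\<^sup>2 * (norm xs)\<^sup>2)" using energy_bound by blast
  show ?thesis
  proof (rule that[OF K(1)])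
    fix T C y assume y: "y \<in> reach T C" "C \<ge> (0::real)"
    show "norm y \<le> K * C"
    proof (rule norm_le_dualI)
      fix xs :: "'e \<Rightarrow>\<^sub>L real" assume xs: "norm xs \<le> 1"
      have "energy T xs \<le> ennreal ((K * norm xs)\<^sup>2)" using K(2) by (simp add: power_mult_distrib)
      then have "\<bar>blinfun_apply xs y\<bar> \<le> C * (K * norm xs)"
        by (rule reach_apply_le[OF y(1)]) (use K y in auto)
      also have "\<dots> \<le> C * (K * 1)" using xs K y by (intro mult_left_mono) auto
      finally show "blinfun_apply xs y \<le> K * C" by (simp add: mult.commute)
    qed
  qed
qed

lemma reach_small:
  assumes \<epsilon>: "\<epsilon> > 0" and C: "C \<ge> 0"
  obtains h where "h > 0" "\<And>y. y \<in> reach h C \<Longrightarrow> norm y \<le> \<epsilon>"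
proof -
  define b where "b = \<epsilon> / (C + 1)"
  have b: "b > 0" "C * b \<le> \<epsilon>" using \<epsilon> C by (auto simp: b_def field_simps)
  obtain h where h: "h > 0" "\<And>xs. norm xs \<le> 1 \<Longrightarrow> energy h xs \<le> ennreal (b\<^sup>2)"
    using energy_small[of "b\<^sup>2"] b by auto
  show ?thesis
  proof (rule that[OF h(1)], rule norm_le_dualI)
    fix y and xs :: "'e \<Rightarrow>\<^sub>L real" assume "y \<in> reach h C" "norm xs \<le> 1"
    then have "\<bar>blinfun_apply xs y\<bar> \<le> C * b" using h b C by (intro reach_apply_le) auto
    then show "blinfun_apply xs y \<le> \<epsilon>" using b(2) by linarith
  qed
qed

text \<open>Points and functionals exchange roles: an arbitrary functional is replaced by a member
  of the net, at a cost of \<open>\<epsilon> / 2\<close> at each of the two points, so finitely many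
  functionals decide distances in the set up to a fixed error.\<close>

lemma reach_dual_net:
  assumes T: "T > 0" and C: "C \<ge> 0" and \<epsilon>: "\<epsilon> > 0"
  obtains X where "finite X" "X \<subseteq> cball 0 1"
    "\<And>y y'. y \<in> reach T C \<Longrightarrow> y' \<in> reach T C \<Longrightarrow>
      (\<And>xs. xs \<in> X \<Longrightarrow> \<bar>blinfun_apply xs y - blinfun_apply xs y'\<bar> \<le> \<epsilon>) \<Longrightarrow> norm (y - y') \<le> 2 * \<epsilon>"
proof -
  define b where "b = \<epsilon> / (2 * (C + 1))"
  have b: "b > 0" "C * b \<le> \<epsilon> / 2" using \<epsilon> C by (auto simp: b_def field_simps)
  obtain X where X: "finite X" "X \<subseteq> cball 0 1" "\<And>xs. norm xs \<le> 1 \<Longrightarrow> \<exists>ys\<in>X. energy T (xs - ys) \<le> ennreal (b\<^sup>2)"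
    using energy_net[OF T, of "b\<^sup>2"] b by auto
  show ?thesis
  proof (rule that[OF X(1,2)], rule norm_le_dualI)
    fix y y' and xs :: "'e \<Rightarrow>\<^sub>L real"
    assume y: "y \<in> reach T C" "y' \<in> reach T C" and xs: "norm xs \<le> 1"
      and d: "\<And>xs. xs \<in> X \<Longrightarrow> \<bar>blinfun_apply xs y - blinfun_apply xs y'\<bar> \<le> \<epsilon>"
    obtain ys where ys: "ys \<in> X" "energy T (xs - ys) \<le> ennreal (b\<^sup>2)" using X(3)[OF xs] by blast
    have "\<bar>blinfun_apply (xs - ys) y\<bar> \<le> \<epsilon> / 2" "\<bar>blinfun_apply (xs - ys) y'\<bar> \<le> \<epsilon> / 2"
      using reach_apply_le[OF y(1) ys(2)] reach_apply_le[OF y(2) ys(2)] b C by auto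
    then show "blinfun_apply xs (y - y') \<le> 2 * \<epsilon>"
      using d[OF ys(1)] unfolding blinfun.diff_left blinfun.diff_right abs_le_iff by linarith
  qed
qed

text \<open>As in Schauder's theorem, total boundedness passes from the dual ball to the set:
  finitely many bounded functionals have a grid net, and by the previous lemma they separate points
  well enough.\<close>

lemma reach_finite_net:
  assumes T: "T > 0" and C: "C \<ge> 0" and \<epsilon>: "\<epsilon> > 0"
  shows "\<exists>N. finite N \<and> (\<forall>y\<in>reach T C. \<exists>y'\<in>N. norm (y - y') < \<epsilon>)"
proof -
  obtain X where X: "finite X" "X \<subseteq> cball 0 1"
    "\<And>y y'. y \<in> reach T C \<Longrightarrow> y' \<in> reach T C \<Longrightarrow>
      (\<And>xs. xs \<in> X \<Longrightarrow> \<bar>blinfun_apply xs y - blinfun_apply xs y'\<bar> \<le> \<epsilon> / 3) \<Longrightarrow> norm (y - y') \<le> 2 * (\<epsilon> / 3)"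
    using reach_dual_net[OF T C, of "\<epsilon> / 3"] \<epsilon> by auto
  obtain K where K: "K \<ge> 0" "\<And>T C y. y \<in> reach T C \<Longrightarrow> C \<ge> 0 \<Longrightarrow> norm y \<le> K * C" using reach_norm_le by blast
  have bd: "\<exists>b. \<forall>y\<in>reach T C. \<bar>blinfun_apply xs y\<bar> \<le> b" if "xs \<in> X" for xs
  proof (intro exI ballI)
    fix y assume "y \<in> reach T C"
    then have "norm xs * norm y \<le> 1 * (K * C)" using X(2) that K(2)[OF _ C] by (intro mult_mono) auto
    then show "\<bar>blinfun_apply xs y\<bar> \<le> K * C" using norm_blinfun[of xs y] by simp
  qed
  have e3: "\<epsilon> / 3 > 0" using \<epsilon> by simp
  obtain N where N: "finite N" "N \<subseteq> reach T C"
    "\<And>y. y \<in> reach T C \<Longrightarrow> \<exists>y'\<in>N. \<forall>xs\<in>X. \<bar>blinfun_apply xs y - blinfun_apply xs y'\<bar> < \<epsilon> / 3"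
    by (rule finite_family_net[of X "reach T C" blinfun_apply "\<epsilon> / 3", OF X(1) bd e3]) (assumption, rule that)
  have "\<exists>y'\<in>N. norm (y - y') < \<epsilon>" if y: "y \<in> reach T C" for y
  proof -
    obtain y' where y': "y' \<in> N" "\<And>xs. xs \<in> X \<Longrightarrow> \<bar>blinfun_apply xs y - blinfun_apply xs y'\<bar> < \<epsilon> / 3"
      using N(3)[OF y] by blast
    have "norm (y - y') \<le> 2 * (\<epsilon> / 3)" using y y' N(2) by (intro X(3)) (auto intro: less_imp_le)
    then show ?thesis using y'(1) \<epsilon> by (intro bexI[of _ y']) auto
  qed
  then show ?thesis using N(1) by blast
qed

lemma S_uniform_on_reach:
  assumes "T > 0" "C \<ge> 0" "\<epsilon> > 0"
  shows "\<forall>\<^sub>F h in at_right 0. \<forall>y\<in>reach T C. norm (S h y - y) < \<epsilon>"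
  by (rule equibounded_tendsto_uniform[where C = M])
     (use S_bound S_right_cont reach_finite_net assms in \<open>auto intro: bounded_linear.linear blinfun.bounded_linear_right\<close>)

end

section \<open>Equicontinuity of noise parts, the a priori bound, and comparison of controlled
  paths\<close>

context controlled_system begin

definition controlled :: "real \<Rightarrow> (real \<Rightarrow> 'h) \<Rightarrow> (real \<Rightarrow> 'e) \<Rightarrow> bool" where
  "controlled T \<psi> X \<longleftrightarrow> square_integrable_on \<psi> {0..T} \<and> controlled_solution S SQ F B T (X 0) \<psi> X"

text \<open>Computed from the path alone: it is the same for every control that produces the path,
  and a limit of paths has one before any control for it is known.\<close>

definition noise_part :: "(real \<Rightarrow> 'e) \<Rightarrow> real \<Rightarrow> 'e" where
  "noise_part X t = X t - S t (X 0) - integral {0..t} (\<lambda>s. S (t - s) (F (X s)))"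

text \<open>Multiplied by the square of \<open>\<kappa>\<close> this majorises the squared norm of
  \<open>B (X s) (\<psi> s)\<close>, by the growth condition on \<open>B\<close>.\<close>

definition cost :: "(real \<Rightarrow> 'h) \<Rightarrow> (real \<Rightarrow> 'e) \<Rightarrow> real \<Rightarrow> real" where
  "cost \<psi> X s = ((1 + norm (X s)) * norm (\<psi> s))\<^sup>2"

lemma controlled_cont: "controlled T \<psi> X \<Longrightarrow> continuous_on {0..T} X"
  by (simp add: controlled_def controlled_solution_def)

lemma noise_part_0 [simp]: "noise_part X 0 = 0"
  by (simp add: noise_part_def)

lemma noise_part_weak:
  assumes "controlled T \<psi> X" "t \<in> {0..T}"
  shows "has_weak_integral (lebesgue_on {0..t}) (\<lambda>s. SQ (t - s) (B (X s) (\<psi> s))) (noise_part X t)"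
proof -
  obtain y where y: "has_weak_integral (lebesgue_on {0..t}) (\<lambda>s. SQ (t - s) (B (X s) (\<psi> s))) y"
    "X t = S t (X 0) + integral {0..t} (\<lambda>s. S (t - s) (F (X s))) + y"
    using assms unfolding controlled_def controlled_solution_def by blast
  have "noise_part X t = y" unfolding noise_part_def by (subst y(2)) simp
  then show ?thesis using y(1) by simp
qed

lemma cost_nonneg [simp]: "0 \<le> cost \<psi> X s"
  by (simp add: cost_def)

lemma control_measurable:
  assumes "controlled T \<psi> X" "0 \<le> a" "t \<le> T"
  shows "(\<lambda>s. (1 + norm (X s)) * norm (\<psi> s)) \<in> borel_measurable (lebesgue_on {a..t})"
    "(\<lambda>s. norm (\<psi> s)) \<in> borel_measurable (lebesgue_on {a..t})"
proof -
  have "X \<in> borel_measurable (lebesgue_on {0..T})"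
    by (rule continuous_imp_measurable_on_sets_lebesgue[OF controlled_cont[OF assms(1)]]) simp
  moreover have "(\<lambda>s. norm (X s)) \<in> borel_measurable (lebesgue_on {0..T})"
    by (intro continuous_imp_measurable_on_sets_lebesgue continuous_intros controlled_cont[OF assms(1)]) simp
  moreover have "\<psi> \<in> borel_measurable (lebesgue_on {0..T})"
    using assms(1) by (simp add: controlled_def square_integrable_on_def)
  ultimately have "(\<lambda>s. (1 + norm (X s)) * norm (\<psi> s)) \<in> borel_measurable (lebesgue_on {0..T})"
    "(\<lambda>s. norm (\<psi> s)) \<in> borel_measurable (lebesgue_on {0..T})" by measurable
  then show "(\<lambda>s. (1 + norm (X s)) * norm (\<psi> s)) \<in> borel_measurable (lebesgue_on {a..t})"
    "(\<lambda>s. norm (\<psi> s)) \<in> borel_measurable (lebesgue_on {a..t})"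
    using assms by (auto elim!: measurable_restrict_mono)
qed

lemma control_integrable:
  assumes "controlled T \<psi> X"
  shows "integrable (lebesgue_on {0..T}) (\<lambda>s. (norm (\<psi> s))\<^sup>2)"
  using assms by (simp add: controlled_def square_integrable_on_def)

lemma cost_le:
  assumes "norm (X s) \<le> R" shows "cost \<psi> X s \<le> (1 + R)\<^sup>2 * (norm (\<psi> s))\<^sup>2"
  unfolding cost_def power_mult_distrib
  using assms by (intro mult_right_mono power_mono) auto

lemma cost_integrable:
  assumes c: "controlled T \<psi> X"
  shows "integrable (lebesgue_on {0..T}) (cost \<psi> X)"
proof -
  have "compact (X ` {0..T})" using controlled_cont[OF c] by (intro compact_continuous_image) auto
  then obtain R where R: "\<And>s. s \<in> {0..T} \<Longrightarrow> norm (X s) \<le> R"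
    using compact_imp_bounded by (fastforce simp: bounded_iff)
  show ?thesis
  proof (rule Bochner_Integration.integrable_bound)
    show "integrable (lebesgue_on {0..T}) (\<lambda>s. (1 + R)\<^sup>2 * (norm (\<psi> s))\<^sup>2)"
      using control_integrable[OF c] by simp
    have "(\<lambda>s. (1 + norm (X s)) * norm (\<psi> s)) \<in> borel_measurable (lebesgue_on {0..T})"
      using control_measurable(1)[OF c, of 0 T] by simp
    then show "cost \<psi> X \<in> borel_measurable (lebesgue_on {0..T})" unfolding cost_def[abs_def] by measurable
    show "AE s in lebesgue_on {0..T}. norm (cost \<psi> X s) \<le> norm ((1 + R)\<^sup>2 * (norm (\<psi> s))\<^sup>2)"
      using cost_le[OF R] by (intro AE_I2) simp
  qed
qed

lemma noise_part_increment:
  assumes c: "controlled T \<psi> X" and at: "0 \<le> a" "a \<le> t" "t \<le> T" and C: "0 \<le> C"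
    and le: "(LINT s|lebesgue_on {a..t}. cost \<psi> X s) \<le> C\<^sup>2"
  shows "noise_part X t - S (t - a) (noise_part X a) \<in> reach (t - a) (\<kappa> * C)"
proof (rule weak_integral_reach[OF at(2)])
  show "has_weak_integral (lebesgue_on {a..t}) (\<lambda>s. SQ (t - s) (B (X s) (\<psi> s))) (noise_part X t - S (t - a) (noise_part X a))"
    using at by (intro weak_integral_flow noise_part_weak[OF c]) auto
  show "(\<lambda>s. \<kappa> * ((1 + norm (X s)) * norm (\<psi> s))) \<in> borel_measurable (lebesgue_on {a..t})"
    using control_measurable(1)[OF c at(1,3)] by simp
  show "norm (B (X s) (\<psi> s)) \<le> \<kappa> * ((1 + norm (X s)) * norm (\<psi> s))" for s
    using B_growth[of "X s" "\<psi> s"] by (simp add: mult.assoc)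
  have int: "integrable (lebesgue_on {a..t}) (cost \<psi> X)"
    using at by (intro integrable_lebesgue_on_subinterval[OF cost_integrable[OF c]]) auto
  have "(\<integral>\<^sup>+s. ennreal ((\<kappa> * ((1 + norm (X s)) * norm (\<psi> s)))\<^sup>2) \<partial>lebesgue_on {a..t}) =
      (\<integral>\<^sup>+s. ennreal (\<kappa>\<^sup>2 * cost \<psi> X s) \<partial>lebesgue_on {a..t})"
    by (simp add: cost_def power_mult_distrib)
  also have "\<dots> = ennreal (\<kappa>\<^sup>2 * (LINT s|lebesgue_on {a..t}. cost \<psi> X s))"
    using int by (subst nn_integral_eq_integral) auto
  also have "\<dots> \<le> ennreal ((\<kappa> * C)\<^sup>2)"
    unfolding power_mult_distrib by (intro ennreal_leI mult_left_mono le) simp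
  finally show "(\<integral>\<^sup>+s. ennreal ((\<kappa> * ((1 + norm (X s)) * norm (\<psi> s)))\<^sup>2) \<partial>lebesgue_on {a..t}) \<le> ennreal ((\<kappa> * C)\<^sup>2)" .
qed

lemma noise_part_reach:
  assumes c: "controlled T \<psi> X" and t: "0 \<le> t" "t \<le> T" and C: "0 \<le> C"
    and le: "(LINT s|lebesgue_on {0..t}. cost \<psi> X s) \<le> C\<^sup>2"
  shows "noise_part X t \<in> reach t (\<kappa> * C)"
  using noise_part_increment[OF c _ t(1) t(2) C le] by (simp add: blinfun.zero_right)

lemma cost_integral_mono:
  assumes c: "controlled T \<psi> X" and "0 \<le> a'" "a' \<le> a" "a \<le> t" "t \<le> t'" "t' \<le> T"
  shows "(LINT s|lebesgue_on {a..t}. cost \<psi> X s) \<le> (LINT s|lebesgue_on {a'..t'}. cost \<psi> X s)"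
proof -
  have i: "integrable (lebesgue_on {a'..t'}) (cost \<psi> X)" "integrable (lebesgue_on {a..t'}) (cost \<psi> X)"
    using assms by (auto intro!: integrable_lebesgue_on_subinterval[OF cost_integrable[OF c]])
  show ?thesis
    using integral_lebesgue_on_combine[OF i(1), of a] integral_lebesgue_on_combine[OF i(2), of t] assms
      Bochner_Integration.integral_nonneg[of "lebesgue_on {a'..a}" "cost \<psi> X"]
      Bochner_Integration.integral_nonneg[of "lebesgue_on {t..t'}" "cost \<psi> X"]
    by simp
qed

text \<open>Two effects: noise entering during \<open>[a, t]\<close> lies in a reachable set of
  short duration and is small; noise from before \<open>a\<close> is moved by
  \<open>S (t - a)\<close>, which is uniformly close to the identity on a totally bounded set. Hence
  the modulus is common to all paths of bounded cost.\<close>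

lemma noise_part_equicontinuous:
  assumes T: "T > 0" and C: "C \<ge> 0" and \<epsilon>: "\<epsilon> > 0"
  obtains d where "d > 0" "\<And>\<psi> X a t. controlled T \<psi> X \<Longrightarrow> (LINT s|lebesgue_on {0..T}. cost \<psi> X s) \<le> C\<^sup>2 \<Longrightarrow>
    0 \<le> a \<Longrightarrow> a \<le> t \<Longrightarrow> t \<le> T \<Longrightarrow> t - a < d \<Longrightarrow> norm (noise_part X t - noise_part X a) < \<epsilon>"
proof -
  have kC: "\<kappa> * C \<ge> 0" using \<kappa> C by simp
  obtain d1 where d1: "d1 > 0" "\<And>y. y \<in> reach d1 (\<kappa> * C) \<Longrightarrow> norm y \<le> \<epsilon> / 3"
    using reach_small[of "\<epsilon> / 3" "\<kappa> * C"] \<epsilon> kC by auto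
  have "\<forall>\<^sub>F h in at_right 0. \<forall>y\<in>reach T (\<kappa> * C). norm (S h y - y) < \<epsilon> / 3"
    using T kC \<epsilon> by (intro S_uniform_on_reach) auto
  then obtain d2 where d2: "d2 > 0" "\<And>h y. 0 < h \<Longrightarrow> h < d2 \<Longrightarrow> y \<in> reach T (\<kappa> * C) \<Longrightarrow> norm (S h y - y) < \<epsilon> / 3"
    unfolding eventually_at_right_field by blast
  show ?thesis
  proof (rule that[of "min d1 d2"])
    fix \<psi> X a t
    assume c: "controlled T \<psi> X" and le: "(LINT s|lebesgue_on {0..T}. cost \<psi> X s) \<le> C\<^sup>2"
      and at: "0 \<le> a" "a \<le> t" "t \<le> T" "t - a < min d1 d2"
    have "noise_part X t - S (t - a) (noise_part X a) \<in> reach (t - a) (\<kappa> * C)"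
      using cost_integral_mono[OF c, of 0 a t T] at le by (intro noise_part_increment[OF c at(1-3) C]) auto
    then have "noise_part X t - S (t - a) (noise_part X a) \<in> reach d1 (\<kappa> * C)"
      by (rule reach_mono) (use at kC in auto)
    then have 1: "norm (noise_part X t - S (t - a) (noise_part X a)) \<le> \<epsilon> / 3" by (rule d1(2))
    have "noise_part X a \<in> reach a (\<kappa> * C)"
      using cost_integral_mono[OF c, of 0 0 a T] at le by (intro noise_part_reach[OF c at(1) _ C]) auto
    then have "noise_part X a \<in> reach T (\<kappa> * C)" by (rule reach_mono) (use at kC in auto)
    then have 2: "norm (S (t - a) (noise_part X a) - noise_part X a) < \<epsilon> / 3"
      using d2(2)[of "t - a"] at \<epsilon> by (cases "t = a") auto
    show "norm (noise_part X t - noise_part X a) < \<epsilon>"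
      using norm_triangle_ineq[of "noise_part X t - S (t - a) (noise_part X a)" "S (t - a) (noise_part X a) - noise_part X a"]
        1 2 \<epsilon> by simp
  qed (use d1 d2 in auto)
qed

lemma noise_part_cont:
  assumes c: "controlled T \<psi> X"
  shows "continuous_on {0..T} (noise_part X)"
proof (cases "T > 0")
  case False
  then have "{0..T} = {} \<or> {0..T} = {0}" by auto
  then show ?thesis by (elim disjE) simp_all
next
  case True
  define C where "C = sqrt (LINT s|lebesgue_on {0..T}. cost \<psi> X s)"
  have C: "C \<ge> 0" "(LINT s|lebesgue_on {0..T}. cost \<psi> X s) \<le> C\<^sup>2" by (auto simp: C_def)
  show ?thesis
    unfolding continuous_on_iff
  proof (intro ballI allI impI)
    fix t \<epsilon> :: real assume t: "t \<in> {0..T}" and \<epsilon>: "\<epsilon> > 0"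
    obtain d where d: "d > 0" "\<And>\<psi> X a t. controlled T \<psi> X \<Longrightarrow> (LINT s|lebesgue_on {0..T}. cost \<psi> X s) \<le> C\<^sup>2 \<Longrightarrow>
      0 \<le> a \<Longrightarrow> a \<le> t \<Longrightarrow> t \<le> T \<Longrightarrow> t - a < d \<Longrightarrow> norm (noise_part X t - noise_part X a) < \<epsilon>"
      by (fact noise_part_equicontinuous[OF True C(1) \<epsilon>])
    have "dist (noise_part X s) (noise_part X t) < \<epsilon>" if s: "s \<in> {0..T}" "dist s t < d" for s
    proof (cases "s \<le> t")
      case True
      then show ?thesis using d(2)[OF c C(2), of s t] s t by (simp add: dist_norm norm_minus_commute)
    next
      case False
      then show ?thesis using d(2)[OF c C(2), of t s] s t by (simp add: dist_norm)
    qed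
    then show "\<exists>d>0. \<forall>s\<in>{0..T}. dist s t < d \<longrightarrow> dist (noise_part X s) (noise_part X t) < \<epsilon>" using d(1) by blast
  qed
qed

text \<open>The forcing is written in the shape \<open>F (y t + z t)\<close> so that the comparison
  and growth lemmas apply with \<open>z\<close> the noise part.\<close>

lemma mild_part:
  assumes c: "controlled T \<psi> X"
  shows "mild T (\<lambda>t. F ((X t - noise_part X t) + noise_part X t)) (\<lambda>t. X t - noise_part X t)"
proof -
  have "continuous_on {0..T} (\<lambda>t. X t - noise_part X t)"
    by (intro continuous_intros controlled_cont[OF c] noise_part_cont[OF c])
  moreover have "continuous_on {0..T} (\<lambda>t. F (X t))"
    by (rule continuous_on_compose2[OF F_continuous[of UNIV] controlled_cont[OF c]]) simp
  ultimately show ?thesis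
    unfolding mild_def by (simp add: noise_part_def[of X])
qed

text \<open>Arzela-Ascoli in quantitative form. Equicontinuity moves a time \<open>t\<close> to the
  last grid point before it, where finitely many functionals decide; \<open>4 * \<epsilon>\<close>
  is \<open>2 * \<epsilon>\<close> at the grid point and \<open>\<epsilon>\<close> for each path in
  between.\<close>

lemma noise_parts_close:
  assumes T: "T > 0" and C: "C \<ge> 0" and \<epsilon>: "\<epsilon> > 0"
  obtains \<Theta> Y where "finite \<Theta>" "\<Theta> \<subseteq> {0..T}" "finite Y" "Y \<subseteq> cball 0 1"
    "\<And>\<psi> X \<psi>' X' t. controlled T \<psi> X \<Longrightarrow> (LINT s|lebesgue_on {0..T}. cost \<psi> X s) \<le> C\<^sup>2 \<Longrightarrow>
      controlled T \<psi>' X' \<Longrightarrow> (LINT s|lebesgue_on {0..T}. cost \<psi>' X' s) \<le> C\<^sup>2 \<Longrightarrow>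
      (\<And>\<theta> xs. \<theta> \<in> \<Theta> \<Longrightarrow> xs \<in> Y \<Longrightarrow> \<bar>blinfun_apply xs (noise_part X \<theta>) - blinfun_apply xs (noise_part X' \<theta>)\<bar> \<le> \<epsilon>) \<Longrightarrow>
      t \<in> {0..T} \<Longrightarrow> norm (noise_part X t - noise_part X' t) \<le> 4 * \<epsilon>"
proof -
  have kC: "\<kappa> * C \<ge> 0" using \<kappa> C by simp
  obtain Y where Y: "finite Y" "Y \<subseteq> cball 0 1" and
    Yd: "\<And>y y'. y \<in> reach T (\<kappa> * C) \<Longrightarrow> y' \<in> reach T (\<kappa> * C) \<Longrightarrow>
      (\<And>xs. xs \<in> Y \<Longrightarrow> \<bar>blinfun_apply xs y - blinfun_apply xs y'\<bar> \<le> \<epsilon>) \<Longrightarrow> norm (y - y') \<le> 2 * \<epsilon>"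
    by (fact reach_dual_net[OF T kC \<epsilon>])
  obtain d where d: "d > 0" "\<And>\<psi> X a t. controlled T \<psi> X \<Longrightarrow> (LINT s|lebesgue_on {0..T}. cost \<psi> X s) \<le> C\<^sup>2 \<Longrightarrow>
    0 \<le> a \<Longrightarrow> a \<le> t \<Longrightarrow> t \<le> T \<Longrightarrow> t - a < d \<Longrightarrow> norm (noise_part X t - noise_part X a) < \<epsilon>"
    by (fact noise_part_equicontinuous[OF T C \<epsilon>])
  define n where "n = nat \<lceil>T / d\<rceil>"
  define \<Theta> where "\<Theta> = (\<lambda>i. real i * d) ` {..n} \<inter> {0..T}"
  have cover: "\<exists>\<theta>\<in>\<Theta>. \<theta> \<le> t \<and> t - \<theta> < d" if t: "t \<in> {0..T}" for t
  proof -
    define i where "i = nat \<lfloor>t / d\<rfloor>"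
    have t0: "t / d \<ge> 0" using t d by simp
    have ri: "real i \<le> t / d" "t / d < real i + 1" using t0 by (auto simp: i_def)
    have "real i * d \<le> t" "t - real i * d < d" using ri d(1) by (auto simp: field_simps)
    moreover have "t / d \<le> T / d" using t d by (intro divide_right_mono) auto
    then have "i \<le> n" using t0 unfolding i_def n_def by (intro nat_mono) linarith
    ultimately show ?thesis using t d(1) unfolding \<Theta>_def by (intro bexI[of _ "real i * d"]) auto
  qed
  show ?thesis
  proof (rule that[of \<Theta> Y, OF _ _ Y])
    show "finite \<Theta>" "\<Theta> \<subseteq> {0..T}" by (auto simp: \<Theta>_def)
    fix \<psi> X \<psi>' X' t
    assume c: "controlled T \<psi> X" "controlled T \<psi>' X'"
      and le: "(LINT s|lebesgue_on {0..T}. cost \<psi> X s) \<le> C\<^sup>2" "(LINT s|lebesgue_on {0..T}. cost \<psi>' X' s) \<le> C\<^sup>2"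
      and cl: "\<And>\<theta> xs. \<theta> \<in> \<Theta> \<Longrightarrow> xs \<in> Y \<Longrightarrow> \<bar>blinfun_apply xs (noise_part X \<theta>) - blinfun_apply xs (noise_part X' \<theta>)\<bar> \<le> \<epsilon>"
      and t: "t \<in> {0..T}"
    obtain \<theta> where \<theta>: "\<theta> \<in> \<Theta>" "\<theta> \<le> t" "t - \<theta> < d" using cover[OF t] by blast
    have \<theta>0: "0 \<le> \<theta>" "\<theta> \<le> T" using \<theta>(1) by (auto simp: \<Theta>_def)
    have r: "noise_part X \<theta> \<in> reach T (\<kappa> * C)" if "controlled T \<psi> X" "(LINT s|lebesgue_on {0..T}. cost \<psi> X s) \<le> C\<^sup>2" for \<psi> X
    proof (rule reach_mono)
      show "noise_part X \<theta> \<in> reach \<theta> (\<kappa> * C)"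
        using cost_integral_mono[OF that(1), of 0 0 \<theta> T] \<theta>0 that(2) by (intro noise_part_reach[OF that(1) \<theta>0(1) _ C]) auto
    qed (use \<theta>0 kC in auto)
    have "norm (noise_part X \<theta> - noise_part X' \<theta>) \<le> 2 * \<epsilon>"
      by (rule Yd[OF r[OF c(1) le(1)] r[OF c(2) le(2)] cl[OF \<theta>(1)]])
    moreover have "norm (noise_part X t - noise_part X \<theta>) < \<epsilon>" "norm (noise_part X' t - noise_part X' \<theta>) < \<epsilon>"
      using \<theta> \<theta>0 t by (auto intro!: d(2)[OF c(1) le(1)] d(2)[OF c(2) le(2)])
    moreover have "noise_part X t - noise_part X' t = (noise_part X t - noise_part X \<theta>) + (noise_part X \<theta> - noise_part X' \<theta>)
        - (noise_part X' t - noise_part X' \<theta>)" by simp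
    ultimately show "norm (noise_part X t - noise_part X' t) \<le> 4 * \<epsilon>"
      using norm_triangle_ineq4[of "(noise_part X t - noise_part X \<theta>) + (noise_part X \<theta> - noise_part X' \<theta>)" "noise_part X' t - noise_part X' \<theta>"]
        norm_triangle_ineq[of "noise_part X t - noise_part X \<theta>" "noise_part X \<theta> - noise_part X' \<theta>"] by simp
  qed
qed

text \<open>With \<open>V t\<close> equal to one plus the cost up to \<open>t\<close>, the noise
  part is at most a multiple of \<open>sqrt (V t)\<close>; by the linear bound so is
  \<open>1 + norm (X t)\<close>, and the cost density is at most \<open>k\<^sup>2 * V t\<close>
  times the energy density. The dyadic Gronwall lemma then bounds \<open>V\<close> through
  \<open>E\<close>, for every \<open>T\<close>.\<close>

lemma controlled_apriori_bound:
  assumes E: "E \<ge> 0"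
  obtains R where "R \<ge> 0" "\<And>T \<psi> X t. controlled T \<psi> X \<Longrightarrow> L2_norm_sq \<psi> {0..T} \<le> E \<Longrightarrow> norm (X 0) \<le> 1 \<Longrightarrow>
    t \<in> {0..T} \<Longrightarrow> norm (X t) \<le> R"
proof -
  obtain K where K: "K \<ge> 0" "\<And>T C y. y \<in> reach T C \<Longrightarrow> C \<ge> 0 \<Longrightarrow> norm y \<le> K * C" using reach_norm_le by blast
  obtain L where L: "L \<ge> 0" and Lb: "\<And>T y z Z. mild T (\<lambda>t. F (y t + z t)) y \<Longrightarrow> continuous_on {0..T} z \<Longrightarrow> 0 \<le> T \<Longrightarrow>
    (\<And>t. t \<in> {0..T} \<Longrightarrow> norm (z t) \<le> Z) \<Longrightarrow> norm (y T) \<le> norm (y 0) + L * (1 + Z)"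
    by (fact mild_linear_bound)
  \<comment> \<open>\<open>2 + L\<close> collects the initial value and the additive part of the
    linear bound, \<open>(L + 1) * (K * \<kappa>)\<close> the noise; the former is multiplied by
    \<open>sqrt (V t) \<ge> 1\<close> below.\<close>
  define k where "k = 2 + L + (L + 1) * (K * \<kappa>)"
  have k: "k \<ge> 1" using L K \<kappa> by (auto simp: k_def)
  \<comment> \<open>In the Gronwall lemma \<open>n\<close> doublings cover an energy of
    \<open>n / (2 * k\<^sup>2)\<close>, which has to reach \<open>E\<close>.\<close>
  obtain n where n: "2 * k\<^sup>2 * E \<le> real n" using real_arch_simple by blast
  show ?thesis
  proof (rule that[of "k * sqrt (2 ^ n)"])
    show "0 \<le> k * sqrt (2 ^ n)" using k by simp
    fix T \<psi> X t
    assume c: "controlled T \<psi> X" and le: "L2_norm_sq \<psi> {0..T} \<le> E" and X0: "norm (X 0) \<le> 1" and t: "t \<in> {0..T}"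
    define V where "V t = 1 + (LINT s|lebesgue_on {0..t}. cost \<psi> X s)" for t
    define a where "a t = (LINT s|lebesgue_on {0..t}. (norm (\<psi> s))\<^sup>2)" for t
    have V1: "V t \<ge> 1" for t by (simp add: V_def)
    have Vm: "V s \<le> V t" if "0 \<le> s" "s \<le> t" "t \<le> T" for s t
      unfolding V_def using cost_integral_mono[OF c, of 0 0 s t] that by simp
    have Xb: "1 + norm (X t) \<le> k * sqrt (V t)" if t: "0 \<le> t" "t \<le> T" for t
    proof -
      define Z where "Z = K * (\<kappa> * sqrt (V t))"
      have Z: "norm (noise_part X s) \<le> Z" if s: "s \<in> {0..t}" for s
      proof -
        have "noise_part X s \<in> reach s (\<kappa> * sqrt (V t))"
        proof (rule noise_part_reach[OF c])
          have "(LINT u|lebesgue_on {0..s}. cost \<psi> X u) \<le> V s" by (simp add: V_def)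
          also have "\<dots> \<le> V t" using s t by (intro Vm) auto
          finally show "(LINT u|lebesgue_on {0..s}. cost \<psi> X u) \<le> (sqrt (V t))\<^sup>2" using V1[of t] by simp
        qed (use s t V1[of t] in auto)
        then show ?thesis unfolding Z_def using K(2) \<kappa> V1[of t] by simp
      qed
      have "mild t (\<lambda>t. F ((X t - noise_part X t) + noise_part X t)) (\<lambda>t. X t - noise_part X t)"
        by (rule mild_restrict[OF mild_part[OF c] t(2)])
      from Lb[OF this continuous_on_subset[OF noise_part_cont[OF c]] t(1) Z] t
      have "norm (X t - noise_part X t) \<le> norm (X 0) + L * (1 + Z)" by simp
      then have "norm (X t) \<le> 1 + L * (1 + Z) + Z"
        using norm_triangle_ineq[of "X t - noise_part X t" "noise_part X t"] Z[of t] t X0 by simp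
      then have "1 + norm (X t) \<le> (2 + L) * 1 + (L + 1) * Z" by (simp add: algebra_simps)
      also have "\<dots> \<le> (2 + L) * sqrt (V t) + (L + 1) * Z" using L V1[of t] by (intro add_right_mono mult_left_mono) auto
      also have "\<dots> = k * sqrt (V t)" by (simp add: k_def Z_def algebra_simps)
      finally show ?thesis .
    qed
    have "V t \<le> 2 ^ n"
    proof (rule Gronwall_dyadic[where V = V and T = T and a = a and C = "k\<^sup>2"])
      show "continuous_on {0..T} a"
        unfolding a_def by (rule continuous_on_integral_lebesgue_on[OF control_integrable[OF c]])
      have null: "AE s in lebesgue_on {0..0::real}. False"
        using AE_lebesgue_on_neq[where a = 0 and t = 0 and c = 0] AE_space by eventually_elim auto
      show "a 0 = 0" unfolding a_def by (rule integral_eq_zero_AE) (use null in \<open>auto elim: eventually_mono\<close>)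
      have "(LINT s|lebesgue_on {0..0}. cost \<psi> X s) = 0" by (rule integral_eq_zero_AE) (use null in \<open>auto elim: eventually_mono\<close>)
      then show "V 0 = 1" by (simp add: V_def)
      show "k\<^sup>2 > 0" using k by simp
      show "0 \<le> V t" for t using V1[of t] by simp
      show "V t - V s \<le> k\<^sup>2 * V t * (a t - a s)" if s: "0 \<le> s" "s \<le> t" "t \<le> T" for s t
      proof -
        have ic: "integrable (lebesgue_on {0..t}) (cost \<psi> X)" "integrable (lebesgue_on {s..t}) (cost \<psi> X)"
          using s by (auto intro!: integrable_lebesgue_on_subinterval[OF cost_integrable[OF c]])
        have ip: "integrable (lebesgue_on {0..t}) (\<lambda>s. (norm (\<psi> s))\<^sup>2)" "integrable (lebesgue_on {s..t}) (\<lambda>s. (norm (\<psi> s))\<^sup>2)"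
          using s by (auto intro!: integrable_lebesgue_on_subinterval[OF control_integrable[OF c]])
        have "V t - V s = (LINT u|lebesgue_on {s..t}. cost \<psi> X u)"
          unfolding V_def using integral_lebesgue_on_combine[OF ic(1) s(1,2)] by simp
        also have "\<dots> \<le> (LINT u|lebesgue_on {s..t}. k\<^sup>2 * V t * (norm (\<psi> u))\<^sup>2)"
        proof (rule integral_mono)
          fix u assume "u \<in> space (lebesgue_on {s..t})"
          then have u: "0 \<le> u" "u \<le> t" "u \<le> T" using s by auto
          have "(1 + norm (X u))\<^sup>2 \<le> (k * sqrt (V u))\<^sup>2" using Xb[OF u(1,3)] by (intro power_mono) auto
          also have "\<dots> = k\<^sup>2 * V u" using V1[of u] by (simp add: power_mult_distrib)
          also have "\<dots> \<le> k\<^sup>2 * V t" using Vm[OF u(1,2) s(3)] by (intro mult_left_mono) auto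
          finally show "cost \<psi> X u \<le> k\<^sup>2 * V t * (norm (\<psi> u))\<^sup>2"
            unfolding cost_def power_mult_distrib by (rule mult_right_mono) simp
        qed (use ic ip in auto)
        also have "\<dots> = k\<^sup>2 * V t * (a t - a s)"
          unfolding a_def using integral_lebesgue_on_combine[OF ip(1) s(1,2)] by simp
        finally show ?thesis .
      qed
      show "0 \<le> t" "t \<le> T" using t by auto
      have nn: "0 \<le> (LINT s|lebesgue_on {t..T}. (norm (\<psi> s))\<^sup>2)" by simp
      have "a t \<le> E"
        using integral_lebesgue_on_combine[OF control_integrable[OF c] \<open>0 \<le> t\<close> \<open>t \<le> T\<close>] le nn
        unfolding a_def L2_norm_sq_def by linarith
      also have "\<dots> \<le> real n / (2 * k\<^sup>2)" using n k by (simp add: field_simps)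
      finally show "a t \<le> real n / (2 * k\<^sup>2)" .
    qed
    then have "k * sqrt (V t) \<le> k * sqrt (2 ^ n)" using k by simp
    then show "norm (X t) \<le> k * sqrt (2 ^ n)" using Xb[of t] t by simp
  qed
qed

text \<open>Only \<open>X'\<close> needs a bound: \<open>F\<close> is compared at \<open>X'\<close>
  and at \<open>X'\<close> plus the difference of the noise parts, which is the origin of the radius
  \<open>R + \<eta>\<close>.\<close>

lemma controlled_comparison:
  assumes c: "controlled T \<psi> X" "controlled T \<psi>' X'" and t: "t \<in> {0..T}"
    and R: "\<And>s. s \<in> {0..t} \<Longrightarrow> norm (X' s) \<le> R"
    and \<eta>: "\<And>s. s \<in> {0..t} \<Longrightarrow> norm (noise_part X s - noise_part X' s) \<le> \<eta>"
    and \<rho>: "\<And>u v. norm u \<le> R + \<eta> \<Longrightarrow> norm v \<le> R + \<eta> \<Longrightarrow> norm (u - v) \<le> \<eta> \<Longrightarrow> norm (F u - F v) \<le> \<rho>"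
  shows "norm (X t - X' t) \<le> exp (- lam * t) * norm (X 0 - X' 0) + M * \<rho> / lam + \<eta>"
proof -
  let ?z = "noise_part X" and ?z' = "noise_part X'"
  have tT: "0 \<le> t" "t \<le> T" using t by auto
  have "norm ((X t - ?z t) - (X' t - ?z' t)) \<le> exp (- lam * t) * norm ((X 0 - ?z 0) - (X' 0 - ?z' 0)) + M * \<rho> / lam"
  proof (rule mild_comparison[OF mild_restrict[OF mild_part[OF c(1)] tT(2)] mild_restrict[OF mild_part[OF c(2)] tT(2)]])
    show "continuous_on {0..t} ?z" using tT by (intro continuous_on_subset[OF noise_part_cont[OF c(1)]]) auto
    fix s assume s: "s \<in> {0..t}"
    show "norm (F (X' s - ?z' s + ?z s) - F (X' s - ?z' s + ?z' s)) \<le> \<rho>"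
    proof (rule \<rho>)
      have eq: "X' s - ?z' s + ?z s = X' s + (?z s - ?z' s)" by simp
      show "norm (X' s - ?z' s + ?z s) \<le> R + \<eta>"
        unfolding eq using R[OF s] \<eta>[OF s] norm_triangle_ineq[of "X' s" "?z s - ?z' s"] by linarith
      show "norm (X' s - ?z' s + ?z' s) \<le> R + \<eta>"
        using R[OF s] order_trans[OF norm_ge_zero \<eta>[OF s]] by simp
      show "norm ((X' s - ?z' s + ?z s) - (X' s - ?z' s + ?z' s)) \<le> \<eta>" using \<eta>[OF s] by simp
    qed
  qed (rule tT(1))
  moreover have "X t - X' t = ((X t - ?z t) - (X' t - ?z' t)) + (?z t - ?z' t)" by simp
  then have "norm (X t - X' t) \<le> norm ((X t - ?z t) - (X' t - ?z' t)) + norm (?z t - ?z' t)"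
    by (metis norm_triangle_ineq)
  ultimately show ?thesis using \<eta>[of t] tT by simp
qed

text \<open>Comparison with the zero solution, available because \<open>F 0 = 0\<close>.\<close>

lemma controlled_decay:
  assumes c: "controlled T \<psi> X" and t: "t \<in> {0..T}"
    and \<eta>: "\<And>s. s \<in> {0..t} \<Longrightarrow> norm (noise_part X s) \<le> \<eta>"
    and \<rho>: "\<And>u. norm u \<le> \<eta> \<Longrightarrow> norm (F u) \<le> \<rho>"
  shows "norm (X t) \<le> exp (- lam * t) * norm (X 0) + M * \<rho> / lam + \<eta>"
proof -
  have tT: "0 \<le> t" "t \<le> T" using t by auto
  have zero: "mild t (\<lambda>t. F (0 + 0)) (\<lambda>t. 0)" using mild_zero F_0 by simp
  have "norm ((X t - noise_part X t) - 0) \<le> exp (- lam * t) * norm ((X 0 - noise_part X 0) - 0) + M * \<rho> / lam"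
  proof (rule mild_comparison[OF mild_restrict[OF mild_part[OF c] tT(2)] zero])
    show "continuous_on {0..t} (noise_part X)" using tT by (intro continuous_on_subset[OF noise_part_cont[OF c]]) auto
    fix s assume s: "s \<in> {0..t}"
    show "norm (F (0 + noise_part X s) - F (0 + 0)) \<le> \<rho>" using \<rho>[OF \<eta>[OF s]] F_0 by simp
  qed (rule tT(1))
  moreover have "norm (X t) \<le> norm (X t - noise_part X t) + norm (noise_part X t)"
    using norm_triangle_ineq[of "X t - noise_part X t" "noise_part X t"] by simp
  ultimately show ?thesis using \<eta>[of t] tT by simp
qed

end

section \<open>Mean-square completeness, time shifts and measurability of integrands\<close>

text \<open>On a finite measure space a mean-square Cauchy sequence is Cauchy in the mean, which
  yields an almost everywhere convergent subsequence; Fatou's lemma brings the limit back to mean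
  square.\<close>

lemma L2_cauchy_limit:
  fixes v :: "nat \<Rightarrow> 'a \<Rightarrow> 'h::{banach, second_countable_topology}"
  assumes fin: "finite_measure M" and meas: "\<And>n. v n \<in> borel_measurable M"
    and int: "\<And>n. integrable M (\<lambda>x. (norm (v n x))\<^sup>2)"
    and cau: "\<And>e. e > 0 \<Longrightarrow> \<exists>N. \<forall>n\<ge>N. \<forall>k\<ge>N. (LINT x|M. (norm (v n x - v k x))\<^sup>2) \<le> e"
  obtains \<psi> where "\<psi> \<in> borel_measurable M" "integrable M (\<lambda>x. (norm (\<psi> x))\<^sup>2)"
    "\<And>n. integrable M (\<lambda>x. (norm (\<psi> x - v n x))\<^sup>2)"
    "(\<lambda>n. LINT x|M. (norm (\<psi> x - v n x))\<^sup>2) \<longlonglongrightarrow> 0"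
proof -
  interpret finite_measure M by (rule fin)
  have [measurable]: "v n \<in> borel_measurable M" for n by (rule meas)
  have sq: "(norm (a - b))\<^sup>2 \<le> 2 * (norm a)\<^sup>2 + 2 * (norm b)\<^sup>2" for a b :: 'h
  proof -
    have "(norm (a - b))\<^sup>2 \<le> (norm a + norm b)\<^sup>2" by (intro power_mono norm_triangle_ineq4) simp
    also have "\<dots> \<le> 2 * (norm a)\<^sup>2 + 2 * (norm b)\<^sup>2"
      using zero_le_power2[of "norm a - norm b"] by (simp add: power2_eq_square algebra_simps)
    finally show ?thesis .
  qed
  have intd: "integrable M (\<lambda>x. (norm (v n x - v k x))\<^sup>2)" for n k
  proof (rule Bochner_Integration.integrable_bound)
    show "integrable M (\<lambda>x. 2 * (norm (v n x))\<^sup>2 + 2 * (norm (v k x))\<^sup>2)" using int by simp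
    show "AE x in M. norm ((norm (v n x - v k x))\<^sup>2) \<le> norm (2 * (norm (v n x))\<^sup>2 + 2 * (norm (v k x))\<^sup>2)"
      using sq by (intro AE_I2) simp
  qed simp
  \<comment> \<open>This takes the place of Cauchy-Schwarz: \<open>e\<close> is chosen small against
    the total mass first, and then the second moment small against \<open>e\<close>.\<close>
  have le1: "norm a \<le> e + (norm a)\<^sup>2 / e" if "e > 0" for a :: 'h and e :: real
  proof (cases "norm a \<le> e")
    case True
    then show ?thesis using that by (simp add: add_increasing2)
  next
    case False
    then have "norm a * e \<le> norm a * norm a" by (intro mult_left_mono) auto
    then have "norm a \<le> (norm a)\<^sup>2 / e" using that by (simp add: pos_le_divide_eq power2_eq_square)
    then show ?thesis using that by simp
  qed
  have int1: "integrable M (v n)" for n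
  proof (rule Bochner_Integration.integrable_bound)
    show "integrable M (\<lambda>x. 1 + (norm (v n x))\<^sup>2)" using int by simp
    show "AE x in M. norm (v n x) \<le> norm (1 + (norm (v n x))\<^sup>2)" using le1[of 1] by (intro AE_I2) simp
  qed simp
  have "\<exists>N. \<forall>n\<ge>N. \<forall>k\<ge>N. (LINT x|M. norm (v n x - v k x)) < e" if e: "e > 0" for e
  proof -
    define m where "m = measure M (space M)"
    define d where "d = e / (2 * (m + 1))"
    have m: "m \<ge> 0" by (simp add: m_def)
    have d: "d > 0" "d * m < e / 2" using e m by (auto simp: d_def field_simps)
    have de: "d * e / 2 > 0" using d e by simp
    obtain N where N: "\<And>n k. n \<ge> N \<Longrightarrow> k \<ge> N \<Longrightarrow> (LINT x|M. (norm (v n x - v k x))\<^sup>2) \<le> d * e / 2"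
      using cau[OF de] by blast
    have "(LINT x|M. norm (v n x - v k x)) < e" if "n \<ge> N" "k \<ge> N" for n k
    proof -
      have "(LINT x|M. norm (v n x - v k x)) \<le> (LINT x|M. d + (norm (v n x - v k x))\<^sup>2 / d)"
        using int1 intd le1[OF d(1)] by (intro integral_mono) auto
      also have "\<dots> = d * m + (LINT x|M. (norm (v n x - v k x))\<^sup>2) / d"
        using intd by (simp add: m_def)
      also have "\<dots> \<le> d * m + (d * e / 2) / d"
        using N[OF that] d by (intro add_left_mono divide_right_mono) auto
      also have "\<dots> < e" using d by simp
      finally show ?thesis .
    qed
    then show ?thesis by blast
  qed
  then obtain r where r: "strict_mono r" "AE x in M. Cauchy (\<lambda>i. v (r i) x)"
    using cauchy_L1_AE_cauchy_subseq[of M v] int1 by metis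
  \<comment> \<open>The value 0 off the set of convergence gives a function measurable everywhere
    and matters on a null set only.\<close>
  define \<psi> where "\<psi> x = (if Cauchy (\<lambda>i. v (r i) x) then lim (\<lambda>i. v (r i) x) else 0)" for x
  have \<psi>m [measurable]: "\<psi> \<in> borel_measurable M" unfolding \<psi>_def by measurable
  have lim: "AE x in M. (\<lambda>i. v (r i) x) \<longlonglongrightarrow> \<psi> x"
    using r(2) by eventually_elim (auto simp: \<psi>_def Cauchy_convergent_iff convergent_LIMSEQ_iff)
  have fatou: "(\<integral>\<^sup>+x. ennreal ((norm (\<psi> x - v n x))\<^sup>2) \<partial>M) \<le> ennreal e"
    if N: "\<And>k. k \<ge> N \<Longrightarrow> (LINT x|M. (norm (v k x - v n x))\<^sup>2) \<le> e" for n N e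
  proof -
    have "(\<integral>\<^sup>+x. ennreal ((norm (\<psi> x - v n x))\<^sup>2) \<partial>M) = (\<integral>\<^sup>+x. liminf (\<lambda>i. ennreal ((norm (v (r i) x - v n x))\<^sup>2)) \<partial>M)"
    proof (rule nn_integral_cong_AE)
      show "AE x in M. ennreal ((norm (\<psi> x - v n x))\<^sup>2) = liminf (\<lambda>i. ennreal ((norm (v (r i) x - v n x))\<^sup>2))"
        using lim
      proof eventually_elim
        case (elim x)
        then have "(\<lambda>i. ennreal ((norm (v (r i) x - v n x))\<^sup>2)) \<longlonglongrightarrow> ennreal ((norm (\<psi> x - v n x))\<^sup>2)"
          by (intro tendsto_ennrealI tendsto_intros)
        then show ?case by (rule lim_imp_Liminf[OF sequentially_bot, symmetric])
      qed
    qed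
    also have "\<dots> \<le> liminf (\<lambda>i. \<integral>\<^sup>+x. ennreal ((norm (v (r i) x - v n x))\<^sup>2) \<partial>M)"
      by (rule nn_integral_liminf) simp
    also have "\<dots> = liminf (\<lambda>i. ennreal (LINT x|M. (norm (v (r i) x - v n x))\<^sup>2))"
      using intd by (subst nn_integral_eq_integral) auto
    also have "\<dots> \<le> ennreal e"
    proof (rule Liminf_le)
      have "\<forall>\<^sub>F i in sequentially. r i \<ge> N"
        using filterlim_subseq[OF r(1)] by (auto simp: filterlim_at_top)
      then show "\<forall>\<^sub>F i in sequentially. ennreal (LINT x|M. (norm (v (r i) x - v n x))\<^sup>2) \<le> ennreal e"
        by eventually_elim (intro ennreal_leI N)
    qed simp
    finally show ?thesis .
  qed
  have ints: "integrable M (\<lambda>x. (norm (\<psi> x - v n x))\<^sup>2)" for n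
  proof -
    obtain N where N: "\<And>n k. n \<ge> N \<Longrightarrow> k \<ge> N \<Longrightarrow> (LINT x|M. (norm (v n x - v k x))\<^sup>2) \<le> 1"
      using cau[OF zero_less_one] by blast
    have "(\<integral>\<^sup>+x. ennreal ((norm (\<psi> x - v N x))\<^sup>2) \<partial>M) \<le> ennreal 1"
      by (rule fatou[of N]) (rule N, auto)
    then have iN: "integrable M (\<lambda>x. (norm (\<psi> x - v N x))\<^sup>2)"
      by (auto simp: integrable_iff_bounded intro: le_less_trans)
    show ?thesis
    proof (rule Bochner_Integration.integrable_bound)
      show "integrable M (\<lambda>x. 2 * (norm (\<psi> x - v N x))\<^sup>2 + 2 * (norm (v n x - v N x))\<^sup>2)" using iN intd by simp
      show "AE x in M. norm ((norm (\<psi> x - v n x))\<^sup>2) \<le> norm (2 * (norm (\<psi> x - v N x))\<^sup>2 + 2 * (norm (v n x - v N x))\<^sup>2)"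
      proof (rule AE_I2)
        fix x show "norm ((norm (\<psi> x - v n x))\<^sup>2) \<le> norm (2 * (norm (\<psi> x - v N x))\<^sup>2 + 2 * (norm (v n x - v N x))\<^sup>2)"
          using sq[of "\<psi> x - v N x" "v n x - v N x"] by simp
      qed
    qed simp
  qed
  show ?thesis
  proof (rule that[OF \<psi>m _ ints])
    show "integrable M (\<lambda>x. (norm (\<psi> x))\<^sup>2)"
    proof (rule Bochner_Integration.integrable_bound)
      show "integrable M (\<lambda>x. 2 * (norm (\<psi> x - v 0 x))\<^sup>2 + 2 * (norm (v 0 x))\<^sup>2)" using ints int by simp
      show "AE x in M. norm ((norm (\<psi> x))\<^sup>2) \<le> norm (2 * (norm (\<psi> x - v 0 x))\<^sup>2 + 2 * (norm (v 0 x))\<^sup>2)"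
      proof (rule AE_I2)
        fix x show "norm ((norm (\<psi> x))\<^sup>2) \<le> norm (2 * (norm (\<psi> x - v 0 x))\<^sup>2 + 2 * (norm (v 0 x))\<^sup>2)"
          using sq[of "\<psi> x - v 0 x" "- v 0 x"] by simp
      qed
    qed simp
    show "(\<lambda>n. LINT x|M. (norm (\<psi> x - v n x))\<^sup>2) \<longlonglongrightarrow> 0"
    proof (rule tendstoI)
      fix e :: real assume e: "e > 0"
      then obtain N where N: "\<And>n k. n \<ge> N \<Longrightarrow> k \<ge> N \<Longrightarrow> (LINT x|M. (norm (v n x - v k x))\<^sup>2) \<le> e / 2"
        using cau[of "e / 2"] by auto
      have "(LINT x|M. (norm (\<psi> x - v n x))\<^sup>2) \<le> e / 2" if "n \<ge> N" for n
      proof -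
        have "ennreal (LINT x|M. (norm (\<psi> x - v n x))\<^sup>2) = (\<integral>\<^sup>+x. ennreal ((norm (\<psi> x - v n x))\<^sup>2) \<partial>M)"
          using ints by (subst nn_integral_eq_integral) auto
        also have "\<dots> \<le> ennreal (e / 2)" by (rule fatou[of N]) (rule N[OF _ that])
        finally show ?thesis using e by (simp add: ennreal_le_iff)
      qed
      then have "dist (LINT x|M. (norm (\<psi> x - v n x))\<^sup>2) 0 < e" if "n \<ge> N" for n
        using that e by (force simp: dist_real_def)
      then show "\<forall>\<^sub>F n in sequentially. dist (LINT x|M. (norm (\<psi> x - v n x))\<^sup>2) 0 < e"
        unfolding eventually_sequentially by blast
    qed
  qed
qed

lemma lebesgue_on_shift:
  fixes a b :: real
  shows "(\<lambda>s. s + a) \<in> lebesgue_on {0..b - a} \<rightarrow>\<^sub>M lebesgue_on {a..b}"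
    "\<And>f :: real \<Rightarrow> real. integrable (lebesgue_on {a..b}) f \<Longrightarrow>
      integrable (lebesgue_on {0..b - a}) (\<lambda>s. f (s + a)) \<and>
      (LINT s|lebesgue_on {0..b - a}. f (s + a)) = (LINT s|lebesgue_on {a..b}. f s)"
proof -
  have m: "(\<lambda>s. a + 1 * s) \<in> lebesgue \<rightarrow>\<^sub>M lebesgue"
    using lebesgue_affine_measurable[of "\<lambda>_. 1" a] by simp
  then have m': "(\<lambda>s. s + a) \<in> lebesgue \<rightarrow>\<^sub>M lebesgue" by (simp add: add.commute)
  then show "(\<lambda>s. s + a) \<in> lebesgue_on {0..b - a} \<rightarrow>\<^sub>M lebesgue_on {a..b}"
    by (intro measurable_restrict_space2 measurable_restrict_space1) auto
  have D: "lebesgue = distr lebesgue lebesgue (\<lambda>s. s + a)"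
    using lebesgue_real_affine[of 1 a] by (simp add: density_1 add.commute)
  fix f :: "real \<Rightarrow> real" assume f: "integrable (lebesgue_on {a..b}) f"
  let ?g = "\<lambda>s. indicator {a..b} s *\<^sub>R f s"
  have g: "integrable lebesgue ?g" using f by (simp add: integrable_restrict_space)
  have gm: "?g \<in> borel_measurable lebesgue" using g by (rule borel_measurable_integrable)
  have ind: "(\<lambda>s. ?g (s + a)) = (\<lambda>s. indicator {0..b - a} s *\<^sub>R f (s + a))"
    by (auto simp: indicator_def fun_eq_iff)
  have "integrable lebesgue (\<lambda>s. ?g (s + a))"
    using integrable_distr_eq[OF m' gm] g D by simp
  then have 1: "integrable (lebesgue_on {0..b - a}) (\<lambda>s. f (s + a))"
    unfolding ind by (simp add: integrable_restrict_space)
  have "(LINT s|lebesgue_on {0..b - a}. f (s + a)) = (LINT s|lebesgue. ?g (s + a))"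
    unfolding ind by (simp add: integral_restrict_space)
  also have "\<dots> = (LINT s|lebesgue. ?g s)"
    using integral_distr[OF m' gm] D by simp
  also have "\<dots> = (LINT s|lebesgue_on {a..b}. f s)"
    by (simp add: integral_restrict_space)
  finally show "integrable (lebesgue_on {0..b - a}) (\<lambda>s. f (s + a)) \<and>
      (LINT s|lebesgue_on {0..b - a}. f (s + a)) = (LINT s|lebesgue_on {a..b}. f s)" using 1 by simp
qed

context controlled_system begin

text \<open>By the flow identity, \<open>noise_part X (t + a) - S t (noise_part X a)\<close> is the
  noise part of the restarted path. This allows the energy spent on a window to be compared with the
  rate on a later part of it.\<close>

lemma controlled_restart:
  assumes c: "controlled T \<psi> X" and a: "0 \<le> a" "a \<le> T"
  shows "controlled (T - a) (\<lambda>s. \<psi> (s + a)) (\<lambda>s. X (s + a))"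
    "L2_norm_sq (\<lambda>s. \<psi> (s + a)) {0..T - a} = L2_norm_sq \<psi> {a..T}"
proof -
  have ip: "integrable (lebesgue_on {a..T}) (\<lambda>s. (norm (\<psi> s))\<^sup>2)"
    using a by (intro integrable_lebesgue_on_subinterval[OF control_integrable[OF c]]) auto
  note sh = lebesgue_on_shift(2)[OF ip]
  show "L2_norm_sq (\<lambda>s. \<psi> (s + a)) {0..T - a} = L2_norm_sq \<psi> {a..T}"
    using sh by (simp add: L2_norm_sq_def)
  have "\<psi> \<in> borel_measurable (lebesgue_on {a..T})"
    using c a unfolding controlled_def square_integrable_on_def by (auto elim!: measurable_restrict_mono)
  from measurable_compose[OF lebesgue_on_shift(1) this]
  have sq: "square_integrable_on (\<lambda>s. \<psi> (s + a)) {0..T - a}"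
    using sh by (simp add: square_integrable_on_def)
  have cont: "continuous_on {0..T - a} (\<lambda>s. X (s + a))"
    by (rule continuous_on_compose2[OF controlled_cont[OF c]]) (use a in \<open>auto intro!: continuous_intros\<close>)
  have "\<exists>y. has_weak_integral (lebesgue_on {0..t}) (\<lambda>s. SQ (t - s) (B (X (s + a)) (\<psi> (s + a)))) y \<and>
      X (t + a) = S t (X a) + integral {0..t} (\<lambda>s. S (t - s) (F (X (s + a)))) + y" if t: "t \<in> {0..T - a}" for t
  proof (intro exI conjI)
    let ?y = "noise_part X (t + a) - S t (noise_part X a)"
    have w: "has_weak_integral (lebesgue_on {a..t + a}) (\<lambda>s. SQ (t + a - s) (B (X s) (\<psi> s))) ?y"
      using weak_integral_flow[OF a(1) _ noise_part_weak[OF c] noise_part_weak[OF c], of "t + a"] t a by simp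
    show "has_weak_integral (lebesgue_on {0..t}) (\<lambda>s. SQ (t - s) (B (X (s + a)) (\<psi> (s + a)))) ?y"
      unfolding has_weak_integral_def
    proof
      fix xs :: "'e \<Rightarrow>\<^sub>L real"
      have "integrable (lebesgue_on {a..t + a}) (\<lambda>s. blinfun_apply xs (SQ (t + a - s) (B (X s) (\<psi> s))))"
        "(LINT s|lebesgue_on {a..t + a}. blinfun_apply xs (SQ (t + a - s) (B (X s) (\<psi> s)))) = blinfun_apply xs ?y"
        using w unfolding has_weak_integral_def by blast+
      with lebesgue_on_shift(2)[OF this(1)]
      show "integrable (lebesgue_on {0..t}) (\<lambda>s. blinfun_apply xs (SQ (t - s) (B (X (s + a)) (\<psi> (s + a))))) \<and>
        (LINT s|lebesgue_on {0..t}. blinfun_apply xs (SQ (t - s) (B (X (s + a)) (\<psi> (s + a))))) = blinfun_apply xs ?y"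
        by simp
    qed
    have "X (t + a) - noise_part X (t + a) = S t (X a - noise_part X a) +
        integral {a..t + a} (\<lambda>s. S (t + a - s) (F (X s)))"
      using mild_step[OF mild_part[OF c], of a "t + a"] a t by simp
    moreover have "integral {a..t + a} (\<lambda>s. S (t + a - s) (F (X s))) = integral {0..t} (\<lambda>s. S (t - s) (F (X (s + a))))"
      using integral_shift_real_ivl[of a a "t + a" "\<lambda>s. S (t + a - s) (F (X s))"] by simp
    ultimately show "X (t + a) = S t (X a) + integral {0..t} (\<lambda>s. S (t - s) (F (X (s + a)))) + ?y"
      by (simp add: blinfun.diff_right algebra_simps)
  qed
  then show "controlled (T - a) (\<lambda>s. \<psi> (s + a)) (\<lambda>s. X (s + a))"
    using sq cont by (simp add: controlled_def controlled_solution_def)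
qed

text \<open>The singularity at \<open>s = t\<close> is kept away by factoring through
  \<open>SQ d\<close> with \<open>d\<close> half of the remaining time; the semigroup is jointly
  continuous in time and vector.\<close>

lemma SQ_jointly_cont: "continuous_on ({..<t} \<times> UNIV) (\<lambda>(s, h). SQ (t - s) h)"
proof (rule continuous_at_imp_continuous_on, rule ballI)
  fix p :: "real \<times> 'h" assume p: "p \<in> {..<t} \<times> UNIV"
  define d where "d = (t - fst p) / 2"
  have d: "d > 0" "fst p < t - d" using p by (auto simp: d_def field_simps)
  have "continuous_on ({..<t - d} \<times> UNIV) (\<lambda>p. S (t - d - fst p) (SQ d (snd p)))"
    by (rule S_jointly_cont) (auto intro!: continuous_intros)
  moreover have "S (t - d - fst q) (SQ d (snd q)) = (\<lambda>(s, h). SQ (t - s) h) q" if "q \<in> {..<t - d} \<times> UNIV" for q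
    using SQ_add[of "t - d - fst q" d "snd q"] that d by (cases q) simp
  ultimately have "continuous_on ({..<t - d} \<times> UNIV) (\<lambda>(s, h). SQ (t - s) h)"
    by (rule continuous_on_eq)
  moreover have "open ({..<t - d} \<times> (UNIV :: 'h set))" by (intro open_Times) auto
  ultimately show "isCont (\<lambda>(s, h). SQ (t - s) h) p"
    using d p by (subst (asm) continuous_on_eq_continuous_at) auto
qed

lemma B_cont:
  assumes X: "continuous_on U X" and h: "continuous_on U h"
  shows "continuous_on U (\<lambda>s. B (X s) (h s))"
  unfolding continuous_on_def
proof
  fix a assume a: "a \<in> U"
  let ?F = "at a within U"
  have lim: "(X \<longlongrightarrow> X a) ?F" "(h \<longlongrightarrow> h a) ?F" using X h a by (auto simp: continuous_on_def)
  have "((\<lambda>s. (B (X s) - B (X a)) (h s)) \<longlongrightarrow> 0) ?F"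
  proof (rule Lim_null_comparison)
    show "\<forall>\<^sub>F s in ?F. norm ((B (X s) - B (X a)) (h s)) \<le> \<kappa> * norm (X s - X a) * norm (h s)"
      using B_lipschitz by simp
    have "((\<lambda>s. \<kappa> * norm (X s - X a) * norm (h s)) \<longlongrightarrow> \<kappa> * norm (X a - X a) * norm (h a)) ?F"
      by (intro tendsto_intros lim)
    then show "((\<lambda>s. \<kappa> * norm (X s - X a) * norm (h s)) \<longlongrightarrow> 0) ?F" by simp
  qed
  moreover have "((\<lambda>s. B (X a) (h s)) \<longlongrightarrow> B (X a) (h a)) ?F" by (intro tendsto_intros lim)
  ultimately have "((\<lambda>s. (B (X s) - B (X a)) (h s) + B (X a) (h s)) \<longlongrightarrow> 0 + B (X a) (h a)) ?F"
    by (rule tendsto_add)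
  then show "((\<lambda>s. B (X s) (h s)) \<longlongrightarrow> B (X a) (h a)) ?F" by (simp add: blinfun.diff_left)
qed

text \<open>A function jointly continuous in time and control value is composed with the measurable
  map \<open>s \<mapsto> (s, v s)\<close>.\<close>

lemma integrand_measurable:
  fixes v :: "real \<Rightarrow> 'h" and xs :: "'e \<Rightarrow>\<^sub>L real"
  assumes X: "continuous_on {0..T} X" and t: "t \<le> T" and v: "v \<in> borel_measurable (lebesgue_on {0..t})"
  shows "(\<lambda>s. blinfun_apply xs (SQ (t - s) (B (X s) (v s)))) \<in> borel_measurable (lebesgue_on {0..t})"
proof -
  let ?A = "{0..<t} \<times> (UNIV :: 'h set)"
  define G where "G s = blinfun_apply xs (SQ (t - s) (B (X s) (v s)))" for s
  let ?g = "\<lambda>p. blinfun_apply xs (SQ (t - fst p) (B (X (fst p)) (snd p)))"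
  have Bc: "continuous_on ?A (\<lambda>p. B (X (fst p)) (snd p))"
    by (intro B_cont continuous_on_compose2[OF X] continuous_intros) (use t in auto)
  have "continuous_on ?A (\<lambda>p. (\<lambda>(s, h). SQ (t - s) h) (fst p, B (X (fst p)) (snd p)))"
    by (rule continuous_on_compose2[OF SQ_jointly_cont]) (auto intro!: continuous_intros Bc)
  then have "continuous_on ?A ?g" by (auto intro!: continuous_intros)
  moreover have "?A \<in> sets borel" by (intro borel_Times) auto
  ultimately have g: "(\<lambda>p. indicator ?A p *\<^sub>R ?g p) \<in> borel_measurable borel"
    by (rule borel_measurable_continuous_on_indicator[rotated])
  have "(\<lambda>s. (s, v s)) \<in> lebesgue_on {0..t} \<rightarrow>\<^sub>M (borel \<Otimes>\<^sub>M borel)"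
  proof (rule measurable_Pair)
    show "(\<lambda>s. s) \<in> borel_measurable (lebesgue_on {0..t})"
      by (rule measurable_restrict_space1) (simp add: measurable_completion)
  qed (rule v)
  then have "(\<lambda>s. (s, v s)) \<in> borel_measurable (lebesgue_on {0..t})" by (simp add: borel_prod)
  from measurable_compose[OF this g]
  have m1: "(\<lambda>s. indicator {0..<t} s * G s) \<in> borel_measurable (lebesgue_on {0..t})"
    by (simp add: indicator_times G_def)
  \<comment> \<open>Joint continuity stops short of \<open>s = t\<close>; that single time is added
    as a constant multiple of an indicator.\<close>
  have m2: "(\<lambda>s. indicator {t} s * G t) \<in> borel_measurable (lebesgue_on {0..t})"
    by (rule measurable_restrict_space1[OF borel_measurable_times[OF borel_measurable_indicator borel_measurable_const]]) simp
  have "(\<lambda>s. indicator {0..<t} s * G s + indicator {t} s * G t) \<in> borel_measurable (lebesgue_on {0..t})"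
    using m1 m2 by simp
  then have "G \<in> borel_measurable (lebesgue_on {0..t})"
    by (rule measurable_cong[THEN iffD1, rotated]) (auto simp: indicator_def)
  then show ?thesis unfolding G_def .
qed

end

section \<open>Closedness under uniform limits\<close>

lemma ennreal_power2_le_imp:
  assumes "x\<^sup>2 \<le> (ennreal b)\<^sup>2" "b \<ge> 0"
  shows "x \<le> ennreal b"
proof (cases x)
  case (real a)
  then have "ennreal (a\<^sup>2) \<le> ennreal (b\<^sup>2)" using assms by (simp add: ennreal_power)
  then have "a\<^sup>2 \<le> b\<^sup>2" by (simp add: ennreal_le_iff)
  then show ?thesis using real assms by (simp add: abs_le_square_iff[symmetric] ennreal_leI)
next
  case top
  then show ?thesis using assms by (simp add: ennreal_power top_unique)
qed

context controlled_system begin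

text \<open>Stated for \<open>w\<close> dominated by a multiple of \<open>v\<close>, so as to serve
  both \<open>B\<close> applied to a control and the difference of \<open>B\<close> along two paths
  applied to a control.\<close>

lemma noise_functional_bound:
  obtains K where "K \<ge> 0" "\<And>t v w xs c. 0 \<le> t \<Longrightarrow> (\<lambda>s. blinfun_apply xs (SQ (t - s) (w s))) \<in> borel_measurable (lebesgue_on {0..t}) \<Longrightarrow>
    square_integrable_on v {0..t} \<Longrightarrow> c \<ge> 0 \<Longrightarrow> (\<And>s. s \<in> {0..t} \<Longrightarrow> norm (w s) \<le> c * norm (v s :: 'h)) \<Longrightarrow>
    integrable (lebesgue_on {0..t}) (\<lambda>s. blinfun_apply (xs :: 'e \<Rightarrow>\<^sub>L real) (SQ (t - s) (w s))) \<and>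
    \<bar>LINT s|lebesgue_on {0..t}. blinfun_apply xs (SQ (t - s) (w s))\<bar> \<le> K * norm xs * c * sqrt (L2_norm_sq v {0..t})"
proof -
  obtain K where K: "K \<ge> 0" "\<And>T xs. energy T xs \<le> ennreal (K\<^sup>2 * (norm xs)\<^sup>2)" using energy_bound by blast
  show ?thesis
  proof (rule that[OF K(1)])
    fix t c :: real and v w :: "real \<Rightarrow> 'h" and xs :: "'e \<Rightarrow>\<^sub>L real"
    let ?f = "\<lambda>s. blinfun_apply xs (SQ (t - s) (w s))"
    assume t: "0 \<le> t" and m: "?f \<in> borel_measurable (lebesgue_on {0..t})"
      and v: "square_integrable_on v {0..t}" and c: "c \<ge> 0" and wv: "\<And>s. s \<in> {0..t} \<Longrightarrow> norm (w s) \<le> c * norm (v s)"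
    have vi: "v \<in> borel_measurable (lebesgue_on {0..t})" "integrable (lebesgue_on {0..t}) (\<lambda>s. (norm (v s))\<^sup>2)"
      using v by (auto simp: square_integrable_on_def)
    define b where "b = K * norm xs * c * sqrt (L2_norm_sq v {0..t})"
    have L0: "L2_norm_sq v {0..t} \<ge> 0" by (simp add: L2_norm_sq_def)
    have b: "b \<ge> 0" using K c L0 by (simp add: b_def)
    have "(\<integral>\<^sup>+s. ennreal \<bar>?f s\<bar> \<partial>lebesgue_on {0..t})\<^sup>2 \<le>
        energy (t - 0) xs * (\<integral>\<^sup>+s. ennreal ((c * norm (v s))\<^sup>2) \<partial>lebesgue_on {0..t})"
      using vi(1) by (intro kernel_Cauchy_Schwarz[OF t _ wv]) simp_all
    also have "(\<integral>\<^sup>+s. ennreal ((c * norm (v s))\<^sup>2) \<partial>lebesgue_on {0..t}) = ennreal (c\<^sup>2 * L2_norm_sq v {0..t})"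
      unfolding L2_norm_sq_def power_mult_distrib using vi(2) by (subst nn_integral_eq_integral) auto
    also have "energy (t - 0) xs * ennreal (c\<^sup>2 * L2_norm_sq v {0..t}) \<le>
        ennreal (K\<^sup>2 * (norm xs)\<^sup>2) * ennreal (c\<^sup>2 * L2_norm_sq v {0..t})"
      by (intro mult_right_mono K) simp
    also have "\<dots> = ennreal (b\<^sup>2)"
      using L0 by (simp add: ennreal_mult[symmetric] b_def power_mult_distrib mult.assoc)
    also have "\<dots> = (ennreal b)\<^sup>2" using b by (simp add: ennreal_power)
    finally have le: "(\<integral>\<^sup>+s. ennreal \<bar>?f s\<bar> \<partial>lebesgue_on {0..t}) \<le> ennreal b"
      by (rule ennreal_power2_le_imp) (rule b)
    have int: "integrable (lebesgue_on {0..t}) ?f"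
      unfolding integrable_iff_bounded using m le by (auto intro: le_less_trans)
    have "ennreal \<bar>LINT s|lebesgue_on {0..t}. ?f s\<bar> \<le> (\<integral>\<^sup>+s. ennreal \<bar>?f s\<bar> \<partial>lebesgue_on {0..t})"
      using integral_norm_bound_ennreal[OF int] by simp
    with le have "ennreal \<bar>LINT s|lebesgue_on {0..t}. ?f s\<bar> \<le> ennreal b" by (rule order_trans[rotated])
    then have "\<bar>LINT s|lebesgue_on {0..t}. ?f s\<bar> \<le> b" using b by (simp add: ennreal_le_iff)
    then show "integrable (lebesgue_on {0..t}) ?f \<and> \<bar>LINT s|lebesgue_on {0..t}. ?f s\<bar> \<le> K * norm xs * c * sqrt (L2_norm_sq v {0..t})"
      using int by (simp add: b_def)
  qed
qed

lemma square_integrable_on_subinterval: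
  assumes "square_integrable_on v {0..T}" "t \<le> T"
  shows "square_integrable_on v {0..t}" "L2_norm_sq v {0..t} \<le> L2_norm_sq v {0..T}"
proof -
  have i: "integrable (lebesgue_on {0..T}) (\<lambda>s. (norm (v s))\<^sup>2)" using assms by (simp add: square_integrable_on_def)
  have m: "v \<in> borel_measurable (lebesgue_on {0..t})"
    using assms by (auto simp: square_integrable_on_def elim!: measurable_restrict_mono)
  show "square_integrable_on v {0..t}"
    unfolding square_integrable_on_def
    using m assms(2) by (auto intro: integrable_lebesgue_on_subinterval[OF i])
  show "L2_norm_sq v {0..t} \<le> L2_norm_sq v {0..T}"
  proof (cases "0 \<le> t")
    case True
    have "0 \<le> (LINT s|lebesgue_on {t..T}. (norm (v s))\<^sup>2)" by simp
    then show ?thesis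
      using integral_lebesgue_on_combine[OF i True assms(2)] unfolding L2_norm_sq_def by linarith
  next
    case False
    then show ?thesis by (simp add: L2_norm_sq_def)
  qed
qed

lemma square_integrable_on_lincomb:
  fixes u v :: "real \<Rightarrow> 'h"
  assumes u: "square_integrable_on u U" and v: "square_integrable_on v U"
  shows "square_integrable_on (\<lambda>s. a *\<^sub>R u s + b *\<^sub>R v s) U"
proof -
  have m: "u \<in> borel_measurable (lebesgue_on U)" "v \<in> borel_measurable (lebesgue_on U)"
    and i: "integrable (lebesgue_on U) (\<lambda>s. (norm (u s))\<^sup>2)" "integrable (lebesgue_on U) (\<lambda>s. (norm (v s))\<^sup>2)"
    using u v by (auto simp: square_integrable_on_def)
  have mm: "(\<lambda>s. a *\<^sub>R u s + b *\<^sub>R v s) \<in> borel_measurable (lebesgue_on U)" using m by simp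
  have "integrable (lebesgue_on U) (\<lambda>s. (norm (a *\<^sub>R u s + b *\<^sub>R v s))\<^sup>2)"
  proof (rule Bochner_Integration.integrable_bound)
    show "integrable (lebesgue_on U) (\<lambda>s. 2 * a\<^sup>2 * (norm (u s))\<^sup>2 + 2 * b\<^sup>2 * (norm (v s))\<^sup>2)" using i by simp
    show "(\<lambda>s. (norm (a *\<^sub>R u s + b *\<^sub>R v s))\<^sup>2) \<in> borel_measurable (lebesgue_on U)" using mm by simp
    show "AE s in lebesgue_on U. norm ((norm (a *\<^sub>R u s + b *\<^sub>R v s))\<^sup>2) \<le> norm (2 * a\<^sup>2 * (norm (u s))\<^sup>2 + 2 * b\<^sup>2 * (norm (v s))\<^sup>2)"
    proof (rule AE_I2)
      fix s
      have "(norm (a *\<^sub>R u s + b *\<^sub>R v s))\<^sup>2 \<le> (norm (a *\<^sub>R u s) + norm (b *\<^sub>R v s))\<^sup>2"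
        by (intro power_mono norm_triangle_ineq) simp
      also have "\<dots> \<le> 2 * (norm (a *\<^sub>R u s))\<^sup>2 + 2 * (norm (b *\<^sub>R v s))\<^sup>2"
        using zero_le_power2[of "norm (a *\<^sub>R u s) - norm (b *\<^sub>R v s)"] by (simp add: power2_eq_square algebra_simps)
      also have "\<dots> = 2 * a\<^sup>2 * (norm (u s))\<^sup>2 + 2 * b\<^sup>2 * (norm (v s))\<^sup>2" by (simp add: power_mult_distrib)
      finally show "norm ((norm (a *\<^sub>R u s + b *\<^sub>R v s))\<^sup>2) \<le> norm (2 * a\<^sup>2 * (norm (u s))\<^sup>2 + 2 * b\<^sup>2 * (norm (v s))\<^sup>2)" by simp
    qed
  qed
  then show ?thesis using mm by (simp add: square_integrable_on_def)
qed

lemma L2_parallelogram: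
  fixes u v :: "real \<Rightarrow> 'h"
  assumes u: "square_integrable_on u U" and v: "square_integrable_on v U"
  shows "(LINT s|lebesgue_on U. (norm (u s - v s))\<^sup>2) =
    2 * L2_norm_sq u U + 2 * L2_norm_sq v U - 4 * L2_norm_sq (\<lambda>s. (1/2) *\<^sub>R u s + (1/2) *\<^sub>R v s) U"
proof -
  have i: "integrable (lebesgue_on U) (\<lambda>s. (norm (u s))\<^sup>2)" "integrable (lebesgue_on U) (\<lambda>s. (norm (v s))\<^sup>2)"
    "integrable (lebesgue_on U) (\<lambda>s. (norm ((1/2) *\<^sub>R u s + (1/2) *\<^sub>R v s))\<^sup>2)"
    using u v square_integrable_on_lincomb[OF u v, of "1/2" "1/2"] by (auto simp: square_integrable_on_def)
  have "(norm (x - y))\<^sup>2 = 2 * (norm x)\<^sup>2 + 2 * (norm y)\<^sup>2 - 4 * (norm ((1/2) *\<^sub>R x + (1/2) *\<^sub>R y))\<^sup>2" for x y :: 'h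
    by (simp add: power2_norm_eq_inner inner_simps inner_commute)
  then have "(LINT s|lebesgue_on U. (norm (u s - v s))\<^sup>2) =
      (LINT s|lebesgue_on U. 2 * (norm (u s))\<^sup>2 + 2 * (norm (v s))\<^sup>2 - 4 * (norm ((1/2) *\<^sub>R u s + (1/2) *\<^sub>R v s))\<^sup>2)" by simp
  also have "\<dots> = 2 * L2_norm_sq u U + 2 * L2_norm_sq v U - 4 * L2_norm_sq (\<lambda>s. (1/2) *\<^sub>R u s + (1/2) *\<^sub>R v s) U"
    unfolding L2_norm_sq_def using i by simp
  finally show ?thesis .
qed

text \<open>The controls that are admissible up to an error \<open>\<epsilon>\<close> form a convex set.  Almost minimal elements
  of these sets, as \<open>\<epsilon> \<rightarrow> 0\<close>, are Cauchy by the parallelogram law; this replaces weak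
  compactness of balls in \<open>L\<^sup>2\<close>.\<close>

definition almost_controls :: "real \<Rightarrow> (real \<Rightarrow> 'e) \<Rightarrow> real \<Rightarrow> real \<Rightarrow> (real \<Rightarrow> 'h) set" where
  "almost_controls T X E \<epsilon> = {v. square_integrable_on v {0..T} \<and> L2_norm_sq v {0..T} \<le> E + \<epsilon> \<and>
     (\<forall>t\<in>{0..T}. \<forall>xs :: 'e \<Rightarrow>\<^sub>L real. \<bar>(LINT s|lebesgue_on {0..t}. blinfun_apply xs (SQ (t - s) (B (X s) (v s)))) -
        blinfun_apply xs (noise_part X t)\<bar> \<le> \<epsilon> * norm xs)}"

lemma almost_controls_mono: "\<epsilon> \<le> \<epsilon>' \<Longrightarrow> almost_controls T X E \<epsilon> \<subseteq> almost_controls T X E \<epsilon>'"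
  unfolding almost_controls_def
  by (auto intro: order_trans mult_right_mono) (meson mult_right_mono norm_ge_zero order_trans atLeastAtMost_iff)

text \<open>For fixed \<open>X\<close> the integral is linear in the control; the bound makes it
  continuous in mean square, with one constant for all times of the window.\<close>

lemma control_functional:
  assumes X: "continuous_on {0..T} X"
  obtains K where "K \<ge> 0" "\<And>t v xs. t \<in> {0..T} \<Longrightarrow> square_integrable_on v {0..T} \<Longrightarrow>
    integrable (lebesgue_on {0..t}) (\<lambda>s. blinfun_apply xs (SQ (t - s) (B (X s) (v s)))) \<and>
    \<bar>LINT s|lebesgue_on {0..t}. blinfun_apply xs (SQ (t - s) (B (X s) (v s)))\<bar> \<le> K * norm xs * sqrt (L2_norm_sq v {0..T})"
proof -
  have "compact (X ` {0..T})" using X by (intro compact_continuous_image) auto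
  then obtain R where R: "\<And>s. s \<in> {0..T} \<Longrightarrow> norm (X s) \<le> R"
    using compact_imp_bounded by (fastforce simp: bounded_iff)
  obtain K where K: "K \<ge> 0" and Kb: "\<And>t v w xs c. 0 \<le> t \<Longrightarrow> (\<lambda>s. blinfun_apply xs (SQ (t - s) (w s))) \<in> borel_measurable (lebesgue_on {0..t}) \<Longrightarrow>
    square_integrable_on v {0..t} \<Longrightarrow> c \<ge> 0 \<Longrightarrow> (\<And>s. s \<in> {0..t} \<Longrightarrow> norm (w s) \<le> c * norm (v s :: 'h)) \<Longrightarrow>
    integrable (lebesgue_on {0..t}) (\<lambda>s. blinfun_apply xs (SQ (t - s) (w s))) \<and>
    \<bar>LINT s|lebesgue_on {0..t}. blinfun_apply xs (SQ (t - s) (w s))\<bar> \<le> K * norm xs * c * sqrt (L2_norm_sq v {0..t})"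
    by (fact noise_functional_bound)
  \<comment> \<open>The absolute value is taken because \<open>R\<close> is unconstrained, and
    possibly negative, when \<open>{0..T}\<close> is empty.\<close>
  define c where "c = \<kappa> * (1 + \<bar>R\<bar>)"
  have c: "c \<ge> 0" using \<kappa> by (simp add: c_def)
  show ?thesis
  proof (rule that[of "K * c"])
    show "K * c \<ge> 0" using K c by simp
    fix t :: real and v :: "real \<Rightarrow> 'h" and xs :: "'e \<Rightarrow>\<^sub>L real"
    assume t: "t \<in> {0..T}" and v: "square_integrable_on v {0..T}"
    let ?I = "LINT s|lebesgue_on {0..t}. blinfun_apply xs (SQ (t - s) (B (X s) (v s)))"
    have tT: "t \<le> T" using t by simp
    note vt = square_integrable_on_subinterval[OF v tT]
    have w: "norm (B (X s) (v s)) \<le> c * norm (v s)" if "s \<in> {0..t}" for s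
    proof -
      have "norm (X s) \<le> \<bar>R\<bar>" using R[of s] that t by auto
      then have "\<kappa> * (1 + norm (X s)) * norm (v s) \<le> c * norm (v s)"
        unfolding c_def using \<kappa> by (intro mult_right_mono mult_left_mono) auto
      then show ?thesis using B_growth[of "X s" "v s"] by linarith
    qed
    have "(\<lambda>s. blinfun_apply xs (SQ (t - s) (B (X s) (v s)))) \<in> borel_measurable (lebesgue_on {0..t})"
      using vt(1) by (intro integrand_measurable[OF X tT]) (simp add: square_integrable_on_def)
    from Kb[OF _ this vt(1) c w] t
    have 1: "integrable (lebesgue_on {0..t}) (\<lambda>s. blinfun_apply xs (SQ (t - s) (B (X s) (v s))))"
      "\<bar>?I\<bar> \<le> K * norm xs * c * sqrt (L2_norm_sq v {0..t})" by auto
    have "K * norm xs * c * sqrt (L2_norm_sq v {0..t}) \<le> K * norm xs * c * sqrt (L2_norm_sq v {0..T})"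
      using vt(2) K c by (intro mult_left_mono) auto
    then have "\<bar>?I\<bar> \<le> K * c * norm xs * sqrt (L2_norm_sq v {0..T})"
      using 1(2) by (simp add: mult_ac)
    then show "integrable (lebesgue_on {0..t}) (\<lambda>s. blinfun_apply xs (SQ (t - s) (B (X s) (v s)))) \<and>
        \<bar>?I\<bar> \<le> K * c * norm xs * sqrt (L2_norm_sq v {0..T})" using 1(1) by simp
  qed
qed

text \<open>The path inside \<open>B\<close> is held fixed, so all conditions on the control are
  convex.\<close>

lemma almost_controls_midpoint:
  assumes X: "continuous_on {0..T} X" and u: "u \<in> almost_controls T X E \<epsilon>" and v: "v \<in> almost_controls T X E \<epsilon>"
  shows "(\<lambda>s. (1/2) *\<^sub>R u s + (1/2) *\<^sub>R v s) \<in> almost_controls T X E \<epsilon>"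
proof -
  let ?w = "\<lambda>s. (1/2) *\<^sub>R u s + (1/2) *\<^sub>R v s"
  have sq: "square_integrable_on u {0..T}" "square_integrable_on v {0..T}"
    and L: "L2_norm_sq u {0..T} \<le> E + \<epsilon>" "L2_norm_sq v {0..T} \<le> E + \<epsilon>"
    using u v by (auto simp: almost_controls_def)
  obtain K' where K'0: "K' \<ge> 0" and K': "\<And>t v xs. t \<in> {0..T} \<Longrightarrow> square_integrable_on v {0..T} \<Longrightarrow>
    integrable (lebesgue_on {0..t}) (\<lambda>s. blinfun_apply (xs :: 'e \<Rightarrow>\<^sub>L real) (SQ (t - s) (B (X s) (v s)))) \<and>
    \<bar>LINT s|lebesgue_on {0..t}. blinfun_apply xs (SQ (t - s) (B (X s) (v s)))\<bar> \<le> K' * norm xs * sqrt (L2_norm_sq v {0..T})"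
    by (fact control_functional[OF X])
  note K = K'[THEN conjunct1]
  have "0 \<le> (LINT s|lebesgue_on {0..T}. (norm (u s - v s))\<^sup>2)" by simp
  then have "L2_norm_sq ?w {0..T} \<le> E + \<epsilon>"
    using L2_parallelogram[OF sq] L by linarith
  moreover have "\<bar>(LINT s|lebesgue_on {0..t}. blinfun_apply xs (SQ (t - s) (B (X s) (?w s)))) -
        blinfun_apply xs (noise_part X t)\<bar> \<le> \<epsilon> * norm xs" if t: "t \<in> {0..T}" for t xs
  proof -
    let ?I = "\<lambda>v. LINT s|lebesgue_on {0..t}. blinfun_apply xs (SQ (t - s) (B (X s) (v s)))"
    have "?I ?w = (LINT s|lebesgue_on {0..t}. (1/2) * blinfun_apply xs (SQ (t - s) (B (X s) (u s))) + (1/2) * blinfun_apply xs (SQ (t - s) (B (X s) (v s))))"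
      by (simp add: blinfun.add_right blinfun.scaleR_right)
    also have "\<dots> = (1/2) * ?I u + (1/2) * ?I v"
      using K[OF t sq(1), of xs] K[OF t sq(2), of xs] by simp
    finally have "?I ?w = (1/2) * ?I u + (1/2) * ?I v" .
    moreover have "\<bar>?I u - blinfun_apply xs (noise_part X t)\<bar> \<le> \<epsilon> * norm xs" "\<bar>?I v - blinfun_apply xs (noise_part X t)\<bar> \<le> \<epsilon> * norm xs"
      using u v t by (auto simp: almost_controls_def)
    ultimately show ?thesis unfolding abs_le_iff by linarith
  qed
  ultimately show ?thesis
    using square_integrable_on_lincomb[OF sq, of "1/2" "1/2"] by (simp add: almost_controls_def)
qed

lemma noise_part_uniform_limit:
  assumes X: "continuous_on {0..T} X" and T: "T > 0" and Y: "\<And>n. continuous_on {0..T} (Y n)"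
    and ul: "uniform_limit {0..T} Y X sequentially" and \<epsilon>: "\<epsilon> > 0"
  shows "\<forall>\<^sub>F n in sequentially. \<forall>t\<in>{0..T}. norm (noise_part (Y n) t - noise_part X t) \<le> \<epsilon>"
proof -
  have "compact (X ` {0..T})" using X by (intro compact_continuous_image) auto
  then obtain R where R: "\<And>s. s \<in> {0..T} \<Longrightarrow> norm (X s) \<le> R"
    using compact_imp_bounded by (fastforce simp: bounded_iff)
  define \<eta> where "\<eta> = \<epsilon> / (2 * (M * T))"
  have \<eta>: "\<eta> > 0" "M * \<eta> * T = \<epsilon> / 2" using \<epsilon> M T by (auto simp: \<eta>_def)
  obtain d where d: "d > 0" "\<And>x y. norm x \<le> R + 1 \<Longrightarrow> norm y \<le> R + 1 \<Longrightarrow> norm (y - x) < d \<Longrightarrow> norm (F y - F x) < \<eta>"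
    using F_cont[OF bounded_cball[of 0 "R + 1"]] \<eta>(1)
    unfolding uniformly_continuous_on_def dist_norm by (metis diff_zero mem_cball_0)
  define \<delta> where "\<delta> = min (min d 1) (\<epsilon> / (2 * (1 + M)))"
  have \<delta>: "\<delta> > 0" "\<delta> \<le> d" "\<delta> \<le> 1" "\<delta> \<le> \<epsilon> / (2 * (1 + M))" using d \<epsilon> M by (auto simp: \<delta>_def)
  have \<delta>M: "(1 + M) * \<delta> \<le> \<epsilon> / 2" using \<delta>(4) M by (simp add: field_simps)
  have "\<forall>\<^sub>F n in sequentially. \<forall>t\<in>{0..T}. dist (Y n t) (X t) < \<delta>"
    using ul \<delta>(1) by (simp add: uniform_limit_iff)
  then show ?thesis
  proof eventually_elim
    case (elim n)
    then have cl: "norm (Y n s - X s) < \<delta>" if "s \<in> {0..T}" for s using that by (simp add: dist_norm)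
    show ?case
    proof
      fix t assume t: "t \<in> {0..T}"
      let ?I = "\<lambda>X. integral {0..t} (\<lambda>s. S (t - s) (F (X s)))"
      have sub: "{0..t} \<subseteq> {0..T}" using t by auto
      have FX: "continuous_on {0..t} (\<lambda>s. F (X s))" "continuous_on {0..t} (\<lambda>s. F (Y n s))"
        using continuous_on_subset[OF X sub] continuous_on_subset[OF Y sub]
        by (auto intro: continuous_on_compose2[OF F_continuous[of UNIV]])
      have I: "?I (Y n) - ?I X = integral {0..t} (\<lambda>s. S (t - s) (F (Y n s) - F (X s)))"
        unfolding blinfun.diff_right by (intro integral_diff[symmetric] conv_integrable FX) auto
      have "norm (integral {0..t} (\<lambda>s. S (t - s) (F (Y n s) - F (X s)))) \<le> M * \<eta> * (t - 0)"
      proof (rule integral_bound)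
        show "continuous_on {0..t} (\<lambda>s. S (t - s) (F (Y n s) - F (X s)))"
          by (intro conv_cont continuous_on_diff FX) simp
        fix s assume s: "s \<in> {0..t}"
        have sT: "s \<in> {0..T}" using s sub by auto
        have "norm (Y n s) \<le> R + 1"
          using cl[OF sT] R[OF sT] \<delta>(3) norm_triangle_ineq2[of "Y n s" "X s"] by linarith
        then have "norm (F (Y n s) - F (X s)) < \<eta>" using cl[OF sT] R[OF sT] \<delta>(2) by (intro d(2)) auto
        then have "M * norm (F (Y n s) - F (X s)) \<le> M * \<eta>" using M by (intro mult_left_mono) auto
        then show "norm (S (t - s) (F (Y n s) - F (X s))) \<le> M * \<eta>"
          using S_bound[of "t - s" "F (Y n s) - F (X s)"] s by auto
      qed (use t in auto)
      also have "\<dots> \<le> M * \<eta> * T" using t M \<eta> by (intro mult_left_mono) auto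
      finally have "norm (?I (Y n) - ?I X) \<le> \<epsilon> / 2" unfolding I \<eta>(2) .
      moreover have "norm (S t (Y n 0 - X 0)) \<le> M * \<delta>"
      proof -
        have "norm (S t (Y n 0 - X 0)) \<le> M * norm (Y n 0 - X 0)" using t by (intro S_bound) auto
        also have "\<dots> \<le> M * \<delta>" using cl[of 0] T M by (intro mult_left_mono) auto
        finally show ?thesis .
      qed
      moreover have "noise_part (Y n) t - noise_part X t = (Y n t - X t) - S t (Y n 0 - X 0) - (?I (Y n) - ?I X)"
        by (simp add: noise_part_def blinfun.diff_right)
      then have "norm (noise_part (Y n) t - noise_part X t) \<le> norm (Y n t - X t) + norm (S t (Y n 0 - X 0)) + norm (?I (Y n) - ?I X)"
        using norm_triangle_ineq4[of "(Y n t - X t) - S t (Y n 0 - X 0)" "?I (Y n) - ?I X"]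
          norm_triangle_ineq4[of "Y n t - X t" "S t (Y n 0 - X 0)"] by simp
      ultimately show "norm (noise_part (Y n) t - noise_part X t) \<le> \<epsilon>"
        using cl[OF t] \<delta>M by (simp add: distrib_right)
    qed
  qed
qed

text \<open>For large \<open>n\<close> the control of \<open>Y n\<close> itself is an almost control
  of \<open>X\<close>. Two errors arise: \<open>Y n\<close> is replaced by \<open>X\<close> inside
  \<open>B\<close>, which is small by Lipschitz continuity and bounded energy, and the noise part of
  \<open>Y n\<close> by that of \<open>X\<close>.\<close>

lemma almost_controls_nonempty:
  assumes X: "continuous_on {0..T} X" and T: "T > 0"
    and c: "\<And>n. controlled T (\<psi> n) (Y n)" and E: "\<And>n. L2_norm_sq (\<psi> n) {0..T} \<le> E + 1 / real (Suc n)" "E \<ge> 0"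
    and ul: "uniform_limit {0..T} Y X sequentially" and \<epsilon>: "\<epsilon> > 0"
  shows "almost_controls T X E \<epsilon> \<noteq> {}"
proof -
  obtain K where K: "K \<ge> 0" and Kb: "\<And>t v w xs c. 0 \<le> t \<Longrightarrow> (\<lambda>s. blinfun_apply xs (SQ (t - s) (w s))) \<in> borel_measurable (lebesgue_on {0..t}) \<Longrightarrow>
    square_integrable_on v {0..t} \<Longrightarrow> c \<ge> 0 \<Longrightarrow> (\<And>s. s \<in> {0..t} \<Longrightarrow> norm (w s) \<le> c * norm (v s :: 'h)) \<Longrightarrow>
    integrable (lebesgue_on {0..t}) (\<lambda>s. blinfun_apply (xs :: 'e \<Rightarrow>\<^sub>L real) (SQ (t - s) (w s))) \<and>
    \<bar>LINT s|lebesgue_on {0..t}. blinfun_apply xs (SQ (t - s) (w s))\<bar> \<le> K * norm xs * c * sqrt (L2_norm_sq v {0..t})"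
    by (fact noise_functional_bound)
  obtain K' where K'0: "K' \<ge> 0" and K': "\<And>t v xs. t \<in> {0..T} \<Longrightarrow> square_integrable_on v {0..T} \<Longrightarrow>
    integrable (lebesgue_on {0..t}) (\<lambda>s. blinfun_apply (xs :: 'e \<Rightarrow>\<^sub>L real) (SQ (t - s) (B (X s) (v s)))) \<and>
    \<bar>LINT s|lebesgue_on {0..t}. blinfun_apply xs (SQ (t - s) (B (X s) (v s)))\<bar> \<le> K' * norm xs * sqrt (L2_norm_sq v {0..T})"
    by (fact control_functional[OF X])
  note KX = K'[THEN conjunct1]
  define q where "q = K * \<kappa> * sqrt (E + 1)"
  have q: "q \<ge> 0" using K \<kappa> E by (simp add: q_def)
  define \<eta> where "\<eta> = \<epsilon> / (2 * (q + 1))"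
  have \<eta>: "\<eta> > 0" "q * \<eta> \<le> \<epsilon> / 2" using \<epsilon> q by (auto simp: \<eta>_def field_simps)
  have "\<forall>\<^sub>F n in sequentially. \<forall>t\<in>{0..T}. dist (Y n t) (X t) < \<eta>"
    using ul \<eta>(1) by (simp add: uniform_limit_iff)
  moreover have "\<forall>\<^sub>F n in sequentially. \<forall>t\<in>{0..T}. norm (noise_part (Y n) t - noise_part X t) \<le> \<epsilon> / 2"
    using c controlled_cont \<epsilon> by (intro noise_part_uniform_limit[OF X T _ ul]) auto
  moreover have "\<forall>\<^sub>F n in sequentially. 1 / real (Suc n) < \<epsilon>"
    by (rule order_tendstoD(2)[OF LIMSEQ_Suc[OF lim_1_over_n] \<epsilon>])
  ultimately have "\<forall>\<^sub>F n in sequentially. \<psi> n \<in> almost_controls T X E \<epsilon>"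
  proof eventually_elim
    case (elim n)
    have sq: "square_integrable_on (\<psi> n) {0..T}" using c[of n] by (simp add: controlled_def)
    have "\<bar>(LINT s|lebesgue_on {0..t}. blinfun_apply xs (SQ (t - s) (B (X s) (\<psi> n s)))) -
        blinfun_apply xs (noise_part X t)\<bar> \<le> \<epsilon> * norm xs" if t: "t \<in> {0..T}" for t and xs :: "'e \<Rightarrow>\<^sub>L real"
    proof -
      let ?fX = "\<lambda>s. blinfun_apply xs (SQ (t - s) (B (X s) (\<psi> n s)))"
      let ?fY = "\<lambda>s. blinfun_apply xs (SQ (t - s) (B (Y n s) (\<psi> n s)))"
      let ?w = "\<lambda>s. (B (X s) - B (Y n s)) (\<psi> n s)"
      have tT: "0 \<le> t" "t \<le> T" using t by auto
      note st = square_integrable_on_subinterval[OF sq tT(2)]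
      have iX: "integrable (lebesgue_on {0..t}) ?fX" by (rule KX[OF t sq])
      have iY: "integrable (lebesgue_on {0..t}) ?fY" "(LINT s|lebesgue_on {0..t}. ?fY s) = blinfun_apply xs (noise_part (Y n) t)"
        using noise_part_weak[OF c t] by (auto simp: has_weak_integral_def)
      have weq: "(\<lambda>s. blinfun_apply xs (SQ (t - s) (?w s))) = (\<lambda>s. ?fX s - ?fY s)"
        by (simp add: blinfun.diff_left blinfun.diff_right)
      have "norm (?w s) \<le> (\<kappa> * \<eta>) * norm (\<psi> n s)" if "s \<in> {0..t}" for s
      proof -
        have "norm (X s - Y n s) \<le> \<eta>" using elim(1) that tT by (auto simp: dist_norm norm_minus_commute intro: less_imp_le)
        then have "\<kappa> * norm (X s - Y n s) * norm (\<psi> n s) \<le> \<kappa> * \<eta> * norm (\<psi> n s)"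
          using \<kappa> by (intro mult_right_mono mult_left_mono) auto
        then show ?thesis using B_lipschitz[of "X s" "Y n s" "\<psi> n s"] by linarith
      qed
      moreover have "(\<lambda>s. blinfun_apply xs (SQ (t - s) (?w s))) \<in> borel_measurable (lebesgue_on {0..t})"
        unfolding weq using iX iY by (intro borel_measurable_diff) auto
      ultimately have "\<bar>LINT s|lebesgue_on {0..t}. blinfun_apply xs (SQ (t - s) (?w s))\<bar> \<le>
          K * norm xs * (\<kappa> * \<eta>) * sqrt (L2_norm_sq (\<psi> n) {0..t})"
        using Kb[OF tT(1) _ st(1), of xs ?w "\<kappa> * \<eta>"] \<kappa> \<eta>(1) by simp
      also have "\<dots> \<le> K * norm xs * (\<kappa> * \<eta>) * sqrt (E + 1)"
      proof (intro mult_left_mono real_sqrt_le_mono)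
        have "1 / real (Suc n) \<le> 1" by simp
        then show "L2_norm_sq (\<psi> n) {0..t} \<le> E + 1" using st(2) E(1)[of n] by linarith
      qed (use K \<kappa> \<eta> in auto)
      also have "\<dots> = (q * \<eta>) * norm xs" by (simp add: q_def)
      also have "\<dots> \<le> \<epsilon> / 2 * norm xs" by (intro mult_right_mono \<eta>) simp
      finally have 1: "\<bar>(LINT s|lebesgue_on {0..t}. ?fX s) - blinfun_apply xs (noise_part (Y n) t)\<bar> \<le> \<epsilon> / 2 * norm xs"
        unfolding weq using iX iY by simp
      have "\<bar>blinfun_apply xs (noise_part (Y n) t - noise_part X t)\<bar> \<le> norm xs * norm (noise_part (Y n) t - noise_part X t)"
        using norm_blinfun[of xs "noise_part (Y n) t - noise_part X t"] by simp
      also have "\<dots> \<le> norm xs * (\<epsilon> / 2)" using elim(2) t by (intro mult_left_mono) auto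
      finally have 2: "\<bar>blinfun_apply xs (noise_part (Y n) t) - blinfun_apply xs (noise_part X t)\<bar> \<le> \<epsilon> / 2 * norm xs"
        by (simp add: blinfun.diff_right mult.commute)
      have "\<epsilon> * norm xs = \<epsilon> / 2 * norm xs + \<epsilon> / 2 * norm xs" by simp
      then show ?thesis using 1 2 unfolding abs_le_iff by linarith
    qed
    moreover have "L2_norm_sq (\<psi> n) {0..T} \<le> E + \<epsilon>" using E(1)[of n] elim(3) by linarith
    ultimately show ?case using sq by (simp add: almost_controls_def)
  qed
  then show ?thesis using eventually_happens'[OF sequentially_bot] by blast
qed

text \<open>The given controls need not converge; they only show that the sets of almost controls
  are nonempty. The limit is taken along near-minimal elements of these sets.\<close>

lemma controlled_limit:
  assumes X: "continuous_on {0..T} X" and T: "T > 0"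
    and c: "\<And>n. controlled T (\<psi> n) (Y n)" and E: "\<And>n. L2_norm_sq (\<psi> n) {0..T} \<le> E + 1 / real (Suc n)" "E \<ge> 0"
    and ul: "uniform_limit {0..T} Y X sequentially"
  shows "\<exists>v. controlled T v X \<and> L2_norm_sq v {0..T} \<le> E"
proof -
  define \<epsilon> where "\<epsilon> n = 1 / real (Suc n)" for n
  have \<epsilon>: "\<epsilon> n > 0" for n by (simp add: \<epsilon>_def)
  have \<epsilon>lim: "\<epsilon> \<longlonglongrightarrow> 0" unfolding \<epsilon>_def by (rule LIMSEQ_Suc[OF lim_1_over_n])
  have \<epsilon>mono: "\<epsilon> k \<le> \<epsilon> n" if "n \<le> k" for n k using that by (simp add: \<epsilon>_def frac_le)
  define AC where "AC n = almost_controls T X E (\<epsilon> n)" for n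
  define L where "L v = L2_norm_sq v {0..T}" for v :: "real \<Rightarrow> 'h"
  have L0: "L v \<ge> 0" for v by (simp add: L_def L2_norm_sq_def)
  have ne: "AC n \<noteq> {}" for n
    unfolding AC_def by (rule almost_controls_nonempty[OF X T c E ul \<epsilon>])
  have sub: "AC k \<subseteq> AC n" if "n \<le> k" for n k
    unfolding AC_def by (rule almost_controls_mono[OF \<epsilon>mono[OF that]])
  \<comment> \<open>The sets \<open>AC n\<close> shrink, so their least energies increase, and they
    stay below \<open>E + 1\<close>; the limit \<open>l\<close> is what measures the distances
    between the \<open>v n\<close>.\<close>
  define d where "d n = Inf (L ` AC n)" for n
  have bdd: "bdd_below (L ` A)" for A using L0 by (intro bdd_belowI2[of _ 0]) auto
  have dle: "d n \<le> L v" if "v \<in> AC n" for n v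
    unfolding d_def using that bdd by (intro cInf_lower) auto
  have inc: "incseq d"
  proof (rule monoI)
    fix n k :: nat assume "n \<le> k"
    then show "d n \<le> d k"
      unfolding d_def using ne by (intro cInf_superset_mono bdd image_mono sub) auto
  qed
  have dE: "d n \<le> E + 1" for n
  proof -
    obtain v where v: "v \<in> AC n" using ne by blast
    have "\<epsilon> n \<le> 1" by (simp add: \<epsilon>_def)
    then show ?thesis using dle[OF v] v by (simp add: AC_def almost_controls_def L_def)
  qed
  obtain l where "d \<longlonglongrightarrow> l" "\<forall>n. d n \<le> l"
    by (rule incseq_convergent[OF inc]) (use dE in auto)
  then have l: "d \<longlonglongrightarrow> l" "\<And>n. d n \<le> l" by auto
  have "\<exists>v. v \<in> AC n \<and> L v < d n + \<epsilon> n" for n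
  proof -
    have "Inf (L ` AC n) < d n + \<epsilon> n" using \<epsilon>[of n] by (simp add: d_def)
    then show ?thesis using cInf_less_iff[of "L ` AC n"] ne bdd by auto
  qed
  then obtain v where v: "\<And>n. v n \<in> AC n" "\<And>n. L (v n) < d n + \<epsilon> n"
    using choice[of "\<lambda>n v. v \<in> AC n \<and> L v < d n + \<epsilon> n"] by blast
  have sq: "square_integrable_on (v n) {0..T}" for n using v(1)[of n] by (simp add: AC_def almost_controls_def)
  \<comment> \<open>The midpoint of \<open>v n\<close> and \<open>v k\<close> lies in the larger set
    \<open>AC n\<close>, so its energy is at least \<open>d n\<close>; the parallelogram identity
    converts this into a bound on the distance.\<close>
  have close: "(LINT s|lebesgue_on {0..T}. (norm (v n s - v k s))\<^sup>2) \<le> 4 * (l - d n) + 4 * \<epsilon> n" if nk: "n \<le> k" for n k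
  proof -
    have "(\<lambda>s. (1/2) *\<^sub>R v n s + (1/2) *\<^sub>R v k s) \<in> AC n"
      using v(1)[of n] v(1)[of k] sub[OF nk] unfolding AC_def by (intro almost_controls_midpoint[OF X]) auto
    then have "d n \<le> L (\<lambda>s. (1/2) *\<^sub>R v n s + (1/2) *\<^sub>R v k s)" by (rule dle)
    then have "(LINT s|lebesgue_on {0..T}. (norm (v n s - v k s))\<^sup>2) \<le> 2 * L (v n) + 2 * L (v k) - 4 * d n"
      using L2_parallelogram[OF sq[of n] sq[of k]] by (simp add: L_def)
    moreover have "2 * L (v n) + 2 * L (v k) - 4 * d n \<le> 4 * (l - d n) + 4 * \<epsilon> n"
      using v(2)[of n] v(2)[of k] l(2)[of k] \<epsilon>mono[OF nk] l(2)[of n] by argo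
    ultimately show ?thesis by (rule order_trans)
  qed
  have cau: "\<exists>N. \<forall>n\<ge>N. \<forall>k\<ge>N. (LINT s|lebesgue_on {0..T}. (norm (v n s - v k s))\<^sup>2) \<le> e" if e: "e > 0" for e
  proof -
    have "(\<lambda>n. 4 * (l - d n) + 4 * \<epsilon> n) \<longlonglongrightarrow> 4 * (l - l) + 4 * 0" by (intro tendsto_intros l \<epsilon>lim)
    then have "\<forall>\<^sub>F n in sequentially. 4 * (l - d n) + 4 * \<epsilon> n < e" using e by (intro order_tendstoD(2)) auto
    then obtain N where N: "\<And>n. n \<ge> N \<Longrightarrow> 4 * (l - d n) + 4 * \<epsilon> n < e" by (auto simp: eventually_sequentially)
    have *: "(LINT s|lebesgue_on {0..T}. (norm (v n s - v k s))\<^sup>2) \<le> e" if "n \<ge> N" "n \<le> k" for n k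
      using close[OF that(2)] N[OF that(1)] by linarith
    have "(LINT s|lebesgue_on {0..T}. (norm (v n s - v k s))\<^sup>2) \<le> e" if "n \<ge> N" "k \<ge> N" for n k
      using *[of n k] *[of k n] that by (cases "n \<le> k") (simp_all add: norm_minus_commute)
    then show ?thesis by blast
  qed
  have fm: "finite_measure (lebesgue_on {0..T})" by (rule finite_measure_lebesgue_on) simp
  have vm: "v n \<in> borel_measurable (lebesgue_on {0..T})" "integrable (lebesgue_on {0..T}) (\<lambda>s. (norm (v n s))\<^sup>2)" for n
    using sq by (auto simp: square_integrable_on_def)
  obtain w where w: "w \<in> borel_measurable (lebesgue_on {0..T})" "integrable (lebesgue_on {0..T}) (\<lambda>x. (norm (w x))\<^sup>2)"
    "\<And>n. integrable (lebesgue_on {0..T}) (\<lambda>x. (norm (w x - v n x))\<^sup>2)"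
    "(\<lambda>n. LINT x|lebesgue_on {0..T}. (norm (w x - v n x))\<^sup>2) \<longlonglongrightarrow> 0"
    by (rule L2_cauchy_limit[of "lebesgue_on {0..T}" v, OF fm vm cau]) (assumption | rule that)+
  have sqw: "square_integrable_on w {0..T}" using w by (simp add: square_integrable_on_def)
  have sqd: "square_integrable_on (\<lambda>s. w s - v n s) {0..T}" for n
    using square_integrable_on_lincomb[OF sqw sq[of n], of 1 "-1"] by simp
  define r where "r n = L (\<lambda>s. w s - v n s)" for n
  have rlim: "r \<longlonglongrightarrow> 0" using w(4) by (simp add: r_def[abs_def] L_def L2_norm_sq_def)
  obtain K where K: "K \<ge> 0" and Kb: "\<And>t v xs. t \<in> {0..T} \<Longrightarrow> square_integrable_on v {0..T} \<Longrightarrow>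
    integrable (lebesgue_on {0..t}) (\<lambda>s. blinfun_apply (xs :: 'e \<Rightarrow>\<^sub>L real) (SQ (t - s) (B (X s) (v s)))) \<and>
    \<bar>LINT s|lebesgue_on {0..t}. blinfun_apply xs (SQ (t - s) (B (X s) (v s)))\<bar> \<le> K * norm xs * sqrt (L2_norm_sq v {0..T})"
    by (fact control_functional[OF X])
  have weak: "has_weak_integral (lebesgue_on {0..t}) (\<lambda>s. SQ (t - s) (B (X s) (w s))) (noise_part X t)" if t: "t \<in> {0..T}" for t
    unfolding has_weak_integral_def
  proof
    fix xs :: "'e \<Rightarrow>\<^sub>L real"
    let ?f = "\<lambda>v s. blinfun_apply xs (SQ (t - s) (B (X s) (v s)))"
    let ?I = "\<lambda>v. LINT s|lebesgue_on {0..t}. ?f v s"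
    have i: "integrable (lebesgue_on {0..t}) (?f w)" "integrable (lebesgue_on {0..t}) (?f (v n))" for n
      using Kb[OF t sqw, of xs] Kb[OF t sq[of n], of xs] by auto
    have "\<bar>?I w - blinfun_apply xs (noise_part X t)\<bar> \<le> K * norm xs * sqrt (r n) + \<epsilon> n * norm xs" for n
    proof -
      have "?I w - ?I (v n) = ?I (\<lambda>s. w s - v n s)"
        using i(1) i(2)[of n] by (simp add: blinfun.diff_right)
      then have "\<bar>?I w - ?I (v n)\<bar> \<le> K * norm xs * sqrt (r n)"
        using Kb[OF t sqd[of n], of xs] by (simp add: r_def L_def)
      moreover have "\<bar>?I (v n) - blinfun_apply xs (noise_part X t)\<bar> \<le> \<epsilon> n * norm xs"
        using v(1)[of n] t by (simp add: AC_def almost_controls_def)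
      ultimately show ?thesis unfolding abs_le_iff by linarith
    qed
    moreover have "(\<lambda>n. K * norm xs * sqrt (r n) + \<epsilon> n * norm xs) \<longlonglongrightarrow> K * norm xs * sqrt 0 + 0 * norm xs"
      by (intro tendsto_intros rlim \<epsilon>lim)
    ultimately have "\<bar>?I w - blinfun_apply xs (noise_part X t)\<bar> \<le> K * norm xs * sqrt 0 + 0 * norm xs"
      by (intro LIMSEQ_le_const) auto
    then show "integrable (lebesgue_on {0..t}) (?f w) \<and> ?I w = blinfun_apply xs (noise_part X t)" using i by simp
  qed
  have "X t = S t (X 0) + integral {0..t} (\<lambda>s. S (t - s) (F (X s))) + noise_part X t" for t
    by (simp add: noise_part_def)
  then have "controlled T w X"
    unfolding controlled_def controlled_solution_def using sqw X weak by blast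
  moreover have "L w \<le> E"
  proof (rule field_le_epsilon)
    fix e :: real assume e: "e > 0"
    \<comment> \<open>A weight with \<open>\<theta> * E \<le> e / 2\<close>; the 1 in the
      denominator covers \<open>E = 0\<close>.\<close>
    define \<theta> where "\<theta> = e / (2 * (E + 1))"
    have \<theta>: "\<theta> > 0" "\<theta> * E \<le> e / 2" using e E(2) by (auto simp: \<theta>_def field_simps)
    have "L w \<le> (1 + \<theta>) * (E + \<epsilon> n) + (1 + 1 / \<theta>) * r n" for n
    proof -
      have pw: "(norm a)\<^sup>2 \<le> (1 + \<theta>) * (norm b)\<^sup>2 + (1 + 1 / \<theta>) * (norm (a - b))\<^sup>2" for a b :: 'h
      proof -
        have "(norm a)\<^sup>2 \<le> (norm b + norm (a - b))\<^sup>2"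
          using norm_triangle_ineq[of b "a - b"] by (intro power_mono) auto
        also have "\<dots> \<le> (norm b + norm (a - b))\<^sup>2 + (\<theta> * norm b - norm (a - b))\<^sup>2 / \<theta>" using \<theta> by simp
        also have "\<dots> = (1 + \<theta>) * (norm b)\<^sup>2 + (1 + 1 / \<theta>) * (norm (a - b))\<^sup>2"
          using \<theta> by (simp add: power2_eq_square field_simps)
        finally show ?thesis .
      qed
      have "L w \<le> (LINT s|lebesgue_on {0..T}. (1 + \<theta>) * (norm (v n s))\<^sup>2 + (1 + 1 / \<theta>) * (norm (w s - v n s))\<^sup>2)"
        unfolding L_def L2_norm_sq_def using w vm pw by (intro integral_mono) auto
      also have "\<dots> = (1 + \<theta>) * L (v n) + (1 + 1 / \<theta>) * r n"
        using w vm by (simp add: L_def L2_norm_sq_def r_def)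
      also have "\<dots> \<le> (1 + \<theta>) * (E + \<epsilon> n) + (1 + 1 / \<theta>) * r n"
        using v(1)[of n] \<theta> by (intro add_right_mono mult_left_mono) (auto simp: AC_def almost_controls_def L_def)
      finally show ?thesis .
    qed
    moreover have "(\<lambda>n. (1 + \<theta>) * (E + \<epsilon> n) + (1 + 1 / \<theta>) * r n) \<longlonglongrightarrow> (1 + \<theta>) * (E + 0) + (1 + 1 / \<theta>) * 0"
      by (intro tendsto_intros rlim \<epsilon>lim)
    ultimately have "L w \<le> (1 + \<theta>) * (E + 0) + (1 + 1 / \<theta>) * 0" by (intro LIMSEQ_le_const) auto
    also have "\<dots> = E + \<theta> * E" by (simp add: algebra_simps)
    also have "\<dots> \<le> E + e" using \<theta>(2) e by linarith
    finally show "L w \<le> E + e" .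
  qed
  ultimately show ?thesis unfolding L_def by blast
qed

end

section \<open>A complete metric for the topology of the past\<close>

text \<open>The cut-off tends to 0 in the remote past, so a ball of radius \<open>\<epsilon>\<close>
  constrains only times \<open>t \<ge> 1 - 1 / \<epsilon>\<close>; as the cut-off is positive at
  each time, small distances still control every bounded window. One supremum replaces a weighted
  series of seminorms.\<close>

definition past_dist :: "(real \<Rightarrow> 'a::metric_space) \<Rightarrow> (real \<Rightarrow> 'a) \<Rightarrow> real" where
  "past_dist \<phi> \<xi> = (SUP t\<in>{..0}. min (dist (\<phi> t) (\<xi> t)) (1 / (1 - t)))"

lemma past_dist_bdd: "bdd_above ((\<lambda>t. min (dist (\<phi> t) (\<xi> t)) (1 / (1 - t))) ` {..0})"
  by (intro bdd_aboveI2[of _ _ 1]) (auto simp: min_le_iff_disj divide_le_eq)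

lemma past_dist_upper: "t \<le> 0 \<Longrightarrow> min (dist (\<phi> t) (\<xi> t)) (1 / (1 - t)) \<le> past_dist \<phi> \<xi>"
  unfolding past_dist_def by (rule cSUP_upper[OF _ past_dist_bdd]) simp

lemma past_dist_least: "(\<And>t. t \<le> 0 \<Longrightarrow> min (dist (\<phi> t) (\<xi> t)) (1 / (1 - t)) \<le> c) \<Longrightarrow> past_dist \<phi> \<xi> \<le> c"
  unfolding past_dist_def by (rule cSUP_least) auto

lemma past_metric: "Metric_space past_paths past_dist"
proof
  show nn: "0 \<le> past_dist \<phi> \<xi>" for \<phi> \<xi> :: "real \<Rightarrow> 'a"
    using past_dist_upper[of 0 \<phi> \<xi>] by (rule order_trans[rotated]) (auto intro: min.boundedI)
  show "past_dist \<phi> \<xi> = past_dist \<xi> \<phi>" for \<phi> \<xi> :: "real \<Rightarrow> 'a"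
    by (simp add: past_dist_def dist_commute)
  show "past_dist \<phi> \<xi> = 0 \<longleftrightarrow> \<phi> = \<xi>" if "\<phi> \<in> past_paths" "\<xi> \<in> past_paths" for \<phi> \<xi> :: "real \<Rightarrow> 'a"
  proof
    assume 0: "past_dist \<phi> \<xi> = 0"
    show "\<phi> = \<xi>"
    proof (rule extensionalityI)
      show "\<phi> \<in> extensional {..0}" "\<xi> \<in> extensional {..0}" using that by (auto simp: past_paths_def)
      fix t :: real assume "t \<in> {..0}"
      then have "min (dist (\<phi> t) (\<xi> t)) (1 / (1 - t)) \<le> 0" "1 / (1 - t) > 0"
        using past_dist_upper[of t \<phi> \<xi>] 0 by auto
      then have "dist (\<phi> t) (\<xi> t) \<le> 0" unfolding min_le_iff_disj by linarith
      then show "\<phi> t = \<xi> t" by simp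
    qed
  next
    assume "\<phi> = \<xi>"
    then have "past_dist \<phi> \<xi> \<le> 0" by (intro past_dist_least) (simp add: min_le_iff_disj)
    then show "past_dist \<phi> \<xi> = 0" using nn[of \<phi> \<xi>] by simp
  qed
  show "past_dist \<phi> \<zeta> \<le> past_dist \<phi> \<xi> + past_dist \<xi> \<zeta>" for \<phi> \<xi> \<zeta> :: "real \<Rightarrow> 'a"
  proof (rule past_dist_least)
    fix t :: real assume t: "t \<le> 0"
    have "1 / (1 - t) > 0" using t by simp
    then have "min (dist (\<phi> t) (\<zeta> t)) (1 / (1 - t)) \<le> min (dist (\<phi> t) (\<xi> t)) (1 / (1 - t)) + min (dist (\<xi> t) (\<zeta> t)) (1 / (1 - t))"
      using dist_triangle[of "\<phi> t" "\<zeta> t" "\<xi> t"] zero_le_dist[of "\<phi> t" "\<xi> t"] zero_le_dist[of "\<xi> t" "\<zeta> t"]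
      by linarith
    then show "min (dist (\<phi> t) (\<zeta> t)) (1 / (1 - t)) \<le> past_dist \<phi> \<xi> + past_dist \<xi> \<zeta>"
      using past_dist_upper[OF t, of \<phi> \<xi>] past_dist_upper[OF t, of \<xi> \<zeta>] by linarith
  qed
qed

text \<open>On \<open>[a, 0]\<close> the cut-off is at least \<open>1 / (1 - a)\<close>, hence
  inactive below that threshold.\<close>

lemma past_dist_less_imp:
  assumes "past_dist \<phi> \<xi> < min \<epsilon> (1 / (1 - a))" "a \<le> t" "t \<le> 0"
  shows "dist (\<phi> t) (\<xi> t) < \<epsilon>"
proof -
  have "min (dist (\<phi> t) (\<xi> t)) (1 / (1 - t)) < min \<epsilon> (1 / (1 - a))"
    using past_dist_upper[OF assms(3)] assms(1) by (rule le_less_trans)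
  moreover have "1 / (1 - a) \<le> 1 / (1 - t)" using assms by (intro divide_left_mono) auto
  ultimately show ?thesis by (auto simp: min_def split: if_splits)
qed

lemma past_dist_le:
  assumes "\<epsilon> > 0" and "\<And>t. 1 - 1 / \<epsilon> \<le> t \<Longrightarrow> t \<le> 0 \<Longrightarrow> dist (\<phi> t) (\<xi> t) \<le> \<epsilon>"
  shows "past_dist \<phi> \<xi> \<le> \<epsilon>"
proof (rule past_dist_least)
  fix t :: real assume t: "t \<le> 0"
  show "min (dist (\<phi> t) (\<xi> t)) (1 / (1 - t)) \<le> \<epsilon>"
  proof (cases "1 - 1 / \<epsilon> \<le> t")
    case True
    then show ?thesis using assms(2)[OF True t] by simp
  next
    case False
    then have "1 / \<epsilon> < 1 - t" by simp
    then have "1 / (1 - t) \<le> \<epsilon>" using assms(1) t by (simp add: field_simps)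
    then show ?thesis by simp
  qed
qed

text \<open>This makes total boundedness and sequential compactness, notions of metric spaces,
  available for the topology given by neighbourhoods.\<close>

lemma past_mtopology: "Metric_space.mtopology past_paths past_dist = past_topology"
proof -
  interpret Metric_space past_paths past_dist by (rule past_metric)
  show ?thesis
    unfolding topology_eq openin_mtopology openin_past_topology
  proof (intro allI conj_cong refl iffI ballI impI)
    fix U :: "(real \<Rightarrow> 'a) set" and \<phi>
    assume U: "\<forall>\<phi>. \<phi> \<in> U \<longrightarrow> (\<exists>r>0. mball \<phi> r \<subseteq> U)" and sub: "U \<subseteq> past_paths" and \<phi>: "\<phi> \<in> U"
    then obtain r where r: "r > 0" "mball \<phi> r \<subseteq> U" by blast
    have "past_nbhd (1 - 1 / (r / 2)) (r / 2) \<phi> \<subseteq> mball \<phi> r"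
    proof
      fix \<xi> assume \<xi>: "\<xi> \<in> past_nbhd (1 - 1 / (r / 2)) (r / 2) \<phi>"
      have "past_dist \<phi> \<xi> \<le> r / 2"
        using \<xi> r(1) by (intro past_dist_le) (auto simp: past_nbhd_def dist_commute intro: less_imp_le)
      then show "\<xi> \<in> mball \<phi> r" using \<xi> \<phi> sub r(1) by (auto simp: past_nbhd_def)
    qed
    then show "\<exists>a. \<exists>\<epsilon>>0. past_nbhd a \<epsilon> \<phi> \<subseteq> U" using r by (meson half_gt_zero order_trans)
  next
    fix U :: "(real \<Rightarrow> 'a) set" and \<phi>
    assume U: "\<forall>\<phi>\<in>U. \<exists>a. \<exists>\<epsilon>>0. past_nbhd a \<epsilon> \<phi> \<subseteq> U" and sub: "U \<subseteq> past_paths" and \<phi>: "\<phi> \<in> U"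
    then obtain a \<epsilon> where a: "\<epsilon> > 0" "past_nbhd a \<epsilon> \<phi> \<subseteq> U" by blast
    define b where "b = min a 0"
    have "1 / (1 - b) > 0" by (simp add: b_def)
    have "mball \<phi> (min \<epsilon> (1 / (1 - b))) \<subseteq> past_nbhd b \<epsilon> \<phi>"
    proof
      fix \<xi> assume \<xi>: "\<xi> \<in> mball \<phi> (min \<epsilon> (1 / (1 - b)))"
      have "dist (\<phi> t) (\<xi> t) < \<epsilon>" if "t \<in> {b..0}" for t
        by (rule past_dist_less_imp[where a = b]) (use \<xi> that in auto)
      then show "\<xi> \<in> past_nbhd b \<epsilon> \<phi>" using \<xi> by (simp add: past_nbhd_def dist_commute)
    qed
    also have "\<dots> \<subseteq> past_nbhd a \<epsilon> \<phi>" by (intro past_nbhd_mono) (auto simp: b_def)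
    finally show "\<exists>r>0. mball \<phi> r \<subseteq> U"
      using a \<open>1 / (1 - b) > 0\<close> by (intro exI[of _ "min \<epsilon> (1 / (1 - b))"]) auto
  qed
qed

lemma past_paths_complete:
  fixes \<sigma> :: "nat \<Rightarrow> real \<Rightarrow> 'a::complete_space"
  assumes \<sigma>: "\<And>n. \<sigma> n \<in> past_paths" and cau: "\<And>a. uniformly_Cauchy_on {a..0} \<sigma>"
  obtains \<phi> where "\<phi> \<in> past_paths" "\<And>a. uniform_limit {a..0} \<sigma> \<phi> sequentially"
proof -
  define \<phi> where "\<phi> = (\<lambda>t\<in>{..0}. lim (\<lambda>n. \<sigma> n t))"
  have ul: "uniform_limit {a..0} \<sigma> \<phi> sequentially" for a
  proof -
    have "uniform_limit {a..0} \<sigma> (\<lambda>t. lim (\<lambda>n. \<sigma> n t)) sequentially"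
      using Cauchy_uniformly_convergent[OF cau] by (simp add: uniformly_convergent_uniform_limit_iff)
    then show ?thesis
      by (rule uniform_limit_cong'[THEN iffD1, rotated 2]) (auto simp: \<phi>_def)
  qed
  have "continuous_on {..0} \<phi>"
    unfolding continuous_on_eq_continuous_within
  proof
    fix t :: real assume t: "t \<in> {..0}"
    \<comment> \<open>\<open>{t - 1..0}\<close> is a neighbourhood of \<open>t\<close> within
      \<open>{..0}\<close>, so uniform convergence on this window is enough for continuity at
      \<open>t\<close>.\<close>
    have "continuous_on {t - 1..0} (\<sigma> n)" for n
      using \<sigma>[of n] by (auto simp: past_paths_def intro: continuous_on_subset)
    then have "continuous_on {t - 1..0} \<phi>"
      by (intro uniform_limit_theorem[OF _ ul]) auto
    then have "continuous (at t within {t - 1..0}) \<phi>" using t by (auto simp: continuous_on_eq_continuous_within)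
    moreover have "at t within {t - 1..0} = at t within {..0}"
      by (rule at_within_nhd[of _ "{t - 1<..}"]) auto
    ultimately show "continuous (at t within {..0}) \<phi>" by simp
  qed
  then have "\<phi> \<in> past_paths" by (auto simp: past_paths_def \<phi>_def)
  then show ?thesis using ul by (rule that)
qed

text \<open>Total boundedness gives Cauchy subsequences, completeness of the path space gives their
  limits, and closedness keeps the limits in \<open>K\<close>.\<close>

lemma compactin_past_topologyI:
  fixes K :: "(real \<Rightarrow> 'a::complete_space) set"
  assumes K: "K \<subseteq> past_paths"
    and net: "\<And>a \<epsilon>. a \<le> 0 \<Longrightarrow> \<epsilon> > 0 \<Longrightarrow> \<exists>N. finite N \<and> N \<subseteq> K \<and> (\<forall>\<phi>\<in>K. \<exists>\<xi>\<in>N. \<forall>t\<in>{a..0}. dist (\<phi> t) (\<xi> t) \<le> \<epsilon>)"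
    and closed: "\<And>\<sigma> \<phi>. (\<And>n. \<sigma> n \<in> K) \<Longrightarrow> \<phi> \<in> past_paths \<Longrightarrow> (\<And>a. uniform_limit {a..0} \<sigma> \<phi> sequentially) \<Longrightarrow> \<phi> \<in> K"
  shows "compactin past_topology K"
proof -
  interpret Metric_space past_paths past_dist by (rule past_metric)
  have "mtotally_bounded K"
    unfolding mtotally_bounded_def
  proof (intro allI impI)
    fix \<epsilon> :: real assume \<epsilon>: "\<epsilon> > 0"
    \<comment> \<open>At earlier times the cut-off in the metric is already below
      \<open>\<epsilon> / 2\<close>, so a net on \<open>{a..0}\<close> suffices.\<close>
    define a where "a = min 0 (1 - 1 / (\<epsilon> / 2))"
    obtain N where N: "finite N" "N \<subseteq> K" "\<And>\<phi>. \<phi> \<in> K \<Longrightarrow> \<exists>\<xi>\<in>N. \<forall>t\<in>{a..0}. dist (\<phi> t) (\<xi> t) \<le> \<epsilon> / 2"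
      using net[of a "\<epsilon> / 2"] \<epsilon> by (auto simp: a_def)
    have "\<exists>\<xi>\<in>N. \<phi> \<in> mball \<xi> \<epsilon>" if \<phi>: "\<phi> \<in> K" for \<phi>
    proof -
      obtain \<xi> where \<xi>: "\<xi> \<in> N" "\<forall>t\<in>{a..0}. dist (\<phi> t) (\<xi> t) \<le> \<epsilon> / 2" using N(3)[OF \<phi>] by blast
      have "past_dist \<xi> \<phi> \<le> \<epsilon> / 2" using \<xi>(2) \<epsilon> by (intro past_dist_le) (auto simp: a_def dist_commute)
      then show ?thesis using \<xi>(1) \<phi> N(2) K \<epsilon> by (intro bexI[of _ \<xi>]) auto
    qed
    then show "\<exists>N. finite N \<and> N \<subseteq> K \<and> K \<subseteq> (\<Union>\<xi>\<in>N. mball \<xi> \<epsilon>)"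
      using N(1,2) by (intro exI[of _ N]) (simp add: subset_iff)
  qed
  then have sub: "\<exists>r. strict_mono r \<and> MCauchy (\<sigma> \<circ> r)" if "range \<sigma> \<subseteq> K" for \<sigma> :: "nat \<Rightarrow> real \<Rightarrow> 'a"
    using that by (simp add: mtotally_bounded_sequentially)
  have "compactin mtopology K"
    unfolding compactin_sequentially
  proof (intro conjI allI impI K)
    fix \<sigma> :: "nat \<Rightarrow> real \<Rightarrow> 'a" assume \<sigma>: "range \<sigma> \<subseteq> K"
    obtain r where r: "strict_mono r" "MCauchy (\<sigma> \<circ> r)" using sub[OF \<sigma>] by blast
    have \<sigma>r: "(\<sigma> \<circ> r) n \<in> K" for n using \<sigma> by auto
    have ucauchy: "uniformly_Cauchy_on {a..0} (\<sigma> \<circ> r)" for a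
      unfolding uniformly_Cauchy_on_def
    proof (intro allI impI)
      fix e :: real assume e: "e > 0"
      define b where "b = min a 0"
      have "min e (1 / (1 - b)) > 0" using e by (simp add: b_def)
      then obtain N where N: "\<And>n n'. N \<le> n \<Longrightarrow> N \<le> n' \<Longrightarrow> past_dist ((\<sigma> \<circ> r) n) ((\<sigma> \<circ> r) n') < min e (1 / (1 - b))"
        using r(2) unfolding MCauchy_def by blast
      have "dist ((\<sigma> \<circ> r) m t) ((\<sigma> \<circ> r) n t) < e" if "t \<in> {a..0}" "N \<le> m" "N \<le> n" for t m n
        by (rule past_dist_less_imp[OF N[OF that(2,3)]]) (use that in \<open>auto simp: b_def\<close>)
      then show "\<exists>N. \<forall>t\<in>{a..0}. \<forall>m\<ge>N. \<forall>n\<ge>N. dist ((\<sigma> \<circ> r) m t) ((\<sigma> \<circ> r) n t) < e" by blast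
    qed
    obtain \<phi> where \<phi>: "\<phi> \<in> past_paths" "\<And>a. uniform_limit {a..0} (\<sigma> \<circ> r) \<phi> sequentially"
      by (rule past_paths_complete[OF _ ucauchy]) (use \<sigma>r K in auto)
    have "limitin past_topology (\<sigma> \<circ> r) \<phi> sequentially"
      using past_topology_limitin[OF \<phi>(1), of "\<sigma> \<circ> r"] \<sigma>r K \<phi>(2) by blast
    moreover have "\<phi> \<in> K" by (rule closed[OF \<sigma>r \<phi>])
    ultimately show "\<exists>l r. l \<in> K \<and> strict_mono r \<and> limitin mtopology (\<sigma> \<circ> r) l sequentially"
      using r(1) unfolding past_mtopology by blast
  qed
  then show ?thesis by (simp add: past_mtopology)
qed

section \<open>Level sets\<close>

context controlled_system begin

lemma rate_0_le: "controlled T \<psi> X \<Longrightarrow> rate_0 S SQ F B T X \<le> ereal (1/2 * L2_norm_sq \<psi> {0..T})"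
  unfolding rate_0_def controlled_def by (intro INF_lower) simp

lemma rate_nonneg: "0 \<le> rate S SQ F B s 0 \<phi>"
  unfolding rate_def rate_0_def by (intro INF_greatest) (simp add: L2_norm_sq_def)

text \<open>The slack \<open>e\<close> allows for an infimum that is not attained, and the factor 2
  undoes the 1/2 in the rate.\<close>

lemma near_optimal_control:
  assumes r: "rate_past S SQ F B \<phi> \<le> ereal r" and s: "s < 0" and e: "e > 0"
  obtains \<psi> where "controlled (- s) \<psi> (\<lambda>\<tau>. \<phi> (\<tau> + s))" "L2_norm_sq \<psi> {0..- s} \<le> 2 * r + e"
proof -
  have "rate S SQ F B s 0 \<phi> \<le> ereal r"
    using r s unfolding rate_past_def by (auto simp: SUP_le_iff)
  also have "\<dots> < ereal (r + e / 2)" using e by simp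
  finally obtain \<psi> where "square_integrable_on \<psi> {0..- s}"
    "controlled_solution S SQ F B (- s) (\<phi> (0 + s)) \<psi> (\<lambda>\<tau>. \<phi> (\<tau> + s))" "1/2 * L2_norm_sq \<psi> {0..- s} < r + e / 2"
    unfolding rate_def rate_0_def INF_less_iff by auto
  then show ?thesis by (intro that[of \<psi>]) (auto simp: controlled_def)
qed

text \<open>Decay at \<open>-\<infinity>\<close> supplies a starting time at which the path lies in
  the unit ball. How remote this time is does not matter, since the a priori bound is independent of
  the length of the window.\<close>

lemma level_bounded:
  assumes r: "r \<ge> 0"
  obtains R where "R \<ge> 0" "\<And>\<phi> t. ((\<lambda>t. norm (\<phi> t)) \<longlongrightarrow> 0) at_bot \<Longrightarrow> rate_past S SQ F B \<phi> \<le> ereal r \<Longrightarrow> t \<le> 0 \<Longrightarrow> norm (\<phi> t) \<le> R"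
proof -
  have r1: "2 * r + 1 \<ge> 0" using r by simp
  obtain R where R: "R \<ge> 0" and Rb: "\<And>T \<psi> X t. controlled T \<psi> X \<Longrightarrow> L2_norm_sq \<psi> {0..T} \<le> 2 * r + 1 \<Longrightarrow> norm (X 0) \<le> 1 \<Longrightarrow>
    t \<in> {0..T} \<Longrightarrow> norm (X t) \<le> R" by (fact controlled_apriori_bound[OF r1])
  show ?thesis
  proof (rule that[OF R])
    fix \<phi> :: "real \<Rightarrow> 'e" and t :: real
    assume lim: "((\<lambda>t. norm (\<phi> t)) \<longlongrightarrow> 0) at_bot" and rate: "rate_past S SQ F B \<phi> \<le> ereal r" and t: "t \<le> 0"
    have "\<forall>\<^sub>F s in at_bot. norm (\<phi> s) < 1" using lim by (rule order_tendstoD) simp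
    moreover have "\<forall>\<^sub>F s in at_bot. s < t" by (rule eventually_gt_at_bot)
    ultimately have "\<forall>\<^sub>F s in at_bot. norm (\<phi> s) < 1 \<and> s < t" by eventually_elim simp
    then obtain s where s: "norm (\<phi> s) < 1" "s < t" using eventually_happens'[OF trivial_limit_at_bot_linorder] by blast
    obtain \<psi> where \<psi>: "controlled (- s) \<psi> (\<lambda>\<tau>. \<phi> (\<tau> + s))" "L2_norm_sq \<psi> {0..- s} \<le> 2 * r + 1"
      by (rule near_optimal_control[OF rate, of s 1]) (use s t in auto)
    show "norm (\<phi> t) \<le> R" using Rb[OF \<psi>, of "t - s"] s t by simp
  qed
qed

lemma cost_integral_le:
  assumes c: "controlled T \<psi> X" and t: "0 \<le> t" "t \<le> T" and R: "\<And>s. s \<in> {0..T} \<Longrightarrow> norm (X s) \<le> R"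
  shows "(LINT s|lebesgue_on {0..t}. cost \<psi> X s) \<le> (1 + R)\<^sup>2 * L2_norm_sq \<psi> {0..t}"
proof -
  have "(LINT s|lebesgue_on {0..t}. cost \<psi> X s) \<le> (LINT s|lebesgue_on {0..t}. (1 + R)\<^sup>2 * (norm (\<psi> s))\<^sup>2)"
  proof (rule integral_mono)
    show "integrable (lebesgue_on {0..t}) (cost \<psi> X)"
      using t by (intro integrable_lebesgue_on_subinterval[OF cost_integrable[OF c]]) auto
    have "integrable (lebesgue_on {0..t}) (\<lambda>s. (norm (\<psi> s))\<^sup>2)"
      using t by (intro integrable_lebesgue_on_subinterval[OF control_integrable[OF c]]) auto
    then show "integrable (lebesgue_on {0..t}) (\<lambda>s. (1 + R)\<^sup>2 * (norm (\<psi> s))\<^sup>2)" by simp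
    show "cost \<psi> X s \<le> (1 + R)\<^sup>2 * (norm (\<psi> s))\<^sup>2" if "s \<in> space (lebesgue_on {0..t})" for s
      using that t by (intro cost_le R) auto
  qed
  then show ?thesis by (simp add: L2_norm_sq_def)
qed

lemma exp_decay_small:
  assumes "\<epsilon> > 0"
  obtains T where "T > 0" "\<And>t. t \<ge> T \<Longrightarrow> exp (- lam * t) * C \<le> \<epsilon>"
proof -
  have "((\<lambda>t. exp (- lam * t) * C) \<longlongrightarrow> 0 * C) at_top"
  proof (intro tendsto_mult tendsto_const)
    have "filterlim (\<lambda>t. - lam * t) at_bot at_top"
      using lam by (intro filterlim_tendsto_neg_mult_at_bot[OF tendsto_const]) (auto simp: filterlim_ident)
    then show "((\<lambda>t. exp (- lam * t)) \<longlongrightarrow> 0) at_top" by (rule filterlim_compose[OF exp_at_bot])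
  qed
  then have "\<forall>\<^sub>F t in at_top. exp (- lam * t) * C < \<epsilon>" using assms by (intro order_tendstoD(2)) auto
  then obtain N where N: "\<And>t. t \<ge> N \<Longrightarrow> exp (- lam * t) * C < \<epsilon>" by (auto simp: eventually_at_top_linorder)
  show ?thesis by (rule that[of "max N 1"]) (use N in \<open>auto intro: less_imp_le\<close>)
qed

text \<open>Initial values range over a ball, which need not have finite nets. Starting early enough
  makes their influence small, and afterwards the path is determined, up to a small error, by its
  noise part and hence by finitely many numbers. The three errors, from initial values, from
  \<open>F\<close> and from the noise parts, take \<open>\<epsilon> / 4\<close> each.\<close>

lemma level_net:
  assumes r: "r \<ge> 0" and a: "a \<le> 0" and \<epsilon>: "\<epsilon> > 0"
    and G: "\<And>\<phi>. \<phi> \<in> G \<Longrightarrow> ((\<lambda>t. norm (\<phi> t)) \<longlongrightarrow> 0) at_bot \<and> rate_past S SQ F B \<phi> \<le> ereal r"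
  shows "\<exists>N. finite N \<and> N \<subseteq> G \<and> (\<forall>\<phi>\<in>G. \<exists>\<xi>\<in>N. \<forall>t\<in>{a..0}. dist (\<phi> t) (\<xi> t) \<le> \<epsilon>)"
proof -
  obtain R where R: "R \<ge> 0" and Rb: "\<And>\<phi> t. \<phi> \<in> G \<Longrightarrow> t \<le> 0 \<Longrightarrow> norm (\<phi> t) \<le> R"
  proof -
    obtain R where "R \<ge> 0" and Rb: "\<And>\<phi> t. ((\<lambda>t. norm (\<phi> t)) \<longlongrightarrow> 0) at_bot \<Longrightarrow> rate_past S SQ F B \<phi> \<le> ereal r \<Longrightarrow> t \<le> 0 \<Longrightarrow> norm (\<phi> t) \<le> R"
      by (fact level_bounded[OF r])
    then show thesis using G by (intro that[of R]) auto
  qed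
  have e4: "\<epsilon> / 4 > 0" using \<epsilon> by simp
  obtain T0 where T0: "T0 > 0" "\<And>t. t \<ge> T0 \<Longrightarrow> exp (- lam * t) * (2 * R) \<le> \<epsilon> / 4"
    using exp_decay_small[OF e4] by blast
  \<comment> \<open>Paths are followed from \<open>- T\<close>, so that by any time of the window
    \<open>{a..0}\<close> at least \<open>T0\<close> has elapsed.\<close>
  define T where "T = T0 - a"
  have T: "T > 0" using T0(1) a by (simp add: T_def)
  define \<rho> where "\<rho> = \<epsilon> / 4 * lam / M"
  have \<rho>: "\<rho> > 0" "M * \<rho> / lam = \<epsilon> / 4" using \<epsilon> lam M by (auto simp: \<rho>_def)
  obtain d where d: "d > 0" "\<And>x y. norm x \<le> R + 1 \<Longrightarrow> norm y \<le> R + 1 \<Longrightarrow> norm (y - x) < d \<Longrightarrow> norm (F y - F x) < \<rho>"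
    using F_cont[OF bounded_cball[of 0 "R + 1"]] \<rho>(1)
    unfolding uniformly_continuous_on_def dist_norm by (metis diff_zero mem_cball_0)
  define \<eta> where "\<eta> = min (min 1 (d / 2)) (\<epsilon> / 4)"
  have \<eta>: "\<eta> > 0" "\<eta> \<le> 1" "\<eta> < d" "\<eta> \<le> \<epsilon> / 4" using d(1) \<epsilon> by (auto simp: \<eta>_def min_def)
  \<comment> \<open>The square of \<open>C\<close> bounds the cost: \<open>1 + R\<close> comes from
    the size of the path, and \<open>2 * r + 1\<close> is the energy of a control that is optimal up
    to slack 1.\<close>
  define C where "C = (1 + R) * sqrt (2 * r + 1)"
  have C: "C \<ge> 0" "C\<^sup>2 = (1 + R)\<^sup>2 * (2 * r + 1)" using R r by (auto simp: C_def power_mult_distrib)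
  have \<eta>4: "\<eta> / 4 > 0" using \<eta>(1) by simp
  obtain \<Theta> Y where \<Theta>: "finite \<Theta>" "\<Theta> \<subseteq> {0..T}" and Y: "finite Y" "Y \<subseteq> cball 0 1" and
    close: "\<And>\<psi> X \<psi>' X' t. controlled T \<psi> X \<Longrightarrow> (LINT s|lebesgue_on {0..T}. cost \<psi> X s) \<le> C\<^sup>2 \<Longrightarrow>
      controlled T \<psi>' X' \<Longrightarrow> (LINT s|lebesgue_on {0..T}. cost \<psi>' X' s) \<le> C\<^sup>2 \<Longrightarrow>
      (\<And>\<theta> xs. \<theta> \<in> \<Theta> \<Longrightarrow> xs \<in> Y \<Longrightarrow> \<bar>blinfun_apply xs (noise_part X \<theta>) - blinfun_apply xs (noise_part X' \<theta>)\<bar> \<le> \<eta> / 4) \<Longrightarrow>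
      t \<in> {0..T} \<Longrightarrow> norm (noise_part X t - noise_part X' t) \<le> 4 * (\<eta> / 4)"
    by (fact noise_parts_close[OF T C(1) \<eta>4])
  let ?X = "\<lambda>\<phi> \<tau>. \<phi> (\<tau> + (- T))"
  have ctl: "\<exists>\<psi>. controlled T \<psi> (?X \<phi>) \<and> (LINT s|lebesgue_on {0..T}. cost \<psi> (?X \<phi>) s) \<le> C\<^sup>2" if \<phi>: "\<phi> \<in> G" for \<phi>
  proof -
    obtain \<psi> where \<psi>: "controlled T \<psi> (?X \<phi>)" "L2_norm_sq \<psi> {0..T} \<le> 2 * r + 1"
      using near_optimal_control[of \<phi> r "- T" 1] G[OF \<phi>] T by auto
    have "(LINT s|lebesgue_on {0..T}. cost \<psi> (?X \<phi>) s) \<le> (1 + R)\<^sup>2 * L2_norm_sq \<psi> {0..T}"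
      using T by (intro cost_integral_le[OF \<psi>(1)] Rb[OF \<phi>]) auto
    also have "\<dots> \<le> C\<^sup>2" unfolding C(2) using \<psi>(2) by (intro mult_left_mono) auto
    finally show ?thesis using \<psi>(1) by blast
  qed
  obtain K where K: "K \<ge> 0" "\<And>T C y. y \<in> reach T C \<Longrightarrow> C \<ge> 0 \<Longrightarrow> norm y \<le> K * C" using reach_norm_le by blast
  define f where "f p \<phi> = blinfun_apply (snd p) (noise_part (?X \<phi>) (fst p))" for p :: "real \<times> ('e \<Rightarrow>\<^sub>L real)" and \<phi>
  have fin: "finite (\<Theta> \<times> Y)" using \<Theta> Y by simp
  have bd: "\<exists>b. \<forall>\<phi>\<in>G. \<bar>f p \<phi>\<bar> \<le> b" if p: "p \<in> \<Theta> \<times> Y" for p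
  proof (intro exI ballI)
    fix \<phi> assume \<phi>: "\<phi> \<in> G"
    obtain \<psi> where \<psi>: "controlled T \<psi> (?X \<phi>)" "(LINT s|lebesgue_on {0..T}. cost \<psi> (?X \<phi>) s) \<le> C\<^sup>2" using ctl[OF \<phi>] by blast
    have p1: "0 \<le> fst p" "fst p \<le> T" "norm (snd p) \<le> 1" using p \<Theta> Y by auto
    have "noise_part (?X \<phi>) (fst p) \<in> reach (fst p) (\<kappa> * C)"
      using cost_integral_mono[OF \<psi>(1), of 0 0 "fst p" T] p1 \<psi>(2) by (intro noise_part_reach[OF \<psi>(1) p1(1,2) C(1)]) auto
    then have "norm (noise_part (?X \<phi>) (fst p)) \<le> K * (\<kappa> * C)" using K(2) \<kappa> C(1) by simp
    then have "norm (snd p) * norm (noise_part (?X \<phi>) (fst p)) \<le> 1 * (K * (\<kappa> * C))"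
      using p1(3) by (intro mult_mono) auto
    then show "\<bar>f p \<phi>\<bar> \<le> K * (\<kappa> * C)" unfolding f_def using norm_blinfun[of "snd p" "noise_part (?X \<phi>) (fst p)"] by simp
  qed
  obtain N where N: "finite N" "N \<subseteq> G" "\<And>\<phi>. \<phi> \<in> G \<Longrightarrow> \<exists>\<xi>\<in>N. \<forall>p\<in>\<Theta> \<times> Y. \<bar>f p \<phi> - f p \<xi>\<bar> < \<eta> / 4"
    by (rule finite_family_net[of "\<Theta> \<times> Y" G f "\<eta> / 4", OF fin bd \<eta>4]) (assumption, rule that)
  have "\<exists>\<xi>\<in>N. \<forall>t\<in>{a..0}. dist (\<phi> t) (\<xi> t) \<le> \<epsilon>" if \<phi>: "\<phi> \<in> G" for \<phi>
  proof -
    obtain \<xi> where \<xi>: "\<xi> \<in> N" "\<And>p. p \<in> \<Theta> \<times> Y \<Longrightarrow> \<bar>f p \<phi> - f p \<xi>\<bar> < \<eta> / 4" using N(3)[OF \<phi>] by blast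
    have \<xi>G: "\<xi> \<in> G" using \<xi>(1) N(2) by blast
    obtain \<psi> where \<psi>: "controlled T \<psi> (?X \<phi>)" "(LINT s|lebesgue_on {0..T}. cost \<psi> (?X \<phi>) s) \<le> C\<^sup>2" using ctl[OF \<phi>] by blast
    obtain \<psi>' where \<psi>': "controlled T \<psi>' (?X \<xi>)" "(LINT s|lebesgue_on {0..T}. cost \<psi>' (?X \<xi>) s) \<le> C\<^sup>2" using ctl[OF \<xi>G] by blast
    have fl: "\<bar>blinfun_apply xs (noise_part (?X \<phi>) \<theta>) - blinfun_apply xs (noise_part (?X \<xi>) \<theta>)\<bar> \<le> \<eta> / 4"
      if "\<theta> \<in> \<Theta>" "xs \<in> Y" for \<theta> xs
      using \<xi>(2)[of "(\<theta>, xs)"] that by (simp add: f_def)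
    have nd: "norm (noise_part (?X \<phi>) s - noise_part (?X \<xi>) s) \<le> \<eta>" if "s \<in> {0..T}" for s
      using close[OF \<psi> \<psi>' fl that] by simp
    have "dist (\<phi> t) (\<xi> t) \<le> \<epsilon>" if t: "t \<in> {a..0}" for t
    proof -
      have tT: "t + T \<in> {0..T}" "t + T \<ge> T0" using t T0 by (auto simp: T_def)
      have "norm (?X \<phi> (t + T) - ?X \<xi> (t + T)) \<le> exp (- lam * (t + T)) * norm (?X \<phi> 0 - ?X \<xi> 0) + M * \<rho> / lam + \<eta>"
      proof (rule controlled_comparison[OF \<psi>(1) \<psi>'(1) tT(1), where R = R])
        show "norm (?X \<xi> s) \<le> R" if "s \<in> {0..t + T}" for s using that t by (intro Rb[OF \<xi>G]) auto
        show "norm (noise_part (?X \<phi>) s - noise_part (?X \<xi>) s) \<le> \<eta>" if "s \<in> {0..t + T}" for s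
          using that t by (intro nd) auto
        show "norm (F u - F v) \<le> \<rho>" if "norm u \<le> R + \<eta>" "norm v \<le> R + \<eta>" "norm (u - v) \<le> \<eta>" for u v
          using d(2)[of v u] that \<eta> by simp
      qed
      also have "exp (- lam * (t + T)) * norm (?X \<phi> 0 - ?X \<xi> 0) \<le> exp (- lam * (t + T)) * (2 * R)"
      proof (rule mult_left_mono)
        have "norm (?X \<phi> 0) \<le> R" "norm (?X \<xi> 0) \<le> R" using Rb[OF \<phi>, of "0 + - T"] Rb[OF \<xi>G, of "0 + - T"] T by auto
        then show "norm (?X \<phi> 0 - ?X \<xi> 0) \<le> 2 * R" using norm_triangle_ineq4[of "?X \<phi> 0" "?X \<xi> 0"] by linarith
      qed simp
      also have "\<dots> \<le> \<epsilon> / 4" by (rule T0(2)[OF tT(2)])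
      finally show ?thesis using \<rho>(2) \<eta>(4) \<epsilon> by (simp add: dist_norm)
    qed
    then show ?thesis using \<xi>(1) by blast
  qed
  then show ?thesis using N(1,2) by blast
qed

text \<open>Restricting a control on \<open>[s, 0]\<close> to \<open>[t\<^sub>0, 0]\<close> shows that near-optimal controls spend
  little energy before \<open>t\<^sub>0\<close>, uniformly in \<open>s\<close>, once \<open>t\<^sub>0\<close> is close to optimal for the supremum
  defining the rate.\<close>

lemma level_tail:
  assumes rate: "rate_past S SQ F B \<phi> \<le> ereal r" and R: "\<And>t. t \<le> 0 \<Longrightarrow> norm (\<phi> t) \<le> R"
  shows "((\<lambda>t. norm (\<phi> t)) \<longlongrightarrow> 0) at_bot"
proof (rule tendstoI)
  fix \<epsilon> :: real assume \<epsilon>: "\<epsilon> > 0"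
  have R0: "R \<ge> 0" using R[of 0] norm_ge_zero[of "\<phi> 0"] by linarith
  have "0 \<le> rate S SQ F B (- 1) 0 \<phi>" by (rule rate_nonneg)
  also have "\<dots> \<le> rate_past S SQ F B \<phi>" unfolding rate_past_def by (rule SUP_upper) simp
  finally have nn: "0 \<le> rate_past S SQ F B \<phi>" .
  obtain l where l: "rate_past S SQ F B \<phi> = ereal l"
    using nn rate by (cases "rate_past S SQ F B \<phi>") auto
  have l0: "l \<ge> 0" using nn l by simp
  define \<rho> where "\<rho> = \<epsilon> / 4 * lam / M"
  have \<rho>: "\<rho> > 0" "M * \<rho> / lam = \<epsilon> / 4" using \<epsilon> lam M by (auto simp: \<rho>_def)
  have "isCont F 0" using F_continuous[of UNIV] by (simp add: continuous_on_eq_continuous_at)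
  then obtain d where "d > 0" "\<forall>u. dist u 0 < d \<longrightarrow> dist (F u) (F 0) < \<rho>"
    using \<rho>(1) unfolding continuous_at_eps_delta by blast
  then have d: "d > 0" "\<And>u. norm u < d \<Longrightarrow> norm (F u) < \<rho>"
    by (simp_all add: F_0)
  define \<eta> where "\<eta> = min (d / 2) (\<epsilon> / 4)"
  have \<eta>: "\<eta> > 0" "\<eta> < d" "\<eta> \<le> \<epsilon> / 4" using d(1) \<epsilon> by (auto simp: \<eta>_def)
  obtain K where K: "K \<ge> 0" "\<And>T C y. y \<in> reach T C \<Longrightarrow> C \<ge> 0 \<Longrightarrow> norm y \<le> K * C" using reach_norm_le by blast
  \<comment> \<open>A cost of at most the square of \<open>C\<close> keeps the noise part below
    \<open>K * (\<kappa> * C) \<le> \<eta>\<close>; the 1 in the denominator excludes division by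
    0.\<close>
  define C where "C = \<eta> / (K * \<kappa> + 1)"
  have KK: "K * \<kappa> \<ge> 0" using K \<kappa> by simp
  have C: "C > 0" "K * (\<kappa> * C) \<le> \<eta>"
    using \<eta>(1) KK by (auto simp: C_def field_simps)
  \<comment> \<open>The energy spent before \<open>t0\<close> will turn out to be at most
    \<open>4 * \<delta>\<close>, and \<open>(1 + R)\<^sup>2\<close> converts energy into
    cost.\<close>
  define \<delta> where "\<delta> = C\<^sup>2 / (4 * (1 + R)\<^sup>2)"
  have \<delta>: "\<delta> > 0" "(1 + R)\<^sup>2 * (4 * \<delta>) = C\<^sup>2" using C R0 by (auto simp: \<delta>_def)
  have "ereal (l - \<delta>) < rate_past S SQ F B \<phi>" using l \<delta> by simp
  then obtain t0 where t0: "t0 < 0" "ereal (l - \<delta>) < rate S SQ F B t0 0 \<phi>"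
    unfolding rate_past_def less_SUP_iff by auto
  have e4: "\<epsilon> / 4 > 0" using \<epsilon> by simp
  obtain T0 where T0: "T0 > 0" "\<And>t. t \<ge> T0 \<Longrightarrow> exp (- lam * t) * R \<le> \<epsilon> / 4"
    using exp_decay_small[OF e4] by blast
  have "norm (\<phi> t) < \<epsilon>" if t: "t \<le> t0" for t
  proof -
    \<comment> \<open>The path is started \<open>T0\<close> before \<open>t\<close>, so that its
      initial value is forgotten by time \<open>t\<close>. On the clock starting at
      \<open>s\<close>, the time \<open>t0\<close> is \<open>a\<close>, and the control restarted
      there competes in the infimum defining the rate on \<open>[t0, 0]\<close>.\<close>
    define s where "s = t - T0"
    have s: "s < t" "s < 0" using T0 t t0 by (auto simp: s_def)
    define T where "T = - s"
    define a where "a = t0 - s"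
    let ?X = "\<lambda>\<tau>. \<phi> (\<tau> + s)"
    have a: "0 \<le> a" "a \<le> T" "T - a = 0 - t0" using s t t0 by (auto simp: a_def T_def)
    obtain \<psi> where \<psi>: "controlled T \<psi> ?X" "L2_norm_sq \<psi> {0..T} \<le> 2 * l + 2 * \<delta>"
      unfolding T_def by (rule near_optimal_control[of \<phi> l s "2 * \<delta>"]) (use l s \<delta> in auto)
    note re = controlled_restart[OF \<psi>(1) a(1,2)]
    have "rate S SQ F B t0 0 \<phi> = rate_0 S SQ F B (T - a) (\<lambda>\<tau>. ?X (\<tau> + a))"
      unfolding rate_def a(3) by (simp add: a_def)
    also have "\<dots> \<le> ereal (1/2 * L2_norm_sq \<psi> {a..T})"
      using rate_0_le[OF re(1)] unfolding re(2) .
    finally have re_le: "rate S SQ F B t0 0 \<phi> \<le> ereal (1/2 * L2_norm_sq \<psi> {a..T})" .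
    have "l - \<delta> < 1/2 * L2_norm_sq \<psi> {a..T}" using order_less_le_trans[OF t0(2) re_le] by simp
    \<comment> \<open>The total energy is at most \<open>2 * l + 2 * \<delta>\<close>, and more than
      \<open>2 * l - 2 * \<delta>\<close> of it is spent after \<open>t0\<close>.\<close>
    then have "L2_norm_sq \<psi> {0..a} \<le> 4 * \<delta>"
      using integral_lebesgue_on_combine[OF control_integrable[OF \<psi>(1)] a(1,2)] \<psi>(2) unfolding L2_norm_sq_def by linarith
    then have "(1 + R)\<^sup>2 * L2_norm_sq \<psi> {0..a} \<le> C\<^sup>2"
      unfolding \<delta>(2)[symmetric] by (intro mult_left_mono) auto
    moreover have "(LINT u|lebesgue_on {0..a}. cost \<psi> ?X u) \<le> (1 + R)\<^sup>2 * L2_norm_sq \<psi> {0..a}"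
      by (intro cost_integral_le[OF \<psi>(1) a(1,2)] R) (auto simp: T_def)
    ultimately have costa: "(LINT u|lebesgue_on {0..a}. cost \<psi> ?X u) \<le> C\<^sup>2" by linarith
    have tT: "t - s \<in> {0..T}" "t - s \<le> a" using s t t0 by (auto simp: T_def a_def)
    have "norm (?X (t - s)) \<le> exp (- lam * (t - s)) * norm (?X 0) + M * \<rho> / lam + \<eta>"
    proof (rule controlled_decay[OF \<psi>(1) tT(1)])
      fix u assume u: "u \<in> {0..t - s}"
      have "noise_part ?X u \<in> reach u (\<kappa> * C)"
        using cost_integral_mono[OF \<psi>(1), of 0 0 u a] u tT a costa C(1)
        by (intro noise_part_reach[OF \<psi>(1)]) auto
      then have "norm (noise_part ?X u) \<le> K * (\<kappa> * C)" using \<kappa> C(1) by (intro K(2)) auto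
      then show "norm (noise_part ?X u) \<le> \<eta>" using C(2) by linarith
    next
      fix u :: 'e assume "norm u \<le> \<eta>"
      then show "norm (F u) \<le> \<rho>" using d(2)[of u] \<eta>(2) by simp
    qed
    moreover have "exp (- lam * (t - s)) * norm (?X 0) \<le> exp (- lam * (t - s)) * R"
      using R[of "0 + s"] s by (intro mult_left_mono) auto
    moreover have "exp (- lam * (t - s)) * R \<le> \<epsilon> / 4" by (rule T0(2)) (simp add: s_def)
    ultimately have "norm (?X (t - s)) \<le> \<epsilon> / 4 + \<epsilon> / 4 + \<epsilon> / 4" using \<rho>(2) \<eta>(3) by argo
    then show ?thesis using \<epsilon> by simp
  qed
  then show "\<forall>\<^sub>F t in at_bot. dist (norm (\<phi> t)) 0 < \<epsilon>"
    unfolding eventually_at_bot_linorder by (intro exI[of _ t0]) simp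
qed

text \<open>The order matters: \<open>level_bounded\<close> presupposes decay, which is not yet
  known for the limit. So the rate bound is obtained first, on each window separately; the norm
  bound is inherited pointwise from the sequence; and only these two together give decay, by
  \<open>level_tail\<close>.\<close>

lemma level_closed:
  assumes r: "r \<ge> 0" and \<sigma>: "\<And>n. ((\<lambda>t. norm (\<sigma> n t)) \<longlongrightarrow> 0) at_bot \<and> rate_past S SQ F B (\<sigma> n) \<le> ereal r"
    and \<phi>: "\<phi> \<in> past_paths" and ul: "\<And>a. uniform_limit {a..0} \<sigma> \<phi> sequentially"
  shows "((\<lambda>t. norm (\<phi> t)) \<longlongrightarrow> 0) at_bot \<and> rate_past S SQ F B \<phi> \<le> ereal r"
proof -
  have "rate S SQ F B s 0 \<phi> \<le> ereal r" if s: "s < 0" for s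
  proof -
    have "\<exists>\<psi>. controlled (- s) \<psi> (\<lambda>\<tau>. \<sigma> n (\<tau> + s)) \<and> L2_norm_sq \<psi> {0..- s} \<le> 2 * r + 1 / real (Suc n)" for n
      using near_optimal_control[of "\<sigma> n" r s "1 / real (Suc n)"] \<sigma>[of n] s by auto
    then obtain \<psi> where \<psi>: "\<And>n. controlled (- s) (\<psi> n) (\<lambda>\<tau>. \<sigma> n (\<tau> + s))" "\<And>n. L2_norm_sq (\<psi> n) {0..- s} \<le> 2 * r + 1 / real (Suc n)"
      using choice[of "\<lambda>n \<psi>. controlled (- s) \<psi> (\<lambda>\<tau>. \<sigma> n (\<tau> + s)) \<and> L2_norm_sq \<psi> {0..- s} \<le> 2 * r + 1 / real (Suc n)"] by blast
    have "continuous_on {0..- s} (\<lambda>\<tau>. \<phi> (\<tau> + s))"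
      using \<phi> by (auto simp: past_paths_def intro!: continuous_on_compose2[of "{..0}" \<phi>] continuous_intros)
    moreover have "uniform_limit {0..- s} (\<lambda>n \<tau>. \<sigma> n (\<tau> + s)) (\<lambda>\<tau>. \<phi> (\<tau> + s)) sequentially"
    proof (rule uniform_limitI)
      fix e :: real assume "e > 0"
      then have "\<forall>\<^sub>F n in sequentially. \<forall>t\<in>{s..0}. dist (\<sigma> n t) (\<phi> t) < e" using ul[of s] by (simp add: uniform_limit_iff)
      then show "\<forall>\<^sub>F n in sequentially. \<forall>\<tau>\<in>{0..- s}. dist (\<sigma> n (\<tau> + s)) (\<phi> (\<tau> + s)) < e"
        by eventually_elim auto
    qed
    ultimately obtain v where v: "controlled (- s) v (\<lambda>\<tau>. \<phi> (\<tau> + s))" "L2_norm_sq v {0..- s} \<le> 2 * r"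
      using controlled_limit[OF _ _ \<psi>] s r by auto
    have "rate S SQ F B s 0 \<phi> \<le> ereal (1/2 * L2_norm_sq v {0..- s})"
      using rate_0_le[OF v(1)] by (simp add: rate_def)
    also have "\<dots> \<le> ereal r" using v(2) by simp
    finally show ?thesis .
  qed
  then have rate: "rate_past S SQ F B \<phi> \<le> ereal r"
    unfolding rate_past_def by (intro SUP_least) auto
  obtain R where "R \<ge> 0" and R: "\<And>\<phi> t. ((\<lambda>t. norm (\<phi> t)) \<longlongrightarrow> 0) at_bot \<Longrightarrow> rate_past S SQ F B \<phi> \<le> ereal r \<Longrightarrow> t \<le> 0 \<Longrightarrow> norm (\<phi> t) \<le> R"
    by (fact level_bounded[OF r])
  have "norm (\<phi> t) \<le> R" if t: "t \<le> 0" for t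
  proof (rule tendsto_upperbound)
    have "(\<lambda>n. \<sigma> n t) \<longlonglongrightarrow> \<phi> t" using ul[of t] t by (intro tendsto_uniform_limitI) auto
    then show "(\<lambda>n. norm (\<sigma> n t)) \<longlonglongrightarrow> norm (\<phi> t)" by (rule tendsto_norm)
    show "\<forall>\<^sub>F n in sequentially. norm (\<sigma> n t) \<le> R" using R \<sigma> t by (intro always_eventually) blast
  qed simp
  from level_tail[OF rate this] rate show ?thesis by simp
qed

end

theorem theorem5p5:
  fixes S :: "real \<Rightarrow> 'e::banach \<Rightarrow>\<^sub>L 'e"
    and D :: "'e set" and A :: "'e \<Rightarrow> 'e"
    and SQ :: "real \<Rightarrow> 'h::{real_inner, banach, second_countable_topology} \<Rightarrow>\<^sub>L 'e"
    and F :: "'e \<Rightarrow> 'e"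
    and B :: "'e \<Rightarrow> 'h \<Rightarrow>\<^sub>L 'h"
    and P :: "'w measure" and K :: "nat set" and e :: "nat \<Rightarrow> 'h"
    and \<beta> :: "nat \<Rightarrow> real \<Rightarrow> 'w \<Rightarrow> real" and Z :: "real \<Rightarrow> 'w \<Rightarrow> 'e"
    and M \<omega> lam \<kappa> \<kappa>' lam' r :: real and m :: nat
  assumes semigroup: "C0_semigroup S" and generator: "is_generator S D A"
    and M: "M \<ge> 1" and \<omega>: "\<omega> > 0"
    and decay: "\<And>t. t \<ge> 0 \<Longrightarrow> norm (S t) \<le> M * exp (- \<omega> * t)"
    and noise: "smoothed_noise_operator S SQ"
    and wiener: "cylindrical_wiener P K e \<beta>"
    and convolution: "\<And>t. t > 0 \<Longrightarrow> is_stochastic_convolution P K e \<beta> SQ t (Z t)"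
    and gaussian: "\<And>t. t > 0 \<Longrightarrow> gaussian_random_variable P (Z t)"
    and F_cont: "\<And>G. bounded G \<Longrightarrow> uniformly_continuous_on G F" and F_0: "F 0 = 0"
    and lam: "lam > 0"
    and dissipative: "\<And>x y. x \<in> D \<Longrightarrow> y \<in> D \<Longrightarrow>
      \<exists>xs \<in> norm_subdiff (x - y). blinfun_apply xs (A (x - y) + F x - F y) \<le> - lam * norm (x - y)"
    and \<kappa>: "\<kappa> > 0"
    and B_lipschitz: "\<And>x y h. norm ((B x - B y) h) \<le> \<kappa> * norm (x - y) * norm h"
    and B_growth: "\<And>x h. norm (B x h) \<le> \<kappa> * (1 + norm x) * norm h"
    and \<kappa>': "\<kappa>' > 0" and lam': "lam' > 0"
    and F_growth: "\<And>x. norm (F x) \<le> \<kappa>' * (1 + norm x ^ m)"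
    and F_coercive: "\<And>x h. x \<in> D \<Longrightarrow> h \<in> D \<Longrightarrow>
      \<exists>hs \<in> norm_subdiff h. blinfun_apply hs (F (x + h) - F x) \<le> - lam' * norm h ^ m + \<kappa>' * (1 + norm x ^ m)"
    and r: "r > 0"
  shows "compactin past_topology
    {\<phi> \<in> past_paths. ((\<lambda>t. norm (\<phi> t)) \<longlongrightarrow> 0) at_bot \<and> rate_past S SQ F B \<phi> \<le> ereal r}"
proof -
  have P: "prob_space P" using wiener by (simp add: cylindrical_wiener_def)
  interpret noise_semigroup S M \<omega> SQ
    using semigroup M \<omega> decay noise by unfold_locales
  interpret controlled_system S M \<omega> D A F lam \<kappa>' lam' m SQ B \<kappa>
  proof unfold_locales
    fix t :: real assume t: "t > 0"
    show "energy t xs < \<infinity>" for xs by (rule energy_finite[OF P wiener convolution[OF t]])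
    fix \<epsilon> :: real assume "\<epsilon> > 0"
    then show "\<exists>X. finite X \<and> X \<subseteq> cball 0 1 \<and> (\<forall>xs. norm xs \<le> 1 \<longrightarrow> (\<exists>ys\<in>X. energy t (xs - ys) \<le> ennreal \<epsilon>))"
      using energy_totally_bounded[OF P wiener convolution[OF t] gaussian[OF t]] by metis
  qed (fact generator F_cont F_0 lam dissipative \<kappa>' lam' F_growth F_coercive \<kappa> B_lipschitz B_growth)+
  have r0: "r \<ge> 0" using r by simp
  show ?thesis
  proof (rule compactin_past_topologyI)
    fix a \<epsilon> :: real assume "a \<le> 0" "\<epsilon> > 0"
    then show "\<exists>N. finite N \<and> N \<subseteq> {\<phi> \<in> past_paths. ((\<lambda>t. norm (\<phi> t)) \<longlongrightarrow> 0) at_bot \<and> rate_past S SQ F B \<phi> \<le> ereal r} \<and>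
      (\<forall>\<phi>\<in>{\<phi> \<in> past_paths. ((\<lambda>t. norm (\<phi> t)) \<longlongrightarrow> 0) at_bot \<and> rate_past S SQ F B \<phi> \<le> ereal r}.
        \<exists>\<xi>\<in>N. \<forall>t\<in>{a..0}. dist (\<phi> t) (\<xi> t) \<le> \<epsilon>)"
      by (intro level_net[OF r0]) auto
  next
    fix \<sigma> \<phi>
    assume "\<And>n. \<sigma> n \<in> {\<phi> \<in> past_paths. ((\<lambda>t. norm (\<phi> t)) \<longlongrightarrow> 0) at_bot \<and> rate_past S SQ F B \<phi> \<le> ereal r}"
      and \<phi>: "\<phi> \<in> past_paths" "\<And>a. uniform_limit {a..0} \<sigma> \<phi> sequentially"
    then show "\<phi> \<in> {\<phi> \<in> past_paths. ((\<lambda>t. norm (\<phi> t)) \<longlongrightarrow> 0) at_bot \<and> rate_past S SQ F B \<phi> \<le> ereal r}"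
      using level_closed[OF r0 _ \<phi>] by simp
  qed auto
qed

end
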